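(* Let $\mathbb{F}$ be a field, $G$ a finite group and $m\geq 1$. There is an algebra isomorphism $$\overline{\mathcal{Z}}_m\cong \overline{\mathcal{Z}}_0\otimes\overline{\mathcal{H}}_m(G).$$ Moreover, $\overline{\mathcal{H}}_m(G)$ is isomorphic to the algebra with generators all $g\in G^m$, $s_1,\ldots,s_{m-1}$, $\varepsilon_1,\ldots,\varepsilon_m$ and $u_1,\ldots,u_m$, subject to the multiplication relations of the group $G^m$ and the following relations (for all admissible indices, all $g\in G^m$ and all $h\in G$): - $s_i^2=1$, $s_is_j=s_js_i$ if $|i-j|>1$, $s_is_{i+1}s_i=s_{i+1}s_is_{i+1}$; - $s_ig={}^{s_i}g\,s_i$; - $\varepsilon_i^2=\varepsilon_i$, $\varepsilon_i\varepsilon_j=\varepsilon_j\varepsilon_i$; - $s_i\varepsilon_i=\varepsilon_{i+1}s_i$, $s_i\varepsilon_j=\varepsilon_js_i$ for $j\neq i,i+1$, $s_i\varepsilon_i\varepsilon_{i+1}=\varepsilon_i\varepsilon_{i+1}$; - $\varepsilon_ig=g\varepsilon_i$, $\varepsilon_ih^{(i)}=h^{(i)}\varepsilon_i=\varepsilon_i$; - $gu_k=u_kg$ for $1\le k\le m$; - $s_ku_k=u_{k+1}s_k+t_{k,k+1}(1-\varepsilon_k)(1-\varepsilon_{k+1})$ and $s_ku_l=u_ls_k$ for $l\neq k,k+1$, $1\le k\le m-1$; - $u_ku_l=u_lu_k$, $\varepsilon_ku_k=u_k\varepsilon_k=0$, and $\varepsilon_lu_k=u_k\varepsilon_l$ for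 $1\le l\neq k\le m$.
   Context: For $n\ge 1$, $\overline{G}_n$ is the semigroup of $n\times n$ matrices with entries in $G\cup\{0\}$ having at most one nonzero entry in each row and column, under matrix multiplication with $g0=0g=0$, $g+0=0+g=g$ (0 an extra symbol); $\overline{G}_0=\{1\}$. $\mathbb{F}\overline{G}_n$ is the semigroup algebra with basis $\overline{G}_n$ (the zero matrix is one of the basis elements). A permutation $\sigma\in S_n$ is identified with the matrix having $1$ in position $(i,j)$ iff $\sigma(j)=i$, and $g=(g_1,\dots,g_n)\in G^n$ with the diagonal matrix with entries $g_i$; $s_i=(i,i+1)$; ${}^{w}g=(g_{w^{-1}(1)},\ldots,g_{w^{-1}(n)})$; $h^{(i)}\in G^n$ has $h$ in position $i$ and $1$ elsewhere; $\varepsilon_i$ is the diagonal matrix with $(i,i)$ entry $0$ and other diagonal entries $1$; $t_{kl}=\sum_{h\in G}h^{(k)}(h^{-1})^{(l)}$. For $m\le n$, $\overline{G}_m$ is embedded in $\overline{G}_n$ by $\gamma\mapsto \mathrm{diag}(\gamma,1,\dots,1)$. For $0\le m\le n$, $\overline{G}'_{n-m}\subseteq\overline{G}_n$ is the subsemigroup of matrices whose first $m$ diagonal entries equal $1$, and $\overline{\mathcal{Z}}_{m,n}$ is the centralizer of $\overline{G}'_{n-m}$ in $\mathbb{F}\overline{G}_n$. For $\gamma\in\overline{G}_n$, $\deg(\gamma)=|\{k:\gamma_{kk}\ne 1\}|$, and $\deg$ of a linear combination is the maximum of the degrees of the elements of $\overline{G}_n$ occurring with nonzero coefficient. Let $\theta_n:\mathbb{F}\overline{G}_n\to\mathbb{F}\overline{G}_{n-1}$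 be the linear map sending $\gamma\in\overline{G}_n$ to its upper left corner of order $n-1$; it restricts to algebra homomorphisms $\overline{\mathcal{Z}}_{m,n}\to\overline{\mathcal{Z}}_{m,n-1}$ for $n>m$. For $m\geq 0$, $\overline{\mathcal{Z}}_m$ is the algebra of sequences $(\alpha_n)_{n\ge m}$ with $\alpha_n\in\overline{\mathcal{Z}}_{m,n}$, $\theta_n(\alpha_n)=\alpha_{n-1}$ for $n>m$, and $\sup_n\deg(\alpha_n)<\infty$, with componentwise operations. $\mathbb{F}\overline{G}_m$ embeds in $\overline{\mathcal{Z}}_m$ as constant sequences. For $1\le k\le m\le n$ put $u_{k|n}=\sum_{i=k+1}^n t_{ki}\,(k\,i)(1-\varepsilon_k)(1-\varepsilon_i)\in\overline{\mathcal{Z}}_{m,n}$, where $(k\,i)$ is the transposition, and $u_k=(u_{k|n})_{n\ge m}\in\overline{\mathcal{Z}}_m$. $\overline{\mathcal{H}}_m(G)$ is the subalgebra of $\overline{\mathcal{Z}}_m$ generated by $\mathbb{F}\overline{G}_m$ and $u_1,\ldots,u_m$. In the presentation, $t_{k,k+1}$ denotes the corresponding sum of generators in $G^m$. *)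

theory Defs
  imports
    "HOL-Algebra.QuotRing"
    "HOL-Algebra.Subrings"
    "HOL-Algebra.Product_Groups"
    "HOL-Library.Poly_Mapping"
    "HOL-Combinatorics.Transposition"
begin

section \<open>Associative algebras over a field\<close>

text \<open>
  The ground field is a type \<open>'f\<close> of class \<open>field\<close>. Unital associative algebras over it are
  carried by the record type \<open>module\<close> of HOL-Algebra, which has both the ring operations and a
  scalar multiplication. (The library's \<open>algebra\<close> locale cannot be used: it demands commutativity.)
\<close>

definition is_subalg :: "'a set \<Rightarrow> ('f::field, 'a) module \<Rightarrow> bool" where
  "is_subalg B A \<longleftrightarrow> subring B A \<and> (\<forall>c. \<forall>x\<in>B. c \<odot>\<^bsub>A\<^esub> x \<in> B)"

definition gen_subalg :: "('f::field, 'a) module \<Rightarrow> 'a set \<Rightarrow> 'a set" where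
  "gen_subalg A S = \<Inter>{B. is_subalg B A \<and> S \<subseteq> B}"

definition alg_iso :: "('f::field, 'a) module \<Rightarrow> ('f, 'b) module \<Rightarrow> ('a \<Rightarrow> 'b) set" where
  "alg_iso A B = {\<phi> \<in> ring_iso A B. \<forall>c. \<forall>x\<in>carrier A. \<phi> (c \<odot>\<^bsub>A\<^esub> x) = c \<odot>\<^bsub>B\<^esub> \<phi> x}"

definition alg_quot :: "('f::field, 'a) module \<Rightarrow> 'a set \<Rightarrow> ('f, 'a set) module" where
  "alg_quot A I =
    \<lparr>carrier = carrier (A Quot I), mult = mult (A Quot I), one = one (A Quot I),
     zero = zero (A Quot I), add = add (A Quot I),
     smult = (\<lambda>c X. \<Union>x\<in>X. I +>\<^bsub>A\<^esub> (c \<odot>\<^bsub>A\<^esub> x))\<rparr>"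

text \<open>The algebra of finite formal linear combinations of elements of \<open>carrier M\<close>.\<close>

definition monoid_algebra :: "('a, 'x) monoid_scheme \<Rightarrow> ('f::field, 'a \<Rightarrow>\<^sub>0 'f) module" where
  "monoid_algebra M =
    \<lparr>carrier = {a. Poly_Mapping.keys a \<subseteq> carrier M},
     mult = (\<lambda>a b. \<Sum>x\<in>Poly_Mapping.keys a. \<Sum>y\<in>Poly_Mapping.keys b.
               Poly_Mapping.single (x \<otimes>\<^bsub>M\<^esub> y)
                 (Poly_Mapping.lookup a x * Poly_Mapping.lookup b y)),
     one = Poly_Mapping.single \<one>\<^bsub>M\<^esub> 1,
     zero = 0,
     add = (+),
     smult = (\<lambda>c. Poly_Mapping.map ((*) c))\<rparr>"

abbreviation basis :: "'a \<Rightarrow> 'a \<Rightarrow>\<^sub>0 'f::field" where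
  "basis x \<equiv> Poly_Mapping.single x 1"

text \<open>The linear map that sends the basis element \<open>x\<close> to the basis element \<open>f x\<close>.\<close>

definition lin_ext :: "('a \<Rightarrow> 'b) \<Rightarrow> ('a \<Rightarrow>\<^sub>0 'f::field) \<Rightarrow> 'b \<Rightarrow>\<^sub>0 'f" where
  "lin_ext f a = (\<Sum>x\<in>Poly_Mapping.keys a. Poly_Mapping.single (f x) (Poly_Mapping.lookup a x))"

subsection \<open>Tensor products\<close>

text \<open>
  \<open>A \<otimes> B\<close> is the free vector space on \<open>A \<times> B\<close> modulo the span of the bilinearity relators, with
  \<open>(a \<otimes> b) (a' \<otimes> b') = a a' \<otimes> b b'\<close>. A product of a relator with a pair is a relator
  again, so this span coincides with the ideal that the relators generate.
\<close>

definition tensor_relators ::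
  "('f::field, 'a) module \<Rightarrow> ('f, 'b) module \<Rightarrow> ('a \<times> 'b \<Rightarrow>\<^sub>0 'f) set" where
  "tensor_relators A B =
     {basis (x \<oplus>\<^bsub>A\<^esub> x', y) - basis (x, y) - basis (x', y) | x x' y.
        x \<in> carrier A \<and> x' \<in> carrier A \<and> y \<in> carrier B}
   \<union> {basis (x, y \<oplus>\<^bsub>B\<^esub> y') - basis (x, y) - basis (x, y') | x y y'.
        x \<in> carrier A \<and> y \<in> carrier B \<and> y' \<in> carrier B}
   \<union> {basis (c \<odot>\<^bsub>A\<^esub> x, y) - Poly_Mapping.single (x, y) c | c x y.
        x \<in> carrier A \<and> y \<in> carrier B}
   \<union> {basis (x, c \<odot>\<^bsub>B\<^esub> y) - Poly_Mapping.single (x, y) c | c x y.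
        x \<in> carrier A \<and> y \<in> carrier B}"

definition tensor_alg ::
  "('f::field, 'a) module \<Rightarrow> ('f, 'b) module \<Rightarrow> ('f, ('a \<times> 'b \<Rightarrow>\<^sub>0 'f) set) module" where
  "tensor_alg A B =
     alg_quot (monoid_algebra (A \<times>\<times> B)) (Idl\<^bsub>monoid_algebra (A \<times>\<times> B)\<^esub> (tensor_relators A B))"

subsection \<open>Presented algebras\<close>

definition free_alg :: "'a set \<Rightarrow> ('f::field, 'a list \<Rightarrow>\<^sub>0 'f) module" where
  "free_alg X = monoid_algebra \<lparr>carrier = lists X, mult = (@), one = []\<rparr>"

text \<open>A pair \<open>(l, r)\<close> in the second argument stands for the relation \<open>l = r\<close>.\<close>

definition relation_ideal ::
  "'a set \<Rightarrow> (('a list \<Rightarrow>\<^sub>0 'f::field) \<times> ('a list \<Rightarrow>\<^sub>0 'f)) set \<Rightarrow> ('a list \<Rightarrow>\<^sub>0 'f) set" where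
  "relation_ideal X R = Idl\<^bsub>free_alg X\<^esub> {l - r | l r. (l, r) \<in> R}"

definition presented_alg ::
  "'a set \<Rightarrow> (('a list \<Rightarrow>\<^sub>0 'f::field) \<times> ('a list \<Rightarrow>\<^sub>0 'f)) set
    \<Rightarrow> ('f, ('a list \<Rightarrow>\<^sub>0 'f) set) module" where
  "presented_alg X R = alg_quot (free_alg X) (relation_ideal X R)"

definition presented_gen ::
  "'a set \<Rightarrow> (('a list \<Rightarrow>\<^sub>0 'f::field) \<times> ('a list \<Rightarrow>\<^sub>0 'f)) set \<Rightarrow> 'a \<Rightarrow> ('a list \<Rightarrow>\<^sub>0 'f) set" where
  "presented_gen X R x = relation_ideal X R +>\<^bsub>free_alg X\<^esub> basis [x]"


section \<open>The semigroups of monomial matrices\<close>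

text \<open>
  The extra symbol \<open>0\<close> is \<open>None\<close>. An \<open>n \<times> n\<close> matrix is indexed by \<open>{1..n}\<close> and is
  \<open>None\<close> outside this range; \<open>n\<close> is not recorded in the matrix.
\<close>

type_synonym 'g mtx = "nat \<Rightarrow> nat \<Rightarrow> 'g option"

fun zmul :: "('g, 'x) monoid_scheme \<Rightarrow> 'g option \<Rightarrow> 'g option \<Rightarrow> 'g option" where
  "zmul G (Some g) (Some h) = Some (g \<otimes>\<^bsub>G\<^esub> h)"
| "zmul G _ _ = None"

text \<open>The sum of two elements of \<open>G\<close> never occurs in a product of monomial matrices.\<close>

fun zadd :: "'g option \<Rightarrow> 'g option \<Rightarrow> 'g option" where
  "zadd None y = y"
| "zadd x None = x"
| "zadd (Some g) (Some h) = undefined"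

definition mtx_mult :: "('g, 'x) monoid_scheme \<Rightarrow> nat \<Rightarrow> 'g mtx \<Rightarrow> 'g mtx \<Rightarrow> 'g mtx" where
  "mtx_mult G n \<gamma> \<delta> = (\<lambda>i j. foldr (\<lambda>k. zadd (zmul G (\<gamma> i k) (\<delta> k j))) [1..<Suc n] None)"

definition mtx_diag :: "nat \<Rightarrow> (nat \<Rightarrow> 'g) \<Rightarrow> 'g mtx" where
  "mtx_diag n g = (\<lambda>i j. if i \<in> {1..n} \<and> i = j then Some (g i) else None)"

definition mtx_perm :: "('g, 'x) monoid_scheme \<Rightarrow> nat \<Rightarrow> (nat \<Rightarrow> nat) \<Rightarrow> 'g mtx" where
  "mtx_perm G n \<sigma> =
     (\<lambda>i j. if i \<in> {1..n} \<and> j \<in> {1..n} \<and> \<sigma> j = i then Some \<one>\<^bsub>G\<^esub> else None)"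

definition mtx_eps :: "('g, 'x) monoid_scheme \<Rightarrow> nat \<Rightarrow> nat \<Rightarrow> 'g mtx" where
  "mtx_eps G n k = (\<lambda>i j. if i \<in> {1..n} \<and> i = j \<and> i \<noteq> k then Some \<one>\<^bsub>G\<^esub> else None)"

text \<open>For \<open>n = 0\<close> the carrier consists of the empty matrix only, which is the identity.\<close>

definition Gbar :: "('g, 'x) monoid_scheme \<Rightarrow> nat \<Rightarrow> 'g mtx monoid" where
  "Gbar G n =
    \<lparr>carrier = {\<gamma>.
        (\<forall>i j g. \<gamma> i j = Some g \<longrightarrow> i \<in> {1..n} \<and> j \<in> {1..n} \<and> g \<in> carrier G) \<and>
        (\<forall>i j j'. \<gamma> i j \<noteq> None \<and> \<gamma> i j' \<noteq> None \<longrightarrow> j = j') \<and>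
        (\<forall>i i' j. \<gamma> i j \<noteq> None \<and> \<gamma> i' j \<noteq> None \<longrightarrow> i = i')},
     mult = mtx_mult G n,
     one = mtx_diag n (\<lambda>_. \<one>\<^bsub>G\<^esub>)\<rparr>"

abbreviation FGbar :: "('g, 'x) monoid_scheme \<Rightarrow> nat \<Rightarrow> ('f::field, 'g mtx \<Rightarrow>\<^sub>0 'f) module" where
  "FGbar G n \<equiv> monoid_algebra (Gbar G n)"

abbreviation Gpow :: "('g, 'x) monoid_scheme \<Rightarrow> nat \<Rightarrow> (nat \<Rightarrow> 'g) monoid" where
  "Gpow G n \<equiv> product_group {1..n} (\<lambda>_. G)"

text \<open>The element \<open>h\<^sup>(\<^sup>i\<^sup>)\<close> of \<open>G\<^sup>n\<close>.\<close>

definition at_pos :: "('g, 'x) monoid_scheme \<Rightarrow> nat \<Rightarrow> nat \<Rightarrow> 'g \<Rightarrow> nat \<Rightarrow> 'g" where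
  "at_pos G n i h = (\<lambda>j\<in>{1..n}. if j = i then h else \<one>\<^bsub>G\<^esub>)"

definition perm_act :: "nat \<Rightarrow> (nat \<Rightarrow> nat) \<Rightarrow> (nat \<Rightarrow> 'g) \<Rightarrow> nat \<Rightarrow> 'g" where
  "perm_act n w g = (\<lambda>j\<in>{1..n}. g (inv_into UNIV w j))"

text \<open>The element \<open>h\<^sup>(\<^sup>k\<^sup>) (h\<^sup>-\<^sup>1)\<^sup>(\<^sup>l\<^sup>)\<close> of \<open>G\<^sup>n\<close>.\<close>

definition pair_elt :: "('g, 'x) monoid_scheme \<Rightarrow> nat \<Rightarrow> nat \<Rightarrow> nat \<Rightarrow> 'g \<Rightarrow> nat \<Rightarrow> 'g" where
  "pair_elt G n k l h = at_pos G n k h \<otimes>\<^bsub>Gpow G n\<^esub> at_pos G n l (inv\<^bsub>G\<^esub> h)"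

definition t_elt ::
  "('g, 'x) monoid_scheme \<Rightarrow> nat \<Rightarrow> nat \<Rightarrow> nat \<Rightarrow> 'g mtx \<Rightarrow>\<^sub>0 'f::field" where
  "t_elt G n k l = (\<Sum>h\<in>carrier G. basis (mtx_diag n (pair_elt G n k l h)))"

text \<open>The embedding \<open>\<gamma> \<mapsto> diag(\<gamma>, 1, \<dots>, 1)\<close> of \<open>Gbar G m\<close> into \<open>Gbar G n\<close>, for \<open>m \<le> n\<close>.\<close>

definition mtx_embed :: "('g, 'x) monoid_scheme \<Rightarrow> nat \<Rightarrow> nat \<Rightarrow> 'g mtx \<Rightarrow> 'g mtx" where
  "mtx_embed G m n \<gamma> =
     (\<lambda>i j. if i \<le> m \<and> j \<le> m then \<gamma> i j
            else if m < i \<and> i \<le> n \<and> i = j then Some \<one>\<^bsub>G\<^esub> else None)"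

text \<open>The upper left corner of order \<open>n\<close>.\<close>

definition mtx_corner :: "nat \<Rightarrow> 'g mtx \<Rightarrow> 'g mtx" where
  "mtx_corner n \<gamma> = (\<lambda>i j. if i \<le> n \<and> j \<le> n then \<gamma> i j else None)"

definition mtx_deg :: "('g, 'x) monoid_scheme \<Rightarrow> nat \<Rightarrow> 'g mtx \<Rightarrow> nat" where
  "mtx_deg G n \<gamma> = card {k \<in> {1..n}. \<gamma> k k \<noteq> Some \<one>\<^bsub>G\<^esub>}"

text \<open>The supremum is a maximum, as \<open>keys a\<close> is finite; the degree of \<open>0\<close> is \<open>0\<close>.\<close>

definition deg :: "('g, 'x) monoid_scheme \<Rightarrow> nat \<Rightarrow> ('g mtx \<Rightarrow>\<^sub>0 'f::field) \<Rightarrow> nat" where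
  "deg G n a = Sup (mtx_deg G n ` Poly_Mapping.keys a)"

definition theta :: "nat \<Rightarrow> ('g mtx \<Rightarrow>\<^sub>0 'f::field) \<Rightarrow> 'g mtx \<Rightarrow>\<^sub>0 'f" where
  "theta n = lin_ext (mtx_corner (n - 1))"


section \<open>The limit centralizer algebras\<close>

text \<open>The matrices \<open>diag(1, \<dots>, 1, \<delta>)\<close> with \<open>m\<close> leading ones.\<close>

definition Gprime :: "('g, 'x) monoid_scheme \<Rightarrow> nat \<Rightarrow> nat \<Rightarrow> 'g mtx set" where
  "Gprime G m n = {\<gamma> \<in> carrier (Gbar G n). \<forall>k\<in>{1..m}. \<gamma> k k = Some \<one>\<^bsub>G\<^esub>}"

definition Zcent :: "('g, 'x) monoid_scheme \<Rightarrow> nat \<Rightarrow> nat \<Rightarrow> ('g mtx \<Rightarrow>\<^sub>0 'f::field) set" where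
  "Zcent G m n = {a \<in> carrier (FGbar G n). \<forall>\<gamma>\<in>Gprime G m n.
      a \<otimes>\<^bsub>FGbar G n\<^esub> basis \<gamma> = basis \<gamma> \<otimes>\<^bsub>FGbar G n\<^esub> a}"

text \<open>The sequences are indexed by \<open>{m..}\<close> and \<open>undefined\<close> below \<open>m\<close>.\<close>

definition Zbar :: "('g, 'x) monoid_scheme \<Rightarrow> nat \<Rightarrow> ('f::field, nat \<Rightarrow> 'g mtx \<Rightarrow>\<^sub>0 'f) module" where
  "Zbar G m =
    \<lparr>carrier = {\<alpha> \<in> (\<Pi>\<^sub>E n\<in>{m..}. Zcent G m n).
        (\<forall>n>m. theta n (\<alpha> n) = \<alpha> (n - 1)) \<and> bdd_above ((\<lambda>n. deg G n (\<alpha> n)) ` {m..})},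
     mult = (\<lambda>\<alpha> \<beta>. \<lambda>n\<in>{m..}. \<alpha> n \<otimes>\<^bsub>FGbar G n\<^esub> \<beta> n),
     one = (\<lambda>n\<in>{m..}. \<one>\<^bsub>FGbar G n\<^esub>),
     zero = (\<lambda>n\<in>{m..}. \<zero>\<^bsub>FGbar G n\<^esub>),
     add = (\<lambda>\<alpha> \<beta>. \<lambda>n\<in>{m..}. \<alpha> n \<oplus>\<^bsub>FGbar G n\<^esub> \<beta> n),
     smult = (\<lambda>c \<alpha>. \<lambda>n\<in>{m..}. c \<odot>\<^bsub>FGbar G n\<^esub> \<alpha> n)\<rparr>"

definition const_seq ::
  "('g, 'x) monoid_scheme \<Rightarrow> nat \<Rightarrow> ('g mtx \<Rightarrow>\<^sub>0 'f::field) \<Rightarrow> nat \<Rightarrow> 'g mtx \<Rightarrow>\<^sub>0 'f" where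
  "const_seq G m a = (\<lambda>n\<in>{m..}. lin_ext (mtx_embed G m n) a)"

definition u_elt :: "('g, 'x) monoid_scheme \<Rightarrow> nat \<Rightarrow> nat \<Rightarrow> 'g mtx \<Rightarrow>\<^sub>0 'f::field" where
  "u_elt G k n = (\<Sum>i=k+1..n.
      t_elt G n k i \<otimes>\<^bsub>FGbar G n\<^esub> basis (mtx_perm G n (transpose k i))
        \<otimes>\<^bsub>FGbar G n\<^esub> (\<one>\<^bsub>FGbar G n\<^esub> - basis (mtx_eps G n k))
        \<otimes>\<^bsub>FGbar G n\<^esub> (\<one>\<^bsub>FGbar G n\<^esub> - basis (mtx_eps G n i)))"

definition u_seq ::
  "('g, 'x) monoid_scheme \<Rightarrow> nat \<Rightarrow> nat \<Rightarrow> nat \<Rightarrow> 'g mtx \<Rightarrow>\<^sub>0 'f::field" where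
  "u_seq G m k = (\<lambda>n\<in>{m..}. u_elt G k n)"

definition Hbar :: "('g, 'x) monoid_scheme \<Rightarrow> nat \<Rightarrow> ('f::field, nat \<Rightarrow> 'g mtx \<Rightarrow>\<^sub>0 'f) module" where
  "Hbar G m = (Zbar G m)\<lparr>carrier :=
      gen_subalg (Zbar G m) (const_seq G m ` carrier (FGbar G m) \<union> u_seq G m ` {1..m})\<rparr>"


section \<open>The presentation\<close>

datatype 'g gen = GenG "nat \<Rightarrow> 'g" | GenS nat | GenE nat | GenU nat

definition Hgens :: "('g, 'x) monoid_scheme \<Rightarrow> nat \<Rightarrow> 'g gen set" where
  "Hgens G m = GenG ` carrier (Gpow G m) \<union> GenS ` {1..<m} \<union> GenE ` {1..m} \<union> GenU ` {1..m}"

text \<open>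
  \<open>basis w\<close> is the monomial of the word \<open>w\<close> in the generators. \<open>G_one\<close> identifies the identity of
  \<open>G\<^sup>m\<close> with that of the algebra and counts among the multiplication relations of the group; it
  does not follow from the other relations.
\<close>

inductive_set Hrels ::
  "('g, 'x) monoid_scheme \<Rightarrow> nat \<Rightarrow> (('g gen list \<Rightarrow>\<^sub>0 'f::field) \<times> ('g gen list \<Rightarrow>\<^sub>0 'f)) set"
  for G :: "('g, 'x) monoid_scheme" and m :: nat where
  G_mult: "g \<in> carrier (Gpow G m) \<Longrightarrow> g' \<in> carrier (Gpow G m) \<Longrightarrow>
    (basis [GenG g, GenG g'], basis [GenG (g \<otimes>\<^bsub>Gpow G m\<^esub> g')]) \<in> Hrels G m"
| G_one: "(basis [GenG \<one>\<^bsub>Gpow G m\<^esub>], basis []) \<in> Hrels G m"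
| S_square: "i \<in> {1..<m} \<Longrightarrow> (basis [GenS i, GenS i], basis []) \<in> Hrels G m"
| S_comm: "i \<in> {1..<m} \<Longrightarrow> j \<in> {1..<m} \<Longrightarrow> \<bar>int i - int j\<bar> > 1 \<Longrightarrow>
    (basis [GenS i, GenS j], basis [GenS j, GenS i]) \<in> Hrels G m"
| S_braid: "i \<in> {1..<m} \<Longrightarrow> i + 1 \<in> {1..<m} \<Longrightarrow>
    (basis [GenS i, GenS (i + 1), GenS i], basis [GenS (i + 1), GenS i, GenS (i + 1)]) \<in> Hrels G m"
| S_G: "i \<in> {1..<m} \<Longrightarrow> g \<in> carrier (Gpow G m) \<Longrightarrow>
    (basis [GenS i, GenG g], basis [GenG (perm_act m (transpose i (i + 1)) g), GenS i]) \<in> Hrels G m"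
| E_idem: "i \<in> {1..m} \<Longrightarrow> (basis [GenE i, GenE i], basis [GenE i]) \<in> Hrels G m"
| E_comm: "i \<in> {1..m} \<Longrightarrow> j \<in> {1..m} \<Longrightarrow>
    (basis [GenE i, GenE j], basis [GenE j, GenE i]) \<in> Hrels G m"
| S_E: "i \<in> {1..<m} \<Longrightarrow> (basis [GenS i, GenE i], basis [GenE (i + 1), GenS i]) \<in> Hrels G m"
| S_E_comm: "i \<in> {1..<m} \<Longrightarrow> j \<in> {1..m} \<Longrightarrow> j \<noteq> i \<Longrightarrow> j \<noteq> i + 1 \<Longrightarrow>
    (basis [GenS i, GenE j], basis [GenE j, GenS i]) \<in> Hrels G m"
| S_E_E: "i \<in> {1..<m} \<Longrightarrow>
    (basis [GenS i, GenE i, GenE (i + 1)], basis [GenE i, GenE (i + 1)]) \<in> Hrels G m"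
| E_G: "i \<in> {1..m} \<Longrightarrow> g \<in> carrier (Gpow G m) \<Longrightarrow>
    (basis [GenE i, GenG g], basis [GenG g, GenE i]) \<in> Hrels G m"
| E_absorb_left: "i \<in> {1..m} \<Longrightarrow> h \<in> carrier G \<Longrightarrow>
    (basis [GenE i, GenG (at_pos G m i h)], basis [GenE i]) \<in> Hrels G m"
| E_absorb_right: "i \<in> {1..m} \<Longrightarrow> h \<in> carrier G \<Longrightarrow>
    (basis [GenG (at_pos G m i h), GenE i], basis [GenE i]) \<in> Hrels G m"
| G_U: "k \<in> {1..m} \<Longrightarrow> g \<in> carrier (Gpow G m) \<Longrightarrow>
    (basis [GenG g, GenU k], basis [GenU k, GenG g]) \<in> Hrels G m"
| S_U: "k \<in> {1..<m} \<Longrightarrow>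
    (basis [GenS k, GenU k],
     basis [GenU (k + 1), GenS k]
       + (\<Sum>h\<in>carrier G. basis [GenG (pair_elt G m k (k + 1) h)])
           \<otimes>\<^bsub>free_alg (Hgens G m)\<^esub> (basis [] - basis [GenE k])
           \<otimes>\<^bsub>free_alg (Hgens G m)\<^esub> (basis [] - basis [GenE (k + 1)])) \<in> Hrels G m"
| S_U_comm: "k \<in> {1..<m} \<Longrightarrow> l \<in> {1..m} \<Longrightarrow> l \<noteq> k \<Longrightarrow> l \<noteq> k + 1 \<Longrightarrow>
    (basis [GenS k, GenU l], basis [GenU l, GenS k]) \<in> Hrels G m"
| U_comm: "k \<in> {1..m} \<Longrightarrow> l \<in> {1..m} \<Longrightarrow>
    (basis [GenU k, GenU l], basis [GenU l, GenU k]) \<in> Hrels G m"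
| E_U_zero: "k \<in> {1..m} \<Longrightarrow> (basis [GenE k, GenU k], 0) \<in> Hrels G m"
| U_E_zero: "k \<in> {1..m} \<Longrightarrow> (basis [GenU k, GenE k], 0) \<in> Hrels G m"
| E_U_comm: "k \<in> {1..m} \<Longrightarrow> l \<in> {1..m} \<Longrightarrow> l \<noteq> k \<Longrightarrow>
    (basis [GenE l, GenU k], basis [GenU k, GenE l]) \<in> Hrels G m"

definition Hpres ::
  "('g, 'x) monoid_scheme \<Rightarrow> nat \<Rightarrow> ('f::field, ('g gen list \<Rightarrow>\<^sub>0 'f) set) module" where
  "Hpres G m = presented_alg (Hgens G m) (Hrels G m)"

fun gen_elt ::
  "('g, 'x) monoid_scheme \<Rightarrow> nat \<Rightarrow> 'g gen \<Rightarrow> nat \<Rightarrow> 'g mtx \<Rightarrow>\<^sub>0 'f::field" where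
  "gen_elt G m (GenG g) = const_seq G m (basis (mtx_diag m g))"
| "gen_elt G m (GenS i) = const_seq G m (basis (mtx_perm G m (transpose i (i + 1))))"
| "gen_elt G m (GenE i) = const_seq G m (basis (mtx_eps G m i))"
| "gen_elt G m (GenU k) = u_seq G m k"

end

theory Submission
 imports Defs "HOL-Combinatorics.Permutations"
begin

text \<open>
An element of \<open>Z\<^sub>m\<close> is described by coordinates on partial monomial matrices \<open>\<g>\<close>: the sums of its
coefficients over all matrices containing \<open>\<g>\<close>, followed by inclusion and exclusion over the fixed points
of \<open>\<g>\<close> beyond \<open>m\<close>. The coordinates (\<open>XS\<close>) are arbitrary invariant functions of bounded support size, so
an element has a degree and a top symbol. On top symbols, \<open>u\<^sub>k\<close> contracts the path that leaves \<open>{1..m}\<close> at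
row \<open>k\<close>, and \<open>Z\<^sub>0\<close> together with the matrices of order \<open>m\<close> gives the symbols supported on block matrices.
Removing paths one by one shows that \<open>Z\<^sub>0\<close>, the matrices and the \<open>u\<^sub>k\<close> generate. As contractions commute, the
products of a sorted word in the \<open>u\<^sub>k\<close> with a matrix having nonzero rows at its letters are independent
over \<open>Z\<^sub>0\<close>. The relations of the presentation reduce every word to such products, which yields both claims.
\<close>

section \<open>Algebras over a field\<close>

text \<open>Containment is the right test because it survives truncation: a partial matrix with
  indices up to \<open>n - 1\<close> is contained in a matrix exactly when it is contained in its
  corner. A compatible sequence thus yields one function on finite partial matrices, with no
  \<open>n\<close> in it. This function hides the degree bound: already for the unit sequence it is
  nonzero on arbitrarily large identity pieces. The alternating sum over fixed points cancels such
  pieces, so that bounded degree becomes bounded support size. The same cancellation produces the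
  contractions. \<open>u_k\<close> swaps row k with a row i; a swapped matrix keeps its outer
  support and is too large to carry a coordinate of the other factor, so only a swap that creates a
  new fixed point leaves a smaller matrix behind. Undoing a contraction costs a fresh index, hence
  independence is tested at orders \<open>n\<close> that grow with the words involved. On the
  presented side, that a matrix has a well-defined image is derived from the relations themselves,
  starting with words in adjacent transpositions.\<close>

abbreviation (input) Iff (infixr "<->" 25) where "A <-> B \<equiv> A = B"
abbreviation psc :: "'b::field => ('a \<Rightarrow>\<^sub>0 'b) => ('a \<Rightarrow>\<^sub>0 'b)" where "psc c \<equiv> Poly_Mapping.map ((*) c)"
abbreviation keys :: "('a \<Rightarrow>\<^sub>0 'b::zero) => 'a set" where "keys \<equiv> Poly_Mapping.keys"
abbreviation lookup :: "('a \<Rightarrow>\<^sub>0 'b::zero) => 'a => 'b" where "lookup \<equiv> Poly_Mapping.lookup"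
abbreviation single :: "'a => 'b => 'a \<Rightarrow>\<^sub>0 'b::zero" where "single \<equiv> Poly_Mapping.single"

text \<open>The functional on formal combinations with prescribed values on the basis. Coefficients
  are a special case (\<open>lookup_lf\<close>), so identities in a monoid algebra are checked by
  pairing both sides with functionals.\<close>

definition lf :: "('a => 'f::field) => ('a \<Rightarrow>\<^sub>0 'f) => 'f" where
 "lf h a = (\<Sum>x\<in>keys a. lookup a x * h x)"

lemma lf_superset:
 assumes "finite X" "keys a <= X"
 shows "lf h a = (\<Sum>x\<in>X. lookup a x * h x)"
 unfolding lf_def by (rule sum.mono_neutral_left) (use assms in "auto simp: in_keys_iff")

lemma lf_zero [simp]: "lf h 0 = 0"
 by (simp add: lf_def)

lemma lf_add: "lf h (a + b) = lf h a + lf h b"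
proof -
 let ?X = "keys a \<union> keys b"
 have "lf h (a + b) = (\<Sum>x\<in>?X. lookup (a + b) x * h x)"
  by (rule lf_superset) (simp_all add: Poly_Mapping.keys_add)
 also have "... = lf h a + lf h b"
  by (simp add: lf_superset[of ?X] lookup_add distrib_right sum.distrib)
 finally show ?thesis .
qed

lemma lf_uminus: "lf h (- a) = - lf h a"
 using lf_add[of h a "- a"] by (simp add: add_eq_0_iff)

lemma lf_diff: "lf h (a - b) = lf h a - lf h b"
 using lf_add[of h a "- b"] by (simp add: lf_uminus)

lemma lf_sum: "lf h (\<Sum>i\<in>I. a i) = (\<Sum>i\<in>I. lf h (a i))"
 by (induction I rule: infinite_finite_induct) (simp_all add: lf_add)

lemma lf_single [simp]: "lf h (single x c) = c * h x"
 by (cases "c = 0") (simp_all add: lf_def)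

lemma lf_cong: "(\<And>x. x : keys a ==> h x = h' x) ==> lf h a = lf h' a"
 by (simp add: lf_def)

lemma lf_fun_add: "lf (%x. h x + h' x) a = lf h a + lf h' a"
 by (simp add: lf_def distrib_left sum.distrib)

lemma lf_fun_cmult: "lf (%x. c * h x) a = c * lf h a"
 by (simp add: lf_def sum_distrib_left mult.left_commute)

lemma lf_fun_sum: "lf (%x. \<Sum>i\<in>I. h i x) a = (\<Sum>i\<in>I. lf (h i) a)"
 unfolding lf_def sum_distrib_left by (rule sum.swap)

lemma lf_fun_zero [simp]: "lf (%x. 0) a = 0"
 by (simp add: lf_def)

lemma lookup_lf: "lookup a z = lf (%x. if x = z then 1 else 0) a"
 by (simp add: lf_def if_distrib in_keys_iff cong: if_cong)

lemma lookup_scale [simp]: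
 "lookup (psc (c::'f::field) a) x = c * lookup a x"
 by (simp add: Poly_Mapping.map.rep_eq when_def)

lemma keys_scale: "keys (psc (c::'f::field) a) <= keys a"
 by (auto simp: in_keys_iff)

lemma lf_scale: "lf h (psc c a) = c * lf h a"
 using lf_superset[OF _ keys_scale[of c a], of h]
 by (simp add: lf_def sum_distrib_left mult.assoc)

lemma scale_single [simp]:
 "psc (c::'f::field) (single x d) = single x (c * d)"
 by (rule poly_mapping_eqI) (simp add: lookup_single when_def)

lemma keys_add_sub:
 "keys a <= X ==> keys b <= X ==> keys (a + b) <= X"
 using Poly_Mapping.keys_add[of a b] by (meson Un_least order_trans)

lemma keys_sum:
 "(\<And>i. i : I ==> keys (f i) <= X) ==> keys (\<Sum>i\<in>I. f i) <= X"
 by (induction I rule: infinite_finite_induct) (simp_all add: keys_add_sub)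

lemma sum_singles:
 fixes a :: "'a \<Rightarrow>\<^sub>0 'f::field"
 shows "a = (\<Sum>x\<in>keys a. single x (lookup a x))"
proof (rule poly_mapping_eqI)
 fix z
 show "lookup a z =
   lookup (\<Sum>x\<in>keys a. single x (lookup a x)) z"
  by (simp add: lookup_sum lookup_single when_def in_keys_iff)
qed

lemma pm_induct [consumes 1, case_names zero single add]:
 fixes a :: "'a \<Rightarrow>\<^sub>0 'f::field"
 assumes "keys a <= X"
  and "P 0"
  and "\<And>x c. x : X ==> P (single x c)"
  and "\<And>a b. keys a <= X ==> keys b <= X ==> P a ==> P b ==> P (a + b)"
 shows "P a"
proof -
 have "P (\<Sum>x\<in>Y. single x (lookup a x))" if "finite Y" "Y <= X" for Y
  using that
 proof (induction Y rule: finite_induct)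
  case (insert x Y)
  have "keys (single x (lookup a x)) <= X" using insert by simp
  moreover have "keys (\<Sum>x\<in>Y. single x (lookup a x)) <= X"
   by (rule keys_sum) (use insert in auto)
  ultimately show ?case unfolding sum.insert[OF insert.hyps(1,2)]
   using insert assms(3,4) by blast
 qed (simp add: assms(2))
 from this[of "keys a"] show ?thesis
  using assms(1) sum_singles[of a] by simp
qed

section \<open>Unital associative algebras, linear combinations and spans\<close>

locale falg = ring A for A :: "('f::field, 'a) module" (structure) +
 assumes smult_closed [simp, intro]: "x : carrier A ==> c \<odot> x : carrier A"
  and smult_l_distr: "x : carrier A ==> (c + d) \<odot> x = c \<odot> x \<oplus> d \<odot> x"
  and smult_r_distr: "x : carrier A ==> y : carrier A ==> c \<odot> (x \<oplus> y) = c \<odot> x \<oplus> c \<odot> y"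
  and smult_assoc: "x : carrier A ==> (c * d) \<odot> x = c \<odot> (d \<odot> x)"
  and smult_one [simp]: "x : carrier A ==> 1 \<odot> x = x"
  and smult_mult_l: "x : carrier A ==> y : carrier A ==> (c \<odot> x) \<otimes> y = c \<odot> (x \<otimes> y)"
  and smult_mult_r: "x : carrier A ==> y : carrier A ==> x \<otimes> (c \<odot> y) = c \<odot> (x \<otimes> y)"
begin

lemma smult_zero_l [simp]: "x : carrier A ==> 0 \<odot> x = \<zero>"
 using smult_l_distr[of x 0 0] by (metis add.r_cancel_one' add_0 smult_closed)

lemma smult_zero_r [simp]: "c \<odot> \<zero> = \<zero>"
 using smult_r_distr[of \<zero> \<zero> c] by (metis add.r_cancel_one' l_zero smult_closed zero_closed)

lemma smult_minus_one: "x : carrier A ==> (- 1) \<odot> x = \<ominus> x"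
 using smult_l_distr[of x 1 "- 1"]
 by (metis add.inv_equality add.m_comm add.right_inverse smult_closed smult_one smult_zero_l)

definition lc :: "('b => 'a) => ('b \<Rightarrow>\<^sub>0 'f) => 'a" where
 "lc \<f> a = (\<Oplus>x\<in>keys a. lookup a x \<odot> \<f> x)"

lemma lc_closed [simp]: "(\<And>x. x : keys a ==> \<f> x : carrier A) ==> lc \<f> a : carrier A"
 unfolding lc_def by (rule finsum_closed) auto

lemma lc_zero [simp]: "lc \<f> 0 = \<zero>"
 by (simp add: lc_def)

lemma lc_single [simp]: "\<f> x : carrier A ==> lc \<f> (single x c) = c \<odot> \<f> x"
 by (cases "c = 0") (simp_all add: lc_def)

lemma lc_superset:
 assumes "finite X" "keys a <= X" "\<f> : X \<rightarrow> carrier A"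
 shows "lc \<f> a = (\<Oplus>x\<in>X. lookup a x \<odot> \<f> x)"
 unfolding lc_def
 by (rule add.finprod_mono_neutral_cong_left) (use assms in "auto simp: in_keys_iff Pi_iff")

lemma lc_add:
 assumes "keys a <= X" "keys b <= X" "\<f> : X \<rightarrow> carrier A"
 shows "lc \<f> (a + b) = lc \<f> a \<oplus> lc \<f> b"
proof -
 let ?X = "keys a \<union> keys b"
 have c: "\<f> : ?X \<rightarrow> carrier A" using assms by auto
 have "lc \<f> (a + b) = (\<Oplus>x\<in>?X. lookup (a + b) x \<odot> \<f> x)"
  by (rule lc_superset) (use c in "simp_all add: Poly_Mapping.keys_add")
 also have "... = (\<Oplus>x\<in>?X. lookup a x \<odot> \<f> x \<oplus> lookup b x \<odot> \<f> x)"
  by (rule finsum_cong') (use c in "auto simp: lookup_add smult_l_distr Pi_iff")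
 also have "... = (\<Oplus>x\<in>?X. lookup a x \<odot> \<f> x) \<oplus> (\<Oplus>x\<in>?X. lookup b x \<odot> \<f> x)"
  by (rule finsum_addf) (use c in "auto simp: Pi_iff")
 also have "... = lc \<f> a \<oplus> lc \<f> b"
  using c by (simp add: lc_superset[of ?X])
 finally show ?thesis .
qed

lemma finsum_smult:
 assumes "finite X" "f : X \<rightarrow> carrier A"
 shows "c \<odot> (\<Oplus>x\<in>X. f x) = (\<Oplus>x\<in>X. c \<odot> f x)"
 using assms by (induction X rule: finite_induct) (auto simp: smult_r_distr Pi_iff)

lemma lc_scale:
 assumes "\<f> : keys a \<rightarrow> carrier A"
 shows "lc \<f> (psc c a) = c \<odot> lc \<f> a"
proof -
 have "lc \<f> (psc c a) = (\<Oplus>x\<in>keys a. (c * lookup a x) \<odot> \<f> x)"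
  using lc_superset[OF _ keys_scale assms] by simp
 also have "... = (\<Oplus>x\<in>keys a. c \<odot> (lookup a x \<odot> \<f> x))"
  by (rule finsum_cong') (use assms in "auto simp: smult_assoc Pi_iff")
 also have "... = c \<odot> lc \<f> a"
  unfolding lc_def by (rule finsum_smult[symmetric]) (use assms in auto)
 finally show ?thesis .
qed

lemma lc_cong:
 "(\<And>x. x : keys a ==> \<f> x = \<psi> x) ==> \<psi> : keys a \<rightarrow> carrier A ==> lc \<f> a = lc \<psi> a"
 unfolding lc_def by (rule finsum_cong') auto

text \<open>Built by adding one scaled generator at a time, so that stability of a span under a left
  multiplication reduces to the generators by induction (\<open>lspan_map\<close>).\<close>

inductive_set lspan :: "'a set => 'a set" for S where
 lspan_zero: "\<zero> : lspan S"
| lspan_step: "x : S ==> v : lspan S ==> c \<odot> x \<oplus> v : lspan S"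

lemma lspan_carrier: "S <= carrier A ==> v : lspan S ==> v : carrier A"
 by (rotate_tac, induction rule: lspan.induct) auto

lemma lspan_base: "S <= carrier A ==> x : S ==> x : lspan S"
 using lspan_step[of x S \<zero> 1] lspan_zero by (auto simp: subset_iff)

lemma lspan_add:
 assumes "S <= carrier A" "v : lspan S" "w : lspan S"
 shows "v \<oplus> w : lspan S"
 using assms(2)
proof (induction rule: lspan.induct)
 case lspan_zero
 then show ?case using assms lspan_carrier by simp
next
 case (lspan_step x v c)
 then have "c \<odot> x \<oplus> v \<oplus> w = c \<odot> x \<oplus> (v \<oplus> w)"
  using assms lspan_carrier[OF assms(1)] by (auto simp: a_assoc subset_iff)
 then show ?case using lspan_step lspan.lspan_step by metis
qed

lemma lspan_smult:
 assumes "S <= carrier A" "v : lspan S"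
 shows "d \<odot> v : lspan S"
 using assms(2)
proof (induction rule: lspan.induct)
 case lspan_zero
 then show ?case by (simp add: lspan.lspan_zero)
next
 case (lspan_step x v c)
 then have "d \<odot> (c \<odot> x \<oplus> v) = (d * c) \<odot> x \<oplus> d \<odot> v"
  using assms lspan_carrier[OF assms(1)] by (auto simp: smult_r_distr smult_assoc subset_iff)
 then show ?case using lspan_step lspan.lspan_step by metis
qed

lemma lspan_uminus:
 assumes "S <= carrier A" "v : lspan S"
 shows "\<ominus> v : lspan S"
 using lspan_smult[OF assms, of "- 1"] lspan_carrier[OF assms] by (simp add: smult_minus_one)

lemma lspan_map:
 assumes "S <= carrier A" "T <= carrier A" "v : lspan S" "x : carrier A"
  and "\<And>s. s : S ==> x \<otimes> s : lspan T"
 shows "x \<otimes> v : lspan T"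
 using assms(3)
proof (induction rule: lspan.induct)
 case lspan_zero
 then show ?case using assms by (simp add: lspan.lspan_zero)
next
 case (lspan_step y v c)
 then have "x \<otimes> (c \<odot> y \<oplus> v) = c \<odot> (x \<otimes> y) \<oplus> x \<otimes> v"
  using assms lspan_carrier[OF assms(1)] by (auto simp: r_distr smult_mult_r subset_iff)
 then show ?case using lspan_step assms(2,5) lspan_smult lspan_add by metis
qed

lemma lspan_mono: "S <= T ==> lspan S <= lspan T"
proof
 fix v assume "S <= T" "v : lspan S"
 from this(2,1) show "v : lspan T"
  by (induction rule: lspan.induct) (auto intro: lspan.intros)
qed

lemma lspan_lspan:
 assumes "S <= lspan T" "T <= carrier A" "v : lspan S"
 shows "v : lspan T"
 using assms(3)
 by (induction rule: lspan.induct)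
  (use assms lspan_smult lspan_add in "auto intro!: lspan.intros(1) simp: subset_iff")

lemma lspan_image_lc:
 assumes "b : X \<rightarrow> carrier A" "v : lspan (b ` X)"
 shows "\<exists>a. keys a <= X & v = lc b a"
 using assms(2)
proof (induction rule: lspan.induct)
 case lspan_zero
 show ?case by (rule exI[of _ 0]) simp
next
 case (lspan_step y v c)
 then obtain a x where a: "keys a <= X" "v = lc b a" "x : X" "y = b x" by auto
 have k: "keys (single x c) <= X" using a by auto
 have "c \<odot> y \<oplus> v = lc b (single x c + a)"
  unfolding lc_add[OF k a(1) assms(1)] a(2,4)
  by (subst lc_single) (use a(3) assms(1) in "auto simp: Pi_iff")
 moreover have "keys (single x c + a) <= X"
  using k a(1) by (rule keys_add_sub)
 ultimately show ?case by blast
qed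

end

section \<open>Algebra homomorphisms\<close>

definition alg_hom :: "('f::field, 'a) module => ('f, 'b) module => ('a => 'b) set" where
 "alg_hom A B = {\<f> : ring_hom A B. \<forall>c. \<forall>x\<in>carrier A. \<f> (c \<odot>\<^bsub>A\<^esub> x) = c \<odot>\<^bsub>B\<^esub> \<f> x}"

lemma homD:
 assumes "\<f> : alg_hom A B"
 shows "x : carrier A ==> \<f> x : carrier B"
  and "x : carrier A ==> y : carrier A ==> \<f> (x \<otimes>\<^bsub>A\<^esub> y) = \<f> x \<otimes>\<^bsub>B\<^esub> \<f> y"
  and "x : carrier A ==> y : carrier A ==> \<f> (x \<oplus>\<^bsub>A\<^esub> y) = \<f> x \<oplus>\<^bsub>B\<^esub> \<f> y"
  and "\<f> \<one>\<^bsub>A\<^esub> = \<one>\<^bsub>B\<^esub>"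
  and "x : carrier A ==> \<f> (c \<odot>\<^bsub>A\<^esub> x) = c \<odot>\<^bsub>B\<^esub> \<f> x"
 using assms by (auto simp: alg_hom_def ring_hom_def)

lemma alg_hom_zero:
 assumes "falg A" "falg B" "\<f> : alg_hom A B"
 shows "\<f> \<zero>\<^bsub>A\<^esub> = \<zero>\<^bsub>B\<^esub>"
proof -
 interpret A: falg A by fact
 interpret B: falg B by fact
 have "\<f> \<zero>\<^bsub>A\<^esub> = \<f> (0 \<odot>\<^bsub>A\<^esub> \<zero>\<^bsub>A\<^esub>)" by simp
 also have "... = 0 \<odot>\<^bsub>B\<^esub> \<f> \<zero>\<^bsub>A\<^esub>" using homD(5)[OF assms(3)] A.zero_closed by blast
 also have "... = \<zero>\<^bsub>B\<^esub>" using homD(1)[OF assms(3)] by auto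
 finally show ?thesis .
qed

lemma alg_hom_ring:
 assumes "falg A" "falg B" "\<f> : alg_hom A B"
 shows "ring_hom_ring A B \<f>"
proof -
 interpret A: falg A by fact
 interpret B: falg B by fact
 show ?thesis
  by (rule ring_hom_ringI2) (use assms in "auto simp: alg_hom_def A.ring_axioms B.ring_axioms")
qed

lemma (in falg) alg_hom_lc:
 assumes "falg B" "h : alg_hom A B" "\<f> : X \<rightarrow> carrier A" "keys a <= X"
 shows "h (lc \<f> a) = falg.lc B (h o \<f>) a"
proof -
 interpret B: falg B by fact
 have h\<f>: "h o \<f> : X \<rightarrow> carrier B" using assms(2,3) by (auto simp: Pi_iff homD)
 show ?thesis using assms(4)
 proof (induction rule: pm_induct)
  case zero
  show ?case using alg_hom_zero[OF falg_axioms assms(1,2)] by simp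
 next
  case (single x c)
  then show ?case using assms(3) h\<f> by (simp add: Pi_iff homD[OF assms(2)])
 next
  case (add a b)
  have "lc \<f> a : carrier A" "lc \<f> b : carrier A" using assms(3) add by (auto simp: Pi_iff subset_iff)
  then show ?case
   using add lc_add[OF add(1,2) assms(3)] B.lc_add[OF add(1,2) h\<f>]
   by (simp add: homD[OF assms(2)] comp_def)
 qed
qed

subsection \<open>Monoid algebras\<close>

text \<open>A functional of a product is an iterated pairing. Associativity, the unit laws and
  distributivity of monoid algebras then become identities between nested evaluations on basis
  elements.\<close>

lemma lf_ma_mult:
 "lf h (a \<otimes>\<^bsub>monoid_algebra M\<^esub> b) = lf (%x. lf (%y. h (x \<otimes>\<^bsub>M\<^esub> y)) b) a"
 unfolding monoid_algebra_def
 by (simp add: lf_sum) (simp add: lf_def sum_distrib_left mult.assoc)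

lemma ma_simps [simp]:
 "\<one>\<^bsub>monoid_algebra M\<^esub> = basis \<one>\<^bsub>M\<^esub>" "\<zero>\<^bsub>monoid_algebra M\<^esub> = 0"
 "a \<oplus>\<^bsub>monoid_algebra M\<^esub> b = a + b" "c \<odot>\<^bsub>monoid_algebra M\<^esub> a = psc c a"
 "a : carrier (monoid_algebra M) <-> keys a <= carrier M"
 by (simp_all add: monoid_algebra_def)

lemma ma_single_mult [simp]:
 "single x c \<otimes>\<^bsub>monoid_algebra M\<^esub> single y d = single (x \<otimes>\<^bsub>M\<^esub> y) (c * d)"
 by (rule poly_mapping_eqI)
  (simp add: lookup_lf lf_ma_mult mult.assoc)

lemma ma_keys_mult:
 assumes "keys a <= X" "keys b <= Y" "\<And>x y. x : X ==> y : Y ==> x \<otimes>\<^bsub>M\<^esub> y : Z"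
 shows "keys (a \<otimes>\<^bsub>monoid_algebra M\<^esub> b) <= Z"
 unfolding monoid_algebra_def
 by (simp, intro keys_sum) (use assms in "auto split: if_splits")

lemma ma_l_distr:
 "(a + b) \<otimes>\<^bsub>monoid_algebra M\<^esub> c = a \<otimes>\<^bsub>monoid_algebra M\<^esub> c + b \<otimes>\<^bsub>monoid_algebra M\<^esub> c"
 by (rule poly_mapping_eqI) (simp only: lookup_lf lf_ma_mult lookup_add lf_add)

lemma ma_r_distr:
 "a \<otimes>\<^bsub>monoid_algebra M\<^esub> (b + c) = a \<otimes>\<^bsub>monoid_algebra M\<^esub> b + a \<otimes>\<^bsub>monoid_algebra M\<^esub> c"
 by (rule poly_mapping_eqI) (simp only: lookup_lf lf_ma_mult lookup_add lf_add lf_fun_add)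

lemma falg_ma:
 assumes "monoid M"
 shows "falg (monoid_algebra M :: ('f::field, _) module)"
proof -
 interpret M: monoid M by fact
 let ?A = "monoid_algebra M :: ('f::field, _) module"
 have "abelian_group ?A"
 proof (rule abelian_groupI)
  fix x assume "x : carrier ?A"
  then show "\<exists>y\<in>carrier ?A. y \<oplus>\<^bsub>?A\<^esub> x = \<zero>\<^bsub>?A\<^esub>"
   by (intro bexI[of _ "- x"]) (auto simp: in_keys_iff)
 qed (auto simp: add_ac keys_add_sub)
 moreover have "monoid ?A"
 proof (rule monoidI)
  fix x y assume "x : carrier ?A" "y : carrier ?A"
  then show "x \<otimes>\<^bsub>?A\<^esub> y : carrier ?A"
   unfolding ma_simps by (rule ma_keys_mult) simp
 next
  fix x y z assume *: "x : carrier ?A" "y : carrier ?A" "z : carrier ?A"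
  show "x \<otimes>\<^bsub>?A\<^esub> y \<otimes>\<^bsub>?A\<^esub> z = x \<otimes>\<^bsub>?A\<^esub> (y \<otimes>\<^bsub>?A\<^esub> z)"
   by (rule poly_mapping_eqI, simp only: lookup_lf lf_ma_mult)
    (use * in "auto intro!: lf_cong simp: M.m_assoc subset_iff")
 next
  fix x assume *: "x : carrier ?A"
  show "\<one>\<^bsub>?A\<^esub> \<otimes>\<^bsub>?A\<^esub> x = x"
   by (rule poly_mapping_eqI, simp only: lookup_lf lf_ma_mult ma_simps lf_single)
    (use * in "auto intro!: lf_cong simp: subset_iff")
  show "x \<otimes>\<^bsub>?A\<^esub> \<one>\<^bsub>?A\<^esub> = x"
   by (rule poly_mapping_eqI, simp only: lookup_lf lf_ma_mult ma_simps lf_single)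
    (use * in "auto intro!: lf_cong simp: subset_iff")
 qed auto
 ultimately have "ring ?A"
  by (intro ringI) (auto simp: ma_l_distr ma_r_distr)
 moreover have "falg_axioms ?A"
  by unfold_locales
   (auto intro!: poly_mapping_eqI dest!: keys_scale[THEN subsetD] simp: lookup_add algebra_simps,
    simp_all only: lookup_scale lookup_lf lf_ma_mult lf_scale lf_fun_cmult)
 ultimately show ?thesis by (rule falg.intro)
qed

text \<open>Multiplicativity on the basis extends in two rounds of linear induction: over the right
  factor while the left one is a single term, then over the left factor.\<close>

lemma (in falg) lc_ma_hom:
 assumes "\<f> : carrier M \<rightarrow> carrier A" "\<f> \<one>\<^bsub>M\<^esub> = \<one>" "monoid M"
  and "\<And>x y. x : carrier M ==> y : carrier M ==> \<f> (x \<otimes>\<^bsub>M\<^esub> y) = \<f> x \<otimes> \<f> y"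
 shows "lc \<f> : alg_hom (monoid_algebra M) A"
proof -
 interpret M: monoid M by fact
 let ?X = "carrier M"
 have cl: "lc \<f> a : carrier A" if "keys a <= ?X" for a
  using that assms(1) by (auto simp: Pi_iff subset_iff)
 have add: "lc \<f> (a + b) = lc \<f> a \<oplus> lc \<f> b"
  if "keys a <= ?X" "keys b <= ?X" for a b
  using lc_add[OF that assms(1)] .
 have mc: "keys (a \<otimes>\<^bsub>monoid_algebra M\<^esub> b) <= ?X"
  if "keys a <= ?X" "keys b <= ?X" for a b :: "_ \<Rightarrow>\<^sub>0 'f"
  using that by (rule ma_keys_mult) simp
 have m1: "lc \<f> (single x c \<otimes>\<^bsub>monoid_algebra M\<^esub> b) = lc \<f> (single x c) \<otimes> lc \<f> b"
  if "keys b <= ?X" "x : ?X" for x c b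
  using that(1)
 proof (induction rule: pm_induct)
  case zero
  have "single x c \<otimes>\<^bsub>monoid_algebra M\<^esub> 0 = 0" by (simp add: monoid_algebra_def)
  then show ?case using that assms(1) by (simp add: Pi_iff)
 next
  case (single y d)
  then show ?case using that assms(1)
   by (simp add: Pi_iff assms(4) smult_mult_l smult_mult_r smult_assoc[symmetric] mult.commute)
 next
  case (add a b)
  have k: "keys (single x c) <= ?X" using that by auto
  show ?case using add by (simp add: ma_r_distr lc_add[OF mc[OF k] mc[OF k] assms(1)] cl
    lc_add[OF add(1,2) assms(1)] r_distr cl[OF k])
 qed
 have m: "lc \<f> (a \<otimes>\<^bsub>monoid_algebra M\<^esub> b) = lc \<f> a \<otimes> lc \<f> b"
  if "keys a <= ?X" "keys b <= ?X" for a b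
  using that(1)
 proof (induction rule: pm_induct)
  case zero
  have "0 \<otimes>\<^bsub>monoid_algebra M\<^esub> b = 0" by (simp add: monoid_algebra_def)
  then show ?case using that cl by simp
 next
  case (single y d)
  then show ?case using m1 that by simp
 next
  case (add a' a'')
  show ?case using add that
   by (simp add: ma_l_distr lc_add[OF mc mc assms(1)] cl lc_add[OF add(1,2) assms(1)] l_distr)
 qed
 show ?thesis unfolding alg_hom_def ring_hom_def
  using assms(1,2) cl add m by (auto simp: lc_scale Pi_iff subset_iff)
qed

subsection \<open>Subalgebras and quotients\<close>

lemma alg_iso_alt: "alg_iso A B = {\<f> : alg_hom A B. bij_betw \<f> (carrier A) (carrier B)}"
 by (auto simp: alg_iso_def alg_hom_def ring_iso_def)

lemma alg_iso_inv:
 assumes "falg A" "\<f> : alg_iso A B"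
 shows "inv_into (carrier A) \<f> : alg_iso B A"
proof -
 interpret A: falg A by fact
 have bij: "bij_betw \<f> (carrier A) (carrier B)" using assms by (simp add: alg_iso_alt)
 have inv: "inv_into (carrier A) \<f> (\<f> x) = x" if "x : carrier A" for x
  using bij that by (rule bij_betw_inv_into_left)
 have "inv_into (carrier A) \<f> (c \<odot>\<^bsub>B\<^esub> y) = c \<odot>\<^bsub>A\<^esub> inv_into (carrier A) \<f> y"
  if y: "y : carrier B" for c y
 proof -
  obtain x where x: "x : carrier A" "y = \<f> x" using bij y by (auto simp: bij_betw_def)
  have "c \<odot>\<^bsub>B\<^esub> y = \<f> (c \<odot>\<^bsub>A\<^esub> x)" using assms(2) x by (simp add: alg_iso_def)
  then show ?thesis using x inv by simp
 qed
 moreover have "inv_into (carrier A) \<f> : ring_iso B A"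
  by (rule ring_iso_set_sym) (use assms in "auto simp: alg_iso_def A.ring_axioms")
 ultimately show ?thesis by (simp add: alg_iso_def)
qed

lemma falg_subalg:
 assumes "falg A" "is_subalg B A"
 shows "falg (A\<lparr>carrier := B\<rparr>)"
proof -
 interpret A: falg A by fact
 have sub: "B <= carrier A" using assms(2) subringE(1) unfolding is_subalg_def by blast
 have "ring (A\<lparr>carrier := B\<rparr>)" using assms(2) A.subring_is_ring by (simp add: is_subalg_def)
 moreover have "falg_axioms (A\<lparr>carrier := B\<rparr>)"
  using assms(2) sub
  by unfold_locales (auto simp: is_subalg_def subset_iff A.smult_l_distr A.smult_r_distr
    A.smult_assoc A.smult_mult_l A.smult_mult_r)
 ultimately show ?thesis by (rule falg.intro)
qed

lemma is_subalgI:
 assumes "falg A" "B <= carrier A" "\<one>\<^bsub>A\<^esub> : B"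
  "\<And>x y. x : B ==> y : B ==> x \<oplus>\<^bsub>A\<^esub> y : B"
  "\<And>x y. x : B ==> y : B ==> x \<otimes>\<^bsub>A\<^esub> y : B"
  "\<And>c x. x : B ==> c \<odot>\<^bsub>A\<^esub> x : B"
 shows "is_subalg B A"
proof -
 interpret A: falg A by fact
 have "subring B A"
  by (rule A.subringI) (use assms A.smult_minus_one in "metis subsetD")+
 then show ?thesis using assms(6) by (simp add: is_subalg_def)
qed

lemma is_subalgD:
 assumes "is_subalg B A"
 shows "B <= carrier A" "\<one>\<^bsub>A\<^esub> : B" "\<zero>\<^bsub>A\<^esub> : B" "x : B ==> y : B ==> x \<oplus>\<^bsub>A\<^esub> y : B"
  "x : B ==> y : B ==> x \<otimes>\<^bsub>A\<^esub> y : B" "x : B ==> c \<odot>\<^bsub>A\<^esub> x : B"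
 using assms subringE unfolding is_subalg_def by metis+

lemma subalg_c: "falg A ==> is_subalg (carrier A) A"
proof -
 assume "falg A"
 then interpret A: falg A .
 show ?thesis by (rule is_subalgI) (use \<open>falg A\<close> in auto)
qed

lemma gen_subalg:
 assumes "falg A" "S <= carrier A"
 shows "is_subalg (gen_subalg A S) A" "S <= gen_subalg A S"
  "is_subalg B A ==> S <= B ==> gen_subalg A S <= B"
proof -
 show "is_subalg (gen_subalg A S) A"
  using subalg_c[OF assms(1)] assms(2) unfolding gen_subalg_def
  by (intro is_subalgI[OF assms(1)]) (auto intro: is_subalgD)
qed (auto simp: gen_subalg_def)

lemma is_subalg_image:
 assumes "falg A" "falg B" "h : alg_hom A B"
 shows "is_subalg (h ` carrier A) B"
proof -
 interpret A: falg A by fact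
 note h = homD[OF assms(3)]
 show ?thesis
 proof (rule is_subalgI[OF assms(2)])
  show "\<one>\<^bsub>B\<^esub> : h ` carrier A" using h(4) by (metis A.one_closed imageI)
 qed (use h in "force simp flip: h(2,3,5)")+
qed

text \<open>Multiplying by the scalar multiple of the unit realises the scalar, so a ring ideal is
  automatically a subspace and the quotient carries scalars.\<close>

lemma (in falg) ideal_smult:
 assumes "ideal I A" "i : I"
 shows "c \<odot> i : I"
proof -
 interpret ideal I A by fact
 have "i : carrier A" using assms(2) by (rule a_Hcarr)
 then show ?thesis using I_l_closed[OF assms(2), of "c \<odot> \<one>"] by (simp add: smult_mult_l)
qed

lemma alg_quot_simps [simp]:
 "carrier (alg_quot A I) = carrier (A Quot I)" "monoid.mult (alg_quot A I) = monoid.mult (A Quot I)"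
 "one (alg_quot A I) = one (A Quot I)" "zero (alg_quot A I) = zero (A Quot I)"
 "add (alg_quot A I) = add (A Quot I)"
 by (simp_all add: alg_quot_def)

lemma (in falg) alg_quot_smult:
 assumes "ideal I A" "x : carrier A"
 shows "c \<odot>\<^bsub>alg_quot A I\<^esub> (I +> x) = I +> (c \<odot> x)"
proof -
 interpret I: ideal I A by fact
 have "I +> (c \<odot> y) = I +> (c \<odot> x)" if "y : I +> x" for y
 proof -
  obtain i where i: "i : I" "y = i \<oplus> x" using \<open>y : I +> x\<close> by (auto simp: a_r_coset_def')
  have ic: "i : carrier A" using i(1) by (rule I.a_Hcarr)
  have "c \<odot> y = c \<odot> i \<oplus> c \<odot> x" using i ic assms by (simp add: smult_r_distr)
  then have "c \<odot> y : I +> (c \<odot> x)"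
   using ideal_smult[OF assms(1) i(1)] by (auto simp: a_r_coset_def')
  then show ?thesis using I.a_repr_independence' smult_closed[OF assms(2)] by metis
 qed
 moreover have "I +> x ~= {}" using I.a_rcos_self[OF assms(2)] by auto
 ultimately show ?thesis by (auto simp: alg_quot_def)
qed

lemma (in falg) coset_alg_hom:
 assumes "ideal I A"
 shows "(+>) I : alg_hom A (alg_quot A I)"
 using ideal.rcos_ring_hom[OF assms] alg_quot_smult[OF assms]
 by (auto simp: alg_hom_def ring_hom_def)

lemma (in falg) carrier_alg_quot: "carrier (alg_quot A I) = (+>) I ` carrier A"
 by (auto simp: FactRing_simps a_r_coset_def')

lemma (in falg) falg_alg_quot:
 assumes "ideal I A"
 shows "falg (alg_quot A I)"
proof -
 let ?Q = "alg_quot A I"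
 note h = homD[OF coset_alg_hom[OF assms], unfolded alg_quot_simps]
 have *: "ring (A Quot I)" using assms by (rule ideal.quotient_is_ring)
 \<comment> \<open>The two records have different types, but the ring axioms only read fields on
   which they agree; unfolding all locales makes the two propositions identical.\<close>
 have "ring ?Q <-> ring (A Quot I)"
  unfolding ring_def abelian_group_def abelian_monoid_def abelian_group_axioms_def ring_axioms_def
   monoid_def comm_monoid_def comm_monoid_axioms_def comm_group_def group_def group_axioms_def Units_def
   alg_quot_simps monoid.simps partial_object.simps by (rule refl)
 then have "ring ?Q" using * by simp
 moreover have "falg_axioms ?Q"
  unfolding falg_axioms_def carrier_alg_quot
  unfolding alg_quot_simps
  by (auto simp flip: h(2,3,5) simp: smult_l_distr smult_r_distr smult_assoc smult_mult_l smult_mult_r)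
 ultimately show ?thesis by (rule falg.intro)
qed

lemma alg_quot_iso:
 assumes "falg A" "falg B" "h : alg_hom A B" "h ` carrier A = carrier B"
 defines "I \<equiv> a_kernel A B h"
 shows "(%X. the_elem (h ` X)) : alg_iso (alg_quot A I) B"
  and "x : carrier A ==> the_elem (h ` (I +>\<^bsub>A\<^esub> x)) = h x"
proof -
 interpret A: falg A by fact
 interpret h: ring_hom_ring A B h using alg_hom_ring assms by blast
 have I: "ideal I A" unfolding I_def by (rule h.kernel_is_ideal)
 show el: "the_elem (h ` (I +>\<^bsub>A\<^esub> x)) = h x" if "x : carrier A" for x
  unfolding I_def using that by (rule h.the_elem_simp)
 have "(%X. the_elem (h ` X)) : ring_iso (A Quot I) B"
  unfolding I_def by (rule h.FactRing_iso_set) (rule assms(4))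
 then show "(%X. the_elem (h ` X)) : alg_iso (alg_quot A I) B"
  unfolding alg_iso_def ring_iso_def ring_hom_def A.carrier_alg_quot[symmetric]
  using homD(5)[OF assms(3)]
  by (auto simp: A.carrier_alg_quot[of I, simplified] A.alg_quot_smult[OF I] el)
qed

lemma pm_diff: "a - b = a + psc (- 1) (b :: 'a \<Rightarrow>\<^sub>0 'f::field)"
 by (rule poly_mapping_eqI) (simp add: lookup_add lookup_minus)

lemma alg_hom_diff:
 fixes a b :: "'c \<Rightarrow>\<^sub>0 'f::field"
 assumes A: "falg A" and \<f>: "\<f> : alg_hom (monoid_algebra M) A"
  and "keys a <= carrier M" "keys b <= carrier M"
 shows "\<f> (a - b) = \<f> a \<ominus>\<^bsub>A\<^esub> \<f> b"
proof -
 interpret A: falg A by fact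
 have b: "keys (psc (- 1) b) <= carrier M" by (rule order_trans[OF keys_scale assms(4)])
 have "\<f> (a - b) = \<f> a \<oplus>\<^bsub>A\<^esub> \<f> (psc (- 1) b)"
  unfolding pm_diff using homD(3)[OF \<f>, of a "psc (- 1) b"] assms(3) b by simp
 also have "\<f> (psc (- 1) b) = \<ominus>\<^bsub>A\<^esub> \<f> b"
  using homD(5)[OF \<f>, of b "- 1"] homD(1)[OF \<f>, of b] assms(4) by (simp add: A.smult_minus_one)
 finally show ?thesis by (simp add: A.minus_eq)
qed

lemma alg_hom_sum:
 fixes f :: "'i => 'c \<Rightarrow>\<^sub>0 'f::field"
 assumes A: "falg A" and \<f>: "\<f> : alg_hom (monoid_algebra M) A" and M: "monoid M"
  and "finite I" "\<And>i. i : I ==> keys (f i) <= carrier M"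
 shows "\<f> (\<Sum>i\<in>I. f i) = (\<Oplus>\<^bsub>A\<^esub>i\<in>I. \<f> (f i))"
 using assms(4,5)
proof (induction I rule: finite_induct)
 interpret A: falg A by fact
 {
  case empty
  then show ?case using alg_hom_zero[OF falg_ma[OF M] A \<f>] by simp
 next
  case (insert i I)
  have c: "\<f> (f j) : carrier A" if "j : insert i I" for j
   using homD(1)[OF \<f>, of "f j"] insert.prems[OF that] by simp
  have "keys (\<Sum>i\<in>I. f i) <= carrier M" by (rule keys_sum) (use insert.prems in blast)
  then have "\<f> (\<Sum>i\<in>insert i I. f i) = \<f> (f i) \<oplus>\<^bsub>A\<^esub> \<f> (\<Sum>i\<in>I. f i)"
   using homD(3)[OF \<f>, of "f i" "\<Sum>i\<in>I. f i"] insert by simp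
  also have "\<f> (\<Sum>i\<in>I. f i) = (\<Oplus>\<^bsub>A\<^esub>i\<in>I. \<f> (f i))" using insert by blast
  also have "\<f> (f i) \<oplus>\<^bsub>A\<^esub> (\<Oplus>\<^bsub>A\<^esub>i\<in>I. \<f> (f i)) = (\<Oplus>\<^bsub>A\<^esub>i\<in>insert i I. \<f> (f i))"
   by (rule A.finsum_insert[symmetric]) (use insert.hyps c in auto)
  finally show ?case .
 }
qed

subsection \<open>Recognising tensor products\<close>

text \<open>The hypotheses say that \<open>Z\<close> is a free \<open>A\<close>-module on the images of a basis of \<open>B\<close>.\<close>

lemma tensor_iso_of_free:
 fixes A :: "('f::field, 'a) module" and B :: "('f, 'b) module" and Z :: "('f, 'c) module"
  and b :: "'i => 'b"
 assumes A: "falg A" and B: "falg B" and Z: "falg Z"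
  and \<r>: "\<r> : alg_hom A Z" and \<iota>: "\<iota> : alg_hom B Z"
  and comm: "\<And>x y. x : carrier A ==> y : carrier B ==> \<r> x \<otimes>\<^bsub>Z\<^esub> \<iota> y = \<iota> y \<otimes>\<^bsub>Z\<^esub> \<r> x"
  and b: "b : I \<rightarrow> carrier B"
  and span: "\<And>y. y : carrier B ==> \<exists>c. keys c <= I & y = falg.lc B b c"
  and gen: "\<And>W. is_subalg W Z ==> \<r> ` carrier A <= W ==> \<iota> ` carrier B <= W ==> carrier Z <= W"
  and indep: "\<And>F z. finite F ==> F <= I ==> z : F \<rightarrow> carrier A ==>
   (\<Oplus>\<^bsub>Z\<^esub>i\<in>F. \<r> (z i) \<otimes>\<^bsub>Z\<^esub> \<iota> (b i)) = \<zero>\<^bsub>Z\<^esub> ==> \<forall>i\<in>F. z i = \<zero>\<^bsub>A\<^esub>"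
 shows "alg_iso Z (tensor_alg A B) ~= {}"
proof -
 interpret A: falg A by fact
 interpret B: falg B by fact
 interpret Z: falg Z by fact
 let ?M = "A \<times>\<times> B"
 let ?MA = "monoid_algebra ?M :: ('f, _) module"
 have monM: "monoid ?M" by (rule DirProd_monoid) (rule A.monoid_axioms B.monoid_axioms)+
 interpret MA: falg ?MA by (rule falg_ma) (rule monM)
 note \<r>' = homD[OF \<r>] and \<iota>' = homD[OF \<iota>]
 have cM: "carrier ?M = carrier A \<times> carrier B" by (simp add: DirProd_def)
 define \<mu> where "\<mu> = (%(x, y). \<r> x \<otimes>\<^bsub>Z\<^esub> \<iota> y)"
 have \<mu>: "\<mu> : carrier ?M \<rightarrow> carrier Z" using \<r>' \<iota>' by (auto simp: cM \<mu>_def)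
 define \<Psi> where "\<Psi> = Z.lc \<mu>"
 have \<Psi>: "\<Psi> : alg_hom ?MA Z"
  unfolding \<Psi>_def
 proof (rule Z.lc_ma_hom)
  show "\<mu> \<one>\<^bsub>?M\<^esub> = \<one>\<^bsub>Z\<^esub>" by (simp add: \<mu>_def DirProd_def \<r>' \<iota>')
  fix p q assume "p : carrier ?M" "q : carrier ?M"
  then obtain x y x' y' where *: "p = (x, y)" "q = (x', y')" "x : carrier A" "y : carrier B"
   "x' : carrier A" "y' : carrier B" by (auto simp: cM)
  have c: "\<r> x : carrier Z" "\<r> x' : carrier Z" "\<iota> y : carrier Z" "\<iota> y' : carrier Z"
   using * \<r>' \<iota>' by auto
  have "\<mu> (p \<otimes>\<^bsub>?M\<^esub> q) = (\<r> x \<otimes>\<^bsub>Z\<^esub> \<r> x') \<otimes>\<^bsub>Z\<^esub> (\<iota> y \<otimes>\<^bsub>Z\<^esub> \<iota> y')"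
   using * by (simp add: \<mu>_def DirProd_def \<r>' \<iota>')
  also have "... = \<r> x \<otimes>\<^bsub>Z\<^esub> (\<r> x' \<otimes>\<^bsub>Z\<^esub> \<iota> y) \<otimes>\<^bsub>Z\<^esub> \<iota> y'" using c by (simp add: Z.m_assoc)
  also have "\<r> x' \<otimes>\<^bsub>Z\<^esub> \<iota> y = \<iota> y \<otimes>\<^bsub>Z\<^esub> \<r> x'" using comm * by simp
  finally show "\<mu> (p \<otimes>\<^bsub>?M\<^esub> q) = \<mu> p \<otimes>\<^bsub>Z\<^esub> \<mu> q" using c * by (simp add: Z.m_assoc \<mu>_def)
 qed (use \<mu> monM in auto)
 note \<Psi>' = homD[OF \<Psi>]
 have \<Psi>b: "\<Psi> (single (x, y) c) = c \<odot>\<^bsub>Z\<^esub> (\<r> x \<otimes>\<^bsub>Z\<^esub> \<iota> y)"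
  if "x : carrier A" "y : carrier B" for x y c
  using that \<mu> by (simp add: \<Psi>_def \<mu>_def cM Pi_iff)
 have surj: "\<Psi> ` carrier ?MA = carrier Z"
 proof (rule antisym)
  show "\<Psi> ` carrier ?MA <= carrier Z" using \<Psi>' by auto
  have r: "\<r> x : \<Psi> ` carrier ?MA" if "x : carrier A" for x
   by (rule image_eqI[of _ _ "basis (x, \<one>\<^bsub>B\<^esub>)"]) (use that \<r>' in "simp_all add: \<Psi>b \<iota>' cM")
  have i: "\<iota> x : \<Psi> ` carrier ?MA" if "x : carrier B" for x
   by (rule image_eqI[of _ _ "basis (\<one>\<^bsub>A\<^esub>, x)"]) (use that \<iota>' in "simp_all add: \<Psi>b \<r>' cM")
  show "carrier Z <= \<Psi> ` carrier ?MA"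
   by (rule gen) (use r i is_subalg_image[OF MA.falg_axioms Z \<Psi>] in auto)
 qed
 let ?J = "tensor_relators A B :: (_ \<Rightarrow>\<^sub>0 'f) set"
 define K where "K = Idl\<^bsub>?MA\<^esub> ?J"
 have JM: "?J <= carrier ?MA"
  unfolding tensor_relators_def ma_simps cM
  by (auto simp: in_keys_iff lookup_minus lookup_single when_def split: if_splits)
 have KI: "ideal K ?MA" unfolding K_def by (rule MA.genideal_ideal[OF JM])
 interpret K: ideal K ?MA by (rule KI)
 have JK: "?J <= K" unfolding K_def by (rule MA.genideal_self[OF JM])
 have Kadd: "x + y : K" if "x : K" "y : K" for x y using K.a_closed[OF that] by simp
 have Ksm: "psc c x : K" if "x : K" for x c
  using MA.ideal_smult[OF KI that, of c] by simp
 have Kneg: "- x : K" if "x : K" for x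
 proof -
  have "- x = psc (- 1) x" by (rule poly_mapping_eqI) simp
  then show ?thesis using Ksm that by metis
 qed
 have Kdiff: "x - y : K" if "x : K" "y : K" for x y using Kadd[OF that(1) Kneg[OF that(2)]] by simp
 have ker: "ideal (a_kernel ?MA Z \<Psi>) ?MA"
  by (rule ring_hom_ring.kernel_is_ideal) (rule alg_hom_ring[OF MA.falg_axioms Z \<Psi>])
 have \<Psi>d: "\<Psi> (x - y) = \<Psi> x \<ominus>\<^bsub>Z\<^esub> \<Psi> y" if "x : carrier ?MA" "y : carrier ?MA" for x y
  by (rule alg_hom_diff[OF Z \<Psi>]) (use that in simp_all)
 have Jker: "?J <= a_kernel ?MA Z \<Psi>"
 proof
  fix p assume p: "p : ?J"
  have pc: "p : carrier ?MA" using p JM by blast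
  have cancel: "u \<oplus>\<^bsub>Z\<^esub> v \<ominus>\<^bsub>Z\<^esub> u \<ominus>\<^bsub>Z\<^esub> v = \<zero>\<^bsub>Z\<^esub>" if "u : carrier Z" "v : carrier Z" for u v
  proof -
   have "u \<oplus>\<^bsub>Z\<^esub> v \<ominus>\<^bsub>Z\<^esub> u \<ominus>\<^bsub>Z\<^esub> v = (u \<oplus>\<^bsub>Z\<^esub> \<ominus>\<^bsub>Z\<^esub> u) \<oplus>\<^bsub>Z\<^esub> (v \<oplus>\<^bsub>Z\<^esub> \<ominus>\<^bsub>Z\<^esub> v)"
    using that by (simp add: a_minus_def Z.a_ac)
   then show ?thesis using that by (simp add: Z.r_neg)
  qed
  have cancel': "u \<ominus>\<^bsub>Z\<^esub> u = \<zero>\<^bsub>Z\<^esub>" if "u : carrier Z" for u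
   using that by (simp add: a_minus_def Z.r_neg)
  have k: "basis (x, y) : carrier ?MA" "single (x, y) c : carrier ?MA"
   if "x : carrier A" "y : carrier B" for x y c using that by (simp_all add: cM)
  have kd: "u - v : carrier ?MA" if "u : carrier ?MA" "v : carrier ?MA" for u v :: "_ \<Rightarrow>\<^sub>0 'f"
   using that Poly_Mapping.keys_diff[of u v] unfolding ma_simps by (meson Un_least order_trans)
  consider (1) x x' y where "p = basis (x \<oplus>\<^bsub>A\<^esub> x', y) - basis (x, y) - basis (x', y)"
    "x : carrier A" "x' : carrier A" "y : carrier B"
   | (2) x y y' where "p = basis (x, y \<oplus>\<^bsub>B\<^esub> y') - basis (x, y) - basis (x, y')"
    "x : carrier A" "y : carrier B" "y' : carrier B"
   | (3) c x y where "p = basis (c \<odot>\<^bsub>A\<^esub> x, y) - single (x, y) c" "x : carrier A" "y : carrier B"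
   | (4) c x y where "p = basis (x, c \<odot>\<^bsub>B\<^esub> y) - single (x, y) c" "x : carrier A" "y : carrier B"
   using p unfolding tensor_relators_def by blast
  then have "\<Psi> p = \<zero>\<^bsub>Z\<^esub>"
   by cases (simp_all only: \<Psi>d k kd A.a_closed B.a_closed A.smult_closed B.smult_closed \<Psi>b \<r>' \<iota>' Z.l_distr
     Z.r_distr Z.smult_mult_l Z.smult_mult_r Z.smult_one Z.m_closed Z.a_closed Z.smult_closed cancel cancel')
  then show "p : a_kernel ?MA Z \<Psi>" using pc by (simp add: a_kernel_def')
 qed
 have Kker: "K <= a_kernel ?MA Z \<Psi>" unfolding K_def by (rule MA.genideal_minimal[OF ker Jker])
 have R1: "basis (x \<oplus>\<^bsub>A\<^esub> x', y) - basis (x, y) - basis (x', y) : K"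
  if "x : carrier A" "x' : carrier A" "y : carrier B" for x x' y
  by (rule subsetD[OF JK], unfold tensor_relators_def) (use that in blast)
 have R2: "basis (x, y \<oplus>\<^bsub>B\<^esub> y') - basis (x, y) - basis (x, y') : K"
  if "x : carrier A" "y : carrier B" "y' : carrier B" for x y y'
  by (rule subsetD[OF JK], unfold tensor_relators_def) (use that in blast)
 have R3: "basis (c \<odot>\<^bsub>A\<^esub> x, y) - single (x, y) c : K"
  if "x : carrier A" "y : carrier B" for x y c
  by (rule subsetD[OF JK], unfold tensor_relators_def) (use that in blast)
 have R4: "basis (x, c \<odot>\<^bsub>B\<^esub> y) - single (x, y) c : K"
  if "x : carrier A" "y : carrier B" for x y c
  by (rule subsetD[OF JK], unfold tensor_relators_def) (use that in blast)
 have R0: "basis (\<zero>\<^bsub>A\<^esub>, y) : K" if "y : carrier B" for y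
  using R3[of "\<zero>\<^bsub>A\<^esub>" y 0] that by simp
 have R0': "basis (x, \<zero>\<^bsub>B\<^esub>) : K" if "x : carrier A" for x
  using R4[of x "\<zero>\<^bsub>B\<^esub>" 0] that by simp
 \<comment> \<open>Elements congruent modulo \<open>K\<close> to a sum with exactly one left factor
   per basis index. For sums of this shape vanishing under \<open>\<Psi>\<close> is decided by
   \<open>indep\<close>, so the aim is to show that every element lies in \<open>N\<close>.\<close>
 define N where "N = {p. \<exists>F z. finite F & F <= I & z : F \<rightarrow> carrier A & p - (\<Sum>i\<in>F. basis (z i, b i)) : K}"
 have bI: "b i : carrier B" if "i : I" for i using that b by auto
 have N0: "p : N" if "p : K" for p
  unfolding N_def by (simp, rule exI[of _ "{}"]) (use that in simp)
 have N1: "p + basis (a, b j) : N" if "p : N" "a : carrier A" "j : I" for p a j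
 proof -
  from that(1) obtain F z where F: "finite F" "F <= I" "z : F \<rightarrow> carrier A" "p - (\<Sum>i\<in>F. basis (z i, b i)) : K"
   unfolding N_def by blast
  \<comment> \<open>If the index \<open>j\<close> occurs already, the new left factor is added to
    the old one; additivity in the first argument costs one relator and keeps the indices
    distinct.\<close>
  let ?z = "z(j := if j : F then z j \<oplus>\<^bsub>A\<^esub> a else a)"
  have "p + basis (a, b j) - (\<Sum>i\<in>insert j F. basis (?z i, b i)) : K"
  proof (cases "j : F")
   case False
   then have "(\<Sum>i\<in>insert j F. basis (?z i, b i) :: _ \<Rightarrow>\<^sub>0 'f) = basis (a, b j) + (\<Sum>i\<in>F. basis (z i, b i))"
    using F(1) by (simp, intro sum.cong) auto
   then show ?thesis using F(4) by (simp add: algebra_simps)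
  next
   case True
   have "(\<Sum>i\<in>insert j F. basis (?z i, b i) :: _ \<Rightarrow>\<^sub>0 'f) =
     basis (z j \<oplus>\<^bsub>A\<^esub> a, b j) + (\<Sum>i\<in>F - {j}. basis (z i, b i))"
    using True F(1) by (simp add: insert_absorb sum.remove[of F j])
   moreover have "(\<Sum>i\<in>F. basis (z i, b i) :: _ \<Rightarrow>\<^sub>0 'f) = basis (z j, b j) + (\<Sum>i\<in>F - {j}. basis (z i, b i))"
    using True F(1) by (simp add: sum.remove[of F j])
   moreover have "basis (z j \<oplus>\<^bsub>A\<^esub> a, b j) - basis (z j, b j) - basis (a, b j) : K"
    by (rule R1) (use F True that bI in auto)
   ultimately show ?thesis using Kdiff[OF F(4), of "basis (z j \<oplus>\<^bsub>A\<^esub> a, b j) - basis (z j, b j) - basis (a, b j)"]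
    by (simp add: algebra_simps)
  qed
  then show ?thesis unfolding N_def
   by (intro CollectI exI[of _ "insert j F"] exI[of _ ?z]) (use F that in "auto simp: Pi_iff")
 qed
 have NK: "p + k : N" if "p : N" "k : K" for p k
 proof -
  from that(1) obtain F z where F: "finite F" "F <= I" "z : F \<rightarrow> carrier A" "p - (\<Sum>i\<in>F. basis (z i, b i)) : K"
   unfolding N_def by blast
  have "p + k - (\<Sum>i\<in>F. basis (z i, b i)) : K" using Kadd[OF F(4) that(2)] by (simp add: algebra_simps)
  then show ?thesis unfolding N_def using F(1-3) by blast
 qed
 have Nadd: "p + q : N" if "p : N" "q : N" for p q
 proof -
  from that(2) obtain F z where F: "finite F" "F <= I" "z : F \<rightarrow> carrier A" "q - (\<Sum>i\<in>F. basis (z i, b i)) : K"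
   unfolding N_def by blast
  have "p + (\<Sum>i\<in>F. basis (z i, b i)) : N"
   using F(1,2,3)
  proof (induction F rule: finite_induct)
   case (insert j F)
   then have "p + (\<Sum>i\<in>F. basis (z i, b i)) + basis (z j, b j) : N" by (intro N1) auto
   then show ?case using insert.hyps by (simp add: add_ac)
  qed (simp add: that)
  from NK[OF this F(4)] show ?thesis by simp
 qed
 have Nsm: "psc c p : N" if "p : N" for p c
 proof -
  from that(1) obtain F z where F: "finite F" "F <= I" "z : F \<rightarrow> carrier A" "p - (\<Sum>i\<in>F. basis (z i, b i)) : K"
   unfolding N_def by blast
  \<comment> \<open>The scalar is moved into the left factor modulo a relator, which restores
    coefficient 1.\<close>
  have 1: "single (z i, b i) c : N" if "i : F" for i
  proof -
   have zi: "z i : carrier A" "i : I" using F that by auto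
   have "0 + basis (c \<odot>\<^bsub>A\<^esub> z i, b i) + - (basis (c \<odot>\<^bsub>A\<^esub> z i, b i) - single (z i, b i) c) : N"
    using N0[OF K.zero_closed] zi bI by (intro NK N1 Kneg R3) auto
   then show ?thesis by simp
  qed
  have 2: "(\<Sum>i\<in>F. single (z i, b i) c) : N"
   using F(1) 1 by (induction F rule: finite_induct) (auto intro: Nadd N0 simp: K.zero_closed[simplified])
  have "psc c p = (\<Sum>i\<in>F. single (z i, b i) c) + psc c (p - (\<Sum>i\<in>F. basis (z i, b i)))"
   by (rule poly_mapping_eqI)
    (simp add: lookup_add lookup_minus lookup_sum lookup_single when_def algebra_simps sum_distrib_left if_distrib cong: if_cong)
  then show ?thesis using NK[OF 2 Ksm[OF F(4)]] by simp
 qed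
 have Nxy: "basis (x, y) : N" if xy: "x : carrier A" "y : carrier B" for x y
 proof -
  obtain c where c: "keys c <= I" "y = B.lc b c" using span xy by blast
  have "basis (x, B.lc b c) : N" using c(1)
  proof (induction rule: pm_induct)
   case zero
   then show ?case using R0' N0 xy by simp
  next
   case (single i d)
   have "0 + basis (x, b i) : N" by (rule N1) (use N0 K.zero_closed xy single in auto)
   from NK[OF Nsm[OF this, of d] R4[OF xy(1) bI[OF single], of d]]
   show ?case using single bI by simp
  next
   case (add a a')
   have cc: "B.lc b a : carrier B" "B.lc b a' : carrier B" using add bI by (auto simp: subset_iff)
   from NK[OF Nadd[OF add(3,4)] R2[OF xy(1) cc]]
   show ?case using B.lc_add[OF add(1,2) b] by simp
  qed
  then show ?thesis using c by simp
 qed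
 have NM: "p : N" if "p : carrier ?MA" for p
  using that unfolding ma_simps
 proof (induction rule: pm_induct)
  case (single x c)
  then show ?case using Nsm[OF Nxy, of "fst x" "snd x" c] by (auto simp: cM)
 qed (use N0 K.zero_closed Nadd in auto)
 \<comment> \<open>Modulo \<open>K\<close> a kernel element is a sum in the shape of
   \<open>N\<close> whose image vanishes. Independence makes all its left factors zero, and a pair
   with a zero component lies in \<open>K\<close>.\<close>
 have "a_kernel ?MA Z \<Psi> <= K"
 proof
  fix p assume "p : a_kernel ?MA Z \<Psi>"
  then have p: "p : carrier ?MA" "\<Psi> p = \<zero>\<^bsub>Z\<^esub>" by (auto simp: a_kernel_def')
  obtain F z where F: "finite F" "F <= I" "z : F \<rightarrow> carrier A" "p - (\<Sum>i\<in>F. basis (z i, b i)) : K"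
   using NM[OF p(1)] unfolding N_def by blast
  let ?s = "\<Sum>i\<in>F. basis (z i, b i) :: _ \<Rightarrow>\<^sub>0 'f"
  have s: "?s : carrier ?MA" unfolding ma_simps
   by (rule keys_sum) (use F bI in "auto simp: cM")
  have "\<Psi> p \<ominus>\<^bsub>Z\<^esub> \<Psi> ?s = \<zero>\<^bsub>Z\<^esub>" using Kker F(4) \<Psi>d[OF p(1) s] by (auto simp: a_kernel_def')
  then have s0: "\<Psi> ?s = \<zero>\<^bsub>Z\<^esub>" using p(2) \<Psi>'(1)[OF s] by (simp add: a_minus_def Z.l_neg)
  have zb: "z i : carrier A" "b i : carrier B" if "i : F" for i using that F(2,3) bI by auto
  have "\<Psi> ?s = (\<Oplus>\<^bsub>Z\<^esub>i\<in>F. \<Psi> (basis (z i, b i)))"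
   by (rule alg_hom_sum[OF Z \<Psi> monM F(1)]) (use zb in "simp add: cM")
  also have "... = (\<Oplus>\<^bsub>Z\<^esub>i\<in>F. \<r> (z i) \<otimes>\<^bsub>Z\<^esub> \<iota> (b i))"
   by (rule Z.finsum_cong') (use zb \<r>' \<iota>' in "auto simp: \<Psi>b")
  finally have "\<Psi> ?s = (\<Oplus>\<^bsub>Z\<^esub>i\<in>F. \<r> (z i) \<otimes>\<^bsub>Z\<^esub> \<iota> (b i))" .
  then have "\<forall>i\<in>F. z i = \<zero>\<^bsub>A\<^esub>" using indep[OF F(1-3)] s0 by simp
  then have "?s = (\<Sum>i\<in>F. basis (\<zero>\<^bsub>A\<^esub>, b i))" by (intro sum.cong) auto
  moreover have "(\<Sum>i\<in>F. basis (\<zero>\<^bsub>A\<^esub>, b i)) : K" using F(1,2)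
   by (induction F rule: finite_induct) (auto intro!: Kadd R0 bI simp: K.zero_closed[simplified])
  ultimately show "p : K" using Kadd[OF F(4)] by fastforce
 qed
 then have "a_kernel ?MA Z \<Psi> = K" using Kker by simp
 then have "(%X. the_elem (\<Psi> ` X)) : alg_iso (tensor_alg A B) Z"
  using alg_quot_iso(1)[OF MA.falg_axioms Z \<Psi> surj] by (simp add: tensor_alg_def K_def)
 moreover have "falg (tensor_alg A B)"
  unfolding tensor_alg_def using MA.falg_alg_quot[OF KI] by (simp add: K_def)
 ultimately show ?thesis using alg_iso_inv by blast
qed

section \<open>Partial monomial matrices\<close>

lemma mtxI: "(\<And>i j x. \<g> i j = Some x <-> \<d> i j = Some x) ==> \<g> = (\<d> :: 'g mtx)"
 by (intro ext) (metis not_Some_eq)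

definition sub :: "'g mtx => 'g mtx => bool" where
 "sub \<e> \<d> <-> (\<forall>i j x. \<e> i j = Some x --> \<d> i j = Some x)"

definition cols :: "'g mtx => nat set" where "cols \<g> = {j. \<exists>i x. \<g> i j = Some x}"
definition rows :: "'g mtx => nat set" where "rows \<g> = {i. \<exists>j x. \<g> i j = Some x}"

text \<open>Evaluating on all matrices that contain \<open>\<e>\<close>, rather than on
  \<open>\<e>\<close> alone, gives coordinates that are unchanged by truncation
  (\<open>hat_theta\<close>) and through which multiplication by a matrix can be moved
  (\<open>hat_left\<close>, \<open>hat_right\<close>).\<close>

definition hat :: "('g mtx \<Rightarrow>\<^sub>0 'f::field) => 'g mtx => 'f" where
 "hat a \<e> = lf (%\<d>. if sub \<e> \<d> then 1 else 0) a"

lemma hat_lin [simp]: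
 "hat 0 \<e> = 0" "hat (a + b) \<e> = hat a \<e> + hat b \<e>" "hat (a - b) \<e> = hat a \<e> - hat b \<e>"
 "hat (psc c a) \<e> = c * hat a \<e>" "hat (\<Sum>i\<in>I. f i) \<e> = (\<Sum>i\<in>I. hat (f i) \<e>)"
 "hat (single \<d> c) \<e> = (if sub \<e> \<d> then c else 0)"
 by (simp_all add: hat_def lf_add lf_diff lf_scale lf_sum)

lemma zadd_None [simp]: "zadd x None = x"
 by (cases x) auto

text \<open>At most one summand is present, so the undefined clause of \<open>zadd\<close> is never
  reached and the sum is an existential statement about that summand.\<close>

lemma foldr_zadd:
 assumes "distinct xs" "\<And>k l. k : set xs ==> l : set xs ==> f k ~= None ==> f l ~= None ==> k = l"
 shows "foldr (%k. zadd (f k)) xs None = Some x <-> (\<exists>k\<in>set xs. f k = Some x)"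
 using assms
proof (induction xs)
 case (Cons a xs)
 show ?case
 proof (cases "f a")
  case None
  then show ?thesis using Cons by auto
 next
  case (Some y)
  have "f k = None" if "k : set xs" for k
   using Cons.prems that Some by (metis distinct.simps(2) list.set_intros not_Some_eq)
  then have "foldr (%k. zadd (f k)) xs None = None"
   by (induction xs) auto
  then show ?thesis using Some \<open>\<And>k. k : set xs ==> f k = None\<close> by auto
 qed
qed simp

lemma zmul_Some [simp]: "zmul G a b = Some x <-> (\<exists>g h. a = Some g & b = Some h & x = g \<otimes>\<^bsub>G\<^esub> h)"
 by (cases a; cases b) auto

lemma zmul_None [simp]: "zmul G a b = None <-> a = None \<or> b = None"
 by (cases a; cases b) auto

type_synonym ('a, 'f) fgel = "'a mtx \<Rightarrow>\<^sub>0 'f"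
type_synonym ('a, 'f) fw = "'a gen list \<Rightarrow>\<^sub>0 'f"
type_synonym ('a, 'f) zel = "nat => ('a, 'f) fgel"
type_synonym ('a, 'f) fgalg = "('f, ('a, 'f) fgel) module"
type_synonym ('a, 'f) zalg = "('f, ('a, 'f) zel) module"

locale gmat = group G for G (structure) +
 assumes finG: "finite (carrier G)"
begin

abbreviation emb :: "nat => nat => 'a mtx => 'a mtx" where "emb \<equiv> mtx_embed G"
abbreviation em :: "nat => nat => 'a mtx" where "em \<equiv> mtx_eps G"
abbreviation pm :: "nat => nat => 'a mtx" where "pm m i \<equiv> mtx_perm G m (transpose i (Suc i))"
abbreviation prk :: "nat => nat => 'a => nat => 'a" where "prk m k \<equiv> pair_elt G m k (k + 1)"
abbreviation csq :: "nat => ('a, 'f::field) fgel => ('a, 'f) zel" where "csq \<equiv> const_seq G"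
abbreviation us :: "nat => nat => ('a, 'f::field) zel" where "us \<equiv> u_seq G"
abbreviation Fc :: "nat => ('a, 'f::field) fgel set" where "Fc n \<equiv> carrier (FGbar G n)"
abbreviation Gp :: "nat => (nat => 'a) set" where "Gp m \<equiv> carrier (Gpow G m)"
abbreviation Zc :: "nat => ('a, 'f::field) zel set" where "Zc m \<equiv> carrier (Zbar G m)"
abbreviation dgl :: "nat => ('a, 'f::field) fgel => nat => bool" where
 "dgl n a d \<equiv> \<forall>\<g>\<in>keys a. mtx_deg G n \<g> <= d"
abbreviation FG_mult ("_ \<star>[_] _" [70, 0, 71] 70) where "a \<star>[n] b \<equiv> a \<otimes>\<^bsub>FGbar G n\<^esub> b"
abbreviation Zbar_mult ("_ \<bullet>[_] _" [70, 0, 71] 70) where "a \<bullet>[n] b \<equiv> a \<otimes>\<^bsub>Zbar G n\<^esub> b"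
abbreviation PM :: "nat => 'a mtx set" where "PM n \<equiv> carrier (Gbar G n)"
abbreviation mm :: "nat => 'a mtx => 'a mtx => 'a mtx" where "mm n \<equiv> mtx_mult G n"
abbreviation I1 :: "nat => 'a mtx" where "I1 n \<equiv> mtx_diag n (%_. \<one>)"

lemma Gbar_simps [simp]: "monoid.mult (Gbar G n) = mm n" "one (Gbar G n) = I1 n"
 by (simp_all add: Gbar_def)

lemma PM_iff: "\<g> : PM n <-> (\<forall>i j g. \<g> i j = Some g --> 1 <= i & i <= n & 1 <= j & j <= n & g : carrier G) \<and>
  (\<forall>i j j' g g'. \<g> i j = Some g --> \<g> i j' = Some g' --> j = j') \<and>
  (\<forall>i i' j g g'. \<g> i j = Some g --> \<g> i' j = Some g' --> i = i')"
 unfolding Gbar_def by (simp, blast)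

lemma PM_D:
 assumes "\<g> : PM n"
 shows "\<g> i j = Some g ==> 1 <= i" "\<g> i j = Some g ==> i <= n" "\<g> i j = Some g ==> 1 <= j"
  "\<g> i j = Some g ==> j <= n" "\<g> i j = Some g ==> g : carrier G"
  "\<g> i j = Some g ==> \<g> i j' = Some g' ==> j = j'"
  "\<g> i j = Some g ==> \<g> i' j = Some g' ==> i = i'"
 using assms unfolding PM_iff by blast+

lemma PM_mono: "n <= n' ==> PM n <= PM n'"
 unfolding PM_iff subset_iff by (meson le_trans)

lemma mSome:
 assumes "\<g> : PM n" "\<d> : PM n"
 shows "mm n \<g> \<d> i j = Some x <-> (\<exists>k g h. \<g> i k = Some g & \<d> k j = Some h & x = g \<otimes> h)"
proof -
 have "mm n \<g> \<d> i j = Some x <-> (\<exists>k\<in>set [1..<Suc n]. zmul G (\<g> i k) (\<d> k j) = Some x)"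
  unfolding mtx_mult_def
  by (rule foldr_zadd) (use assms in "auto dest: PM_D(6)")
 also have "... <-> (\<exists>k g h. \<g> i k = Some g & \<d> k j = Some h & x = g \<otimes> h)"
 proof
  assume "\<exists>k g h. \<g> i k = Some g & \<d> k j = Some h & x = g \<otimes> h"
  then obtain k g h where k: "\<g> i k = Some g" "\<d> k j = Some h" "x = g \<otimes> h" by blast
  then show "\<exists>k\<in>set [1..<Suc n]. zmul G (\<g> i k) (\<d> k j) = Some x"
   using PM_D(3,4)[OF assms(1) k(1)] by (intro bexI[of _ k]) auto
 qed auto
 finally show ?thesis .
qed

lemma mult_SomeI:
 "\<g> : PM n ==> \<d> : PM n ==> \<g> i k = Some g ==> \<d> k j = Some h ==> mm n \<g> \<d> i j = Some (g \<otimes> h)"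
 by (auto simp: mSome)

lemma mm_closed [simp, intro]:
 assumes "\<g> : PM n" "\<d> : PM n"
 shows "mm n \<g> \<d> : PM n"
 unfolding PM_iff mSome[OF assms]
 using PM_D[OF assms(1)] PM_D[OF assms(2)] m_closed by (intro conjI allI impI; elim exE conjE) metis+

lemma diag_Some [simp]: "mtx_diag n g i j = Some x <-> 1 <= i & i <= n & i = j & x = g i"
 by (auto simp: mtx_diag_def)

lemma perm_Some [simp]: "mtx_perm G n p i j = Some x <-> 1 <= i & i <= n & 1 <= j & j <= n & p j = i & x = \<one>"
 by (auto simp: mtx_perm_def)

lemma eps_Some [simp]: "mtx_eps G n k i j = Some x <-> 1 <= i & i <= n & i = j & i ~= k & x = \<one>"
 by (auto simp: mtx_eps_def)

lemma embed_Some [simp]: "emb m n \<g> i j = Some x <->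
  (i <= m & j <= m & \<g> i j = Some x) \<or> (m < i & i <= n & i = j & x = \<one>)"
 by (auto simp: mtx_embed_def)

lemma corner_Some [simp]: "mtx_corner n \<g> i j = Some x <-> i <= n & j <= n & \<g> i j = Some x"
 by (auto simp: mtx_corner_def)

lemma diag_PM: "(\<And>i. 1 <= i ==> i <= n ==> g i : carrier G) ==> mtx_diag n g : PM n"
 unfolding PM_iff by auto
lemma I1_PM [simp, intro]: "I1 n : PM n" by (rule diag_PM) simp
lemma perm_PM: "inj p ==> mtx_perm G n p : PM n"
 unfolding PM_iff by (auto dest: injD)
lemma eps_PM [simp, intro]: "mtx_eps G n k : PM n"
 unfolding PM_iff by auto
lemma embed_PM:
 assumes "\<g> : PM m" "m <= n"
 shows "emb m n \<g> : PM n"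
 unfolding PM_iff embed_Some
proof (intro conjI allI impI, goal_cases)
 case (6 i j j' x x')
 then show ?case using PM_D(6)[OF assms(1), of i j x j' x'] by auto
next
 case (7 i i' j x x')
 then show ?case using PM_D(7)[OF assms(1), of i j x i' x'] by auto
next
 case (1 i j x)
 then show ?case using assms(2) PM_D(1-5)[OF assms(1), of i j x] by auto
next
 case (2 i j x)
 then show ?case using assms(2) PM_D(1-5)[OF assms(1), of i j x] by auto
next
 case (3 i j x)
 then show ?case using assms(2) PM_D(1-5)[OF assms(1), of i j x] by auto
next
 case (4 i j x)
 then show ?case using assms(2) PM_D(1-5)[OF assms(1), of i j x] by auto
next
 case (5 i j x)
 then show ?case using assms(2) PM_D(1-5)[OF assms(1), of i j x] by auto
qed

lemma corner_PM: "\<g> : PM n' ==> mtx_corner n \<g> : PM n"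
 unfolding PM_iff corner_Some by (intro conjI allI impI; elim conjE; blast)

lemma monoid_Gbar: "monoid (Gbar G n)"
proof (rule monoidI)
 fix x y z assume *: "x : PM n" "y : PM n" "z : PM n"
 show "x \<otimes>\<^bsub>Gbar G n\<^esub> y \<otimes>\<^bsub>Gbar G n\<^esub> z = x \<otimes>\<^bsub>Gbar G n\<^esub> (y \<otimes>\<^bsub>Gbar G n\<^esub> z)"
  unfolding Gbar_simps
 proof (rule mtxI)
  fix i j a
  show "mm n (mm n x y) z i j = Some a <-> mm n x (mm n y z) i j = Some a"
  proof
   assume "mm n (mm n x y) z i j = Some a"
   then obtain k l g h g' where k: "x i k = Some g" "y k l = Some h" "z l j = Some g'" "a = g \<otimes> h \<otimes> g'"
    using * by (auto simp: mSome)
   from k have a: "a = g \<otimes> (h \<otimes> g')" using * by (simp add: m_assoc PM_D(5))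
   show "mm n x (mm n y z) i j = Some a"
    unfolding a by (rule mult_SomeI[OF *(1) mm_closed[OF *(2,3)] k(1) mult_SomeI[OF *(2,3) k(2,3)]])
  next
   assume "mm n x (mm n y z) i j = Some a"
   then obtain k l g h g' where k: "x i k = Some g" "y k l = Some h" "z l j = Some g'" "a = g \<otimes> (h \<otimes> g')"
    using * by (auto simp: mSome)
   from k have a: "a = g \<otimes> h \<otimes> g'" using * by (simp add: m_assoc PM_D(5))
   show "mm n (mm n x y) z i j = Some a"
    unfolding a by (rule mult_SomeI[OF mm_closed[OF *(1,2)] *(3) mult_SomeI[OF *(1,2) k(1,2)] k(3)])
  qed
 qed
next
 fix x assume *: "x : PM n"
 note D = PM_D(1-5)[OF *]
 show "\<one>\<^bsub>Gbar G n\<^esub> \<otimes>\<^bsub>Gbar G n\<^esub> x = x"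
  unfolding Gbar_simps
 proof (rule mtxI, rule iffI)
  fix i j a assume x: "x i j = Some a"
  have "I1 n i i = Some \<one>" using D[OF x] by simp
  from mult_SomeI[OF I1_PM * this x] show "mm n (I1 n) x i j = Some a" using D(5)[OF x] by simp
 qed (auto simp: mSome * D(5))
 show "x \<otimes>\<^bsub>Gbar G n\<^esub> \<one>\<^bsub>Gbar G n\<^esub> = x"
  unfolding Gbar_simps
 proof (rule mtxI, rule iffI)
  fix i j a assume x: "x i j = Some a"
  have "I1 n j j = Some \<one>" using D[OF x] by simp
  from mult_SomeI[OF * I1_PM x this] show "mm n x (I1 n) i j = Some a" using D(5)[OF x] by simp
 qed (auto simp: mSome * D(5))
qed auto

lemma finite_PM [simp, intro]: "finite (PM n)"
proof -
 let ?F = "{f. \<forall>x. (x : {1..n} \<times> {1..n} --> f x : insert None (Some ` carrier G)) \<and>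
       (x ~: {1..n} \<times> {1..n} --> f x = None)}"
 have "PM n <= curry ` ?F"
 proof
  fix \<g> assume \<g>: "\<g> : PM n"
  have "\<g> i j : insert None (Some ` carrier G)" for i j
   using PM_D(5)[OF \<g>, of i j] by (cases "\<g> i j") auto
  moreover have "\<g> i j = None" if "(i, j) ~: {1..n} \<times> {1..n}" for i j
   using PM_D(1-4)[OF \<g>, of i j] that by (cases "\<g> i j") auto
  ultimately have "case_prod \<g> : ?F" by auto
  then show "\<g> : curry ` ?F" by (intro image_eqI[of _ _ "case_prod \<g>"]) auto
 qed
 moreover have "finite ?F" by (rule finite_set_of_finite_funs) (use finG in auto)
 ultimately show ?thesis by (rule finite_subset[OF _ finite_imageI])
qed

lemma mm_mono: "\<g> : PM n ==> \<d> : PM n ==> n <= n' ==> mm n' \<g> \<d> = mm n \<g> \<d>"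
 using PM_mono[of n n'] by (intro mtxI) (simp add: mSome subset_iff)

text \<open>The inverse in the sense of inverse semigroups: on the rows where \<open>\<g>\<close> is
  nonzero it undoes \<open>\<g>\<close>, elsewhere it vanishes.\<close>

definition tr :: "'a mtx => 'a mtx" where "tr \<g> = (%i j. map_option (m_inv G) (\<g> j i))"

lemma tr_Some: "tr \<g> i j = Some x <-> (\<exists>y. \<g> j i = Some y & x = inv y)"
 by (auto simp: tr_def)

lemma tr_PM [simp, intro]:
 assumes "\<g> : PM n"
 shows "tr \<g> : PM n"
 unfolding PM_iff tr_Some
proof (intro conjI allI impI, goal_cases)
 case (6 i j j' x x')
 then show ?case using PM_D(7)[OF assms, of j i _ j'] by blast
next
 case (7 i i' j x x')
 then show ?case using PM_D(6)[OF assms, of j i _ i'] by blast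
next
 case (1 i j x)
 then show ?case using PM_D(1-5)[OF assms, of j i] by auto
next
 case (2 i j x)
 then show ?case using PM_D(1-5)[OF assms, of j i] by auto
next
 case (3 i j x)
 then show ?case using PM_D(1-5)[OF assms, of j i] by auto
next
 case (4 i j x)
 then show ?case using PM_D(1-5)[OF assms, of j i] by auto
next
 case (5 i j x)
 then show ?case using PM_D(1-5)[OF assms, of j i] by auto
qed

lemma subD: "sub \<e> \<d> ==> \<e> i j = Some x ==> \<d> i j = Some x"
 by (auto simp: sub_def)

text \<open>\<open>tr \<s>\<close> cancels \<open>\<s>\<close> wherever \<open>\<s>\<close> is
  defined, so \<open>\<s>\<close> can be carried to the other side of the containment; the condition
  on rows says that \<open>\<e>\<close> lives where \<open>\<s>\<close> can be cancelled.\<close>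

lemma sub_mm_left:
 assumes "\<s> : PM n" "\<d> : PM n" "\<e> : PM n"
 shows "sub \<e> (mm n \<s> \<d>) <-> rows \<e> <= rows \<s> & sub (mm n (tr \<s>) \<e>) \<d>"
proof (intro iffI conjI)
 assume s: "sub \<e> (mm n \<s> \<d>)"
 show "rows \<e> <= rows \<s>"
  using subD[OF s] by (force simp: rows_def mSome assms)
 show "sub (mm n (tr \<s>) \<e>) \<d>"
  unfolding sub_def
 proof (intro allI impI)
  fix i j x assume "mm n (tr \<s>) \<e> i j = Some x"
  then obtain k g h where k: "\<s> k i = Some g" "\<e> k j = Some h" "x = inv g \<otimes> h"
   by (auto simp: mSome assms tr_Some)
  obtain l g' h' where l: "\<s> k l = Some g'" "\<d> l j = Some h'" "h = g' \<otimes> h'"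
   using subD[OF s k(2)] by (auto simp: mSome assms)
  have "l = i" "g' = g" using PM_D(6)[OF assms(1) k(1) l(1)] k(1) l(1) by auto
  then show "\<d> i j = Some x" using l k PM_D(5)[OF assms(1) k(1)] PM_D(5)[OF assms(2) l(2)]
   by (simp flip: m_assoc)
 qed
next
 assume s: "rows \<e> <= rows \<s> & sub (mm n (tr \<s>) \<e>) \<d>"
 show "sub \<e> (mm n \<s> \<d>)"
  unfolding sub_def
 proof (intro allI impI)
  fix i j x assume e: "\<e> i j = Some x"
  then obtain k g where k: "\<s> i k = Some g" using s by (force simp: rows_def)
  have "mm n (tr \<s>) \<e> k j = Some (inv g \<otimes> x)" using e k by (auto simp: mSome assms tr_Some)
  then have "\<d> k j = Some (inv g \<otimes> x)" by (rule subD[OF conjunct2[OF s]])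
  moreover have "x = g \<otimes> (inv g \<otimes> x)"
   using PM_D(5)[OF assms(1) k] PM_D(5)[OF assms(3) e] by (simp flip: m_assoc)
  ultimately show "mm n \<s> \<d> i j = Some x" using k by (auto simp: mSome assms)
 qed
qed

lemma sub_mm_right:
 assumes "\<s> : PM n" "\<d> : PM n" "\<e> : PM n"
 shows "sub \<e> (mm n \<d> \<s>) <-> cols \<e> <= cols \<s> & sub (mm n \<e> (tr \<s>)) \<d>"
proof (intro iffI conjI)
 assume s: "sub \<e> (mm n \<d> \<s>)"
 show "cols \<e> <= cols \<s>"
  using subD[OF s] by (force simp: cols_def mSome assms)
 show "sub (mm n \<e> (tr \<s>)) \<d>"
  unfolding sub_def
 proof (intro allI impI)
  fix i j x assume "mm n \<e> (tr \<s>) i j = Some x"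
  then obtain k g h where k: "\<s> j k = Some g" "\<e> i k = Some h" "x = h \<otimes> inv g"
   by (auto simp: mSome assms tr_Some)
  obtain l g' h' where l: "\<s> l k = Some g'" "\<d> i l = Some h'" "h = h' \<otimes> g'"
   using subD[OF s k(2)] by (auto simp: mSome assms)
  have "l = j" "g' = g" using PM_D(7)[OF assms(1) k(1) l(1)] k(1) l(1) by auto
  then show "\<d> i j = Some x" using l k PM_D(5)[OF assms(1) k(1)] PM_D(5)[OF assms(2) l(2)]
   by (simp add: m_assoc)
 qed
next
 assume s: "cols \<e> <= cols \<s> & sub (mm n \<e> (tr \<s>)) \<d>"
 show "sub \<e> (mm n \<d> \<s>)"
  unfolding sub_def
 proof (intro allI impI)
  fix i j x assume e: "\<e> i j = Some x"
  then obtain k g where k: "\<s> k j = Some g" using s by (force simp: cols_def)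
  have "mm n \<e> (tr \<s>) i k = Some (x \<otimes> inv g)" using e k by (auto simp: mSome assms tr_Some)
  then have "\<d> i k = Some (x \<otimes> inv g)" by (rule subD[OF conjunct2[OF s]])
  moreover have "x = (x \<otimes> inv g) \<otimes> g"
   using PM_D(5)[OF assms(1) k] PM_D(5)[OF assms(3) e] by (simp add: m_assoc)
  ultimately show "mm n \<d> \<s> i j = Some x" using k by (auto simp: mSome assms)
 qed
qed

lemma hat_left:
 assumes "\<s> : PM n" "\<e> : PM n" "keys b <= PM n"
 shows "hat (basis \<s> \<star>[n] b) \<e> = (if rows \<e> <= rows \<s> then hat b (mm n (tr \<s>) \<e>) else 0)"
proof -
 have "hat (basis \<s> \<star>[n] b) \<e> = lf (%y. if sub \<e> (mm n \<s> y) then 1 else 0) b"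
  by (simp add: hat_def lf_ma_mult)
 also have "... = lf (%y. if rows \<e> <= rows \<s> & sub (mm n (tr \<s>) \<e>) y then 1 else 0) b"
  by (rule lf_cong) (use assms in "auto simp: sub_mm_left subset_iff")
 finally show ?thesis by (simp add: hat_def)
qed

lemma hat_right:
 assumes "\<s> : PM n" "\<e> : PM n" "keys b <= PM n"
 shows "hat (b \<star>[n] basis \<s>) \<e> = (if cols \<e> <= cols \<s> then hat b (mm n \<e> (tr \<s>)) else 0)"
proof -
 have "hat (b \<star>[n] basis \<s>) \<e> = lf (%y. if sub \<e> (mm n y \<s>) then 1 else 0) b"
  by (simp add: hat_def lf_ma_mult)
 also have "... = lf (%y. if cols \<e> <= cols \<s> & sub (mm n \<e> (tr \<s>)) y then 1 else 0) b"
  by (rule lf_cong) (use assms in "auto simp: sub_mm_right subset_iff")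
 finally show ?thesis by (simp add: hat_def)
qed

definition supp :: "'a mtx => (nat \<times> nat) set" where "supp \<g> = {(i, j). \<exists>x. \<g> i j = Some x}"

lemma finite_supp: "\<g> : PM n ==> finite (supp \<g>)"
 by (rule finite_subset[of _ "{1..n} \<times> {1..n}"]) (use PM_D in "auto simp: supp_def")

lemma sub_supp: "sub \<e> \<d> ==> supp \<e> <= supp \<d>"
 by (force simp: sub_def supp_def)

lemma sub_supp_eq: "sub \<e> \<d> ==> supp \<d> <= supp \<e> ==> \<e> = \<d>"
 by (rule mtxI) (force simp: sub_def supp_def)

lemma sub_refl [simp]: "sub \<e> \<e>" by (simp add: sub_def)

text \<open>Triangularity with respect to containment: at a key of maximal support size no other key
  contains it, so there \<open>hat\<close> is the plain coefficient.\<close>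

lemma hat_inj:
 fixes a :: "('a, 'f::field) fgel"
 assumes "keys a <= PM n" "\<And>\<e>. \<e> : PM n ==> hat a \<e> = 0"
 shows "a = 0"
proof (rule ccontr)
 assume "a ~= 0"
 then have ne: "keys a ~= {}" by simp
 let ?C = "(%\<d>. card (supp \<d>)) ` keys a"
 have "Max ?C : ?C" using ne by (intro Max_in) auto
 then obtain \<d> where d: "\<d> : keys a" and m: "card (supp \<d>) = Max ?C" by auto
 have d2: "card (supp x) <= card (supp \<d>)" if "x : keys a" for x
  unfolding m by (rule Max_ge) (use that in auto)
 have "(if sub \<d> x then 1 else 0) = (if x = \<d> then 1 else (0::'f))" if "x : keys a" for x
 proof (cases "sub \<d> x")
  case True
  have "supp x = supp \<d>"
   using card_seteq[OF finite_supp sub_supp[OF True] d2[OF that]] that assms(1) by auto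
  then show ?thesis using sub_supp_eq[OF True] by auto
 qed auto
 then have "hat a \<d> = lf (%x. if x = \<d> then 1 else 0) a" unfolding hat_def by (rule lf_cong)
 then have "hat a \<d> = lookup a \<d>" by (simp add: lookup_lf)
 then show False using assms d by (auto simp: in_keys_iff)
qed

lemma hat_eqI:
 assumes "keys a <= PM n" "keys b <= PM n" "\<And>\<e>. \<e> : PM n ==> hat a \<e> = hat b \<e>"
 shows "a = b"
proof -
 have "keys (a - b) <= PM n"
  using assms(1,2) Poly_Mapping.keys_diff[of a b] by (meson Un_least order_trans)
 then have "a - b = 0" by (rule hat_inj) (simp add: assms(3))
 then show ?thesis by simp
qed

section \<open>Semigroup algebras of finite order and truncation\<close>

abbreviation FG :: "nat => ('a, 'f::field) fgalg" where "FG n \<equiv> FGbar G n"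

lemma falg_FG: "falg (FGbar G n :: ('a, 'f::field) fgalg)"
 by (rule falg_ma[OF monoid_Gbar])

lemma lf_lin_ext: "lf h (lin_ext f a) = lf (%x. h (f x)) a"
 unfolding lin_ext_def lf_sum lf_single by (simp add: lf_def)

lemma lookup_lin_ext: "lookup (lin_ext f a) z = lf (%x. if f x = z then 1 else 0) a"
 by (simp add: lookup_lf[of "lin_ext f a"] lf_lin_ext)

lemma lin_ext_lin:
 "lin_ext f (a + b) = lin_ext f a + lin_ext f b" "lin_ext f (psc c a) = psc c (lin_ext f a)"
 "lin_ext f 0 = 0" "lin_ext f (single x c) = single (f x) c"
 "lin_ext f (a - b) = lin_ext f a - lin_ext f b" "lin_ext f (\<Sum>i\<in>I. g i) = (\<Sum>i\<in>I. lin_ext f (g i))"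
 by (rule poly_mapping_eqI;
   auto simp: lookup_lin_ext lookup_add lookup_sum lookup_minus lf_add lf_scale lf_diff lf_sum lookup_single when_def)+

lemma lin_ext_keys: "(\<And>x. x : keys a ==> f x : X) ==> keys (lin_ext f a) <= X"
 unfolding lin_ext_def by (rule keys_sum) auto

lemma lin_ext_mult:
 assumes "keys a <= PM m" "keys b <= PM m"
  "\<And>x y. x : PM m ==> y : PM m ==> f (mm m x y) = mm n (f x) (f y)"
 shows "lin_ext f (a \<star>[m] b) = lin_ext f a \<star>[n] lin_ext f b"
 by (rule poly_mapping_eqI, simp add: lookup_lf lf_lin_ext lf_ma_mult)
  (intro lf_cong, use assms in "auto simp: subset_iff")

lemma FG_mult_mono:
 assumes "keys a <= PM m" "keys b <= PM m" "m <= n"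
 shows "a \<star>[n] b = a \<star>[m] b"
 by (rule poly_mapping_eqI, simp add: lookup_lf lf_ma_mult)
  (intro lf_cong, use assms mm_mono[OF _ _ assms(3)] in "auto simp: subset_iff")

text \<open>Truncation is compression by the idempotent that erases the last index. This form makes
  multiplicativity a matter of commuting with one idempotent.\<close>

lemma corner_conv:
 assumes "\<g> : PM n" "n >= 1"
 shows "mm n (mm n (mtx_eps G n n) \<g>) (mtx_eps G n n) = mtx_corner (n - 1) \<g>" (is "?l = ?r")
proof (rule mtxI)
 fix i j x
 have "mm n (mm n (mtx_eps G n n) \<g>) (mtx_eps G n n) i j = Some x <-> i ~= n & j ~= n & \<g> i j = Some x"
  using PM_D(1-5)[OF assms(1), of i j] by (auto simp: mSome assms(1))
 then show "?l i j = Some x <-> ?r i j = Some x"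
  using PM_D(1-5)[OF assms(1), of i j x] assms(2) by auto
qed

lemma theta_conv:
 assumes "keys a <= PM n" "n >= 1"
 shows "theta n a = basis (mtx_eps G n n) \<star>[n] a \<star>[n] basis (mtx_eps G n n)"
 unfolding theta_def
 by (rule poly_mapping_eqI, simp add: lookup_lf lf_lin_ext lf_ma_mult)
  (intro lf_cong, use assms in "auto simp: subset_iff corner_conv")

lemma theta_keys: "keys a <= PM n ==> keys (theta n a) <= PM (n - 1)"
 unfolding theta_def by (rule lin_ext_keys) (auto intro: corner_PM)

lemma hat_theta: "\<e> : PM (n - 1) ==> hat (theta n a) \<e> = hat a \<e>"
proof -
 assume *: "\<e> : PM (n - 1)"
 have "sub \<e> (mtx_corner (n - 1) x) <-> sub \<e> x" for x
  using PM_D[OF *] by (auto simp: sub_def)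
 then show ?thesis by (simp add: theta_def hat_def lf_lin_ext)
qed

text \<open>With \<open>e\<close> the idempotent at n:
  \<open>(eae)(ebe) = e(ae)be = e(ea)be = e(ab)e\<close>, where commutation is applied to the left
  factor. Products at orders n and \<open>n - 1\<close> agree on truncated elements.\<close>

lemma theta_mult:
 fixes a b :: "('a, 'f::field) fgel"
 assumes a: "keys a <= PM n" and b: "keys b <= PM n" and n: "n >= 1"
  and comm: "a \<star>[n] basis (mtx_eps G n n) = basis (mtx_eps G n n) \<star>[n] a"
 shows "theta n (a \<star>[n] b) = theta n a \<star>[n - 1] theta n b"
proof -
 interpret A: falg "FGbar G n :: ('a, 'f) fgalg" by (rule falg_FG)
 let ?e = "basis (mtx_eps G n n) :: ('a, 'f) fgel"
 have c: "a : Fc n" "b : Fc n" "?e : Fc n"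
  using a b by auto
 have ee: "?e \<star>[n] ?e = ?e"
  by (simp, rule arg_cong[of _ _ basis], rule mtxI) (auto simp: mSome)
 have "theta n a \<star>[n - 1] theta n b = theta n a \<star>[n] theta n b"
  by (rule FG_mult_mono[OF theta_keys[OF a] theta_keys[OF b], symmetric]) simp
 also have "... = ?e \<star>[n] a \<star>[n] ?e \<star>[n] (?e \<star>[n] b \<star>[n] ?e)"
  using a b n by (simp only: theta_conv)
 also have "... = ?e \<star>[n] (a \<star>[n] (?e \<star>[n] ?e)) \<star>[n] b \<star>[n] ?e"
  using c by (simp only: A.m_assoc A.m_closed)
 also have "... = ?e \<star>[n] (?e \<star>[n] a) \<star>[n] b \<star>[n] ?e"
  by (simp only: ee comm)
 also have "... = (?e \<star>[n] ?e) \<star>[n] a \<star>[n] b \<star>[n] ?e"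
  using c by (simp only: A.m_assoc A.m_closed)
 also have "... = theta n (a \<star>[n] b)"
  unfolding ee using c theta_conv[OF _ n, of "a \<star>[n] b"] A.m_closed[OF c(1,2)]
  by (simp only: ma_simps(5)[symmetric] A.m_assoc A.m_closed)
 finally show ?thesis by simp
qed

end

section \<open>The limit centralizer algebras\<close>

context gmat begin

lemma Zcent_iff:
 "a : Zcent G m n <-> keys a <= PM n & (\<forall>\<g>\<in>Gprime G m n. a \<star>[n] basis \<g> = basis \<g> \<star>[n] a)"
 by (simp add: Zcent_def)

lemma GprimeD:
 assumes "\<g> : Gprime G m n"
 shows "\<g> : PM n" "1 <= k ==> k <= m ==> \<g> k k = Some \<one>"
  "\<g> i j = Some x ==> i <= m ==> j = i & x = \<one>" "\<g> i j = Some x ==> j <= m ==> j = i & x = \<one>"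
proof -
 show P: "\<g> : PM n" using assms by (simp add: Gprime_def)
 show 1: "\<g> k k = Some \<one>" if "1 <= k" "k <= m" for k using assms that by (simp add: Gprime_def)
 show "j = i & x = \<one>" if "\<g> i j = Some x" "i <= m"
  using PM_D(6)[OF P that(1) 1[of i]] PM_D(1)[OF P that(1)] 1[of i] that by auto
 show "j = i & x = \<one>" if "\<g> i j = Some x" "j <= m"
  using PM_D(7)[OF P that(1) 1[of j]] PM_D(3)[OF P that(1)] 1[of j] that by auto
qed

lemma eps_Gprime: "m < k ==> m <= n ==> mtx_eps G n k : Gprime G m n"
 by (auto simp: Gprime_def)

lemma Gprime_mono: "k <= m ==> Gprime G m n <= Gprime G k n"
 by (auto simp: Gprime_def)

lemma Zcent_mono: "k <= m ==> Zcent G k n <= Zcent G m n"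
 unfolding Zcent_def using Gprime_mono[of k m n] by blast

lemma comm_lin:
 fixes a b :: "('a, 'f::field) fgel"
 assumes "keys a <= PM n" "keys b <= PM n"
  "\<And>\<g>. \<g> : keys b ==> a \<star>[n] basis \<g> = basis \<g> \<star>[n] a"
 shows "a \<star>[n] b = b \<star>[n] a"
proof -
 interpret A: falg "FGbar G n :: ('a, 'f) fgalg" by (rule falg_FG)
 let ?X = "{\<g> : PM n. a \<star>[n] basis \<g> = basis \<g> \<star>[n] a}"
 have a: "a : Fc n" using assms by simp
 have "keys b <= ?X" using assms by auto
 then show ?thesis
 proof (induction rule: pm_induct)
  case zero
  show ?case using A.r_null[OF a] A.l_null[OF a] by simp
 next
  case (single x c)
  have x: "basis x : Fc n" using single by simp
  have e: "single x c = psc c (basis x)" by simp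
  show ?case unfolding e
   using A.smult_mult_r[OF a x, of c] A.smult_mult_l[OF x a, of c] single by simp
 next
  case (add b b')
  then show ?case by (simp add: ma_l_distr ma_r_distr)
 qed
qed

lemma Zcent_subalg: "is_subalg (Zcent G m n) (FGbar G n :: ('a, 'f::field) fgalg)"
proof -
 interpret A: falg "FGbar G n :: ('a, 'f) fgalg" by (rule falg_FG)
 let ?A = "FGbar G n :: ('a, 'f) fgalg"
 have Z: "a : Zcent G m n <-> a : carrier ?A & (\<forall>\<g>\<in>Gprime G m n. a \<otimes>\<^bsub>?A\<^esub> basis \<g> = basis \<g> \<otimes>\<^bsub>?A\<^esub> a)"
  for a :: "('a, 'f) fgel" by (simp add: Zcent_def)
 have g: "basis \<g> : carrier ?A" if "\<g> : Gprime G m n" for \<g> using GprimeD(1)[OF that] by simp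
 show ?thesis
 proof (rule is_subalgI[OF A.falg_axioms])
  show "\<one>\<^bsub>?A\<^esub> : Zcent G m n" unfolding Z using g A.l_one A.r_one A.one_closed by metis
  fix x y :: "('a, 'f) fgel" assume x: "x : Zcent G m n" and y: "y : Zcent G m n"
  have c: "x : carrier ?A" "y : carrier ?A" using x y unfolding Z by blast+
  show "x \<oplus>\<^bsub>?A\<^esub> y : Zcent G m n" unfolding Z
   using x y g A.l_distr A.r_distr A.a_closed unfolding Z by metis
  show "x \<otimes>\<^bsub>?A\<^esub> y : Zcent G m n" unfolding Z
  proof (intro conjI ballI A.m_closed c)
   fix \<g> assume h: "\<g> : Gprime G m n"
   have "x \<otimes>\<^bsub>?A\<^esub> basis \<g> = basis \<g> \<otimes>\<^bsub>?A\<^esub> x" "y \<otimes>\<^bsub>?A\<^esub> basis \<g> = basis \<g> \<otimes>\<^bsub>?A\<^esub> y"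
    using x y h unfolding Z by blast+
   then show "x \<otimes>\<^bsub>?A\<^esub> y \<otimes>\<^bsub>?A\<^esub> basis \<g> = basis \<g> \<otimes>\<^bsub>?A\<^esub> (x \<otimes>\<^bsub>?A\<^esub> y)"
    using c g[OF h] A.m_assoc by metis
  qed
  show "c \<odot>\<^bsub>?A\<^esub> x : Zcent G m n" for c unfolding Z
   using x g A.smult_mult_l A.smult_mult_r A.smult_closed unfolding Z by metis
 qed (simp add: Z subset_iff)
qed

text \<open>Replaces the bounded supremum by one bound on all keys of all terms, the form in which
  degrees are estimated below.\<close>

lemma deg_bdd_iff:
 "bdd_above ((%n. deg G n (\<a> n)) ` {m..}) <-> (\<exists>d. \<forall>n\<ge>m. dgl n (\<a> n) d)"
proof
 assume "bdd_above ((%n. deg G n (\<a> n)) ` {m..})"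
 then obtain d where d: "\<And>n. n >= m ==> deg G n (\<a> n) <= d" by (auto simp: bdd_above_def)
 have "mtx_deg G n \<g> <= d" if "n >= m" "\<g> : keys (\<a> n)" for n \<g>
 proof -
  have "mtx_deg G n \<g> <= deg G n (\<a> n)" unfolding deg_def
   by (rule le_cSup_finite) (use that in auto)
  then show ?thesis using d[OF that(1)] by simp
 qed
 then show "\<exists>d. \<forall>n\<ge>m. dgl n (\<a> n) d" by blast
next
 assume "\<exists>d. \<forall>n\<ge>m. dgl n (\<a> n) d"
 then obtain d where d: "\<And>n \<g>. n >= m ==> \<g> : keys (\<a> n) ==> mtx_deg G n \<g> <= d" by blast
 have "deg G n (\<a> n) <= d" if "n >= m" for n
 proof (cases "keys (\<a> n) = {}")
  case False
  then show ?thesis unfolding deg_def by (intro cSup_least) (use d that in auto)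
 qed (simp add: deg_def)
 then show "bdd_above ((%n. deg G n (\<a> n)) ` {m..})" by (auto simp: bdd_above_def)
qed

lemma Zbar_iff: "\<a> : Zc m <-> \<a> : extensional {m..} & (\<forall>n\<ge>m. \<a> n : Zcent G m n) \<and>
  (\<forall>n>m. theta n (\<a> n) = \<a> (n - 1)) & (\<exists>d. \<forall>n\<ge>m. dgl n (\<a> n) d)"
 unfolding Zbar_def partial_object.simps mem_Collect_eq deg_bdd_iff PiE_def Pi_def by auto

lemma Zbar_ops:
 "\<a> \<bullet>[m] \<b> = (\<lambda>n\<in>{m..}. \<a> n \<star>[n] \<b> n)" "\<a> \<oplus>\<^bsub>Zbar G m\<^esub> \<b> = (\<lambda>n\<in>{m..}. \<a> n + \<b> n)"
 "\<one>\<^bsub>Zbar G m\<^esub> = (\<lambda>n\<in>{m..}. basis (I1 n))" "\<zero>\<^bsub>Zbar G m\<^esub> = (\<lambda>n\<in>{m..}. 0)"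
 "c \<odot>\<^bsub>Zbar G m\<^esub> \<a> = (\<lambda>n\<in>{m..}. psc c (\<a> n))"
 by (simp_all add: Zbar_def)

lemma Zb_app:
 assumes "n >= m"
 shows "(\<a> \<bullet>[m] \<b>) n = \<a> n \<star>[n] \<b> n" "(\<a> \<oplus>\<^bsub>Zbar G m\<^esub> \<b>) n = \<a> n + \<b> n"
  "\<one>\<^bsub>Zbar G m\<^esub> n = basis (I1 n)" "\<zero>\<^bsub>Zbar G m\<^esub> n = 0" "(c \<odot>\<^bsub>Zbar G m\<^esub> \<a>) n = psc c (\<a> n)"
 using assms by (simp_all add: Zbar_ops)

lemma Zbar_ext: "\<a> : extensional {m..} ==> \<b> : extensional {m..} ==> (\<And>n. n >= m ==> \<a> n = \<b> n) ==> \<a> = \<b>"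
 by (rule extensionalityI) auto

lemma ZbarD:
 assumes "\<a> : Zc m"
 shows "\<a> : extensional {m..}" "n >= m ==> \<a> n : Zcent G m n" "n > m ==> theta n (\<a> n) = \<a> (n - 1)"
  "\<exists>d. \<forall>n\<ge>m. dgl n (\<a> n) d" "n >= m ==> keys (\<a> n) <= PM n"
  "n >= m ==> \<a> n : Fc n"
 using assms unfolding Zbar_iff by (auto simp: Zcent_iff)

text \<open>A diagonal position that holds 1 in both factors holds 1 in the product.\<close>

lemma mtx_deg_mult:
 assumes "\<g> : PM n" "\<d> : PM n"
 shows "mtx_deg G n (mm n \<g> \<d>) <= mtx_deg G n \<g> + mtx_deg G n \<d>"
proof -
 let ?D = "%\<g>. {k : {1..n}. \<g> k k ~= Some \<one>}"
 have "?D (mm n \<g> \<d>) <= ?D \<g> \<union> ?D \<d>"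
  using mult_SomeI[OF assms, of _ _ \<one> _ \<one>] by auto
 then have "card (?D (mm n \<g> \<d>)) <= card (?D \<g> \<union> ?D \<d>)" by (intro card_mono) auto
 also have "... <= card (?D \<g>) + card (?D \<d>)" by (rule card_Un_le)
 finally show ?thesis by (simp add: mtx_deg_def)
qed

lemma deg_bound_mult:
 assumes "keys a <= PM n" "keys b <= PM n"
  "dgl n a d" "dgl n b e"
 shows "dgl n (a \<star>[n] b) (d + e)"
proof -
 have "keys (a \<star>[n] b) <= {\<g>. mtx_deg G n \<g> <= d + e}"
 proof (rule ma_keys_mult)
  fix x y assume "x : {x : PM n. mtx_deg G n x <= d}" "y : {x : PM n. mtx_deg G n x <= e}"
  then show "x \<otimes>\<^bsub>Gbar G n\<^esub> y : {\<g>. mtx_deg G n \<g> <= d + e}"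
   using mtx_deg_mult[of x n y] by auto
 qed (use assms in auto)
 then show ?thesis by blast
qed

lemma mtx_deg_I1: "mtx_deg G n (I1 n) = 0"
 by (auto simp: mtx_deg_def)

lemma corner_I1: "n >= 1 ==> mtx_corner (n - 1) (I1 n) = I1 (n - 1)"
 by (rule mtxI) auto

lemma falg_Z: "falg (Zbar G m :: ('a, 'f::field) zalg)"
proof -
 let ?Z = "Zbar G m :: ('a, 'f) zalg"
 have FA: "falg (FGbar G n :: ('a, 'f) fgalg)" for n by (rule falg_FG)
 have R: "ring (FGbar G n :: ('a, 'f) fgalg)" for n using FA[of n] falg.axioms(1) by blast
 note ZS = is_subalgD[OF Zcent_subalg, unfolded ma_simps Gbar_simps]
 have add: "x \<oplus>\<^bsub>?Z\<^esub> y : carrier ?Z" if x: "x : carrier ?Z" and y: "y : carrier ?Z" for x y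
 proof -
  obtain d e where d: "\<forall>n\<ge>m. dgl n (x n) d"
   and e: "\<forall>n\<ge>m. dgl n (y n) e" using ZbarD(4)[OF x] ZbarD(4)[OF y] by blast
  have "\<forall>n\<ge>m. dgl n ((x \<oplus>\<^bsub>?Z\<^esub> y) n) (max d e)"
  proof (intro allI impI ballI)
   fix n \<g> assume n: "n >= m" and "\<g> : keys ((x \<oplus>\<^bsub>?Z\<^esub> y) n)"
   then have "\<g> : keys (x n) \<union> keys (y n)"
    using Poly_Mapping.keys_add[of "x n" "y n"] by (auto simp: Zb_app)
   then show "mtx_deg G n \<g> <= max d e" using d e n by (auto simp: le_max_iff_disj)
  qed
  then show ?thesis unfolding Zbar_iff
   using x y by (auto simp: Zbar_iff Zbar_ops lin_ext_lin theta_def ZS)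
 qed
 have mult: "x \<otimes>\<^bsub>?Z\<^esub> y : carrier ?Z" if x: "x : carrier ?Z" and y: "y : carrier ?Z" for x y
 proof -
  obtain d e where d: "\<forall>n\<ge>m. dgl n (x n) d"
   and e: "\<forall>n\<ge>m. dgl n (y n) e" using ZbarD(4)[OF x] ZbarD(4)[OF y] by blast
  have "\<forall>n\<ge>m. dgl n ((x \<otimes>\<^bsub>?Z\<^esub> y) n) (d + e)"
  proof (intro allI impI)
   fix n assume n: "n >= m"
   show "dgl n ((x \<otimes>\<^bsub>?Z\<^esub> y) n) (d + e)"
    unfolding Zb_app[OF n]
    by (rule deg_bound_mult[OF ZbarD(5)[OF x n] ZbarD(5)[OF y n]]) (use d e n in blast)+
  qed
  moreover have "theta n ((x \<otimes>\<^bsub>?Z\<^esub> y) n) = (x \<otimes>\<^bsub>?Z\<^esub> y) (n - 1)" if n: "n > m" for n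
  proof -
   have "theta n (x n \<star>[n] y n) = theta n (x n) \<star>[n - 1] theta n (y n)"
   proof (rule theta_mult)
    \<comment> \<open>For \<open>n > m\<close> the erasing idempotent lies in the subsemigroup
      centralized by the terms of order n, so truncation is multiplicative on them.\<close>
    have "mtx_eps G n n : Gprime G m n" using n by (intro eps_Gprime) auto
    then show "x n \<star>[n] basis (mtx_eps G n n) = basis (mtx_eps G n n) \<star>[n] x n"
     using ZbarD(2)[OF x, of n] n by (simp add: Zcent_iff)
   qed (use ZbarD(5)[OF x, of n] ZbarD(5)[OF y, of n] n in auto)
   then show ?thesis using n ZbarD(3)[OF x n] ZbarD(3)[OF y n] by (simp add: Zb_app)
  qed
  ultimately show ?thesis unfolding Zbar_iff
   using ZbarD(2)[OF x] ZbarD(2)[OF y] by (auto simp: Zbar_ops ZS)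
 qed
 have sm: "c \<odot>\<^bsub>?Z\<^esub> x : carrier ?Z" if x: "x : carrier ?Z" for c x
 proof -
  obtain d where d: "\<forall>n\<ge>m. dgl n (x n) d" using ZbarD(4)[OF x] by blast
  have "\<forall>n\<ge>m. dgl n ((c \<odot>\<^bsub>?Z\<^esub> x) n) d"
  proof (intro allI impI ballI)
   fix n \<g> assume n: "n >= m" and "\<g> : keys ((c \<odot>\<^bsub>?Z\<^esub> x) n)"
   then have "\<g> : keys (x n)"
    unfolding Zb_app[OF n] using keys_scale[of c "x n"] by blast
   then show "mtx_deg G n \<g> <= d" using d n by blast
  qed
  then show ?thesis unfolding Zbar_iff
   using x by (auto simp: Zbar_iff Zbar_ops lin_ext_lin theta_def ZS)
 qed
 have zero: "\<zero>\<^bsub>?Z\<^esub> : carrier ?Z"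
  by (auto simp: Zbar_iff Zbar_ops ZS theta_def lin_ext_lin)
 have one: "\<one>\<^bsub>?Z\<^esub> : carrier ?Z"
 proof -
  have "theta n (basis (I1 n) :: ('a, 'f) fgel) = basis (I1 (n - 1))" if "m < n" for n
   using corner_I1[of n] that by (simp add: theta_def lin_ext_lin)
  then show ?thesis unfolding Zbar_iff Zbar_ops using ZS(2) mtx_deg_I1 by auto
 qed
 have ext: "x \<otimes>\<^bsub>?Z\<^esub> y : extensional {m..}" "x \<oplus>\<^bsub>?Z\<^esub> y : extensional {m..}" "c \<odot>\<^bsub>?Z\<^esub> x : extensional {m..}"
  "\<zero>\<^bsub>?Z\<^esub> : extensional {m..}" "\<one>\<^bsub>?Z\<^esub> : extensional {m..}" for x y c
  by (simp_all add: Zbar_ops)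
 note car = ZbarD(6)
 have "abelian_group ?Z"
 proof (rule abelian_groupI)
  fix x assume x: "x : carrier ?Z"
  have "(- 1) \<odot>\<^bsub>?Z\<^esub> x \<oplus>\<^bsub>?Z\<^esub> x = \<zero>\<^bsub>?Z\<^esub>"
   by (rule Zbar_ext[OF ext(2,4)]) (auto simp: Zb_app lookup_add intro!: poly_mapping_eqI)
  then show "\<exists>y\<in>carrier ?Z. y \<oplus>\<^bsub>?Z\<^esub> x = \<zero>\<^bsub>?Z\<^esub>" using sm[OF x] by blast
  show "\<zero>\<^bsub>?Z\<^esub> \<oplus>\<^bsub>?Z\<^esub> x = x"
   by (rule Zbar_ext[OF ext(2) ZbarD(1)[OF x]]) (simp add: Zb_app)
  fix y
  show "x \<oplus>\<^bsub>?Z\<^esub> y = y \<oplus>\<^bsub>?Z\<^esub> x"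
   by (rule Zbar_ext[OF ext(2) ext(2)]) (simp add: Zb_app add.commute)
  fix z
  show "x \<oplus>\<^bsub>?Z\<^esub> y \<oplus>\<^bsub>?Z\<^esub> z = x \<oplus>\<^bsub>?Z\<^esub> (y \<oplus>\<^bsub>?Z\<^esub> z)"
   by (rule Zbar_ext[OF ext(2) ext(2)]) (simp add: Zb_app add.assoc)
 qed (use add zero in auto)
 moreover have "monoid ?Z"
 proof (rule monoidI)
  fix x assume x: "x : carrier ?Z"
  show "\<one>\<^bsub>?Z\<^esub> \<otimes>\<^bsub>?Z\<^esub> x = x"
   by (rule Zbar_ext[OF ext(1) ZbarD(1)[OF x]])
    (use monoid.l_one[OF ring.is_monoid[OF R] car[OF x]] in "simp add: Zb_app")
  show "x \<otimes>\<^bsub>?Z\<^esub> \<one>\<^bsub>?Z\<^esub> = x"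
   by (rule Zbar_ext[OF ext(1) ZbarD(1)[OF x]])
    (use monoid.r_one[OF ring.is_monoid[OF R] car[OF x]] in "simp add: Zb_app")
  fix y z assume y: "y : carrier ?Z" and z: "z : carrier ?Z"
  show "x \<otimes>\<^bsub>?Z\<^esub> y \<otimes>\<^bsub>?Z\<^esub> z = x \<otimes>\<^bsub>?Z\<^esub> (y \<otimes>\<^bsub>?Z\<^esub> z)"
   by (rule Zbar_ext[OF ext(1) ext(1)])
    (use monoid.m_assoc[OF ring.is_monoid[OF R] car[OF x] car[OF y] car[OF z]] in "simp add: Zb_app")
 qed (use mult one in auto)
 ultimately have "ring ?Z"
 proof (rule ringI)
  fix x y z
  show "(x \<oplus>\<^bsub>?Z\<^esub> y) \<otimes>\<^bsub>?Z\<^esub> z = x \<otimes>\<^bsub>?Z\<^esub> z \<oplus>\<^bsub>?Z\<^esub> y \<otimes>\<^bsub>?Z\<^esub> z"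
   by (rule Zbar_ext[OF ext(1) ext(2)]) (simp add: Zb_app ma_l_distr)
  show "z \<otimes>\<^bsub>?Z\<^esub> (x \<oplus>\<^bsub>?Z\<^esub> y) = z \<otimes>\<^bsub>?Z\<^esub> x \<oplus>\<^bsub>?Z\<^esub> z \<otimes>\<^bsub>?Z\<^esub> y"
   by (rule Zbar_ext[OF ext(1) ext(2)]) (simp add: Zb_app ma_r_distr)
 qed
 moreover have "falg_axioms ?Z"
 proof
  fix x y c d assume x: "x : carrier ?Z"
  show "c \<odot>\<^bsub>?Z\<^esub> x : carrier ?Z" by (rule sm[OF x])
  show "(c + d) \<odot>\<^bsub>?Z\<^esub> x = c \<odot>\<^bsub>?Z\<^esub> x \<oplus>\<^bsub>?Z\<^esub> d \<odot>\<^bsub>?Z\<^esub> x"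
   by (rule Zbar_ext[OF ext(3) ext(2)]) (auto simp: Zb_app lookup_add algebra_simps intro!: poly_mapping_eqI)
  show "(c * d) \<odot>\<^bsub>?Z\<^esub> x = c \<odot>\<^bsub>?Z\<^esub> (d \<odot>\<^bsub>?Z\<^esub> x)"
   by (rule Zbar_ext[OF ext(3) ext(3)]) (auto simp: Zb_app intro!: poly_mapping_eqI)
  show "1 \<odot>\<^bsub>?Z\<^esub> x = x"
   by (rule Zbar_ext[OF ext(3) ZbarD(1)[OF x]]) (auto simp: Zb_app intro!: poly_mapping_eqI)
  assume y: "y : carrier ?Z"
  show "c \<odot>\<^bsub>?Z\<^esub> (x \<oplus>\<^bsub>?Z\<^esub> y) = c \<odot>\<^bsub>?Z\<^esub> x \<oplus>\<^bsub>?Z\<^esub> c \<odot>\<^bsub>?Z\<^esub> y"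
   by (rule Zbar_ext[OF ext(3) ext(2)]) (auto simp: Zb_app lookup_add algebra_simps intro!: poly_mapping_eqI)
  show "(c \<odot>\<^bsub>?Z\<^esub> x) \<otimes>\<^bsub>?Z\<^esub> y = c \<odot>\<^bsub>?Z\<^esub> (x \<otimes>\<^bsub>?Z\<^esub> y)"
   by (rule Zbar_ext[OF ext(1) ext(3)])
    (use falg.smult_mult_l[OF FA car[OF x] car[OF y]] in "simp add: Zb_app")
  show "x \<otimes>\<^bsub>?Z\<^esub> (c \<odot>\<^bsub>?Z\<^esub> y) = c \<odot>\<^bsub>?Z\<^esub> (x \<otimes>\<^bsub>?Z\<^esub> y)"
   by (rule Zbar_ext[OF ext(1) ext(3)])
    (use falg.smult_mult_r[OF FA car[OF x] car[OF y]] in "simp add: Zb_app")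
 qed
 ultimately show ?thesis by (rule falg.intro)
qed

subsection \<open>Constant sequences and restriction\<close>

lemma embed_mult:
 assumes "\<g> : PM m" "\<d> : PM m" "m <= n"
 shows "emb m n (mm m \<g> \<d>) = mm n (emb m n \<g>) (emb m n \<d>)" (is "?l = ?r")
proof (rule mtxI)
 fix i j x
 note D = PM_D(1-4)[OF assms(1)] PM_D(1-4)[OF assms(2)]
 show "?l i j = Some x <-> ?r i j = Some x"
  unfolding mSome[OF embed_PM[OF assms(1,3)] embed_PM[OF assms(2,3)]] embed_Some mSome[OF assms(1,2)]
 proof
  assume "i <= m & j <= m & (\<exists>k g h. \<g> i k = Some g & \<d> k j = Some h & x = g \<otimes> h) \<or> m < i & i <= n & i = j & x = \<one>"
  then show "\<exists>k g h. (i <= m & k <= m & \<g> i k = Some g \<or> m < i & i <= n & i = k & g = \<one>) \<and>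
    (k <= m & j <= m & \<d> k j = Some h \<or> m < k & k <= n & k = j & h = \<one>) & x = g \<otimes> h"
  proof (elim disjE conjE exE)
   fix k g h assume "i <= m" "j <= m" "\<g> i k = Some g" "\<d> k j = Some h" "x = g \<otimes> h"
   then show ?thesis using D(4)[of i k g] by blast
  qed (intro exI[of _ j] exI[of _ \<one>], auto)
 qed auto
qed

lemma corner_embed: "\<g> : PM m ==> m < n ==> mtx_corner (n - 1) (emb m n \<g>) = emb m (n - 1) \<g>"
 by (rule mtxI) auto

lemma mtx_deg_embed: "\<g> : PM m ==> m <= n ==> mtx_deg G n (emb m n \<g>) <= m"
proof -
 assume "\<g> : PM m" "m <= n"
 have "{k : {1..n}. emb m n \<g> k k ~= Some \<one>} <= {1..m}" by auto
 from card_mono[OF _ this] show ?thesis by (simp add: mtx_deg_def)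
qed

text \<open>The two factors act on complementary diagonal blocks. Both products equal the block
  matrix described by \<open>?R\<close>.\<close>

lemma embed_comm:
 assumes "\<d> : PM m" "\<g> : Gprime G m n" "m <= n"
 shows "mm n (emb m n \<d>) \<g> = mm n \<g> (emb m n \<d>)"
proof (rule mtxI)
 fix i j x
 note g = GprimeD[OF assms(2)]
 note D = PM_D(1-5)[OF assms(1)]
 have E: "emb m n \<d> : PM n" by (rule embed_PM[OF assms(1,3)])
 let ?R = "(i <= m & j <= m & \<d> i j = Some x) \<or> (m < i & m < j & \<g> i j = Some x)"
 have "mm n (emb m n \<d>) \<g> i j = Some x <-> ?R"
 proof
  assume "mm n (emb m n \<d>) \<g> i j = Some x"
  then obtain k a b where k: "emb m n \<d> i k = Some a" "\<g> k j = Some b" "x = a \<otimes> b"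
   by (auto simp: mSome[OF E g(1)])
  show ?R
  proof (cases "k <= m")
   case True
   then show ?thesis using k g(3)[OF k(2)] D(5)[of i k] by auto
  next
   case False
   then show ?thesis using k g(4)[OF k(2)] PM_D(5)[OF g(1) k(2)] by (cases "j <= m") auto
  qed
 next
  assume R: ?R
  then show "mm n (emb m n \<d>) \<g> i j = Some x"
  proof (elim disjE conjE)
   assume a: "i <= m" "j <= m" "\<d> i j = Some x"
   have "emb m n \<d> i j = Some x" using a by simp
   from mult_SomeI[OF E g(1) this g(2)[of j]] show ?thesis using D(3,5)[OF a(3)] a by simp
  next
   assume a: "m < i" "m < j" "\<g> i j = Some x"
   have "emb m n \<d> i i = Some \<one>" using a PM_D(2)[OF g(1) a(3)] by simp
   from mult_SomeI[OF E g(1) this a(3)] show ?thesis using PM_D(5)[OF g(1) a(3)] by simp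
  qed
 qed
 moreover have "mm n \<g> (emb m n \<d>) i j = Some x <-> ?R"
 proof
  assume "mm n \<g> (emb m n \<d>) i j = Some x"
  then obtain k a b where k: "\<g> i k = Some a" "emb m n \<d> k j = Some b" "x = a \<otimes> b"
   by (auto simp: mSome[OF g(1) E])
  show ?R
  proof (cases "k <= m")
   case True
   then show ?thesis using k g(4)[OF k(1)] D(5)[of k j] by auto
  next
   case False
   then show ?thesis using k g(3)[OF k(1)] PM_D(5)[OF g(1) k(1)] by (cases "i <= m") auto
  qed
 next
  assume R: ?R
  then show "mm n \<g> (emb m n \<d>) i j = Some x"
  proof (elim disjE conjE)
   assume a: "i <= m" "j <= m" "\<d> i j = Some x"
   have "emb m n \<d> i j = Some x" using a by simp
   from mult_SomeI[OF g(1) E g(2)[of i] this] show ?thesis using D(1,5)[OF a(3)] a by simp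
  next
   assume a: "m < i" "m < j" "\<g> i j = Some x"
   have "emb m n \<d> j j = Some \<one>" using a PM_D(4)[OF g(1) a(3)] by simp
   from mult_SomeI[OF g(1) E a(3) this] show ?thesis using PM_D(5)[OF g(1) a(3)] by simp
  qed
 qed
 ultimately show "mm n (emb m n \<d>) \<g> i j = Some x <-> mm n \<g> (emb m n \<d>) i j = Some x"
  by simp
qed

lemma embed_I1: "m <= n ==> emb m n (I1 m) = I1 n"
 by (rule mtxI) auto

lemma csq_app: "n >= m ==> csq m y n = lin_ext (emb m n) y"
 by (simp add: const_seq_def)

lemma csq_hom: "csq m : alg_hom (FGbar G m :: ('a, 'f::field) fgalg) (Zbar G m)"
proof -
 let ?F = "FGbar G m :: ('a, 'f) fgalg"
 have ext: "csq m y : extensional {m..}" for y :: "('a, 'f) fgel" by (simp add: const_seq_def)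
 have "csq m y : Zc m" if "y : carrier ?F" for y
 proof -
  have y: "keys y <= PM m" using that by simp
  have "lin_ext (emb m n) y : Zcent G m n" if n: "n >= m" for n
   unfolding Zcent_iff
  proof (intro conjI ballI)
   show "keys (lin_ext (emb m n) y) <= PM n"
    by (rule lin_ext_keys) (use y n embed_PM in auto)
   fix \<g> assume g: "\<g> : Gprime G m n"
   show "lin_ext (emb m n) y \<star>[n] basis \<g> = basis \<g> \<star>[n] lin_ext (emb m n) y"
    by (rule poly_mapping_eqI, simp add: lookup_lf lf_lin_ext lf_ma_mult)
     (intro lf_cong, use y embed_comm[OF _ g n] in "auto simp: subset_iff")
  qed
  moreover have "theta n (lin_ext (emb m n) y) = lin_ext (emb m (n - 1)) y" if n: "n > m" for n
   unfolding theta_def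
   by (rule poly_mapping_eqI, simp add: lookup_lin_ext lf_lin_ext)
    (intro lf_cong, use y corner_embed[OF _ n] in "auto simp: subset_iff")
  moreover have "dgl n (lin_ext (emb m n) y) m" if n: "n >= m" for n
  proof -
   have "keys (lin_ext (emb m n) y) <= {\<g>. mtx_deg G n \<g> <= m}"
    by (rule lin_ext_keys) (use y mtx_deg_embed[OF _ n] in auto)
   then show ?thesis by blast
  qed
  ultimately show ?thesis unfolding Zbar_iff using ext by (auto simp: csq_app)
 qed
 moreover have "csq m (x \<otimes>\<^bsub>?F\<^esub> y) = csq m x \<bullet>[m] csq m y"
  if "x : carrier ?F" "y : carrier ?F" for x y
  by (rule Zbar_ext[OF ext]) (use that in "auto simp: Zbar_ops csq_app intro!: lin_ext_mult embed_mult")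
 moreover have "csq m (x + y) = csq m x \<oplus>\<^bsub>Zbar G m\<^esub> csq m y" for x y :: "('a, 'f) fgel"
  by (rule Zbar_ext[OF ext]) (auto simp: Zbar_ops csq_app lin_ext_lin)
 moreover have "csq m (psc c x) = c \<odot>\<^bsub>Zbar G m\<^esub> csq m x" for c and x :: "('a, 'f) fgel"
  by (rule Zbar_ext[OF ext]) (auto simp: Zbar_ops csq_app lin_ext_lin)
 moreover have "csq m (basis (I1 m) :: ('a, 'f) fgel) = \<one>\<^bsub>Zbar G m\<^esub>"
  by (rule Zbar_ext[OF ext]) (auto simp: Zbar_ops csq_app lin_ext_lin embed_I1)
 ultimately show ?thesis by (auto simp: alg_hom_def ring_hom_def)
qed

text \<open>Forgets the terms of order below m. This maps into \<open>Zbar G m\<close> because the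
  subsemigroup to be centralized shrinks as m grows.\<close>

definition res :: "nat => (('a, 'f) zel) => ('a, 'f::field) zel" where "res m z = restrict z {m..}"

lemma res_app [simp]: "n >= m ==> res m z n = z n" by (simp add: res_def)

lemma res_hom: "res m : alg_hom (Zbar G 0 :: ('a, 'f::field) zalg) (Zbar G m)"
proof -
 have "res m z : Zc m" if "z : Zc 0" for z :: "('a, 'f) zel"
  unfolding Zbar_iff
 proof (intro conjI allI impI)
  show "res m z : extensional {m..}" by (simp add: res_def)
  show "res m z n : Zcent G m n" if "m <= n" for n
   using ZbarD(2)[OF \<open>z : Zc 0\<close>, of n] Zcent_mono[of 0 m n] that by auto
  show "theta n (res m z n) = res m z (n - 1)" if "m < n" for n
   using ZbarD(3)[OF \<open>z : Zc 0\<close>, of n] that by simp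
  show "\<exists>d. \<forall>n\<ge>m. dgl n (res m z n) d"
   using ZbarD(4)[OF that] by auto
 qed
 then show ?thesis by (auto simp: alg_hom_def ring_hom_def Zbar_ops res_def fun_eq_iff restrict_def)
qed

text \<open>For m = 0 no diagonal entry is prescribed, so the centralized subsemigroup is
  everything: the terms of an element of \<open>Zbar G 0\<close> are central in
  \<open>FGbar G n\<close>.\<close>

lemma res_comm:
 assumes "z : Zc 0" "\<b> : Zc m"
 shows "res m z \<bullet>[m] \<b> = \<b> \<bullet>[m] res m z" (is "?l = ?r")
proof (rule Zbar_ext[where m = m])
 fix n assume n: "n >= m"
 have "z n \<star>[n] \<b> n = \<b> n \<star>[n] z n"
 proof (rule comm_lin)
  fix \<g> assume "\<g> : keys (\<b> n)"
  then have "\<g> : Gprime G 0 n" using ZbarD(5)[OF assms(2) n] by (auto simp: Gprime_def)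
  then show "z n \<star>[n] basis \<g> = basis \<g> \<star>[n] z n"
   using ZbarD(2)[OF assms(1), of n] by (simp add: Zcent_iff)
 qed (use ZbarD(5) assms n in auto)
 then show "?l n = ?r n" using n by (simp add: Zb_app)
qed (simp_all add: Zbar_ops)

end

section \<open>Coordinates\<close>

lemma sum_Pow_insert:
 assumes "finite F" "k ~: F"
 shows "(\<Sum>A\<in>Pow (insert k F). s A) = (\<Sum>A\<in>Pow F. s A) + (\<Sum>A\<in>Pow F. s (insert k A))"
proof -
 have "inj_on (insert k) (Pow F)" using assms(2) by (auto simp: inj_on_def)
 moreover have "Pow F \<inter> insert k ` Pow F = {}" using assms(2) by auto
 ultimately show ?thesis
  using assms(1) by (simp add: Pow_insert sum.union_disjoint sum.reindex)
qed

text \<open>Toggling membership of \<open>k\<close> is an involution on subsets that reverses the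
  sign of the summand.\<close>

lemma sum_Pow_cancel:
 fixes s :: "'i set => 'b::ab_group_add"
 assumes "finite F" "k : F" "\<And>A. A <= F ==> k ~: A ==> s (insert k A) = - s A"
 shows "(\<Sum>A\<in>Pow F. s A) = 0"
proof -
 have "(\<Sum>A\<in>Pow (insert k (F - {k})). s A) = (\<Sum>A\<in>Pow (F - {k}). s A) + (\<Sum>A\<in>Pow (F - {k}). s (insert k A))"
  by (rule sum_Pow_insert) (use assms(1) in auto)
 also have "(\<Sum>A\<in>Pow (F - {k}). s (insert k A)) = (\<Sum>A\<in>Pow (F - {k}). - s A)"
  by (rule sum.cong) (use assms in auto)
 finally show ?thesis using assms(2) by (simp add: insert_absorb sum_negf)
qed

lemma sum_Pow_compl: "(\<Sum>A\<in>Pow F. s A) = (\<Sum>A\<in>Pow F. s (F - A))"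
 by (rule sum.reindex_bij_witness[of _ "%A. F - A" "%A. F - A"]) (auto simp: double_diff)

lemma sum_Pow_sign:
 assumes "finite (F :: 'i set)"
 shows "(\<Sum>A\<in>Pow F. (- 1) ^ card A) = (if F = {} then 1 else (0::'b::ring_1))"
proof (cases "F = {}")
 case False
 then obtain k where k: "k : F" by blast
 have "(\<Sum>A\<in>Pow F. (- 1 :: 'b) ^ card A) = 0"
 proof (rule sum_Pow_cancel[OF assms k])
  fix A assume "A <= F" "k ~: A"
  moreover then have "finite A" using assms finite_subset by blast
  ultimately show "(- 1 :: 'b) ^ card (insert k A) = - ((- 1) ^ card A)" by simp
 qed
 then show ?thesis using False by simp
qed simp

text \<open>The complements of \<open>S\<close> and \<open>T\<close> in the finite set
  \<open>U\<close> have equal size, so any bijection between them completes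
  \<open>q\<close>.\<close>

lemma extend_perm:
 assumes "finite U" "S <= U" "T <= U" "bij_betw q S T"
 shows "\<exists>p. p permutes U & (\<forall>i\<in>S. p i = q i)"
proof -
 have f: "finite S" "finite T" using assms finite_subset by auto
 have "card (U - S) = card (U - T)"
  using assms bij_betw_same_card[OF assms(4)] f by (simp add: card_Diff_subset)
 then obtain b where b: "bij_betw b (U - S) (U - T)"
  using finite_same_card_bij assms(1) by (metis finite_Diff)
 define p where "p i = (if i : S then q i else if i : U then b i else i)" for i
 have "bij_betw p S T" using assms(4) by (rule bij_betw_cong[THEN iffD1, rotated]) (simp add: p_def)
 moreover have "bij_betw p (U - S) (U - T)" using b by (rule bij_betw_cong[THEN iffD1, rotated]) (simp add: p_def)
 ultimately have "bij_betw p (S \<union> (U - S)) (T \<union> (U - T))" by (rule bij_betw_combine) auto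
 then have "bij_betw p U U" using assms by (simp add: Un_Diff_cancel Un_absorb1)
 then have "p permutes U" by (rule bij_imp_permutes) (use assms(2) in "auto simp: p_def")
 then show ?thesis by (auto simp: p_def)
qed

section \<open>Fixed points beyond m, outer support and Moebius inversion\<close>

context gmat begin

definition fixp :: "nat => 'a mtx => nat set" where "fixp m \<g> = {k. m < k & \<g> k k = Some \<one>}"
text \<open>Only columns are erased; when \<open>A\<close> consists of fixed points the
  corresponding rows disappear with them (\<open>rows_rm\<close>).\<close>

definition rm :: "'a mtx => nat set => 'a mtx" where "rm \<g> A = (%i j. if j : A then None else \<g> i j)"
text \<open>The outer support. Its size takes over the role of the degree once elements are
  described by coordinates.\<close>

definition S :: "nat => 'a mtx => nat set" where "S m \<g> = {k. m < k & (k : rows \<g> \<or> k : cols \<g>)}"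
text \<open>Commutation with the diagonal idempotents beyond m forces nonzero coordinates onto these
  matrices: beyond m, an index that is a nonzero row is a nonzero column and conversely.\<close>

definition Gam :: "nat => nat => 'a mtx set" where
 "Gam m n = {\<g> : PM n. \<forall>k>m. k : rows \<g> <-> k : cols \<g>}"

lemma rowsI: "\<g> i j = Some x ==> i : rows \<g>" by (auto simp: rows_def)
lemma colsI: "\<g> i j = Some x ==> j : cols \<g>" by (auto simp: cols_def)

lemma rm_Some [simp]: "rm \<g> A i j = Some x <-> j ~: A & \<g> i j = Some x"
 by (auto simp: rm_def)

lemma rm_PM [simp, intro]: "\<g> : PM n ==> rm \<g> A : PM n"
 unfolding PM_iff rm_Some by blast

lemma rm_rm [simp]: "rm (rm \<g> A) B = rm \<g> (A \<union> B)"
 by (rule mtxI) auto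

lemma rm_empty [simp]: "rm \<g> {} = \<g>"
 by (rule mtxI) auto

lemma fixpts_rm [simp]: "fixp m (rm \<g> A) = fixp m \<g> - A"
 by (auto simp: fixp_def rm_def)

lemma PM_rows: "\<g> : PM n ==> rows \<g> <= {1..n}"
 unfolding rows_def by (rule subsetI) (auto dest: PM_D(1,2))

lemma PM_cols: "\<g> : PM n ==> cols \<g> <= {1..n}"
 unfolding cols_def by (rule subsetI) (auto dest: PM_D(3,4))

lemma S_sub: "\<g> : PM n ==> S m \<g> <= {m<..n}"
 using PM_rows[of \<g> n] PM_cols[of \<g> n] by (auto simp: S_def)

lemma finite_S [simp, intro]: "\<g> : PM n ==> finite (S m \<g>)"
 by (rule finite_subset[OF S_sub]) simp_all

lemma fixpts_S: "fixp m \<g> <= S m \<g>"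
 by (auto simp: fixp_def S_def intro: rowsI)

lemma finite_fixp [simp, intro]: "\<g> : PM n ==> finite (fixp m \<g>)"
 using fixpts_S finite_S finite_subset by metis

lemma Gam_PM: "\<g> : Gam m n ==> \<g> : PM n" by (simp add: Gam_def)

lemma Gam_S: "\<g> : Gam m n ==> k : S m \<g> <-> m < k & k : cols \<g>"
 "\<g> : Gam m n ==> k : S m \<g> <-> m < k & k : rows \<g>"
 by (auto simp: Gam_def S_def)

lemma Gam_mono: "n <= n' ==> Gam m n <= Gam m n'"
 using PM_mono by (auto simp: Gam_def)

lemma rows_rm:
 assumes "\<g> : PM n" "A <= fixp m \<g>"
 shows "rows (rm \<g> A) = rows \<g> - A"
proof -
 have "j : A <-> i : A" if "\<g> i j = Some x" for i j x
 proof -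
  have f: "\<g> k k = Some \<one>" if "k : A" for k using that assms(2) by (auto simp: fixp_def)
  show ?thesis using PM_D(6)[OF assms(1) that f] PM_D(7)[OF assms(1) that f] by blast
 qed
 then show ?thesis by (auto simp: rows_def)
qed

lemma cols_rm: "cols (rm \<g> A) = cols \<g> - A"
 by (auto simp: cols_def)

lemma rm_Gam: "\<g> : Gam m n ==> A <= fixp m \<g> ==> rm \<g> A : Gam m n"
 using rows_rm[OF Gam_PM] by (auto simp: Gam_def cols_rm)

lemma rm_Gam_iff: "\<g> : PM n ==> A <= fixp m \<g> ==> rm \<g> A : Gam m n <-> \<g> : Gam m n"
 using rows_rm[of \<g> n A m] by (auto simp: Gam_def cols_rm fixp_def subset_iff intro: rowsI colsI)

lemma S_rm: "\<g> : PM n ==> A <= fixp m \<g> ==> S m (rm \<g> A) = S m \<g> - A"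
 using rows_rm[of \<g> n A m] by (auto simp: S_def cols_rm)

text \<open>Moebius inversion in the Boolean lattice of sets of fixed points, with
  \<open>zet\<close> as the inverse transform.\<close>

definition mob :: "nat => ('a mtx => 'f::field) => 'a mtx => 'f" where
 "mob m h \<g> = (\<Sum>A\<in>Pow (fixp m \<g>). (- 1) ^ card A * h (rm \<g> A))"
definition zet :: "nat => ('a mtx => 'f::field) => 'a mtx => 'f" where
 "zet m c \<g> = (\<Sum>A\<in>Pow (fixp m \<g>). c (rm \<g> A))"

lemma mob_zet:
 fixes c :: "'a mtx => 'f::field"
 assumes "finite (fixp m \<g>)"
 shows "mob m (zet m c) \<g> = c \<g>"
proof -
 let ?F = "fixp m \<g>"
 \<comment> \<open>Subsets are indexed by the fixed points that are kept instead of those removed;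
   in this indexing \<open>zet\<close> sums over the subsets of T, as inclusion and exclusion
   expects.\<close>
 define f where "f T = c (rm \<g> (?F - T))" for T
 have z: "zet m c (rm \<g> (?F - T)) = sum f (Pow T)" if "T <= ?F" for T
 proof -
  have "fixp m (rm \<g> (?F - T)) = T" using that by auto
  then have "zet m c (rm \<g> (?F - T)) = (\<Sum>A\<in>Pow T. c (rm \<g> ((?F - T) \<union> A)))" by (simp add: zet_def)
  also have "... = (\<Sum>A\<in>Pow T. c (rm \<g> ((?F - T) \<union> (T - A))))" by (rule sum_Pow_compl)
  also have "... = (\<Sum>A\<in>Pow T. f A)"
   by (rule sum.cong) (use that in \<open>auto simp: f_def intro!: arg_cong[of _ _ c] arg_cong[of _ _ "rm \<g>"]\<close>)
  finally show ?thesis .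
 qed
 have "f ?F = (\<Sum>T\<in>Pow ?F. (-1) ^ (card ?F - card T) * sum f (Pow T))"
  by (rule inclusion_exclusion_mobius[OF _ assms]) simp
 also have "... = (\<Sum>T\<in>Pow ?F. (-1) ^ card (?F - T) * zet m c (rm \<g> (?F - T)))"
 proof (rule sum.cong)
  fix T assume "T : Pow ?F"
  moreover then have "finite T" using assms finite_subset by blast
  ultimately show "(-1) ^ (card ?F - card T) * sum f (Pow T) = (-1) ^ card (?F - T) * zet m c (rm \<g> (?F - T))"
   by (simp add: z card_Diff_subset)
 qed simp
 also have "... = mob m (zet m c) \<g>"
  unfolding mob_def by (rule sum_Pow_compl[symmetric])
 finally show ?thesis by (simp add: f_def)
qed

lemma zet_mob:
 fixes h :: "'a mtx => 'f::field"
 assumes "finite (fixp m \<g>)"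
 shows "zet m (mob m h) \<g> = h \<g>"
proof -
 let ?F = "fixp m \<g>"
 define f where "f T = h (rm \<g> (?F - T))" for T
 define g where "g T = (\<Sum>U\<in>Pow T. (-1) ^ card U * f U)" for T
 have z: "mob m h (rm \<g> (?F - T)) = (-1) ^ card T * g T" if "T <= ?F" for T
 proof -
  have fT: "finite T" using that assms finite_subset by blast
  have "fixp m (rm \<g> (?F - T)) = T" using that by auto
  then have "mob m h (rm \<g> (?F - T)) = (\<Sum>A\<in>Pow T. (-1) ^ card A * h (rm \<g> ((?F - T) \<union> A)))" by (simp add: mob_def)
  also have "... = (\<Sum>A\<in>Pow T. (-1) ^ card (T - A) * h (rm \<g> ((?F - T) \<union> (T - A))))" by (rule sum_Pow_compl)
  also have "... = (\<Sum>A\<in>Pow T. (-1) ^ card T * ((-1) ^ card A * f A))"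
  proof (rule sum.cong)
   fix A assume A: "A : Pow T"
   have e: "(?F - T) \<union> (T - A) = ?F - A" using A that by auto
   have "card T = card (T - A) + card A"
    using A fT by (metis PowD card_Diff_subset card_mono finite_subset le_add_diff_inverse2)
   then have "(-1 :: 'f) ^ card T * (-1) ^ card A = (-1) ^ card (T - A) * ((-1) ^ card A * (-1) ^ card A)"
    by (simp add: power_add mult.assoc)
   then show "(-1) ^ card (T - A) * h (rm \<g> ((?F - T) \<union> (T - A))) = (-1) ^ card T * ((-1) ^ card A * f A)"
    unfolding e f_def by (simp flip: mult.assoc power_add)
  qed simp
  finally show ?thesis by (simp add: g_def sum_distrib_left)
 qed
 have "f ?F = (\<Sum>T\<in>Pow ?F. (-1) ^ card T * g T)"
  by (rule inclusion_exclusion_symmetric[OF _ assms]) (simp add: g_def)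
 also have "... = (\<Sum>T\<in>Pow ?F. mob m h (rm \<g> (?F - T)))"
  by (rule sum.cong) (auto simp: z)
 also have "... = zet m (mob m h) \<g>"
  unfolding zet_def by (rule sum_Pow_compl[symmetric])
 finally show ?thesis by (simp add: f_def)
qed

subsection \<open>Conjugation\<close>

text \<open>Conjugation by \<open>mon n p l\<close>, written entrywise so that no order n appears
  and the same expression applies to coordinates of all orders (\<open>cj_conv\<close>).\<close>

definition cj :: "(nat => nat) => (nat => 'a) => 'a mtx => 'a mtx" where
 "cj p l \<g> = (%i j. map_option (%x. l i \<otimes> x \<otimes> inv (l j)) (\<g> (p i) (p j)))"
definition mon :: "nat => (nat => nat) => (nat => 'a) => 'a mtx" where
 "mon n p l = (%i j. if 1 <= i & i <= n & j = p i then Some (l i) else None)"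
text \<open>Parameters of the invertible elements of \<open>Gprime G m n\<close>. The labels are
  total functions: trivial up to m, and arbitrary group elements beyond n.\<close>

definition pl_ok :: "nat => nat => (nat => nat) => (nat => 'a) => bool" where
 "pl_ok m n p l <-> p permutes {m<..n} & (\<forall>i. l i : carrier G) & (\<forall>i\<le>m. l i = \<one>)"
definition invf :: "nat => nat => ('a mtx => 'f) => bool" where
 "invf m n c <-> (\<forall>p l \<g>. pl_ok m n p l --> \<g> : PM n --> c (cj p l \<g>) = c \<g>)"

lemma cj_Some [simp]: "cj p l \<g> i j = Some x <-> (\<exists>y. \<g> (p i) (p j) = Some y & x = l i \<otimes> y \<otimes> inv (l j))"
 by (auto simp: cj_def)

lemma mon_Some [simp]: "mon n p l i j = Some x <-> 1 <= i & i <= n & j = p i & x = l i"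
 by (auto simp: mon_def)

lemma pl_okD:
 assumes "pl_ok m n p l"
 shows "p permutes {m<..n}" "l i : carrier G" "i <= m ==> l i = \<one>" "inj p" "p i = p j <-> i = j"
  "i <= m ==> p i = i" "p i <= m <-> i <= m" "m <= n ==> p i <= n <-> i <= n" "1 <= p i <-> 1 <= i" "n < i ==> p i = i"
proof -
 show p: "p permutes {m<..n}" "l i : carrier G" "i <= m ==> l i = \<one>" for i using assms by (auto simp: pl_ok_def)
 show "inj p" using p(1) by (rule permutes_inj)
 then show "p i = p j <-> i = j" by (auto dest: injD)
 have o: "p i = i" if "i ~: {m<..n}" for i using p(1) that by (rule permutes_not_in)
 have k: "p i : {m<..n} <-> i : {m<..n}" for i using p(1) by (rule permutes_in_image)
 show "i <= m ==> p i = i" "n < i ==> p i = i" by (rule o, simp)+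
 show "p i <= m <-> i <= m" using o[of i] k[of i] by (cases "i : {m<..n}") auto
 show "m <= n ==> p i <= n <-> i <= n" using o[of i] k[of i] by (cases "i : {m<..n}") auto
 show "1 <= p i <-> 1 <= i" using o[of i] k[of i] by (cases "i : {m<..n}") auto
qed

lemma cj_PM:
 assumes "pl_ok m n p l" "\<g> : PM n" "m <= n"
 shows "cj p l \<g> : PM n"
 unfolding PM_iff cj_Some
proof (intro conjI allI impI; elim exE conjE)
 fix i j g y assume y: "\<g> (p i) (p j) = Some y" "g = l i \<otimes> y \<otimes> inv (l j)"
 note D = PM_D(1-5)[OF assms(2) y(1)] and P = pl_okD(2,8,9)[OF assms(1)]
 show "1 <= i" "i <= n" "1 <= j" "j <= n" "g : carrier G" using D P y(2) assms(3) by auto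
next
 fix i j j' y y' assume "\<g> (p i) (p j) = Some y" "\<g> (p i) (p j') = Some y'"
 then show "j = j'" using PM_D(6)[OF assms(2)] pl_okD(5)[OF assms(1)] by blast
next
 fix i i' j y y' assume "\<g> (p i) (p j) = Some y" "\<g> (p i') (p j) = Some y'"
 then show "i = i'" using PM_D(7)[OF assms(2)] pl_okD(5)[OF assms(1)] by blast
qed

lemma mon_Gprime:
 assumes "pl_ok m n p l" "m <= n"
 shows "mon n p l : Gprime G m n"
 unfolding Gprime_def PM_iff
 using pl_okD(2,3,5,6,8,9)[OF assms(1)] assms(2) by auto

lemma mon_PM: "pl_ok m n p l ==> m <= n ==> mon n p l : PM n"
 using mon_Gprime GprimeD(1) by blast

lemma rows_mon: "pl_ok m n p l ==> m <= n ==> rows (mon n p l) = {1..n}"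
 by (auto simp: rows_def)

lemma cols_mon:
 assumes "pl_ok m n p l" "m <= n"
 shows "cols (mon n p l) = {1..n}"
proof -
 have "\<exists>i. 1 <= i & i <= n & j = p i" if "1 <= j" "j <= n" for j
 proof -
  obtain i where "j = p i" using permutes_surj[OF pl_okD(1)[OF assms(1)]] by (metis surjD)
  then show ?thesis using pl_okD(8,9)[OF assms(1)] assms(2) that by blast
 qed
 then show ?thesis using pl_okD(8,9)[OF assms(1)] assms(2) by (auto simp: cols_def)
qed

lemma tr_mon_mon:
 assumes "pl_ok m n p l" "m <= n"
 shows "mm n (tr (mon n p l)) (mon n p l) = I1 n" "mm n (mon n p l) (tr (mon n p l)) = I1 n"
proof -
 note P = mon_PM[OF assms] and p = pl_okD[OF assms(1)]
 show "mm n (mon n p l) (tr (mon n p l)) = I1 n"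
  by (rule mtxI) (use p(2,5) in "auto simp: mSome P tr_Some")
 show "mm n (tr (mon n p l)) (mon n p l) = I1 n" (is "?l = ?r")
 proof (rule mtxI)
  fix i j x
  have "i : {1..n} <-> i : cols (mon n p l)" using cols_mon[OF assms] by simp
  then show "?l i j = Some x <-> ?r i j = Some x"
   using p(2) by (auto simp: mSome P tr_Some cols_def)
 qed
qed

lemma cj_conv:
 assumes "pl_ok m n p l" "m <= n" "\<g> : PM n"
 shows "cj p l \<g> = mm n (mm n (mon n p l) \<g>) (tr (mon n p l))" (is "?l = ?r")
proof (rule mtxI)
 fix i j x
 note P = mon_PM[OF assms(1,2)] and p = pl_okD[OF assms(1)]
 have "mm n (mm n (mon n p l) \<g>) (tr (mon n p l)) i j = Some x <->
  1 <= i & i <= n & 1 <= j & j <= n & (\<exists>y. \<g> (p i) (p j) = Some y & x = l i \<otimes> y \<otimes> inv (l j))"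
  by (auto simp: mSome P assms(3) tr_Some)
 also have "... <-> (\<exists>y. \<g> (p i) (p j) = Some y & x = l i \<otimes> y \<otimes> inv (l j))"
  using PM_D(1-4)[OF assms(3), of "p i" "p j"] p(8,9) assms(2) by blast
 finally show "?l i j = Some x <-> ?r i j = Some x"
  by simp
qed

text \<open>As \<open>mon n p l\<close> is invertible, \<open>hat\<close> turns the two products
  into \<open>hat a\<close> at \<open>tr\<close>-translates on either side; substituting a
  translated matrix into one identity gives invariance under conjugation, and conversely.\<close>

lemma comm_mon_iff:
 fixes a :: "('a, 'f::field) fgel"
 assumes "pl_ok m n p l" "m <= n" "keys a <= PM n"
 shows "a \<star>[n] basis (mon n p l) = basis (mon n p l) \<star>[n] a <->
  (\<forall>\<g>\<in>PM n. hat a (cj p l \<g>) = hat a \<g>)"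
proof
 note P = mon_PM[OF assms(1,2)]
 let ?\<s> = "mon n p l"
 interpret M: monoid "Gbar G n" by (rule monoid_Gbar)
 note MA = M.m_assoc[unfolded Gbar_simps] M.l_one[unfolded Gbar_simps] M.r_one[unfolded Gbar_simps]
 have L: "hat (basis ?\<s> \<star>[n] a) \<e> = hat a (mm n (tr ?\<s>) \<e>)"
  and R: "hat (a \<star>[n] basis ?\<s>) \<e> = hat a (mm n \<e> (tr ?\<s>))" if "\<e> : PM n" for \<e>
  using hat_left[OF P that assms(3)] hat_right[OF P that assms(3)] PM_rows[OF that] PM_cols[OF that]
  by (simp_all add: rows_mon[OF assms(1,2)] cols_mon[OF assms(1,2)])
 {
  assume c: "a \<star>[n] basis ?\<s> = basis ?\<s> \<star>[n] a"
  show "\<forall>\<g>\<in>PM n. hat a (cj p l \<g>) = hat a \<g>"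
  proof
   fix \<g> assume g: "\<g> : PM n"
   have "hat a (cj p l \<g>) = hat (a \<star>[n] basis ?\<s>) (mm n ?\<s> \<g>)"
    using R[of "mm n ?\<s> \<g>"] cj_conv[OF assms(1,2) g] P g by simp
   also have "... = hat a (mm n (tr ?\<s>) (mm n ?\<s> \<g>))" unfolding c by (rule L) (use P g in auto)
   also have "mm n (tr ?\<s>) (mm n ?\<s> \<g>) = mm n (mm n (tr ?\<s>) ?\<s>) \<g>" using P g by (simp add: MA)
   also have "... = \<g>" using g by (simp add: tr_mon_mon[OF assms(1,2)] MA)
   finally show "hat a (cj p l \<g>) = hat a \<g>" .
  qed
 }
 {
  assume c: "\<forall>\<g>\<in>PM n. hat a (cj p l \<g>) = hat a \<g>"
  show "a \<star>[n] basis ?\<s> = basis ?\<s> \<star>[n] a"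
  proof (rule hat_eqI)
   fix \<e> assume e: "\<e> : PM n"
   have "mm n (mm n ?\<s> (mm n (tr ?\<s>) \<e>)) (tr ?\<s>) = mm n (mm n (mm n ?\<s> (tr ?\<s>)) \<e>) (tr ?\<s>)"
    using P e by (simp add: MA)
   also have "... = mm n \<e> (tr ?\<s>)" using e P by (simp add: tr_mon_mon[OF assms(1,2)] MA)
   finally have "hat a (mm n \<e> (tr ?\<s>)) = hat a (mm n (tr ?\<s>) \<e>)"
    using c[rule_format, of "mm n (tr ?\<s>) \<e>"] cj_conv[OF assms(1,2), of "mm n (tr ?\<s>) \<e>"] P e by simp
   then show "hat (a \<star>[n] basis ?\<s>) \<e> = hat (basis ?\<s> \<star>[n] a) \<e>" using L R e by simp
  qed (rule ma_keys_mult[where X = "PM n" and Y = "PM n"]; use P assms(3) in auto)+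
 }
qed

definition idm :: "nat => nat set => 'a mtx" where
 "idm n J = (%i j. if 1 <= i & i <= n & i = j & i ~: J then Some \<one> else None)"

lemma idm_Some [simp]: "idm n J i j = Some x <-> 1 <= i & i <= n & i = j & i ~: J & x = \<one>"
 by (auto simp: idm_def)

lemma idm_PM [simp, intro]: "idm n J : PM n"
 unfolding PM_iff by auto

lemma eps_idm: "mtx_eps G n k = idm n {k}"
 by (rule mtxI) auto

lemma hat_idm:
 assumes "keys a <= PM n" "\<e> : PM n"
 shows "hat (basis (idm n J) \<star>[n] a) \<e> = (if rows \<e> \<inter> J = {} then hat a \<e> else 0)"
  "hat (a \<star>[n] basis (idm n J)) \<e> = (if cols \<e> \<inter> J = {} then hat a \<e> else 0)"
proof -
 have i: "tr (idm n J) = idm n J" by (rule mtxI) (auto simp: tr_Some)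
 have rc: "rows (idm n J) = {1..n} - J" "cols (idm n J) = {1..n} - J" by (auto simp: rows_def cols_def)
 have l: "mm n (idm n J) \<e> = \<e>" (is "?l = ?r") if "rows \<e> \<inter> J = {}"
 proof (rule mtxI)
  fix i j x
  show "?l i j = Some x <-> ?r i j = Some x"
   using PM_D(1,2,5)[OF assms(2), of i j] that rowsI[of \<e> i j] by (auto simp: mSome assms(2))
 qed
 have r: "mm n \<e> (idm n J) = \<e>" (is "?l = ?r") if "cols \<e> \<inter> J = {}"
 proof (rule mtxI)
  fix i j x
  show "?l i j = Some x <-> ?r i j = Some x"
   using PM_D(3,4,5)[OF assms(2), of i j] that colsI[of \<e> i j] by (auto simp: mSome assms(2))
 qed
 show "hat (basis (idm n J) \<star>[n] a) \<e> = (if rows \<e> \<inter> J = {} then hat a \<e> else 0)"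
  using l PM_rows[OF assms(2)] by (subst hat_left) (use assms in "auto simp: i rc")
 show "hat (a \<star>[n] basis (idm n J)) \<e> = (if cols \<e> \<inter> J = {} then hat a \<e> else 0)"
  using r PM_cols[OF assms(2)] by (subst hat_right) (use assms in "auto simp: i rc")
qed

text \<open>The rows beyond m on which the matrix is nonzero are mapped injectively to columns
  beyond m. Extending this map to a permutation fills the zero rows, and a diagonal idempotent
  erases them again. Commutation with \<open>Gprime\<close> thus needs checking for idempotents and
  invertible elements separately.\<close>

lemma Gprime_factor:
 assumes "\<u> : Gprime G m n" "m <= n"
 shows "\<exists>p l J. pl_ok m n p l & J <= {m<..n} & \<u> = mm n (idm n J) (mon n p l)"
proof -
 note g = GprimeD[OF assms(1)]
 define q where "q i = (THE j. \<exists>x. \<u> i j = Some x)" for i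
 have q: "q i = j" if "\<u> i j = Some x" for i j x
  unfolding q_def by (rule the_equality) (use that PM_D(6)[OF g(1)] in blast)+
 let ?R = "rows \<u> - {..m}"
 have b: "bij_betw q ?R (cols \<u> - {..m})"
 proof (rule bij_betwI')
  fix i i' assume "i : ?R" "i' : ?R"
  then obtain j x j' x' where "\<u> i j = Some x" "\<u> i' j' = Some x'" by (auto simp: rows_def)
  then show "q i = q i' <-> i = i'" using q PM_D(6,7)[OF g(1)] by metis
 next
  fix i assume i: "i : ?R"
  then obtain j x where j: "\<u> i j = Some x" by (auto simp: rows_def)
  then have "\<not> j <= m" using g(4)[OF j] i by auto
  then show "q i : cols \<u> - {..m}" using q[OF j] colsI[of \<u>, OF j] by simp
 next
  fix j assume j: "j : cols \<u> - {..m}"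
  then obtain i x where i: "\<u> i j = Some x" by (auto simp: cols_def)
  then have "\<not> i <= m" using g(3)[OF i] j by auto
  then show "\<exists>i\<in>?R. j = q i" using q[OF i] rowsI[of \<u>, OF i] by (intro bexI[of _ i]) auto
 qed
 have "?R <= {m<..n}" "cols \<u> - {..m} <= {m<..n}" using PM_rows[OF g(1)] PM_cols[OF g(1)] by auto
 then obtain p where p: "p permutes {m<..n}" "\<forall>i\<in>?R. p i = q i"
  using extend_perm[OF _ _ _ b] by blast
 define l where "l i = (if i : ?R then the (\<u> i (q i)) else \<one>)" for i
 have t: "\<u> i (p i) = Some (l i)" if i: "i : rows \<u>" for i
 proof (cases "i <= m")
  case True
  have "1 <= i" using PM_rows[OF g(1)] i by auto
  moreover have "p i = i" using p(1) True by (intro permutes_not_in[of p]) auto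
  ultimately show ?thesis using g(2)[of i] True by (simp add: l_def)
 next
  case False
  obtain j x where "\<u> i j = Some x" using i by (auto simp: rows_def)
  then show ?thesis using q[of i j x] p(2) i False by (auto simp: l_def)
 qed
 have lc: "l i : carrier G" for i
  using t[of i] PM_D(5)[OF g(1)] by (cases "i : ?R") (auto simp: l_def)
 have ok: "pl_ok m n p l" unfolding pl_ok_def using p(1) lc by (auto simp: l_def)
 define J where "J = {m<..n} - rows \<u>"
 have rr: "i : rows \<u> <-> 1 <= i & i <= n & i ~: J" for i
  using g(2)[of i] PM_rows[OF g(1)] rowsI[of \<u> i i \<one>] by (auto simp: J_def)
 have "\<u> = mm n (idm n J) (mon n p l)" (is "?l = ?r")
 proof (rule mtxI)
  fix i j x
  have "\<u> i j = Some x <-> i : rows \<u> & j = p i & x = l i"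
   using t[of i] PM_D(6)[OF g(1), of i j x "p i" "l i"] rowsI[of \<u> i j x] by auto
  then show "?l i j = Some x <-> ?r i j = Some x"
   using lc by (auto simp: mSome mon_PM[OF ok assms(2)] rr)
 qed
 moreover have "J <= {m<..n}" by (auto simp: J_def)
 ultimately show ?thesis using ok by blast
qed

text \<open>An idempotent on the left filters coordinates by rows and on the right by columns, so
  commuting with idempotents is the support condition \<open>Gam\<close>; commuting with invertible
  elements is invariance. \<open>Gprime_factor\<close> combines the two.\<close>

lemma Zcent_hat:
 fixes a :: "('a, 'f::field) fgel"
 assumes "keys a <= PM n" "m <= n"
 shows "a : Zcent G m n <-> (\<forall>\<g>\<in>PM n. hat a \<g> ~= 0 --> \<g> : Gam m n) & invf m n (hat a)"
proof
 assume a: "a : Zcent G m n"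
 show "(\<forall>\<g>\<in>PM n. hat a \<g> ~= 0 --> \<g> : Gam m n) & invf m n (hat a)"
 proof (intro conjI ballI impI)
  fix \<g> assume g: "\<g> : PM n" "hat a \<g> ~= 0"
  have "k : rows \<g> <-> k : cols \<g>" if k: "k > m" for k
  proof -
   have "a \<star>[n] basis (idm n {k}) = basis (idm n {k}) \<star>[n] a"
    using a eps_Gprime[OF k assms(2)] by (simp add: Zcent_iff eps_idm)
   then show ?thesis using hat_idm[OF assms(1) g(1), of "{k}"] g(2) by (auto split: if_splits)
  qed
  then show "\<g> : Gam m n" using g by (simp add: Gam_def)
 next
  show "invf m n (hat a)"
   unfolding invf_def using a comm_mon_iff[OF _ assms(2,1)] mon_Gprime[OF _ assms(2)]
   by (auto simp: Zcent_iff)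
 qed
next
 assume h: "(\<forall>\<g>\<in>PM n. hat a \<g> ~= 0 --> \<g> : Gam m n) & invf m n (hat a)"
 interpret A: falg "FGbar G n :: ('a, 'f) fgalg" by (rule falg_FG)
 show "a : Zcent G m n"
  unfolding Zcent_iff
 proof (intro conjI ballI assms(1))
  fix \<u> assume t: "\<u> : Gprime G m n"
  from Gprime_factor[OF t assms(2)] obtain p l J
   where *: "pl_ok m n p l" "J <= {m<..n}" "\<u> = mm n (idm n J) (mon n p l)" by blast
  let ?E = "basis (idm n J) :: ('a, 'f) fgel" and ?M = "basis (mon n p l) :: ('a, 'f) fgel"
  have c: "a : Fc n" "?E : Fc n" "?M : Fc n"
   using assms(1) mon_PM[OF *(1) assms(2)] by auto
  have M: "a \<star>[n] ?M = ?M \<star>[n] a"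
   unfolding comm_mon_iff[OF *(1) assms(2,1)] using h *(1) by (auto simp: invf_def)
  have E: "a \<star>[n] ?E = ?E \<star>[n] a"
  proof (rule hat_eqI)
   show "keys (a \<star>[n] ?E) <= PM n" "keys (?E \<star>[n] a) <= PM n"
    using A.m_closed[OF c(1,2)] A.m_closed[OF c(2,1)] by simp_all
   fix \<e> assume e: "\<e> : PM n"
   have "rows \<e> \<inter> J = {} <-> cols \<e> \<inter> J = {}" if "hat a \<e> ~= 0"
   proof -
    have "\<e> : Gam m n" using h e that by blast
    then have "\<forall>k\<in>J. k : rows \<e> <-> k : cols \<e>" using *(2) by (auto simp: Gam_def subset_iff)
    then show ?thesis by blast
   qed
   then show "hat (a \<star>[n] ?E) \<e> = hat (?E \<star>[n] a) \<e>"
    using hat_idm[OF assms(1) e, of J] by auto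
  qed
  have b: "basis \<u> = ?E \<star>[n] ?M" by (simp add: *(3))
  have "a \<star>[n] (?E \<star>[n] ?M) = (a \<star>[n] ?E) \<star>[n] ?M"
   using c by (simp only: A.m_assoc)
  also have "... = ?E \<star>[n] (a \<star>[n] ?M)" unfolding E using c by (simp only: A.m_assoc)
  also have "... = ?E \<star>[n] ?M \<star>[n] a" unfolding M using c by (simp only: A.m_assoc)
  finally show "a \<star>[n] basis \<u> = basis \<u> \<star>[n] a" unfolding b .
 qed
qed

text \<open>A matrix does not record its order, so the least admissible order is chosen;
  compatibility under \<open>theta\<close> makes every larger one give the same value
  (\<open>hs_eq\<close>).\<close>

definition hs :: "nat => (('a, 'f::field) zel) => 'a mtx => 'f" where
 "hs m \<a> \<g> = hat (\<a> (LEAST n. m <= n & \<g> : PM n)) \<g>"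
definition XS :: "nat => (('a, 'f::field) zel) => 'a mtx => 'f" where
 "XS m \<a> = mob m (hs m \<a>)"

lemma hs_eq:
 assumes "\<a> : Zc m" "m <= n" "\<g> : PM n"
 shows "hs m \<a> \<g> = hat (\<a> n) \<g>"
proof -
 define n0 where "n0 = (LEAST n. m <= n & \<g> : PM n)"
 have n0: "m <= n0" "\<g> : PM n0" using LeastI[of "%n. m <= n & \<g> : PM n" n] assms by (simp_all add: n0_def)
 have "n0 <= n" unfolding n0_def by (rule Least_le) (use assms in simp)
 then have "hat (\<a> n) \<g> = hat (\<a> n0) \<g>"
 proof (induction rule: dec_induct)
  case (step k)
  have "\<g> : PM k" using n0(2) PM_mono[of n0 k] step by auto
  then have "hat (theta (Suc k) (\<a> (Suc k))) \<g> = hat (\<a> (Suc k)) \<g>" by (intro hat_theta) simp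
  then show ?case using ZbarD(3)[OF assms(1), of "Suc k"] step n0(1) by simp
 qed simp
 then show ?thesis by (simp add: hs_def n0_def)
qed

lemma mob_cong:
 assumes "\<g> : PM n" "\<And>\<e>. \<e> : PM n ==> h \<e> = h' \<e>"
 shows "mob m h \<g> = mob m h' \<g>"
 unfolding mob_def by (rule sum.cong) (use assms in auto)

lemma XS_eq:
 assumes "\<a> : Zc m" "m <= n" "\<g> : PM n"
 shows "XS m \<a> \<g> = mob m (hat (\<a> n)) \<g>"
 unfolding XS_def by (rule mob_cong[OF assms(3)]) (rule hs_eq[OF assms(1,2)])

lemma XS_lin:
 fixes \<a> \<b> :: "('a, 'f::field) zel"
 assumes "\<a> : Zc m" "\<b> : Zc m" "m <= n" "\<g> : PM n"
 shows "XS m (\<a> \<oplus>\<^bsub>Zbar G m\<^esub> \<b>) \<g> = XS m \<a> \<g> + XS m \<b> \<g>"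
  "XS m (c \<odot>\<^bsub>Zbar G m\<^esub> \<a>) \<g> = c * XS m \<a> \<g>"
  "XS m \<zero>\<^bsub>Zbar G m\<^esub> \<g> = (0::'f)"
proof -
 interpret Z: falg "Zbar G m :: ('a, 'f) zalg" by (rule falg_Z)
 show "XS m (\<a> \<oplus>\<^bsub>Zbar G m\<^esub> \<b>) \<g> = XS m \<a> \<g> + XS m \<b> \<g>"
  using assms XS_eq[OF Z.a_closed[OF assms(1,2)] assms(3,4)]
  by (simp add: XS_eq[OF assms(1,3,4)] XS_eq[OF assms(2,3,4)] Zb_app mob_def distrib_left sum.distrib)
 show "XS m (c \<odot>\<^bsub>Zbar G m\<^esub> \<a>) \<g> = c * XS m \<a> \<g>"
  using assms XS_eq[OF Z.smult_closed[OF assms(1)] assms(3,4)]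
  by (simp add: XS_eq[OF assms(1,3,4)] Zb_app mob_def sum_distrib_left mult.left_commute)
 show "XS m \<zero>\<^bsub>Zbar G m\<^esub> \<g> = (0::'f)"
  using XS_eq[OF Z.zero_closed assms(3,4)] by (simp add: Zb_app[OF assms(3)] mob_def)
qed

lemma hs_Gam:
 assumes "\<a> : Zc m" "m <= n" "\<g> : PM n" "hs m \<a> \<g> ~= 0"
 shows "\<g> : Gam m n"
 using Zcent_hat[OF ZbarD(5)[OF assms(1,2)] assms(2)] ZbarD(2)[OF assms(1,2)] hs_eq[OF assms(1-3)] assms(3,4)
 by auto

lemma XS_Gam:
 assumes "\<a> : Zc m" "m <= n" "\<g> : PM n" "XS m \<a> \<g> ~= 0"
 shows "\<g> : Gam m n"
proof (rule ccontr)
 assume n: "\<g> ~: Gam m n"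
 have "hs m \<a> (rm \<g> A) = 0" if "A <= fixp m \<g>" for A
  using hs_Gam[OF assms(1,2) rm_PM[OF assms(3)]] rm_Gam_iff[OF assms(3) that] n by blast
 then show False using assms(4) by (simp add: XS_def mob_def)
qed

lemma zet_XS:
 assumes "\<a> : Zc m" "m <= n" "\<g> : PM n"
 shows "zet m (XS m \<a>) \<g> = hs m \<a> \<g>"
 unfolding XS_def by (rule zet_mob) (use assms in auto)

text \<open>\<open>zet\<close> recovers all sums over containing matrices from the coordinates, and
  these sums determine each term by \<open>hat_inj\<close>.\<close>

lemma XS_inj:
 fixes \<a> :: "('a, 'f::field) zel"
 assumes a: "\<a> : Zc m" and z: "\<And>n \<g>. m <= n ==> \<g> : Gam m n ==> XS m \<a> \<g> = 0"
 shows "\<a> = \<zero>\<^bsub>Zbar G m\<^esub>"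
proof (rule Zbar_ext[OF ZbarD(1)[OF a]])
 fix n assume n: "n >= m"
 have "hat (\<a> n) \<g> = 0" if g: "\<g> : PM n" for \<g>
 proof -
  have "XS m \<a> (rm \<g> A) = 0" for A
   using XS_Gam[OF a n rm_PM[OF g]] z[OF n] by blast
  then have "zet m (XS m \<a>) \<g> = 0" by (simp add: zet_def)
  then show ?thesis using zet_XS[OF a n g] hs_eq[OF a n g] by simp
 qed
 then show "\<a> n = \<zero>\<^bsub>Zbar G m\<^esub> n" using hat_inj[OF ZbarD(5)[OF a n]] n by (simp add: Zb_app)
qed (simp add: Zbar_ops)

lemma inv_hs:
 assumes "\<a> : Zc m" "m <= n"
 shows "invf m n (hs m \<a>)"
 using Zcent_hat[OF ZbarD(5)[OF assms] assms(2)] ZbarD(2)[OF assms] hs_eq[OF assms] cj_PM[OF _ _ assms(2)]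
 unfolding invf_def by auto

lemma fixpts_cj:
 assumes "pl_ok m n p l" "\<g> : PM n" "m <= n"
 shows "k : fixp m (cj p l \<g>) <-> p k : fixp m \<g>"
proof -
 note P = pl_okD[OF assms(1)]
 have "cj p l \<g> k k = Some \<one> <-> \<g> (p k) (p k) = Some \<one>"
 proof
  assume "cj p l \<g> k k = Some \<one>"
  then obtain y where y: "\<g> (p k) (p k) = Some y" "\<one> = l k \<otimes> y \<otimes> inv (l k)" by auto
  have yc: "y : carrier G" using PM_D(5)[OF assms(2) y(1)] .
  have "l k \<otimes> y = l k" using y(2) yc P(2)[of k] by (metis inv_closed inv_equality inv_inv m_closed)
  then show "\<g> (p k) (p k) = Some \<one>" using y(1) yc P(2)[of k] by simp
 qed (use P(2) in simp)
 then show ?thesis using P(7)[of k] by (auto simp: fixp_def not_le[symmetric])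
qed

text \<open>The permutation carries fixed points of the conjugate to fixed points of
  \<open>\<g>\<close>. A weight that depends on the size of the set covers both \<open>mob\<close>
  (signs) and \<open>zet\<close> (ones).\<close>

lemma sum_cj:
 fixes w :: "nat => 'f::field"
 assumes "pl_ok m n p l" "\<g> : PM n" "m <= n" "invf m n h"
 shows "(\<Sum>A\<in>Pow (fixp m (cj p l \<g>)). w (card A) * h (rm (cj p l \<g>) A)) =
  (\<Sum>A\<in>Pow (fixp m \<g>). w (card A) * h (rm \<g> A))"
proof -
 note P = pl_okD[OF assms(1)]
 have b: "bij_betw p (fixp m (cj p l \<g>)) (fixp m \<g>)"
  unfolding bij_betw_def
 proof (intro conjI equalityI subsetI)
  show "inj_on p (fixp m (cj p l \<g>))" using P(4) by (rule inj_on_subset) simp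
  fix k assume k: "k : fixp m \<g>"
  obtain j where "k = p j" using permutes_surj[OF P(1)] by (metis surjD)
  then show "k : p ` fixp m (cj p l \<g>)" using k fixpts_cj[OF assms(1-3)] by blast
 qed (use fixpts_cj[OF assms(1-3)] in blast)
 have "(\<Sum>A\<in>Pow (fixp m (cj p l \<g>)). w (card A) * h (rm (cj p l \<g>) A)) =
   (\<Sum>A\<in>Pow (fixp m (cj p l \<g>)). w (card (p ` A)) * h (rm \<g> (p ` A)))"
 proof (rule sum.cong)
  fix A
  have "rm (cj p l \<g>) A = cj p l (rm \<g> (p ` A))"
   by (rule mtxI) (auto simp: P(5) image_iff)
  moreover have "card (p ` A) = card A" by (rule card_image) (rule inj_on_subset[OF P(4)], simp)
  ultimately show "w (card A) * h (rm (cj p l \<g>) A) = w (card (p ` A)) * h (rm \<g> (p ` A))"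
   using assms(1,2,4) by (simp add: invf_def)
 qed simp
 also have "... = (\<Sum>A\<in>Pow (fixp m \<g>). w (card A) * h (rm \<g> A))"
  by (rule sum.reindex_bij_betw[OF bij_betw_Pow[OF b]])
 finally show ?thesis .
qed

lemma inv_mob: "invf m n h ==> m <= n ==> invf m n (mob m h)"
 unfolding invf_def mob_def by (intro allI impI sum_cj) (auto simp: invf_def)

lemma inv_zet: "invf m n h ==> m <= n ==> invf m n (zet m h)"
 using sum_cj[of m n _ _ _ h "%_. 1"] unfolding invf_def zet_def by simp

lemma inv_XS:
 assumes "\<a> : Zc m" "m <= n"
 shows "invf m n (XS m \<a>)"
 unfolding XS_def by (rule inv_mob[OF inv_hs[OF assms] assms(2)])

lemma Gam_cj:
 assumes "pl_ok m n p l" "\<g> : PM n" "m <= n"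
 shows "cj p l \<g> : Gam m n <-> \<g> : Gam m n"
  "k : S m (cj p l \<g>) <-> p k : S m \<g>"
proof -
 note P = pl_okD[OF assms(1)]
 have s: "\<exists>j. k = p j" for k using permutes_surj[OF P(1)] by (metis surjD)
 have r: "k : rows (cj p l \<g>) <-> p k : rows \<g>" for k
 proof
  assume "p k : rows \<g>"
  then obtain j' x where "\<g> (p k) j' = Some x" by (auto simp: rows_def)
  moreover obtain j where "j' = p j" using s by blast
  ultimately show "k : rows (cj p l \<g>)" by (auto simp: rows_def)
 qed (auto simp: rows_def)
 have c: "k : cols (cj p l \<g>) <-> p k : cols \<g>" for k
 proof
  assume "p k : cols \<g>"
  then obtain j' x where "\<g> j' (p k) = Some x" by (auto simp: cols_def)
  moreover obtain j where "j' = p j" using s by blast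
  ultimately show "k : cols (cj p l \<g>)" by (auto simp: cols_def)
 qed (auto simp: cols_def)
 have lt: "m < p k <-> m < k" for k using P(7)[of k] by linarith
 show "k : S m (cj p l \<g>) <-> p k : S m \<g>" by (simp add: S_def r c lt)
 have "(\<forall>k>m. p k : rows \<g> <-> p k : cols \<g>) <-> (\<forall>k>m. k : rows \<g> <-> k : cols \<g>)"
  using s lt by metis
 then show "cj p l \<g> : Gam m n <-> \<g> : Gam m n"
  using cj_PM[OF assms] assms(2) by (simp add: Gam_def r c)
qed

text \<open>Conjugacy of partial matrices witnessed on their supports only; the junk value \<open>0\<close> of \<open>q\<close>
 marks the indices outside the support, where all matrices vanish.\<close>

definition sim :: "nat => 'a mtx => 'a mtx => bool" where
 "sim m \<g> \<g>' <-> (\<exists>q l. \<g>' = cj q l \<g> & (\<forall>i\<le>m. q i = i & l i = \<one>) & (\<forall>i. l i : carrier G) \<and>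
   (\<forall>i>m. q i : S m \<g> \<or> q i = 0) & (\<forall>k\<in>S m \<g>. \<exists>i>m. q i = k) \<and>
   (\<forall>i>m. \<forall>j>m. q i = q j --> q i ~= 0 --> i = j))"

text \<open>On the indices that meet the support, \<open>q\<close> is a bijection and extends to a
  permutation of \<open>{m<..n}\<close>. Elsewhere both \<open>q\<close> and the extension point to
  vanishing rows and columns, so the two conjugates coincide.\<close>

lemma sim_inv:
 assumes "sim m \<g> \<g>'" "\<g> : PM n" "\<g>' : PM n" "m <= n" "invf m n c"
 shows "c \<g>' = c \<g>"
proof -
 obtain q l where q: "\<g>' = cj q l \<g>" "\<And>i. i <= m ==> q i = i" "\<And>i. i <= m ==> l i = \<one>" "\<And>i. l i : carrier G"
  "\<And>i. i > m ==> q i : S m \<g> \<or> q i = 0" "\<And>k. k : S m \<g> ==> \<exists>i>m. q i = k"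
  "\<And>i j. i > m ==> j > m ==> q i = q j ==> q i ~= 0 ==> i = j"
  using assms(1) unfolding sim_def by auto
 let ?T = "{i. m < i & q i : S m \<g>}"
 have S0: "m < k" if "k : S m \<g>" for k using that by (simp add: S_def)
 have b: "bij_betw q ?T (S m \<g>)"
  unfolding bij_betw_def
 proof (intro conjI equalityI subsetI)
  show "inj_on q ?T"
  proof (rule inj_onI)
   fix i j assume "i : ?T" "j : ?T" "q i = q j"
   then show "i = j" using q(7)[of i j] S0[of "q i"] by auto
  qed
  fix k assume k: "k : S m \<g>"
  then obtain i where "i > m" "q i = k" using q(6) by blast
  then show "k : q ` ?T" using k by auto
 qed auto
 \<comment> \<open>An index sent by \<open>q\<close> into the support of \<open>\<g>\<close> carries
   an entry of \<open>\<g>'\<close>, and \<open>\<g>'\<close> has order at most n.\<close>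
 have T: "?T <= {m<..n}"
 proof
  fix i assume i: "i : ?T"
  then have iS: "q i : S m \<g>" "m < i" by auto
  have "i : S m \<g>'"
  proof -
   have "\<exists>j x. \<g> (q i) j = Some x \<or> \<g> j (q i) = Some x" using iS(1) by (auto simp: S_def rows_def cols_def)
   then obtain j x where j: "\<g> (q i) j = Some x \<or> \<g> j (q i) = Some x" by blast
   have "\<exists>j'. q j' = j"
   proof (cases "j <= m")
    case True
    then show ?thesis using q(2) by blast
   next
    case False
    then have "j : S m \<g>" using j by (auto simp: S_def rows_def cols_def)
    then show ?thesis using q(6) by blast
   qed
   then obtain j' where "q j' = j" by blast
   then show ?thesis using j iS(2) unfolding q(1) S_def rows_def cols_def mem_Collect_eq cj_Some by blast
  qed
  then show "i : {m<..n}" using S_sub[OF assms(3)] by blast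
 qed
 obtain p where p: "p permutes {m<..n}" "\<forall>i\<in>?T. p i = q i"
  using extend_perm[OF _ T S_sub[OF assms(2)] b] by blast
 have ok: "pl_ok m n p l" unfolding pl_ok_def using p(1) q(3,4) by auto
 have pm: "p i = i" if "i <= m" for i using p(1) that by (intro permutes_not_in[of p]) auto
 have pS: "p i ~: S m \<g>" if "i > m" "i ~: ?T" for i
 proof
  assume "p i : S m \<g>"
  then obtain j where j: "j > m" "q j = p i" using q(6) by blast
  then have "j : ?T" using \<open>p i : S m \<g>\<close> by auto
  then have "p j = p i" using p(2) j by auto
  then have "j = i" using pl_okD(5)[OF ok] by blast
  then show False using that \<open>j : ?T\<close> by blast
 qed
 have z: "\<g> (p i) j = None & \<g> j (p i) = None & \<g> (q i) j = None & \<g> j (q i) = None" if "i > m" "i ~: ?T" for i j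
 proof -
  have "p i > m" using pl_okD(7)[OF ok, of i] that(1) by simp
  then have "\<g> (p i) j = None & \<g> j (p i) = None"
   using pS[OF that] rowsI[of \<g> "p i" j] colsI[of \<g> j "p i"]
   by (cases "\<g> (p i) j"; cases "\<g> j (p i)") (auto simp: S_def)
  moreover have "q i = 0" using q(5)[OF that(1)] that by auto
  moreover have "\<g> 0 j = None & \<g> j 0 = None" using PM_D(1,3)[OF assms(2)] by (metis not_None_eq not_one_le_zero)
  ultimately show ?thesis by simp
 qed
 have pq: "p i = q i \<or> (i > m & i ~: ?T)" for i using pm q(2) p(2) by (cases "i <= m") auto
 have "cj p l \<g> i j = cj q l \<g> i j" for i j
  unfolding cj_def using pq[of i] pq[of j] z[of i] z[of j] by auto
 then have "\<g>' = cj p l \<g>" unfolding q(1) by (intro ext) simp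
 then show ?thesis using assms(2,5) ok by (simp add: invf_def)
qed

subsection \<open>Degrees\<close>

text \<open>A key \<open>\<d>\<close> of degree at most d has a diagonal 1 at some k in the outer
  support of \<open>\<g>\<close>, which has more than d points. If k is a fixed point of
  \<open>\<g>\<close>, removing it or not does not affect containment in \<open>\<d>\<close>, and
  the signs cancel. Otherwise the entry of \<open>\<g>\<close> in column k contradicts the diagonal
  1 of \<open>\<d>\<close>, and no term contributes.\<close>

lemma XS_deg:
 fixes \<a> :: "('a, 'f::field) zel"
 assumes a: "\<a> : Zc m" and d: "\<forall>n\<ge>m. dgl n (\<a> n) d"
  and g: "m <= n" "\<g> : Gam m n" "card (S m \<g>) > d"
 shows "XS m \<a> \<g> = 0"
proof -
 have P: "\<g> : PM n" using Gam_PM g(2) by blast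
 let ?F = "fixp m \<g>"
 have "XS m \<a> \<g> = lf (%\<d>. \<Sum>A\<in>Pow ?F. (- 1) ^ card A * (if sub (rm \<g> A) \<d> then 1 else 0)) (\<a> n)"
  unfolding XS_eq[OF a g(1) P] mob_def hat_def lf_fun_sum lf_fun_cmult ..
 also have "... = lf (%\<d>. 0) (\<a> n)"
 proof (rule lf_cong)
  fix \<d> assume dk: "\<d> : keys (\<a> n)"
  then have dP: "\<d> : PM n" using ZbarD(5)[OF a g(1)] by blast
  have "card {k : {1..n}. \<d> k k ~= Some \<one>} <= d" using d g(1) dk by (auto simp: mtx_deg_def)
  have "\<exists>k\<in>S m \<g>. \<d> k k = Some \<one>"
  proof (rule ccontr)
   assume "\<not> (\<exists>k\<in>S m \<g>. \<d> k k = Some \<one>)"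
   then have "S m \<g> <= {k : {1..n}. \<d> k k ~= Some \<one>}" using S_sub[OF P, of m] by fastforce
   then have "card (S m \<g>) <= card {k : {1..n}. \<d> k k ~= Some \<one>}" by (intro card_mono) auto
   then show False using g(3) \<open>card {k : {1..n}. \<d> k k ~= Some \<one>} <= d\<close> by simp
  qed
  then obtain k where k: "k : S m \<g>" "\<d> k k = Some \<one>" by blast
  show "(\<Sum>A\<in>Pow ?F. (- 1) ^ card A * (if sub (rm \<g> A) \<d> then 1 else 0)) = (0::'f)"
  proof (cases "k : ?F")
   case True
   show ?thesis
   proof (rule sum_Pow_cancel[OF _ True])
    fix A assume A: "A <= ?F" "k ~: A"
    have fA: "finite A" using A(1) finite_fixp[OF P] finite_subset by blast
    have gk: "\<g> k k = Some \<one>" using True by (simp add: fixp_def)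
    have "sub (rm \<g> (insert k A)) \<d> <-> sub (rm \<g> A) \<d>"
    proof
     assume s: "sub (rm \<g> (insert k A)) \<d>"
     show "sub (rm \<g> A) \<d>" unfolding sub_def
     proof (intro allI impI)
      fix i j x assume e: "rm \<g> A i j = Some x"
      show "\<d> i j = Some x"
      proof (cases "j = k")
       case True
       then have "i = k" using PM_D(7)[OF P _ gk] e by auto
       then show ?thesis using True e gk k(2) by auto
      next
       case False
       then show ?thesis using e subD[OF s, of i j x] by auto
      qed
     qed
    qed (auto simp: sub_def)
    then show "(- 1) ^ card (insert k A) * (if sub (rm \<g> (insert k A)) \<d> then 1 else 0) =
      - ((- 1) ^ card A * (if sub (rm \<g> A) \<d> then 1 else (0::'f)))"
     using A fA by simp
   qed (use P in auto)
  next
   case False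
   obtain i x where i: "\<g> i k = Some x" using k(1) Gam_S(1)[OF g(2), of k] by (auto simp: cols_def)
   have "m < k" using k(1) by (simp add: S_def)
   have "\<not> sub (rm \<g> A) \<d>" if "A <= ?F" for A
   proof
    assume "sub (rm \<g> A) \<d>"
    moreover have "rm \<g> A i k = Some x" using i False that by auto
    ultimately have dx: "\<d> i k = Some x" by (rule subD)
    then have "i = k" using PM_D(7)[OF dP dx k(2)] by blast
    moreover then have "x = \<one>" using dx k(2) by simp
    ultimately have "i = k" "x = \<one>" by blast+
    then show False using False i \<open>m < k\<close> by (simp add: fixp_def)
   qed
   then show ?thesis by (intro sum.neutral) auto
  qed
 qed
 finally show ?thesis by simp
qed

text \<open>The bound is strict, so that bound 0 means the zero element and inductions can start
  there. For \<open>ldeg m \<a> (Suc d)\<close>, the top symbol is the restriction of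
  \<open>XS m \<a>\<close> to outer support of size d.\<close>

definition ldeg :: "nat => (('a, 'f::field) zel) => nat => bool" where
 "ldeg m \<a> d <-> (\<forall>n\<ge>m. \<forall>\<g>\<in>Gam m n. XS m \<a> \<g> ~= 0 --> card (S m \<g>) < d)"

lemma ldeg_exists: "\<a> : Zc m ==> \<exists>d. ldeg m \<a> d"
proof -
 assume a: "\<a> : Zc m"
 obtain d where "\<forall>n\<ge>m. dgl n (\<a> n) d" using ZbarD(4)[OF a] by blast
 then have "ldeg m \<a> (Suc d)" unfolding ldeg_def using XS_deg[OF a] by (meson less_Suc_eq_le not_le)
 then show ?thesis ..
qed

subsection \<open>Elements with prescribed coordinates\<close>

text \<open>Completion by ones at the outer indices that \<open>\<g>\<close> leaves alone; this
  keeps the degree bounded while n grows.\<close>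

definition padd :: "nat => nat => 'a mtx => 'a mtx" where
 "padd m n \<g> = (%i j. if m < i & i <= n & i = j & i ~: S m \<g> then Some \<one> else \<g> i j)"
text \<open>The signed sum over erased columns makes \<open>hat\<close> test whether all columns of
  \<open>\<g>\<close> are present. What remains visible are the matrices \<open>\<g>\<close>
  enlarged by fixed points, which is what \<open>zet\<close> sums over.\<close>

definition fel :: "nat => nat => 'a mtx => ('a, 'f::field) fgel" where
 "fel m n \<g> = (\<Sum>B\<in>Pow (cols \<g>). single (rm (padd m n \<g>) B) ((- 1) ^ card B))"
definition Xi :: "nat => ('a mtx => 'f::field) => ('a, 'f) zel" where
 "Xi m c = (\<lambda>n\<in>{m..}. \<Sum>\<g>\<in>Gam m n. psc (c \<g>) (fel m n \<g>))"

lemma padd_Some: "padd m n \<g> i j = Some x <->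
  (m < i & i <= n & i = j & i ~: S m \<g> & x = \<one>) \<or> \<g> i j = Some x"
 by (auto simp: padd_def S_def rows_def)

lemma padd_PM:
 assumes "\<g> : PM n"
 shows "padd m n \<g> : PM n"
 unfolding PM_iff padd_Some
proof (intro conjI allI impI)
 fix i j x assume "m < i & i <= n & i = j & i ~: S m \<g> & x = \<one> \<or> \<g> i j = Some x"
 then show "1 <= i" "i <= n" "1 <= j" "j <= n" "x : carrier G" using PM_D(1-5)[OF assms, of i j x] by auto
next
 fix i j j' x x' assume "m < i & i <= n & i = j & i ~: S m \<g> & x = \<one> \<or> \<g> i j = Some x"
  "m < i & i <= n & i = j' & i ~: S m \<g> & x' = \<one> \<or> \<g> i j' = Some x'"
 then show "j = j'" using PM_D(6)[OF assms, of i j x j' x'] by (auto simp: S_def rows_def)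
next
 fix i i' j x x' assume "m < i & i <= n & i = j & i ~: S m \<g> & x = \<one> \<or> \<g> i j = Some x"
  "m < i' & i' <= n & i' = j & i' ~: S m \<g> & x' = \<one> \<or> \<g> i' j = Some x'"
 then show "i = i'" using PM_D(7)[OF assms, of i j x i' x'] by (auto simp: S_def cols_def)
qed

lemma finite_cols: "\<g> : PM n ==> finite (cols \<g>)"
 by (rule finite_subset[OF PM_cols]) simp_all

lemma fel_keys: "\<g> : PM n ==> keys (fel m n \<g>) <= {rm (padd m n \<g>) B |B. B <= cols \<g>}"
 unfolding fel_def by (rule keys_sum) auto

lemma fel_PM: "\<g> : PM n ==> keys (fel m n \<g>) <= PM n"
 using fel_keys[of \<g> n m] padd_PM[of \<g> n m] by fastforce

lemma hat_fel:
 assumes "\<g> : PM n"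
 shows "hat (fel m n \<g>) \<e> = (if sub \<e> (padd m n \<g>) & cols \<g> <= cols \<e> then 1 else (0::'f::field))"
proof -
 have s: "sub \<e> (rm (padd m n \<g>) B) <-> sub \<e> (padd m n \<g>) & B \<inter> cols \<e> = {}" for B
  unfolding sub_def rm_Some cols_def by blast
 have "hat (fel m n \<g>) \<e> = (\<Sum>B\<in>Pow (cols \<g>). if sub \<e> (padd m n \<g>) & B \<inter> cols \<e> = {} then (- 1) ^ card B else (0::'f))"
  by (simp add: fel_def s)
 also have "... = (if sub \<e> (padd m n \<g>) then (\<Sum>B\<in>Pow (cols \<g>). if B \<inter> cols \<e> = {} then (- 1) ^ card B else (0::'f)) else 0)"
  by simp
 also have "(\<Sum>B\<in>Pow (cols \<g>). if B \<inter> cols \<e> = {} then (- 1) ^ card B else (0::'f)) = (\<Sum>B\<in>Pow (cols \<g> - cols \<e>). (- 1) ^ card B)"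
  by (rule sum.mono_neutral_cong_right) (use finite_cols[OF assms] in auto)
 also have "... = (if cols \<g> - cols \<e> = {} then 1 else (0::'f))"
  by (rule sum_Pow_sign) (use finite_cols[OF assms] in auto)
 finally show ?thesis by auto
qed

text \<open>Read from \<open>\<e>\<close>: an entry of \<open>\<e>\<close> outside the columns of
  \<open>\<g>\<close> must come from the padding, hence is a fixed point. So \<open>\<g>\<close>
  arises from \<open>\<e>\<close> by removing fixed points, and each such removal qualifies.\<close>

lemma fel_supp:
 assumes "\<e> : PM n"
 shows "{\<g> : Gam m n. sub \<e> (padd m n \<g>) & cols \<g> <= cols \<e>} = (if \<e> : Gam m n then rm \<e> ` Pow (fixp m \<e>) else {})"
proof -
 have 1: "\<exists>A\<in>Pow (fixp m \<e>). \<g> = rm \<e> A" if g: "\<g> : Gam m n" and s: "sub \<e> (padd m n \<g>)" and c: "cols \<g> <= cols \<e>" for \<g>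
 proof
  let ?A = "cols \<e> - cols \<g>"
  note gP = Gam_PM[OF g]
  have e: "(m < i & i <= n & i = j & i ~: S m \<g> & x = \<one>) \<or> \<g> i j = Some x" if "\<e> i j = Some x" for i j x
   using subD[OF s that] by (simp add: padd_Some)
  show "?A : Pow (fixp m \<e>)"
  proof (intro PowI subsetI)
   fix k assume k: "k : ?A"
   then obtain i x where i: "\<e> i k = Some x" by (auto simp: cols_def)
   then have "m < i & i = k & x = \<one>" using e[OF i] k colsI[of \<g> i k x] by auto
   then show "k : fixp m \<e>" using i by (simp add: fixp_def)
  qed
  show "\<g> = rm \<e> ?A"
  proof (rule mtxI)
   fix i j x
   have sc: "j ~: S m \<g> ==> m < j ==> j ~: cols \<g>" by (simp add: S_def)
   show "\<g> i j = Some x <-> rm \<e> ?A i j = Some x"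
   proof
    assume g1: "\<g> i j = Some x"
    have jc: "j : cols \<g>" using g1 by (rule colsI)
    then have "j : cols \<e>" using c by blast
    then obtain i' x' where i': "\<e> i' j = Some x'" by (auto simp: cols_def)
    then have "\<g> i' j = Some x'" using e[OF i'] sc jc by auto
    then have "i' = i" "x' = x" using PM_D(7)[OF gP g1] g1 by auto
    then show "rm \<e> ?A i j = Some x" using i' jc by simp
   next
    assume "rm \<e> ?A i j = Some x"
    then have "\<e> i j = Some x" "j : cols \<g>" using colsI[of \<e> i j x] by auto
    then show "\<g> i j = Some x" using e[of i j x] sc by auto
   qed
  qed
 qed
 have 2: "rm \<e> A : Gam m n & sub \<e> (padd m n (rm \<e> A)) & cols (rm \<e> A) <= cols \<e>"
  if A: "A <= fixp m \<e>" and e: "\<e> : Gam m n" for A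
 proof (intro conjI)
  show "rm \<e> A : Gam m n" by (rule rm_Gam[OF e A])
  show "cols (rm \<e> A) <= cols \<e>" by (auto simp: cols_rm)
  show "sub \<e> (padd m n (rm \<e> A))"
   unfolding sub_def padd_Some S_rm[OF assms A]
  proof (intro allI impI)
   fix i j x assume x: "\<e> i j = Some x"
   show "m < i & i <= n & i = j & i ~: S m \<e> - A & x = \<one> \<or> rm \<e> A i j = Some x"
   proof (cases "j : A")
    case True
    then have j: "m < j" "\<e> j j = Some \<one>" using A by (auto simp: fixp_def)
    then have "i = j" "x = \<one>" using PM_D(7)[OF assms x j(2)] x by auto
    then show ?thesis using j True PM_D(2)[OF assms x] by auto
   qed (use x in simp)
  qed
 qed
 show ?thesis
 proof (cases "\<e> : Gam m n")
  case True
  then show ?thesis using 1 2 by auto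
 next
  case False
  have "\<not> (\<g> : Gam m n & sub \<e> (padd m n \<g>) & cols \<g> <= cols \<e>)" for \<g>
   using 1[of \<g>] rm_Gam_iff[OF assms] False by blast
  then show ?thesis using False by auto
 qed
qed

lemma finite_Gam [simp, intro]: "finite (Gam m n)"
 by (rule finite_subset[OF _ finite_PM]) (auto simp: Gam_def)

lemma Xi_app: "m <= n ==> Xi m c n = (\<Sum>\<g>\<in>Gam m n. psc (c \<g>) (fel m n \<g>))"
 by (simp add: Xi_def)

lemma hat_Xi:
 assumes "\<e> : PM n" "m <= n"
 shows "hat (Xi m c n) \<e> = (if \<e> : Gam m n then zet m c \<e> else 0)"
proof -
 have "hat (Xi m c n) \<e> = (\<Sum>\<g>\<in>Gam m n. if sub \<e> (padd m n \<g>) & cols \<g> <= cols \<e> then c \<g> else 0)"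
  unfolding Xi_app[OF assms(2)] hat_lin by (rule sum.cong) (auto simp: hat_fel[OF Gam_PM])
 also have "... = (\<Sum>\<g>\<in>{\<g> : Gam m n. sub \<e> (padd m n \<g>) & cols \<g> <= cols \<e>}. c \<g>)"
  by (rule sum.inter_filter[symmetric]) simp
 also have "... = (if \<e> : Gam m n then zet m c \<e> else 0)"
 proof (cases "\<e> : Gam m n")
  case True
  have "inj_on (rm \<e>) (Pow (fixp m \<e>))"
  proof (rule inj_on_inverseI)
   fix A assume "A : Pow (fixp m \<e>)"
   then have "A <= cols \<e>" by (auto simp: fixp_def cols_def)
   then show "cols \<e> - cols (rm \<e> A) = A" by (auto simp: cols_rm)
  qed
  then show ?thesis using True by (simp add: fel_supp[OF assms(1)] sum.reindex zet_def)
 next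
  case False
  then show ?thesis by (subst fel_supp[OF assms(1)]) simp
 qed
 finally show ?thesis .
qed

lemma fel_deg:
 assumes "\<g> : PM n" "\<d> : keys (fel m n \<g>)"
 shows "mtx_deg G n \<d> <= m + card (S m \<g>)"
proof -
 obtain B where B: "B <= cols \<g>" "\<d> = rm (padd m n \<g>) B" using fel_keys[OF assms(1)] assms(2) by blast
 have "{k : {1..n}. \<d> k k ~= Some \<one>} <= {1..m} \<union> S m \<g>"
 proof
  fix k assume k: "k : {k : {1..n}. \<d> k k ~= Some \<one>}"
  show "k : {1..m} \<union> S m \<g>"
  proof (rule ccontr)
   assume n: "k ~: {1..m} \<union> S m \<g>"
   then have "m < k" "k ~: cols \<g>" using k by (auto simp: S_def)
   then have "\<d> k k = Some \<one>" using n k B by (auto simp: padd_Some)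
   then show False using k by simp
  qed
 qed
 then have "mtx_deg G n \<d> <= card ({1..m} \<union> S m \<g>)"
  unfolding mtx_deg_def by (intro card_mono) (use assms in auto)
 also have "... <= card {1..m} + card (S m \<g>)" by (rule card_Un_le)
 finally show ?thesis by simp
qed

text \<open>By \<open>hat_Xi\<close> the sum over containing matrices does not involve n, which
  gives compatibility under \<open>theta\<close>; invariance of \<open>zet m c\<close> gives
  centrality, and padding bounds the degree by \<open>m + d\<close>.\<close>

lemma Xi_closed:
 fixes c :: "'a mtx => 'f::field"
 assumes inv: "\<And>n. m <= n ==> invf m n c"
  and bd: "\<And>n \<g>. m <= n ==> \<g> : Gam m n ==> c \<g> ~= 0 ==> card (S m \<g>) <= d"
 shows "Xi m c : Zc m"
 unfolding Zbar_iff
proof (intro conjI allI impI)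
 have k: "keys (Xi m c n) <= PM n" if "m <= n" for n
  unfolding Xi_app[OF that]
  by (rule keys_sum) (use order_trans[OF keys_scale fel_PM[OF Gam_PM]] in blast)
 show "Xi m c : extensional {m..}" by (simp add: Xi_def)
 fix n
 {
  assume n: "m <= n"
  show "Xi m c n : Zcent G m n"
   unfolding Zcent_hat[OF k[OF n] n]
  proof (intro conjI ballI impI)
   fix \<g> assume "\<g> : PM n" "hat (Xi m c n) \<g> ~= 0"
   then show "\<g> : Gam m n" using hat_Xi[OF _ n, of \<g> c] by (auto split: if_splits)
  next
   show "invf m n (hat (Xi m c n))"
    unfolding invf_def
   proof (intro allI impI)
    fix p l \<g> assume *: "pl_ok m n p l" "\<g> : PM n"
    show "hat (Xi m c n) (cj p l \<g>) = hat (Xi m c n) \<g>"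
     using hat_Xi[OF *(2) n, of c] hat_Xi[OF cj_PM[OF * n] n, of c] Gam_cj(1)[OF * n] inv_zet[OF inv[OF n] n] *
     by (simp add: invf_def)
   qed
  qed
 }
 {
  assume n: "m < n"
  show "theta n (Xi m c n) = Xi m c (n - 1)"
  proof (rule hat_eqI[where n = "n - 1"])
   show "keys (theta n (Xi m c n)) <= PM (n - 1)" by (rule theta_keys) (use k n in simp)
   show "keys (Xi m c (n - 1)) <= PM (n - 1)" by (rule k) (use n in simp)
   fix \<e> assume e: "\<e> : PM (n - 1)"
   then have "\<e> : PM n" using PM_mono[of "n - 1" n] by auto
   then show "hat (theta n (Xi m c n)) \<e> = hat (Xi m c (n - 1)) \<e>"
    using hat_theta[OF e, of "Xi m c n"] hat_Xi[of \<e> n m c] hat_Xi[OF e, of m c] e n by (simp add: Gam_def)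
  qed
 }
next
 show "\<exists>d. \<forall>n\<ge>m. dgl n (Xi m c n) d"
 proof (intro exI allI impI)
  fix n assume n: "m <= n"
  have "keys (Xi m c n) <= {\<g>. mtx_deg G n \<g> <= m + d}"
   unfolding Xi_app[OF n]
  proof (rule keys_sum)
   fix \<g> assume g: "\<g> : Gam m n"
   show "keys (psc (c \<g>) (fel m n \<g>)) <= {\<g>. mtx_deg G n \<g> <= m + d}"
   proof (cases "c \<g> = 0")
    case True
    then have "psc (c \<g>) (fel m n \<g>) = 0" by (intro poly_mapping_eqI) simp
    then show ?thesis by simp
   next
    case False
    show ?thesis
    proof
     fix \<d> assume "\<d> : keys (psc (c \<g>) (fel m n \<g>))"
     then have "\<d> : keys (fel m n \<g> :: ('a, 'f) fgel)" by (rule subsetD[OF keys_scale])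
     from fel_deg[OF Gam_PM[OF g] this] show "\<d> : {\<g>. mtx_deg G n \<g> <= m + d}"
      using bd[OF n g False] by simp
    qed
   qed
  qed
  then show "dgl n (Xi m c n) (m + d)" by blast
 qed
qed

lemma XS_Xi:
 assumes "Xi m c : Zc m" "m <= n" "\<g> : Gam m n"
 shows "XS m (Xi m c) \<g> = c \<g>"
proof -
 note P = Gam_PM[OF assms(3)]
 have "XS m (Xi m c) \<g> = mob m (zet m c) \<g>"
  unfolding XS_eq[OF assms(1,2) P] mob_def
  by (rule sum.cong) (use rm_Gam[OF assms(3)] in "auto simp: hat_Xi[OF rm_PM[OF P] assms(2)]")
 also have "... = c \<g>" by (rule mob_zet) (use P in auto)
 finally show ?thesis .
qed

end

section \<open>The elements \<open>u\<^sub>k\<close>\<close>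

lemma ma_zero_mult [simp]:
 "0 \<otimes>\<^bsub>monoid_algebra M\<^esub> b = 0" "b \<otimes>\<^bsub>monoid_algebra M\<^esub> 0 = 0"
 by (simp_all add: monoid_algebra_def)

lemma ma_sum:
 "(\<Sum>i\<in>I. f i) \<otimes>\<^bsub>monoid_algebra M\<^esub> b = (\<Sum>i\<in>I. f i \<otimes>\<^bsub>monoid_algebra M\<^esub> b)"
 "b \<otimes>\<^bsub>monoid_algebra M\<^esub> (\<Sum>i\<in>I. f i) = (\<Sum>i\<in>I. b \<otimes>\<^bsub>monoid_algebra M\<^esub> f i)"
 by (induction I rule: infinite_finite_induct) (simp_all add: ma_l_distr ma_r_distr)

lemma ma_diff:
 "(a - c) \<otimes>\<^bsub>monoid_algebra M\<^esub> b = a \<otimes>\<^bsub>monoid_algebra M\<^esub> b - c \<otimes>\<^bsub>monoid_algebra M\<^esub> b"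
 "b \<otimes>\<^bsub>monoid_algebra M\<^esub> (a - c) = b \<otimes>\<^bsub>monoid_algebra M\<^esub> a - b \<otimes>\<^bsub>monoid_algebra M\<^esub> c"
 using ma_l_distr[where M = M and a = "a - c" and b = c and c = b]
  ma_r_distr[where M = M and a = b and b = "a - c" and c = c] by (simp_all add: algebra_simps)

context gmat begin

definition lab :: "nat => nat => 'a => nat => 'a" where
 "lab k i h a = (if a = k then h else if a = i then inv h else \<one>)"
definition SW :: "nat => nat => nat => 'a => 'a mtx" where
 "SW n k i h = mon n (transpose k i) (lab k i h)"
text \<open>The type \<open>zel\<close> is only a convenient name for a family indexed by k; no
  compatible sequence is meant, and the same holds for \<open>R\<close>.\<close>

definition eps1 :: "nat => ('a, 'f::field) zel" where
 "eps1 n k = basis (I1 n) - basis (mtx_eps G n k)"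
definition R :: "nat => nat => ('a, 'f::field) zel" where
 "R n k i = (\<Sum>h\<in>carrier G. basis (SW n k i h)) \<star>[n] eps1 n k \<star>[n] eps1 n i"

lemma transpose_ok:
 assumes "1 <= k" "k <= n" "1 <= i" "i <= n" "\<And>a. l a : carrier G" "l 0 = \<one>"
 shows "pl_ok 0 n (transpose k i) l"
 unfolding pl_ok_def using assms by (auto intro!: permutes_swap_id)

lemma SW_ok:
 assumes "1 <= k" "k <= n" "1 <= i" "i <= n" "h : carrier G"
 shows "pl_ok 0 n (transpose k i) (lab k i h)"
 by (rule transpose_ok) (use assms in "auto simp: lab_def")

lemma mon_PM0: "pl_ok 0 n p l ==> mon n p l : PM n"
 by (rule mon_PM) auto

lemma SW_PM:
 assumes "1 <= k" "k <= n" "1 <= i" "i <= n" "h : carrier G"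
 shows "SW n k i h : PM n"
 unfolding SW_def by (rule mon_PM0[OF SW_ok[OF assms]])

lemma SW_conv:
 assumes "1 <= k" "k <= n" "1 <= i" "i <= n" "k ~= i" "h : carrier G"
 shows "mm n (mtx_diag n (pair_elt G n k i h)) (mtx_perm G n (transpose k i)) = SW n k i h" (is "?l = ?r")
proof (rule mtxI)
 fix a b x
 have p: "pair_elt G n k i h c = lab k i h c" if "1 <= c" "c <= n" for c
  using that assms by (auto simp: pair_elt_def at_pos_def lab_def)
 have P: "mtx_diag n (pair_elt G n k i h) : PM n" by (rule diag_PM) (use assms in "auto simp: p lab_def")
 have Q: "mtx_perm G n (transpose k i) : PM n" by (rule perm_PM) simp
 have lc: "lab k i h c : carrier G" for c using assms by (auto simp: lab_def)
 have t: "1 <= b & b <= n & transpose k i b = a <-> b = transpose k i a" if "1 <= a" "a <= n"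
  using that assms by (auto simp: transpose_def)
 show "?l a b = Some x <-> ?r a b = Some x"
  using t lc by (auto simp: mSome[OF P Q] SW_def p)
qed

lemma SW_carrier_sum:
 assumes "1 <= k" "k <= n" "1 <= i" "i <= n" "k ~= i"
 shows "t_elt G n k i \<star>[n] basis (mtx_perm G n (transpose k i)) = (\<Sum>h\<in>carrier G. basis (SW n k i h))"
 unfolding t_elt_def ma_sum by (rule sum.cong) (use assms in "auto simp: SW_conv")

lemma u_elt_R: "1 <= k ==> u_elt G k n = (\<Sum>i=k+1..n. R n k i)"
 unfolding u_elt_def R_def eps1_def by (rule sum.cong) (auto simp: SW_carrier_sum)

lemma eps1_c [simp]: "(eps1 n k :: ('a, 'f::field) fgel) : Fc n"
proof -
 have "keys (basis (I1 n) - basis (mtx_eps G n k) :: ('a, 'f) fgel) <= {I1 n} \<union> {mtx_eps G n k}"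
  using Poly_Mapping.keys_diff[of "basis (I1 n) :: ('a, 'f) fgel" "basis (mtx_eps G n k)"] by simp
 then show ?thesis unfolding eps1_def ma_simps by (rule order_trans) auto
qed

lemma SWsum_c:
 assumes "1 <= k" "k <= n" "1 <= i" "i <= n"
 shows "(\<Sum>h\<in>carrier G. basis (SW n k i h)) : Fc n"
 unfolding ma_simps by (rule keys_sum) (use SW_PM[OF assms] in auto)

lemma R_closed:
 assumes "1 <= k" "k <= n" "1 <= i" "i <= n"
 shows "(R n k i :: ('a, 'f::field) fgel) : Fc n"
proof -
 interpret A: falg "FGbar G n :: ('a, 'f) fgalg" by (rule falg_FG)
 show ?thesis unfolding R_def by (intro A.m_closed eps1_c SWsum_c assms)
qed

lemma u_elt_c:
 assumes "1 <= k"
 shows "(u_elt G k n :: ('a, 'f::field) fgel) : Fc n"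
 unfolding u_elt_R[OF assms] ma_simps
 by (rule keys_sum, intro R_closed[unfolded ma_simps]) (use assms in auto)

subsection \<open>The action of \<open>u\<^sub>k\<close> in coordinates\<close>

text \<open>The effect on rows of the inverse of the labelled transposition
  \<open>SW n k i h\<close>, again without reference to n (\<open>swp_conv\<close>).\<close>

definition swp :: "nat => nat => 'a => 'a mtx => 'a mtx" where
 "swp k i h \<e> = (%a b. if a = k then map_option ((\<otimes>) h) (\<e> i b)
   else if a = i then map_option ((\<otimes>) (inv h)) (\<e> k b) else \<e> a b)"

lemma swp_Some: "swp k i h \<e> a b = Some x <-> (if a = k then \<exists>y. \<e> i b = Some y & x = h \<otimes> y
  else if a = i then \<exists>y. \<e> k b = Some y & x = inv h \<otimes> y else \<e> a b = Some x)"
 by (auto simp: swp_def)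

lemma swp_conv:
 assumes "1 <= k" "k <= n" "1 <= i" "i <= n" "k ~= i" "h : carrier G" "\<e> : PM n"
 shows "mm n (tr (SW n k i h)) \<e> = swp k i h \<e>" (is "?l = ?r")
proof (rule mtxI)
 fix a b x
 have e: "mm n (tr (SW n k i h)) \<e> a b = Some x <->
  (\<exists>c y. 1 <= c & c <= n & a = transpose k i c & \<e> c b = Some y & x = inv (lab k i h c) \<otimes> y)"
  unfolding mSome[OF tr_PM[OF SW_PM[OF assms(1-4,6)]] assms(7)] tr_Some by (auto simp: SW_def)
 have "... <-> (\<exists>y. \<e> (transpose k i a) b = Some y & x = inv (lab k i h (transpose k i a)) \<otimes> y)"
  using PM_D(1,2)[OF assms(7)] by (metis transpose_involutory)
 also have "... <-> swp k i h \<e> a b = Some x"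
  using assms(5,6) PM_D(5)[OF assms(7), of a b] by (auto simp: swp_Some lab_def transpose_def)
 finally show "?l a b = Some x <-> ?r a b = Some x" using e by simp
qed

lemma swp_PM:
 assumes "1 <= k" "k <= n" "1 <= i" "i <= n" "k ~= i" "h : carrier G" "\<e> : PM n"
 shows "swp k i h \<e> : PM n"
 using swp_conv[OF assms] SW_PM[OF assms(1-4,6)] assms(7) by (metis mm_closed tr_PM)

lemma rows_swp: "k ~= i ==> k : rows \<e> ==> i : rows \<e> ==> rows (swp k i h \<e>) = rows \<e>"
 unfolding rows_def swp_Some by (rule Collect_cong) (auto, metis+)

lemma rows_swp_iff: "k ~= i ==> k : rows (swp k i h \<e>) <-> i : rows \<e>" "k ~= i ==> i : rows (swp k i h \<e>) <-> k : rows \<e>"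
 unfolding rows_def swp_Some by auto

lemma cols_swp: "k ~= i ==> cols (swp k i h \<e>) = cols \<e>"
 unfolding cols_def swp_Some by (rule Collect_cong) (auto split: if_splits, metis+)

lemma hat_eps1:
 assumes "keys b <= PM n" "\<e> : PM n"
 shows "hat (eps1 n k \<star>[n] b) \<e> = (if k : rows \<e> then hat b \<e> else (0::'f::field))"
proof -
 interpret A: falg "FGbar G n :: ('a, 'f) fgalg" by (rule falg_FG)
 have "basis (I1 n) \<star>[n] b = b" using A.l_one[of b] assms(1) by simp
 then have "eps1 n k \<star>[n] b = b - basis (idm n {k}) \<star>[n] b"
  unfolding eps1_def ma_diff eps_idm by simp
 then show ?thesis using hat_idm(1)[OF assms, of "{k}"] by simp
qed

text \<open>Each factor \<open>1 - eps\<close> passes only coordinates whose corresponding row is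
  nonzero. Since the swap exchanges rows k and i, both filters can be read off from
  \<open>\<e>\<close> itself.\<close>

lemma hat_R:
 fixes b :: "('a, 'f::field) fgel"
 assumes "1 <= k" "k <= n" "1 <= i" "i <= n" "k ~= i" "keys b <= PM n" "\<e> : PM n"
 shows "hat (R n k i \<star>[n] b) \<e> =
  (if k : rows \<e> & i : rows \<e> then \<Sum>h\<in>carrier G. hat b (swp k i h \<e>) else 0)"
proof -
 interpret A: falg "FGbar G n :: ('a, 'f) fgalg" by (rule falg_FG)
 let ?c = "eps1 n k \<star>[n] (eps1 n i \<star>[n] b)"
 have bc: "b : Fc n" using assms(6) by simp
 have k1: "keys (eps1 n i \<star>[n] b) <= PM n" using A.m_closed[OF eps1_c bc] by simp
 have k2: "keys ?c <= PM n" using A.m_closed[OF eps1_c A.m_closed[OF eps1_c bc]] by simp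
 have "R n k i \<star>[n] b = (\<Sum>h\<in>carrier G. basis (SW n k i h)) \<star>[n] ?c"
  unfolding R_def using bc by (simp only: A.m_assoc A.m_closed eps1_c SWsum_c[OF assms(1-4)])
 then have "hat (R n k i \<star>[n] b) \<e> = (\<Sum>h\<in>carrier G. hat (basis (SW n k i h) \<star>[n] ?c) \<e>)"
  by (simp add: ma_sum)
 also have "... = (\<Sum>h\<in>carrier G. if k : rows \<e> & i : rows \<e> then hat b (swp k i h \<e>) else 0)"
 proof (rule sum.cong)
  fix h assume h: "h : carrier G"
  have "rows \<e> <= rows (SW n k i h)"
   using PM_rows[OF assms(7)] rows_mon[OF SW_ok[OF assms(1-4) h]] by (simp add: SW_def)
  then have "hat (basis (SW n k i h) \<star>[n] ?c) \<e> = hat ?c (swp k i h \<e>)"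
   using hat_left[OF SW_PM[OF assms(1-4) h] assms(7) k2] swp_conv[OF assms(1-5) h assms(7)] by simp
  also have "... = (if k : rows \<e> & i : rows \<e> then hat b (swp k i h \<e>) else 0)"
   using hat_eps1[OF k1 swp_PM[OF assms(1-5) h assms(7)], of k] hat_eps1[OF assms(6) swp_PM[OF assms(1-5) h assms(7)], of i]
    rows_swp_iff[OF assms(5)] by auto
  finally show "hat (basis (SW n k i h) \<star>[n] ?c) \<e> = (if k : rows \<e> & i : rows \<e> then hat b (swp k i h \<e>) else 0)" .
 qed simp
 finally show ?thesis by auto
qed

lemma hat_u:
 fixes b :: "('a, 'f::field) fgel"
 assumes "1 <= k" "k <= n" "keys b <= PM n" "\<e> : PM n"
 shows "hat (u_elt G k n \<star>[n] b) \<e> =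
  (if k : rows \<e> then \<Sum>i\<in>rows \<e> \<inter> {k<..}. \<Sum>h\<in>carrier G. hat b (swp k i h \<e>) else 0)"
proof -
 have "hat (u_elt G k n \<star>[n] b) \<e> = (\<Sum>i=k+1..n. hat (R n k i \<star>[n] b) \<e>)"
  by (simp add: u_elt_R[OF assms(1)] ma_sum)
 also have "... = (\<Sum>i=k+1..n. if k : rows \<e> & i : rows \<e> then \<Sum>h\<in>carrier G. hat b (swp k i h \<e>) else 0)"
  by (rule sum.cong) (use assms in "auto simp: hat_R")
 also have "... = (if k : rows \<e> then \<Sum>i\<in>rows \<e> \<inter> {k<..}. \<Sum>h\<in>carrier G. hat b (swp k i h \<e>) else 0)"
 proof (cases "k : rows \<e>")
  case True
  have "{k+1..n} \<inter> rows \<e> = rows \<e> \<inter> {k<..}" using PM_rows[OF assms(4)] by auto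
  then show ?thesis using True
   by (simp add: sum.inter_restrict[symmetric])
 qed simp
 finally show ?thesis .
qed

text \<open>Contracting the point that precedes \<open>k\<close> on its path.\<close>

definition ctr :: "nat => nat => 'a => 'a mtx => 'a mtx" where "ctr k i x \<g> = rm (swp k i x \<g>) {i}"

text \<open>Interchanging sums leaves, for each i and h, an alternating sum over the fixed points of
  \<open>\<g>\<close> other than i. If i is no fixed point of the swapped matrix, this is its
  coordinate in c, which is zero for size reasons. If it is one, the full alternating sum is zero
  and splits along i into this sum minus the coordinate of the contraction, so the two are equal. A
  fixed point arises exactly for \<open>m < i\<close> and h the entry at (k, i).\<close>

lemma XS_u:
 fixes c :: "('a, 'f::field) zel"
 assumes c: "c : Zc m" and u: "us m k \<bullet>[m] c : Zc m"
  and k: "1 <= k" "k <= m" and n: "m <= n" and g: "\<g> : Gam m n"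
  and d: "ldeg m c d" "d <= card (S m \<g>)"
 shows "XS m (us m k \<bullet>[m] c) \<g> =
  (if \<exists>i>m. \<exists>x. \<g> k i = Some x then XS m c (ctr k (THE i. \<exists>x. \<g> k i = Some x) (the (\<g> k (THE i. \<exists>x. \<g> k i = Some x))) \<g>) else 0)"
proof -
 let ?F = "fixp m \<g>"
 note P = Gam_PM[OF g]
 have kn: "k <= n" using k n by simp
 have cn: "keys (c n) <= PM n" by (rule ZbarD(5)[OF c n])
 let ?I = "rows \<g> \<inter> {k<..}"
 have fI: "finite ?I" using PM_rows[OF P] finite_subset by blast
 define s where "s A i h = (- 1) ^ card A * hat (c n) (swp k i h (rm \<g> A))" for A i h
 have kF: "k ~: ?F" using k by (simp add: fixp_def)
 have ki: "i ~= k" "1 <= i" "i <= n" if "i : ?I" for i using that PM_rows[OF P] by auto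
 have "XS m (us m k \<bullet>[m] c) \<g> = (\<Sum>A\<in>Pow ?F. (- 1) ^ card A * hat (u_elt G k n \<star>[n] c n) (rm \<g> A))"
  unfolding XS_eq[OF u n P] mob_def Zb_app[OF n] using n by (simp add: u_seq_def)
 also have "... = (if k : rows \<g> then \<Sum>A\<in>Pow ?F. \<Sum>i\<in>?I. if i ~: A then \<Sum>h\<in>carrier G. s A i h else 0 else 0)"
 proof -
  have "(- 1) ^ card A * hat (u_elt G k n \<star>[n] c n) (rm \<g> A) =
    (if k : rows \<g> then \<Sum>i\<in>?I. if i ~: A then \<Sum>h\<in>carrier G. s A i h else 0 else 0)" if A: "A <= ?F" for A
  proof -
   have r: "rows (rm \<g> A) = rows \<g> - A" by (rule rows_rm[OF P A])
   have kA: "k ~: A" using A kF by blast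
   have I: "rows (rm \<g> A) \<inter> {k<..} = {i : ?I. i ~: A}" unfolding r by auto
   show ?thesis
    unfolding hat_u[OF k(1) kn cn rm_PM[OF P]] I
    using kA fI by (simp add: r s_def sum_distrib_left sum.inter_filter[symmetric])
  qed
  then show ?thesis by simp
 qed
 also have "... = (if k : rows \<g> then \<Sum>i\<in>?I. \<Sum>h\<in>carrier G. \<Sum>A\<in>Pow (?F - {i}). s A i h else 0)"
 proof -
  have "(\<Sum>A\<in>Pow ?F. \<Sum>i\<in>?I. if i ~: A then \<Sum>h\<in>carrier G. s A i h else 0) =
    (\<Sum>i\<in>?I. \<Sum>A\<in>Pow ?F. if i ~: A then \<Sum>h\<in>carrier G. s A i h else 0)" by (rule sum.swap)
  also have "... = (\<Sum>i\<in>?I. \<Sum>A\<in>Pow (?F - {i}). \<Sum>h\<in>carrier G. s A i h)"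
   by (intro sum.cong refl sum.mono_neutral_cong_right) (use finite_fixp[OF P] in auto)
  also have "... = (\<Sum>i\<in>?I. \<Sum>h\<in>carrier G. \<Sum>A\<in>Pow (?F - {i}). s A i h)"
   by (intro sum.cong refl sum.swap)
  finally show ?thesis by simp
 qed
 also have "... = (if k : rows \<g> then \<Sum>i\<in>?I. \<Sum>h\<in>carrier G. if m < i & \<g> k i = Some h then XS m c (ctr k i h \<g>) else 0 else 0)"
 proof -
  have "(\<Sum>A\<in>Pow (?F - {i}). s A i h) = (if m < i & \<g> k i = Some h then XS m c (ctr k i h \<g>) else 0)"
   if kr: "k : rows \<g>" and i: "i : ?I" and h: "h : carrier G" for i h
  proof -
   note ki' = ki[OF i]
   let ?g = "swp k i h \<g>"
   have gP: "?g : PM n" by (rule swp_PM) (use k kn ki' h P in auto)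
   have sA: "s A i h = (- 1) ^ card A * hat (c n) (rm ?g A)" if "A <= ?F" for A
   proof -
    have "swp k i h (rm \<g> A) = rm ?g A" by (rule mtxI) (auto simp: swp_Some)
    then show ?thesis by (simp add: s_def)
   qed
   have sA': "s A i h = (- 1) ^ card A * hat (c n) (rm ?g A)" if "A <= ?F - {i}" for A
    using that by (intro sA) blast
   have ir: "i : rows \<g>" using i by simp
   have Sg: "S m ?g = S m \<g>" using rows_swp[OF _ kr ir] cols_swp ki'(1) by (simp add: S_def)
   \<comment> \<open>Swapping two nonzero rows preserves the outer support, whose size has reached
     the bound d for c.\<close>
   have z: "XS m c ?g = 0"
   proof (rule ccontr)
    assume nz: "XS m c ?g ~= 0"
    then have "?g : Gam m n" by (rule XS_Gam[OF c n gP])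
    then have "card (S m ?g) < d" using d(1) n nz by (auto simp: ldeg_def)
    then show False using Sg d(2) by simp
   qed
   \<comment> \<open>The swap changes rows k and i, and k is at most m, so only i can gain or lose
     the status of an outer fixed point.\<close>
   have Fi: "fixp m ?g - {i} = ?F - {i}" using k by (auto simp: fixp_def swp_Some)
   have iF: "i : fixp m ?g <-> m < i & \<g> k i = Some h"
   proof -
    have "(\<exists>y. \<g> k i = Some y & \<one> = inv h \<otimes> y) <-> \<g> k i = Some h"
    proof
     assume "\<exists>y. \<g> k i = Some y & \<one> = inv h \<otimes> y"
     then obtain y where y: "\<g> k i = Some y" "\<one> = inv h \<otimes> y" by blast
     have "y : carrier G" using PM_D(5)[OF P y(1)] .
     then have "y = h" using y(2) h by (metis inv_equality inv_closed inv_inv)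
     then show "\<g> k i = Some h" using y by simp
    qed (use h in simp)
    then show ?thesis using ki' by (simp add: fixp_def swp_Some)
   qed
   show ?thesis
   proof (cases "i : fixp m ?g")
    case False
    then have e: "fixp m ?g = ?F - {i}" using Fi by auto
    have "(\<Sum>A\<in>Pow (?F - {i}). s A i h) = XS m c ?g"
     unfolding XS_eq[OF c n gP] mob_def e by (rule sum.cong) (auto intro!: sA')
    then have "(\<Sum>A\<in>Pow (?F - {i}). s A i h) = 0" unfolding z .
    moreover have "\<not> (m < i & \<g> k i = Some h)" using False iF by blast
    ultimately show ?thesis by (simp only: if_False)
   next
    case True
    have fF: "finite (?F - {i})" using finite_fixp[OF P] by blast
    have e: "fixp m ?g = insert i (?F - {i})" using Fi True by auto
    have "XS m c ?g = (\<Sum>A\<in>Pow (?F - {i}). (- 1) ^ card A * hat (c n) (rm ?g A)) +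
      (\<Sum>A\<in>Pow (?F - {i}). (- 1) ^ card (insert i A) * hat (c n) (rm ?g (insert i A)))"
     unfolding XS_eq[OF c n gP] mob_def e by (rule sum_Pow_insert[OF fF]) simp
    also have "(\<Sum>A\<in>Pow (?F - {i}). (- 1) ^ card (insert i A) * hat (c n) (rm ?g (insert i A))) =
      - (\<Sum>A\<in>Pow (?F - {i}). (- 1) ^ card A * hat (c n) (rm (rm ?g {i}) A))"
     unfolding sum_negf[symmetric]
    proof (rule sum.cong)
     fix A assume A: "A : Pow (?F - {i})"
     then have "finite A" using fF finite_subset by blast
     moreover have "i ~: A" using A by blast
     ultimately show "(- 1) ^ card (insert i A) * hat (c n) (rm ?g (insert i A)) = - ((- 1) ^ card A * hat (c n) (rm (rm ?g {i}) A))"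
      by simp
    qed simp
    also have "(\<Sum>A\<in>Pow (?F - {i}). (- 1) ^ card A * hat (c n) (rm (rm ?g {i}) A)) = XS m c (ctr k i h \<g>)"
     unfolding ctr_def XS_eq[OF c n rm_PM[OF gP]] mob_def fixpts_rm Fi ..
    also have "(\<Sum>A\<in>Pow (?F - {i}). (- 1) ^ card A * hat (c n) (rm ?g A)) = (\<Sum>A\<in>Pow (?F - {i}). s A i h)"
     by (rule sum.cong) (auto simp: sA')
    finally show ?thesis using z True iF by simp
   qed
  qed
  then show ?thesis by simp
 qed
 also have "... = (if \<exists>i>m. \<exists>x. \<g> k i = Some x then XS m c (ctr k (THE i. \<exists>x. \<g> k i = Some x) (the (\<g> k (THE i. \<exists>x. \<g> k i = Some x))) \<g>) else 0)"
 proof (cases "\<exists>i>m. \<exists>x. \<g> k i = Some x")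
  case True
  then obtain i x where i: "m < i" "\<g> k i = Some x" by blast
  have u: "j = i" if "\<g> k j = Some y" for j y using PM_D(6)[OF P that i(2)] .
  have t: "(THE i. \<exists>x. \<g> k i = Some x) = i" by (rule the_equality) (use i u in blast)+
  have kr: "k : rows \<g>" using i(2) by (rule rowsI)
  have iI: "i : ?I"
  proof -
   have "i : cols \<g>" using i(2) by (rule colsI)
   then have "i : rows \<g>" using g i(1) by (simp add: Gam_def)
   then show ?thesis using i(1) k(2) by simp
  qed
  have xc: "x : carrier G" using PM_D(5)[OF P i(2)] .
  have "(\<Sum>j\<in>?I. \<Sum>h\<in>carrier G. if m < j & \<g> k j = Some h then XS m c (ctr k j h \<g>) else 0) =
    (\<Sum>j\<in>?I. if j = i then XS m c (ctr k i x \<g>) else 0)"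
  proof (rule sum.cong)
   fix j
   show "(\<Sum>h\<in>carrier G. if m < j & \<g> k j = Some h then XS m c (ctr k j h \<g>) else 0) = (if j = i then XS m c (ctr k i x \<g>) else 0)"
   proof (cases "j = i")
    case True
    have "(\<Sum>h\<in>carrier G. if m < j & \<g> k j = Some h then XS m c (ctr k j h \<g>) else 0) =
      (\<Sum>h\<in>carrier G. if h = x then XS m c (ctr k i x \<g>) else 0)"
     by (rule sum.cong) (use True i in auto)
    then show ?thesis using True xc finG by simp
   next
    case False
    then have "\<g> k j ~= Some h" for h using u by blast
    then show ?thesis using False by simp
   qed
  qed simp
  also have "... = XS m c (ctr k i x \<g>)" using iI fI by simp
  finally show ?thesis using True kr by (simp add: t i)
 next
  case False
  then have n: "(m < i & \<g> k i = Some h) <-> False" for i h by blast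
  show ?thesis unfolding n if_not_P[OF False] by simp
 qed
 finally show ?thesis .
qed

subsection \<open>Relations\<close>

lemma mon_cong: "(\<And>a. 1 <= a ==> a <= n ==> p a = p' a & l a = l' a) ==> mon n p l = mon n p' l'"
 by (rule mtxI) auto

lemma mon_mon:
 assumes "pl_ok 0 n p l" "pl_ok 0 n p' l'"
 shows "mm n (mon n p l) (mon n p' l') = mon n (p' o p) (%a. l a \<otimes> l' (p a))"
 by (rule mtxI) (use pl_okD(8,9)[OF assms(1)] in "auto simp: mSome[OF mon_PM0[OF assms(1)] mon_PM0[OF assms(2)]]")

lemma mon_idm:
 assumes "pl_ok 0 n p l"
 shows "mm n (mon n p l) (idm n (p ` J)) = mm n (idm n J) (mon n p l)"
 by (rule mtxI) (use pl_okD(2,5,8,9)[OF assms] in "auto simp: mSome[OF mon_PM0[OF assms] idm_PM] mSome[OF idm_PM mon_PM0[OF assms]]")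

lemma idm_idm: "mm n (idm n J) (idm n K) = idm n (J \<union> K)"
 by (rule mtxI) (auto simp: mSome)

lemma I1_idm: "I1 n = idm n {}"
 by (rule mtxI) auto

lemma eps1_idm: "eps1 n k = basis (idm n {}) - basis (idm n {k})"
 by (simp add: eps1_def I1_idm eps_idm)

lemma eps1_comm_idm: "eps1 n k \<star>[n] basis (idm n J) = basis (idm n J) \<star>[n] eps1 n k"
 by (simp add: eps1_idm ma_diff idm_idm Un_commute)

lemma eps1_kill: "k : J ==> eps1 n k \<star>[n] basis (idm n J) = 0"
 by (simp add: eps1_idm ma_diff idm_idm insert_absorb)

lemma eps1_comm: "eps1 n k \<star>[n] eps1 n i = eps1 n i \<star>[n] eps1 n k"
 by (simp add: eps1_idm ma_diff idm_idm insert_commute)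

lemma eps1_mon:
 assumes "pl_ok 0 n p l"
 shows "basis (mon n p l) \<star>[n] eps1 n (p k) = eps1 n k \<star>[n] basis (mon n p l)"
 using mon_idm[OF assms, of "{k}"] mon_idm[OF assms, of "{}"] by (simp add: eps1_idm ma_diff)

text \<open>The labels of the conjugating matrix turn the summand h into the summand
  \<open>l k \<otimes> h \<otimes> inv (l i)\<close>; as h runs over the whole group, the sum is
  unchanged.\<close>

lemma R_conj:
 assumes "pl_ok 0 n p l" "1 <= k" "k <= n" "1 <= i" "i <= n" "k ~= i"
 shows "basis (mon n p l) \<star>[n] R n (p k) (p i) = R n k i \<star>[n] (basis (mon n p l) :: ('a, 'f::field) fgel)"
proof -
 interpret A: falg "FGbar G n :: ('a, 'f) fgalg" by (rule falg_FG)
 note P = pl_okD[OF assms(1)]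
 let ?\<s> = "basis (mon n p l) :: ('a, 'f) fgel"
 have pb: "1 <= p k" "p k <= n" "1 <= p i" "p i <= n" "p k ~= p i" using P(5,8,9) assms by auto
 have s: "mm n (mon n p l) (SW n (p k) (p i) h) = mm n (SW n k i (l k \<otimes> h \<otimes> inv (l i))) (mon n p l)" if h: "h : carrier G" for h
 proof -
  have h': "l k \<otimes> h \<otimes> inv (l i) : carrier G" using P(2) h by simp
  show ?thesis unfolding SW_def mon_mon[OF assms(1) SW_ok[OF pb(1-4) h]] mon_mon[OF SW_ok[OF assms(2-5) h'] assms(1)]
  proof (rule mon_cong)
   fix a
   have "l i \<otimes> inv h = inv (l k \<otimes> h \<otimes> inv (l i)) \<otimes> l k" using P(2) h by (simp add: inv_mult_group m_assoc)
   moreover have "l k \<otimes> h = l k \<otimes> h \<otimes> inv (l i) \<otimes> l i" using P(2) h by (simp add: m_assoc)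
   moreover have "p a = p k <-> a = k" "p a = p i <-> a = i" by (rule P(5))+
   ultimately show "(transpose (p k) (p i) o p) a = (p o transpose k i) a \<and>
     l a \<otimes> lab (p k) (p i) h (p a) = lab k i (l k \<otimes> h \<otimes> inv (l i)) a \<otimes> l (transpose k i a)"
    using P(2) assms(6) by (auto simp: lab_def transpose_def)
  qed
 qed
 have S: "?\<s> \<star>[n] (\<Sum>h\<in>carrier G. basis (SW n (p k) (p i) h)) = (\<Sum>h\<in>carrier G. basis (SW n k i h)) \<star>[n] ?\<s>"
 proof -
  have "?\<s> \<star>[n] (\<Sum>h\<in>carrier G. basis (SW n (p k) (p i) h)) =
    (\<Sum>h\<in>carrier G. basis (mm n (SW n k i (l k \<otimes> h \<otimes> inv (l i))) (mon n p l)))"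
   by (simp add: ma_sum s)
  also have "... = (\<Sum>h\<in>carrier G. basis (mm n (SW n k i h) (mon n p l)))"
   by (rule sum.reindex_bij_witness[of _ "%h. inv (l k) \<otimes> h \<otimes> l i" "%h. l k \<otimes> h \<otimes> inv (l i)"])
    (use P(2) in \<open>auto simp: m_assoc inv_mult_group simp flip: m_assoc\<close>, simp_all add: m_assoc P(2))
  finally show ?thesis by (simp add: ma_sum)
 qed
 have \<s>: "?\<s> : Fc n" using mon_PM0[OF assms(1)] by simp
 let ?T = "\<Sum>h\<in>carrier G. basis (SW n k i h) :: ('a, 'f) fgel"
 have T: "?T : Fc n" by (rule SWsum_c[OF assms(2-5)])
 have "?\<s> \<star>[n] R n (p k) (p i) = (?\<s> \<star>[n] (\<Sum>h\<in>carrier G. basis (SW n (p k) (p i) h))) \<star>[n] eps1 n (p k) \<star>[n] eps1 n (p i)"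
  unfolding R_def using \<s> by (simp only: A.m_assoc A.m_closed eps1_c SWsum_c[OF pb(1-4)])
 also have "... = ?T \<star>[n] (?\<s> \<star>[n] eps1 n (p k)) \<star>[n] eps1 n (p i)"
  unfolding S using \<s> T by (simp only: A.m_assoc A.m_closed eps1_c)
 also have "... = ?T \<star>[n] eps1 n k \<star>[n] (?\<s> \<star>[n] eps1 n (p i))"
 proof -
  have "?T \<star>[n] (?\<s> \<star>[n] eps1 n (p k)) \<star>[n] eps1 n (p i) =
    ?T \<star>[n] (eps1 n k \<star>[n] ?\<s>) \<star>[n] eps1 n (p i)"
   by (simp only: eps1_mon[OF assms(1)])
  then show ?thesis using \<s> T by (simp only: A.m_assoc A.m_closed eps1_c)
 qed
 also have "... = R n k i \<star>[n] ?\<s>"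
  unfolding eps1_mon[OF assms(1)] R_def using \<s> T by (simp only: A.m_assoc A.m_closed eps1_c)
 finally show ?thesis .
qed

text \<open>Interchanging k and i replaces h by its inverse, which permutes the summands; the two
  factors \<open>1 - eps\<close> commute.\<close>

lemma R_sym:
 assumes "1 <= k" "k <= n" "1 <= i" "i <= n" "k ~= i"
 shows "(R n k i :: ('a, 'f::field) fgel) = R n i k"
proof -
 interpret A: falg "FGbar G n :: ('a, 'f) fgalg" by (rule falg_FG)
 have "(\<Sum>h\<in>carrier G. basis (SW n k i h) :: ('a, 'f) fgel) = (\<Sum>h\<in>carrier G. basis (SW n i k h))"
  by (rule sum.reindex_bij_witness[of _ "%h. inv h" "%h. inv h"])
   (auto simp: SW_def transpose_commute intro!: arg_cong[of _ _ basis] mon_cong, (use assms(5) in "auto simp: lab_def")?)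
 then have "R n k i = (\<Sum>h\<in>carrier G. basis (SW n i k h) :: ('a, 'f) fgel) \<star>[n] (eps1 n k \<star>[n] eps1 n i)"
  unfolding R_def by (simp only: A.m_assoc eps1_c SWsum_c[OF assms(3,4,1,2)])
 also have "eps1 n k \<star>[n] eps1 n i = eps1 n i \<star>[n] (eps1 n k :: ('a, 'f) fgel)" by (rule eps1_comm)
 finally show ?thesis
  unfolding R_def[of n i k] by (simp only: A.m_assoc eps1_c SWsum_c[OF assms(3,4,1,2)])
qed

text \<open>If \<open>J\<close> meets k or i, one of the factors \<open>1 - eps\<close> annihilates
  the idempotent. Otherwise the transposition fixes \<open>J\<close> pointwise and everything
  commutes.\<close>

lemma R_idm:
 fixes J :: "nat set"
 assumes "1 <= k" "k <= n" "1 <= i" "i <= n" "k ~= i"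
 shows "k : J \<or> i : J ==> R n k i \<star>[n] basis (idm n J) = (0 :: ('a, 'f::field) fgel)"
  "k : J \<or> i : J ==> basis (idm n J) \<star>[n] R n k i = (0 :: ('a, 'f) fgel)"
  "R n k i \<star>[n] basis (idm n J) = basis (idm n J) \<star>[n] (R n k i :: ('a, 'f) fgel)"
proof -
 interpret A: falg "FGbar G n :: ('a, 'f) fgalg" by (rule falg_FG)
 let ?T = "\<Sum>h\<in>carrier G. basis (SW n k i h) :: ('a, 'f) fgel"
 have T: "?T : Fc n" by (rule SWsum_c[OF assms(1-4)])
 have E: "basis (idm n J) : Fc n" for J by simp
 have *: "R n k i \<star>[n] basis (idm n J) = ?T \<star>[n] (eps1 n k \<star>[n] (eps1 n i \<star>[n] basis (idm n J)))" for J
  unfolding R_def using T E by (simp only: A.m_assoc A.m_closed eps1_c E)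
 have **: "eps1 n k \<star>[n] (eps1 n i \<star>[n] basis (idm n J)) = (0 :: ('a, 'f) fgel)" if "k : J \<or> i : J" for J
 proof (cases "i : J")
  case True
  then show ?thesis by (simp add: eps1_kill)
 next
  case False
  have "eps1 n k \<star>[n] (eps1 n i \<star>[n] basis (idm n J)) =
    (eps1 n k \<star>[n] basis (idm n J)) \<star>[n] (eps1 n i :: ('a, 'f) fgel)"
   unfolding eps1_comm_idm[of n i] using E by (simp only: A.m_assoc A.m_closed eps1_c E)
  then show ?thesis using that False by (simp add: eps1_kill)
 qed
 have st: "mm n (SW n k i h) (idm n J) = mm n (idm n (transpose k i ` J)) (SW n k i h)" if "h : carrier G" for h J
 proof -
  have "transpose k i ` transpose k i ` J = J" by (auto simp: image_iff)
  then show ?thesis using mon_idm[OF SW_ok[OF assms(1-4) that], of "transpose k i ` J"] by (simp add: SW_def)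
 qed
 have TE: "?T \<star>[n] basis (idm n J) = basis (idm n (transpose k i ` J)) \<star>[n] ?T" for J
  by (simp add: ma_sum st)
 have ***: "basis (idm n J) \<star>[n] R n k i = ?T \<star>[n] (eps1 n k \<star>[n] (eps1 n i \<star>[n] basis (idm n (transpose k i ` J))))" for J
 proof -
  have tt: "transpose k i ` transpose k i ` J = J" by (auto simp: image_iff)
  have "basis (idm n J) \<star>[n] R n k i = (basis (idm n J) \<star>[n] ?T) \<star>[n] (eps1 n k \<star>[n] eps1 n i)"
   unfolding R_def using T E by (simp only: A.m_assoc A.m_closed eps1_c E)
  also have "basis (idm n J) \<star>[n] ?T = ?T \<star>[n] basis (idm n (transpose k i ` J))"
   using TE[of "transpose k i ` J"] tt by simp
  also have "?T \<star>[n] basis (idm n (transpose k i ` J)) \<star>[n] (eps1 n k \<star>[n] eps1 n i) =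
    ?T \<star>[n] ((basis (idm n (transpose k i ` J)) \<star>[n] eps1 n k) \<star>[n] eps1 n i)"
   using T E by (simp only: A.m_assoc A.m_closed eps1_c E)
  also have "... = ?T \<star>[n] (eps1 n k \<star>[n] (basis (idm n (transpose k i ` J)) \<star>[n] eps1 n i))"
   unfolding eps1_comm_idm[of n k, symmetric] using T E by (simp only: A.m_assoc A.m_closed eps1_c E)
  finally show ?thesis unfolding eps1_comm_idm[of n i, symmetric] .
 qed
 show 1: "R n k i \<star>[n] basis (idm n J) = (0 :: ('a, 'f) fgel)" if "k : J \<or> i : J"
  unfolding * **[OF that] by simp
 show 2: "basis (idm n J) \<star>[n] R n k i = (0 :: ('a, 'f) fgel)" if "k : J \<or> i : J"
 proof -
  have "k : transpose k i ` J \<or> i : transpose k i ` J" using that by (auto simp: image_iff intro: bexI[of _ i] bexI[of _ k])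
  then show ?thesis unfolding *** by (simp add: **)
 qed
 show "R n k i \<star>[n] basis (idm n J) = basis (idm n J) \<star>[n] (R n k i :: ('a, 'f) fgel)"
 proof (cases "k : J \<or> i : J")
  case True
  then show ?thesis using 1 2 by simp
 next
  case False
  have "transpose k i a = a" if "a : J" for a using that False by (auto simp: transpose_def)
  then have "transpose k i ` J = J" by simp
  then show ?thesis unfolding * *** by simp
 qed
qed

lemma pl_ok_zero: "pl_ok k n p l ==> pl_ok 0 n p l"
 unfolding pl_ok_def by (auto intro: permutes_subset)

text \<open>Permutations of \<open>{k<..n}\<close> permute the summands \<open>R n k i\<close>. The
  subsemigroup here fixes the first k indices rather than the first m; in this strength the lemma
  also yields commutation with the later \<open>u_l\<close>, which are built from such
  elements.\<close>

lemma u_comm_Gprime: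
 assumes "1 <= k" "k <= n" "\<u> : Gprime G k n"
 shows "u_elt G k n \<star>[n] basis \<u> = basis \<u> \<star>[n] (u_elt G k n :: ('a, 'f::field) fgel)"
proof -
 interpret A: falg "FGbar G n :: ('a, 'f) fgalg" by (rule falg_FG)
 from Gprime_factor[OF assms(3,2)] obtain p l J
  where *: "pl_ok k n p l" "J <= {k<..n}" "\<u> = mm n (idm n J) (mon n p l)" by blast
 note ok = pl_ok_zero[OF *(1)] and P = pl_okD[OF *(1)]
 let ?u = "u_elt G k n :: ('a, 'f) fgel" and ?E = "basis (idm n J) :: ('a, 'f) fgel" and ?M = "basis (mon n p l) :: ('a, 'f) fgel"
 have I: "{k+1..n} = {k<..n}" by auto
 have c: "?u : Fc n" "?E : Fc n" "?M : Fc n"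
  using u_elt_c[OF assms(1)] mon_PM0[OF ok] by auto
 have M: "?u \<star>[n] ?M = ?M \<star>[n] ?u"
 proof -
  have "?u \<star>[n] ?M = (\<Sum>i=k+1..n. R n k i \<star>[n] ?M)"
   by (simp add: u_elt_R[OF assms(1)] ma_sum)
  also have "... = (\<Sum>i=k+1..n. ?M \<star>[n] R n k (p i))"
  proof (rule sum.cong)
   fix i assume "i : {k+1..n}"
   then have "?M \<star>[n] R n (p k) (p i) = R n k i \<star>[n] ?M"
    by (intro R_conj[OF ok assms(1,2)]) auto
   then show "R n k i \<star>[n] ?M = ?M \<star>[n] R n k (p i)"
    using P(6)[of k] by simp
  qed simp
  also have "... = ?M \<star>[n] (\<Sum>i=k+1..n. R n k (p i))" by (simp add: ma_sum)
  also have "(\<Sum>i=k+1..n. R n k (p i) :: ('a, 'f) fgel) = (\<Sum>i=k+1..n. R n k i)"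
   unfolding I using sum.permute[OF P(1), of "R n k :: ('a, 'f) zel"] by (simp add: comp_def)
  finally show ?thesis by (simp add: u_elt_R[OF assms(1)])
 qed
 have E: "?u \<star>[n] ?E = ?E \<star>[n] ?u"
  unfolding u_elt_R[OF assms(1)] ma_sum
  by (rule sum.cong[OF refl]) (rule R_idm(3), use assms in auto)
 have b: "basis \<u> = ?E \<star>[n] ?M" by (simp add: *(3))
 have "?u \<star>[n] (?E \<star>[n] ?M) = (?u \<star>[n] ?E) \<star>[n] ?M"
  using c by (simp only: A.m_assoc)
 also have "... = ?E \<star>[n] (?u \<star>[n] ?M)" unfolding E using c by (simp only: A.m_assoc)
 also have "... = ?E \<star>[n] ?M \<star>[n] ?u" unfolding M using c by (simp only: A.m_assoc)
 finally show ?thesis unfolding b .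
qed

lemma u_Zcent:
 assumes "1 <= k" "k <= m" "m <= n"
 shows "(u_elt G k n :: ('a, 'f::field) fgel) : Zcent G m n"
proof -
 have "(u_elt G k n :: ('a, 'f) fgel) : Zcent G k n"
  unfolding Zcent_iff
  by (intro conjI ballI u_elt_c[OF assms(1), unfolded ma_simps] u_comm_Gprime[OF assms(1)])
   (use assms in auto)
 then show ?thesis using Zcent_mono[OF assms(2)] by blast
qed

lemma hat_u1:
 assumes "1 <= k" "k <= n" "\<e> : PM n"
 shows "hat (u_elt G k n :: ('a, 'f::field) fgel) \<e> =
  (if k : rows \<e> then \<Sum>i\<in>rows \<e> \<inter> {k<..}. \<Sum>h\<in>carrier G. if sub (swp k i h \<e>) (I1 n) then 1 else 0 else 0)"
proof -
 interpret A: falg "FGbar G n :: ('a, 'f) fgalg" by (rule falg_FG)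
 have "u_elt G k n \<star>[n] basis (I1 n) = (u_elt G k n :: ('a, 'f) fgel)"
  using A.r_one[OF u_elt_c[OF assms(1)]] by simp
 then show ?thesis using hat_u[OF assms(1,2) _ assms(3), of "basis (I1 n) :: ('a, 'f) fgel"] by simp
qed

text \<open>At a matrix of order \<open>n - 1\<close> only indices i that are among its rows
  contribute, so the summand \<open>i = n\<close> is invisible after truncation.\<close>

lemma theta_u:
 assumes "1 <= k" "k < n"
 shows "theta n (u_elt G k n) = (u_elt G k (n - 1) :: ('a, 'f::field) fgel)"
proof (rule hat_eqI[where n = "n - 1"])
 have c: "keys (u_elt G k n :: ('a, 'f) fgel) <= PM n" for n using u_elt_c[OF assms(1)] by simp
 show "keys (theta n (u_elt G k n) :: ('a, 'f) fgel) <= PM (n - 1)" by (rule theta_keys[OF c])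
 show "keys (u_elt G k (n - 1) :: ('a, 'f) fgel) <= PM (n - 1)" by (rule c)
 fix \<e> assume e: "\<e> : PM (n - 1)"
 have e': "\<e> : PM n" using e PM_mono[of "n - 1" n] by auto
 have s: "sub (swp k i h \<e>) (I1 n) <-> sub (swp k i h \<e>) (I1 (n - 1))" if "i : rows \<e> \<inter> {k<..}" "h : carrier G" for i h
 proof -
  have i: "1 <= i" "i <= n - 1" "k ~= i" using that PM_rows[OF e] by auto
  have Q: "swp k i h \<e> : PM (n - 1)" by (rule swp_PM) (use i assms that e in auto)
  then have "i' <= n <-> i' <= n - 1" if "swp k i h \<e> i' j' = Some x" for i' j' x
   using PM_D(2)[OF Q that] by auto
  then show ?thesis unfolding sub_def diag_Some by blast
 qed
 show "hat (theta n (u_elt G k n) :: ('a, 'f) fgel) \<e> = hat (u_elt G k (n - 1)) \<e>"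
 proof -
  have kn: "k <= n" "k <= n - 1" using assms by auto
  have "(\<Sum>i\<in>rows \<e> \<inter> {k<..}. \<Sum>h\<in>carrier G. if sub (swp k i h \<e>) (I1 n) then 1 else (0::'f)) =
    (\<Sum>i\<in>rows \<e> \<inter> {k<..}. \<Sum>h\<in>carrier G. if sub (swp k i h \<e>) (I1 (n - 1)) then 1 else 0)"
   by (rule sum.cong[OF refl], rule sum.cong[OF refl]) (simp only: s)
  then show ?thesis
   unfolding hat_theta[OF e] hat_u1[OF assms(1) kn(1) e'] hat_u1[OF assms(1) kn(2) e] by simp
 qed
qed

lemma eps1_deg: "dgl n (eps1 n k :: ('a, 'f::field) fgel) 1"
proof -
 have "{j : {1..n}. mtx_eps G n k j j ~= Some \<one>} <= {k}" by auto
 from card_mono[OF _ this] have "mtx_deg G n (mtx_eps G n k) <= 1" by (simp add: mtx_deg_def)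
 moreover have "keys (eps1 n k :: ('a, 'f) fgel) <= {I1 n} \<union> {mtx_eps G n k}"
  using Poly_Mapping.keys_diff[of "basis (I1 n) :: ('a, 'f) fgel" "basis (mtx_eps G n k)"] by (simp add: eps1_def)
 ultimately show ?thesis using mtx_deg_I1 by fastforce
qed

text \<open>A labelled transposition disturbs at most two diagonal entries and each factor
  \<open>1 - eps\<close> one more: 2 + 1 + 1. The bound is uniform in i and n, which is what makes
  the growing sum \<open>u_elt\<close> of bounded degree.\<close>

lemma R_deg:
 assumes "1 <= k" "k <= n" "1 <= i" "i <= n"
 shows "dgl n (R n k i :: ('a, 'f::field) fgel) 4"
proof -
 interpret A: falg "FGbar G n :: ('a, 'f) fgalg" by (rule falg_FG)
 let ?T = "\<Sum>h\<in>carrier G. basis (SW n k i h) :: ('a, 'f) fgel"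
 have T: "?T : Fc n" by (rule SWsum_c[OF assms])
 have e: "(eps1 n k :: ('a, 'f) fgel) : Fc n" for k by (rule eps1_c)
 have "mtx_deg G n (SW n k i h) <= 2" for h
 proof -
  have "{j : {1..n}. SW n k i h j j ~= Some \<one>} <= {k, i}" by (auto simp: SW_def lab_def)
  from card_mono[OF _ this] have "mtx_deg G n (SW n k i h) <= card {k, i}" by (simp add: mtx_deg_def)
  also have "... <= 2" by (cases "k = i") auto
  finally show ?thesis .
 qed
 then have "keys ?T <= {\<g>. mtx_deg G n \<g> <= 2}" by (intro keys_sum) auto
 then have 2: "\<forall>\<g>\<in>keys ?T. mtx_deg G n \<g> <= 2" by blast
 have 3: "dgl n (?T \<star>[n] eps1 n k) (2 + 1)"
  by (rule deg_bound_mult[OF _ _ 2 eps1_deg]) (use T e[of k] in simp_all)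
 have "\<forall>\<g>\<in>keys (R n k i :: ('a, 'f) fgel). mtx_deg G n \<g> <= 2 + 1 + 1"
  unfolding R_def by (rule deg_bound_mult[OF _ _ 3 eps1_deg]) (use A.m_closed[OF T e[of k]] e[of i] in simp_all)
 then show ?thesis by simp
qed

lemma us_Zbar:
 assumes "1 <= k" "k <= m"
 shows "(us m k :: ('a, 'f::field) zel) : Zc m"
 unfolding Zbar_iff
proof (intro conjI allI impI)
 show "(us m k :: ('a, 'f) zel) : extensional {m..}" by (simp add: u_seq_def)
 show "(us m k n :: ('a, 'f) fgel) : Zcent G m n" if "m <= n" for n
  using u_Zcent[OF assms that] that by (simp add: u_seq_def)
 show "theta n (us m k n) = (us m k (n - 1) :: ('a, 'f) fgel)" if "m < n" for n
 proof -
  have "k < n" using assms that by simp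
  moreover have "(us m k n :: ('a, 'f) fgel) = u_elt G k n" "(us m k (n - 1) :: ('a, 'f) fgel) = u_elt G k (n - 1)"
   using that by (auto simp: u_seq_def)
  ultimately show ?thesis by (simp only: theta_u[OF assms(1)])
 qed
 show "\<exists>d. \<forall>n\<ge>m. dgl n (us m k n :: ('a, 'f) fgel) d"
 proof (intro exI allI impI)
  fix n assume n: "m <= n"
  have "keys (\<Sum>i=k+1..n. R n k i :: ('a, 'f) fgel) <= {\<g>. mtx_deg G n \<g> <= 4}"
  proof (rule keys_sum)
   fix i assume "i : {k+1..n}"
   then have "dgl n (R n k i :: ('a, 'f) fgel) 4"
    using assms n by (intro R_deg) auto
   then show "keys (R n k i :: ('a, 'f) fgel) <= {\<g>. mtx_deg G n \<g> <= 4}" by blast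
  qed
  then show "dgl n (us m k n :: ('a, 'f) fgel) 4"
   using n by (auto simp: u_seq_def u_elt_R[OF assms(1)])
 qed
qed

subsection \<open>Contraction and insertion of path points\<close>

definition path :: "nat => 'a mtx => nat => bool" where
 "path m \<g> k <-> (\<exists>i>m. \<exists>x. \<g> k i = Some x)"
definition pp :: "'a mtx => nat => nat" where "pp \<g> k = (THE i. \<exists>x. \<g> k i = Some x)"
definition ctr1 :: "nat => 'a mtx => 'a mtx" where "ctr1 k \<g> = ctr k (pp \<g> k) (the (\<g> k (pp \<g> k))) \<g>"
text \<open>Reverses a contraction: row k is rerouted through the new index i with label 1, and row
  i inherits the former row k.\<close>

definition ins :: "nat => nat => 'a mtx => 'a mtx" where
 "ins k i \<g> = (%a b. if a = k then (if b = i then Some \<one> else None)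
   else if a = i then (if b = i then None else \<g> k b) else \<g> a b)"

lemma pp_eq: "\<g> : PM n ==> \<g> k i = Some x ==> pp \<g> k = i"
 unfolding pp_def by (rule the_equality) (auto dest: PM_D(6))

lemma ctr1_eq: "\<g> : PM n ==> \<g> k i = Some x ==> ctr1 k \<g> = ctr k i x \<g>"
 by (simp add: ctr1_def pp_eq)

lemma ctr_Some:
 assumes "\<g> : PM n" "\<g> k i = Some x" "k ~= i"
 shows "ctr k i x \<g> a b = Some y <-> a ~= i & b ~= i & (if a = k then \<exists>z. \<g> i b = Some z & y = x \<otimes> z else \<g> a b = Some y)"
proof -
 have "b = i" if "\<g> k b = Some z" for z using PM_D(6)[OF assms(1) that assms(2)] .
 then show ?thesis using assms(3) by (auto simp: ctr_def swp_Some)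
qed

lemma ctr_PM:
 assumes "\<g> : PM n" "\<g> k i = Some x" "k ~= i"
 shows "ctr k i x \<g> : PM n"
 unfolding ctr_def by (intro rm_PM swp_PM) (use assms PM_D(1-5)[OF assms(1,2)] in auto)

text \<open>In \<open>Gam\<close> the nonzero column i comes with a nonzero row i, whose entry moves
  to row k. So i is the only index that leaves the outer support, and row k stays nonzero, ready for
  \<open>ins\<close>.\<close>

lemma ctr_Gam:
 assumes g: "\<g> : Gam m n" and x: "\<g> k i = Some x" and k: "k <= m" "m < i"
 shows "ctr k i x \<g> : Gam m n" "S m (ctr k i x \<g>) = S m \<g> - {i}" "i : S m \<g>" "k : rows (ctr k i x \<g>)"
  "Suc (card (S m (ctr k i x \<g>))) = card (S m \<g>)"
proof -
 note P = Gam_PM[OF g]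
 have ki: "k ~= i" using k by simp
 note C = ctr_Some[OF P x ki]
 show iS: "i : S m \<g>" using x k by (auto simp: S_def intro: colsI)
 then obtain b z where b: "\<g> i b = Some z" using Gam_S(2)[OF g, of i] by (auto simp: rows_def)
 have bi: "b ~= i" using PM_D(7)[OF P _ x, of i] b ki by auto
 have r: "a : rows (ctr k i x \<g>) <-> a : rows \<g> - {i}" for a
 proof (cases "a = k")
  case True
  have "ctr k i x \<g> k b = Some (x \<otimes> z)" unfolding C using ki bi b by simp
  then have "k : rows (ctr k i x \<g>)" by (rule rowsI)
  moreover have "k : rows \<g>" using x by (rule rowsI)
  ultimately show ?thesis using True ki by blast
 next
  case False
  have "b ~= i" if "\<g> a b = Some y" for b y using PM_D(7)[OF P _ x, of a] that False by auto
  then show ?thesis unfolding rows_def mem_Collect_eq Diff_iff C using False by auto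
 qed
 have c: "b' : cols (ctr k i x \<g>) <-> b' : cols \<g> - {i}" for b'
 proof
  assume "b' : cols \<g> - {i}"
  then obtain a y where a: "\<g> a b' = Some y" "b' ~= i" by (auto simp: cols_def)
  have ak: "a ~= k" using PM_D(6)[OF P _ x, of b'] a by auto
  show "b' : cols (ctr k i x \<g>)"
  proof (cases "a = i")
   case True
   then have "ctr k i x \<g> k b' = Some (x \<otimes> y)" unfolding C using a ki by auto
   then show ?thesis by (rule colsI)
  next
   case False
   then have "ctr k i x \<g> a b' = Some y" unfolding C using a ak by auto
   then show ?thesis by (rule colsI)
  qed
 qed (auto simp: cols_def C split: if_splits)
 show "k : rows (ctr k i x \<g>)" using r ki rowsI[of \<g>, OF x] by simp
 show S: "S m (ctr k i x \<g>) = S m \<g> - {i}" using r c by (auto simp: S_def)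
 show "ctr k i x \<g> : Gam m n" using g ctr_PM[OF P x ki] by (auto simp: Gam_def r c)
 show "Suc (card (S m (ctr k i x \<g>))) = card (S m \<g>)" unfolding S by (rule card_Suc_Diff1[OF finite_S[OF P] iS])
qed

lemma ins_Some: "ins k i \<g> a b = Some y <-> (if a = k then b = i & y = \<one> else if a = i then b ~= i & \<g> k b = Some y else \<g> a b = Some y)"
 by (auto simp: ins_def)

lemma ins_Gam:
 assumes g: "\<g> : Gam m n" and k: "1 <= k" "k <= m" "k : rows \<g>" and i: "i ~: S m \<g>" "m < i" "i <= n"
 shows "ins k i \<g> : Gam m n" "S m (ins k i \<g>) = insert i (S m \<g>)" "ins k i \<g> k i = Some \<one>" "ctr k i \<one> (ins k i \<g>) = \<g>"
  "rows (ins k i \<g>) = insert i (rows \<g>)"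
proof -
 note P = Gam_PM[OF g]
 have ki: "k ~= i" using k i by simp
 have ri: "\<g> i b ~= Some y" "\<g> b i ~= Some y" for b y
  using i(1,2) rowsI[of \<g> i b y] colsI[of \<g> b i y] by (auto simp: S_def)
 have rn: "\<g> c i = None" "\<g> i c = None" for c using ri by (meson not_None_eq)+
 have PI: "ins k i \<g> : PM n"
  unfolding PM_iff ins_Some
 proof (intro conjI allI impI)
  fix a b y assume "if a = k then b = i & y = \<one> else if a = i then b ~= i & \<g> k b = Some y else \<g> a b = Some y"
  then show "1 <= a" "a <= n" "1 <= b" "b <= n" "y : carrier G"
   using PM_D(1-5)[OF P, of a b y] PM_D(1-5)[OF P, of k b y] i k PM_rows[OF P] by (auto split: if_splits)
 next
  fix a b b' y y' assume "if a = k then b = i & y = \<one> else if a = i then b ~= i & \<g> k b = Some y else \<g> a b = Some y"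
   "if a = k then b' = i & y' = \<one> else if a = i then b' ~= i & \<g> k b' = Some y' else \<g> a b' = Some y'"
  then show "b = b'" using PM_D(6)[OF P, of a b y b' y'] PM_D(6)[OF P, of k b y b' y'] by (auto split: if_splits)
 next
  fix a a' b y y' assume "if a = k then b = i & y = \<one> else if a = i then b ~= i & \<g> k b = Some y else \<g> a b = Some y"
   "if a' = k then b = i & y' = \<one> else if a' = i then b ~= i & \<g> k b = Some y' else \<g> a' b = Some y'"
  note h = this
  show "a = a'"
  proof (cases "b = i")
   case True
   have "a = k" using h(1) True rn(1)[of a] by (auto split: if_splits)
   moreover have "a' = k" using h(2) True rn(1)[of a'] by (auto split: if_splits)
   ultimately show ?thesis by simp
  next
   case False
   have 1: "a ~= k & (if a = i then \<g> k b = Some y else \<g> a b = Some y)" using h(1) False by (auto split: if_splits)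
   have 2: "a' ~= k & (if a' = i then \<g> k b = Some y' else \<g> a' b = Some y')" using h(2) False by (auto split: if_splits)
   show ?thesis
    using 1 2 PM_D(7)[OF P, of a b y a' y'] PM_D(7)[OF P, of k b y a' y'] PM_D(7)[OF P, of a b y k y']
    by (cases "a = i"; cases "a' = i") simp_all
  qed
 qed
 show x: "ins k i \<g> k i = Some \<one>" by (simp add: ins_def)
 show "ctr k i \<one> (ins k i \<g>) = \<g>" (is "?l = ?r")
 proof (rule mtxI)
  fix a b y
  show "?l a b = Some y <-> ?r a b = Some y"
   unfolding ctr_Some[OF PI x ki] ins_Some using ki ri PM_D(5)[OF P, of k b] by auto
 qed
 obtain b0 y0 where b0: "\<g> k b0 = Some y0" using k(3) by (auto simp: rows_def)
 show r: "rows (ins k i \<g>) = insert i (rows \<g>)"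
 proof (intro Set.set_eqI iffI)
  fix a assume "a : insert i (rows \<g>)"
  then consider "a = k" | "a = i" | "a ~= k" "a ~= i" "a : rows \<g>" by blast
  then show "a : rows (ins k i \<g>)"
  proof cases
   case 2
   have "ins k i \<g> i b0 = Some y0" unfolding ins_Some using b0 ri ki by auto
   from rowsI[of "ins k i \<g>", OF this] show ?thesis using 2 by simp
  next
   case 3
   then obtain b y where "\<g> a b = Some y" by (auto simp: rows_def)
   then have "ins k i \<g> a b = Some y" unfolding ins_Some using 3 by simp
   then show ?thesis by (rule rowsI)
  next
   case 1
   then show ?thesis using rowsI[of "ins k i \<g>", OF x] by simp
  qed
 next
  fix a assume "a : rows (ins k i \<g>)"
  then obtain b y where "ins k i \<g> a b = Some y" by (auto simp: rows_def)
  then show "a : insert i (rows \<g>)" unfolding ins_Some using k(3) by (auto split: if_splits intro: rowsI)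
 qed
 have c: "cols (ins k i \<g>) = insert i (cols \<g>)"
 proof (intro Set.set_eqI iffI)
  fix b assume "b : insert i (cols \<g>)"
  then consider "b = i" | "b ~= i" "b : cols \<g>" by blast
  then show "b : cols (ins k i \<g>)"
  proof cases
   case 2
   then obtain a y where a: "\<g> a b = Some y" by (auto simp: cols_def)
   have "a ~= i" using a ri(1)[of b y] by auto
   then have "ins k i \<g> (if a = k then i else a) b = Some y" unfolding ins_Some using a 2 ki by auto
   then show ?thesis by (rule colsI)
  next
   case 1
   then show ?thesis using colsI[of "ins k i \<g>", OF x] by simp
  qed
 next
  fix b assume "b : cols (ins k i \<g>)"
  then obtain a y where "ins k i \<g> a b = Some y" by (auto simp: cols_def)
  then show "b : insert i (cols \<g>)" unfolding ins_Some by (auto split: if_splits intro: colsI)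
 qed
 show "S m (ins k i \<g>) = insert i (S m \<g>)" using i(2) by (auto simp: S_def r c)
 show "ins k i \<g> : Gam m n" using g PI by (auto simp: Gam_def r c)
qed

text \<open>Contracting i and inserting j renames i to j. The label at j is the contracted entry x:
  it cancels x in row k, where \<open>ins\<close> puts 1, and reappears in row j.\<close>

lemma sim_ctr_ins:
 assumes g: "\<g> : Gam m n" and x: "\<g> k i = Some x" and k: "k <= m" "m < i" and j: "j ~: S m \<g> - {i}" "m < j"
 shows "sim m \<g> (ins k j (ctr k i x \<g>))"
proof -
 note P = Gam_PM[OF g]
 have ki: "k ~= i" using k by simp
 have xc: "x : carrier G" using PM_D(5)[OF P x] .
 note C = ctr_Some[OF P x ki]
 define q where "q a = (if a <= m then a else if a = j then i else if a : S m \<g> - {i} then a else 0)" for a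
 define l where "l a = (if a = j then x else \<one>)" for a
 have iS: "i : S m \<g>" by (rule ctr_Gam(3)[OF g x k])
 have n0: "\<g> 0 b ~= Some y" "\<g> b 0 ~= Some y" for b y using PM_D(1,3)[OF P] by fastforce+
 have rS: "a <= m \<or> a : S m \<g>" "b <= m \<or> b : S m \<g>" if "\<g> a b = Some y" for a b y
  using rowsI[of \<g>, OF that] colsI[of \<g>, OF that] by (auto simp: S_def)
 have row_k: "\<g> k b = Some y <-> b = i & y = x" for b y using PM_D(6)[OF P x, of b y] x by auto
 have col_i: "\<g> a i = Some y <-> a = k & y = x" for a y using PM_D(7)[OF P x, of a y] x by auto
 have "ins k j (ctr k i x \<g>) = cj q l \<g>" (is "?l = ?r")
 proof (rule mtxI)
  fix a b y
  have jn: "j ~= k" "\<not> j <= m" using j(2) k by auto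
  have yc: "\<one> \<otimes> z \<otimes> inv \<one> = z" if "\<g> a b = Some z" for a b z using PM_D(5)[OF P that] by simp
  show "?l a b = Some y <-> ?r a b = Some y"
  proof (cases "a = k")
   case True
   have "q b = i <-> b = j" using k j by (auto simp: q_def)
   then show ?thesis using True k jn xc unfolding ins_Some cj_Some by (auto simp: q_def[of k] l_def row_k)
  next
   case ak: False
   show ?thesis
   proof (cases "a = j")
    case aj: True
    have f1: "ctr k i x \<g> k b = Some y <-> b ~= i & (\<exists>z. \<g> i b = Some z & y = x \<otimes> z)" unfolding C using ki by auto
    have f2: "(b ~= j & b ~= i & \<g> i b = Some z) <-> \<g> i (q b) = Some z" for z
    proof
     assume h: "b ~= j & b ~= i & \<g> i b = Some z"
     then have "q b = b" using rS(2)[of i b z] by (auto simp: q_def)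
     then show "\<g> i (q b) = Some z" using h by simp
    next
     assume h: "\<g> i (q b) = Some z"
     have "q b ~= 0" using h n0 by metis
     moreover have "q b ~= i" using h col_i ki by metis
     ultimately show "b ~= j & b ~= i & \<g> i b = Some z"
      using h jn k by (auto simp: q_def split: if_splits)
    qed
    have f3: "x \<otimes> z \<otimes> inv (l b) = x \<otimes> z" if "\<g> i (q b) = Some z" for z
    proof -
     have "b ~= j" using that col_i ki jn by (auto simp: q_def)
     then show ?thesis using PM_D(5)[OF P that] xc by (simp add: l_def)
    qed
    have "b ~= j & ctr k i x \<g> k b = Some y <-> (\<exists>z. \<g> i (q b) = Some z & y = x \<otimes> z)"
     unfolding f1 using f2 by blast
    also have "... <-> (\<exists>z. \<g> i (q b) = Some z & y = x \<otimes> z \<otimes> inv (l b))" using f3 by metis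
    finally show ?thesis using aj ak jn unfolding ins_Some cj_Some by (simp add: q_def[of j] l_def[of j])
   next
    case aj: False
    have "ctr k i x \<g> a b = Some y <-> a ~= i & b ~= i & \<g> a b = Some y" unfolding C using ak by auto
    also have "... <-> \<g> (q a) (q b) = Some y"
    proof
     assume h: "a ~= i & b ~= i & \<g> a b = Some y"
     then have "q a = a" "b ~= j ==> q b = b" using rS[of a b y] aj by (auto simp: q_def)
     moreover have "b ~= j" using h rS(2)[of a b y] j by auto
     ultimately show "\<g> (q a) (q b) = Some y" using h by simp
    next
     assume h: "\<g> (q a) (q b) = Some y"
     have "q b ~= 0" "q a ~= 0" using h n0 by metis+
     moreover have qa: "q a = a" using aj calculation(2) by (auto simp: q_def split: if_splits)
     moreover have "q b ~= i" using h col_i qa ak by metis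
     ultimately show "a ~= i & b ~= i & \<g> a b = Some y"
      using h aj k by (auto simp: q_def split: if_splits)
    qed
    also have "... <-> cj q l \<g> a b = Some y"
    proof -
     have "l b = \<one>" if "\<g> (q a) (q b) = Some z" for z
     proof -
      have "q a ~= 0" using that n0 by metis
      then have qa: "q a = a" using aj by (auto simp: q_def split: if_splits)
      have "q b ~= i" using that col_i qa ak by metis
      then have "b ~= j" using jn by (auto simp: q_def)
      then show ?thesis by (simp add: l_def)
     qed
     then show ?thesis unfolding cj_Some using aj PM_D(5)[OF P] by (auto simp: l_def[of a])
    qed
    finally show ?thesis unfolding ins_Some using ak aj by simp
   qed
  qed
 qed
 moreover have "\<forall>b>m. q b : S m \<g> \<or> q b = 0" using iS by (auto simp: q_def)
 moreover have "\<forall>b\<in>S m \<g>. \<exists>a>m. q a = b"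
 proof
  fix b assume b: "b : S m \<g>"
  then have "m < b" by (simp add: S_def)
  show "\<exists>a>m. q a = b"
  proof (cases "b = i")
   case True
   then show ?thesis using j(2) by (intro exI[of _ j]) (simp add: q_def)
  next
   case False
   then show ?thesis using b \<open>m < b\<close> j(1) by (intro exI[of _ b]) (auto simp: q_def)
  qed
 qed
 moreover have "\<forall>a>m. \<forall>b>m. q a = q b --> q a ~= 0 --> a = b" by (auto simp: q_def)
 moreover have "\<forall>a\<le>m. q a = a & l a = \<one>" using j(2) by (auto simp: q_def l_def)
 moreover have "\<forall>a. l a : carrier G" using xc by (simp add: l_def)
 ultimately show ?thesis unfolding sim_def by blast
qed

end

lemma sum_Pow_Un:
 assumes "finite P" "finite Q" "P \<inter> Q = {}"
 shows "(\<Sum>C\<in>Pow (P \<union> Q). s C) = (\<Sum>A\<in>Pow P. \<Sum>B\<in>Pow Q. s (A \<union> B))"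
proof -
 have "(\<Sum>C\<in>Pow (P \<union> Q). s C) = (\<Sum>(A, B)\<in>Pow P \<times> Pow Q. s (A \<union> B))"
  by (rule sum.reindex_bij_witness[of _ "%(A, B). A \<union> B" "%C. (C \<inter> P, C \<inter> Q)"])
   (use assms in "auto intro!: arg_cong[of _ _ s]")
 then show ?thesis using assms by (simp add: sum.cartesian_product)
qed

section \<open>Top symbols of products of \<open>Zbar G 0\<close> with matrices of order m\<close>

context gmat begin

definition isblk :: "nat => 'a mtx => bool" where
 "isblk m \<g> <-> (\<forall>a b x. \<g> a b = Some x --> (a <= m <-> b <= m))"
definition outer :: "nat => 'a mtx => 'a mtx" where
 "outer m \<g> = (%a b. if m < a & m < b then \<g> a b else None)"
text \<open>In contrast to \<open>outer\<close>, the lower block is shifted by m, since a matrix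
  taken from \<open>Zbar G 0\<close> may use the indices up to m. Up to conjugacy the shift is
  invisible (\<open>XS_shift\<close>, \<open>sim_blk_outer\<close>).\<close>

definition blk :: "nat => 'a mtx => 'a mtx => 'a mtx" where
 "blk m \<k> \<r> = (%a b. if a <= m & b <= m then \<r> a b else if m < a & m < b then \<k> (a - m) (b - m) else None)"

lemma outer_Some [simp]: "outer m \<g> a b = Some x <-> m < a & m < b & \<g> a b = Some x"
 by (auto simp: outer_def)

lemma blk_Some: "blk m \<k> \<r> a b = Some x <->
  (a <= m & b <= m & \<r> a b = Some x) \<or> (m < a & m < b & \<k> (a - m) (b - m) = Some x)"
 by (auto simp: blk_def)

text \<open>Compares coordinates relative to m with coordinates relative to 0. Both sides have the
  same transform under \<open>zet m\<close>, because a set of fixed points splits into its parts up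
  to m and beyond m.\<close>

lemma mob_split:
 fixes h :: "'a mtx => 'f::field"
 assumes "\<t> : PM n"
 shows "mob m h \<t> = (\<Sum>B\<in>Pow (fixp 0 \<t> - fixp m \<t>). mob 0 h (rm \<t> B))"
proof -
 define c' where "c' \<e> = (\<Sum>B\<in>Pow (fixp 0 \<e> - fixp m \<e>). mob 0 h (rm \<e> B))" for \<e>
 have "zet m c' \<e> = h \<e>" if e: "\<e> : PM n" for \<e>
 proof -
  have f: "finite (fixp 0 \<e>)" "finite (fixp m \<e>)" using e by auto
  have s: "fixp m \<e> <= fixp 0 \<e>" by (auto simp: fixp_def)
  have "fixp 0 (rm \<e> A) - fixp m (rm \<e> A) = fixp 0 \<e> - fixp m \<e>" if "A <= fixp m \<e>" for A
   using that by auto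
  then have "zet m c' \<e> = (\<Sum>A\<in>Pow (fixp m \<e>). \<Sum>B\<in>Pow (fixp 0 \<e> - fixp m \<e>). mob 0 h (rm \<e> (A \<union> B)))"
   unfolding zet_def c'_def by (intro sum.cong refl) auto
  also have "... = (\<Sum>C\<in>Pow (fixp m \<e> \<union> (fixp 0 \<e> - fixp m \<e>)). mob 0 h (rm \<e> C))"
   by (rule sum_Pow_Un[symmetric]) (use f in auto)
  also have "fixp m \<e> \<union> (fixp 0 \<e> - fixp m \<e>) = fixp 0 \<e>" using s by auto
  also have "(\<Sum>C\<in>Pow (fixp 0 \<e>). mob 0 h (rm \<e> C)) = zet 0 (mob 0 h) \<e>" by (simp add: zet_def)
  also have "... = h \<e>" by (rule zet_mob[OF f(1)])
  finally show ?thesis .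
 qed
 then have "mob m h \<t> = mob m (zet m c') \<t>" by (intro mob_cong[OF assms]) simp
 also have "... = c' \<t>" by (rule mob_zet) (use assms in auto)
 finally show ?thesis by (simp add: c'_def)
qed

text \<open>Moving \<open>\<d>\<close> across replaces \<open>\<g>\<close> by a matrix
  \<open>\<t>\<close>, and \<open>mob_split\<close> writes the result as a sum of coordinates of z
  over sets of inner fixed points removed from \<open>\<t>\<close>. The outer support alone already
  has size at least d, so the degree of z permits only the term in which nothing inner is
  left.\<close>

lemma XS_zc_basis:
 fixes z :: "('a, 'f::field) zel"
 assumes z: "z : Zc 0" and d: "ldeg 0 z (Suc d)" and \<d>: "\<d> : PM m"
  and n: "m <= n" and g: "\<g> : Gam m n" "d <= card (S m \<g>)"
 shows "XS m (res m z \<bullet>[m] csq m (basis \<d>)) \<g> =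
  (if isblk m \<g> & sub (mtx_corner m \<g>) \<d> then XS 0 z (outer m \<g>) else 0)"
proof -
 interpret Z: falg "Zbar G m :: ('a, 'f) zalg" by (rule falg_Z)
 note P = Gam_PM[OF g(1)]
 let ?E = "emb m n \<d>"
 have E: "?E : PM n" by (rule embed_PM[OF \<d> n])
 have cE: "b : cols ?E <-> (b : cols \<d>) \<or> (m < b & b <= n)" for b
 proof
  assume "b : cols ?E"
  then obtain a x where "?E a b = Some x" by (auto simp: cols_def)
  then show "b : cols \<d> \<or> m < b & b <= n" using colsI[of \<d> a b x] by auto
 next
  assume "b : cols \<d> \<or> m < b & b <= n"
  then show "b : cols ?E"
  proof
   assume "b : cols \<d>"
   then obtain a x where a: "\<d> a b = Some x" by (auto simp: cols_def)
   then have "?E a b = Some x" using PM_D(2,4)[OF \<d> a] by simp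
   then show ?thesis by (rule colsI)
  next
   assume "m < b & b <= n"
   then have "?E b b = Some \<one>" by simp
   then show ?thesis by (rule colsI)
  qed
 qed
 have prod: "res m z \<bullet>[m] csq m (basis \<d>) : Zc m"
  using homD(1)[OF res_hom z] homD(1)[OF csq_hom, of "basis \<d>" m] \<d> by auto
 have zn: "keys (z n) <= PM n" by (rule ZbarD(5)[OF z]) simp
 have P0: "cols (rm \<g> A) <= cols ?E <-> cols \<g> \<inter> {..m} <= cols \<d>" if "A <= fixp m \<g>" for A
  using that PM_cols[OF P] PM_cols[OF \<d>] unfolding cols_rm subset_iff cE by (force simp: fixp_def)
 have X: "XS m (res m z \<bullet>[m] csq m (basis \<d>)) \<g> =
  (\<Sum>A\<in>Pow (fixp m \<g>). (- 1) ^ card A * (if cols \<g> \<inter> {..m} <= cols \<d> then hat (z n) (mm n (rm \<g> A) (tr ?E)) else 0))"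
  unfolding XS_eq[OF prod n P] mob_def Zb_app[OF n] csq_app[OF n] lin_ext_lin res_app[OF n]
  by (rule sum.cong[OF refl]) (use P0 in "auto simp: hat_right[OF E rm_PM[OF P] zn]")
 show ?thesis
 proof (cases "cols \<g> \<inter> {..m} <= cols \<d>")
  case False
  have "\<not> (isblk m \<g> & sub (mtx_corner m \<g>) \<d>)"
  proof
   assume h: "isblk m \<g> & sub (mtx_corner m \<g>) \<d>"
   have "b : cols \<d>" if b: "b : cols \<g>" "b <= m" for b
   proof -
    obtain a x where a: "\<g> a b = Some x" using b by (auto simp: cols_def)
    then have "a <= m" using h b unfolding isblk_def by blast
    then have "mtx_corner m \<g> a b = Some x" using a b by simp
    then have "\<d> a b = Some x" by (rule subD[OF conjunct2[OF h]])
    then show ?thesis by (rule colsI)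
   qed
   then show False using False by auto
  qed
  then show ?thesis unfolding X if_not_P[OF False] by (simp only: if_False mult_zero_right sum.neutral_const)
 next
  case True
  \<comment> \<open>The columns of \<open>\<g>\<close> up to m are carried back through
    \<open>\<d>\<close>; those beyond m stay as they are.\<close>
  define \<t> where "\<t> = mm n \<g> (tr ?E)"
  have \<t>P: "\<t> : PM n" using P E by (auto simp: \<t>_def)
  have t: "\<t> a c = Some x <-> (\<exists>b g h. \<g> a b = Some g & ?E c b = Some h & x = g \<otimes> inv h)" for a c x
   unfolding \<t>_def mSome[OF P tr_PM[OF E]] tr_Some by blast
  have Ebig: "c = b & h = \<one>" if "?E c b = Some h" "m < b \<or> m < c" for c b h using that by auto
  have Esm: "\<d> c b = Some h" if "?E c b = Some h" "b <= m \<or> c <= m" for c b h using that by auto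
  have rmt: "mm n (rm \<g> A) (tr ?E) = rm \<t> A" (is "?l = ?r") if A: "A <= fixp m \<g>" for A
  proof (rule mtxI)
   fix a c x
   have "b : A <-> c : A" if "?E c b = Some h" for b h using Ebig[OF that] A by (auto simp: fixp_def)
   then show "?l a c = Some x <-> ?r a c = Some x"
    unfolding mSome[OF rm_PM[OF P] tr_PM[OF E]] tr_Some rm_Some t by blast
  qed
  have big: "\<t> a c = Some x <-> \<g> a c = Some x" if c: "m < c" for a c x
  proof
   assume "\<t> a c = Some x"
   then obtain b g h where b: "\<g> a b = Some g" "?E c b = Some h" "x = g \<otimes> inv h" using t by blast
   then show "\<g> a c = Some x" using Ebig[OF b(2)] c PM_D(5)[OF P b(1)] by auto
  next
   assume x: "\<g> a c = Some x"
   have "?E c c = Some \<one>" using c PM_D(4)[OF P x] by simp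
   moreover have "x = x \<otimes> inv \<one>" using PM_D(5)[OF P x] by simp
   ultimately show "\<t> a c = Some x" using x t by blast
  qed
  have fx: "fixp m \<t> = fixp m \<g>" using big by (auto simp: fixp_def)
  have rr: "rows \<t> = rows \<g>"
  proof (intro Set.set_eqI iffI)
   fix a assume "a : rows \<g>"
   then obtain b x where b: "\<g> a b = Some x" by (auto simp: rows_def)
   have "b : cols ?E" using True colsI[of \<g>, OF b] PM_D(4)[OF P b] cE[of b] by (cases "b <= m") auto
   then obtain c h where "?E c b = Some h" by (auto simp: cols_def)
   then have "\<t> a c = Some (x \<otimes> inv h)" using b t by blast
   then show "a : rows \<t>" by (rule rowsI)
  qed (auto simp: rows_def t)
  have cc: "c : cols \<t> <-> c : cols \<g>" if "m < c" for c using big[OF that] by (auto simp: cols_def)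
  have SS: "S m \<t> = S m \<g>" using rr cc by (auto simp: S_def)
  let ?Fx = "fixp 0 \<t> - fixp m \<t>"
  have Fx: "b : ?Fx <-> b <= m & \<t> b b = Some \<one>" for b using PM_D(1)[OF \<t>P, of b b] by (auto simp: fixp_def)
  \<comment> \<open>Everything of \<open>\<t>\<close> that touches \<open>{1..m}\<close> is a
    diagonal 1, so removing the inner fixed points leaves the outer part. In terms of
    \<open>\<g>\<close> this says block form with corner contained in \<open>\<d>\<close>.\<close>
  define K where "K <-> (\<forall>a b x. \<t> a b = Some x & (a <= m \<or> b <= m) --> a = b & x = \<one>)"
  have trm: "XS 0 z (rm \<t> B) = (if K & B = ?Fx then XS 0 z (outer m \<t>) else 0)" if B: "B <= ?Fx" for B
  proof (cases "K & B = ?Fx")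
   case True
   have "rm \<t> ?Fx = outer m \<t>" (is "?l = ?r")
   proof (rule mtxI)
    fix a b x
    have "(a <= m \<or> b <= m) & \<t> a b = Some x --> b : ?Fx" using True unfolding K_def Fx by blast
    then show "?l a b = Some x <-> ?r a b = Some x"
     unfolding rm_Some outer_Some using Fx[of b] by (auto simp: not_le)
   qed
   then show ?thesis using True by simp
  next
   case False
   have "XS 0 z (rm \<t> B) = 0"
   proof (rule ccontr)
    assume nz: "XS 0 z (rm \<t> B) ~= 0"
    have rG: "rm \<t> B : Gam 0 n" by (rule XS_Gam[OF z _ rm_PM[OF \<t>P] nz]) simp
    have lt: "card (S 0 (rm \<t> B)) < Suc d" using d rG nz by (auto simp: ldeg_def)
    have B0: "B <= fixp 0 \<t>" using B by blast
    have Bm: "b <= m" if "b : B" for b using B Fx that by blast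
    \<comment> \<open>Removing inner columns keeps all outer points, so the degree bound forces
      equality of the two supports and excludes every remaining inner entry.\<close>
    have "S m \<g> <= S 0 (rm \<t> B)"
     unfolding SS[symmetric] S_rm[OF \<t>P B0] using Bm by (fastforce simp: S_def)
    moreover have "card (S 0 (rm \<t> B)) <= card (S m \<g>)" using lt g(2) by simp
    ultimately have e: "S 0 (rm \<t> B) = S m \<g>" using card_seteq[OF finite_S[OF rm_PM[OF \<t>P]]] by metis
    have out: "m < a & m < b" if "rm \<t> B a b = Some x" for a b x
    proof -
     have "a : S 0 (rm \<t> B)" "b : S 0 (rm \<t> B)"
      using rowsI[of "rm \<t> B", OF that] colsI[of "rm \<t> B", OF that] PM_D(1,3)[OF rm_PM[OF \<t>P] that] by (auto simp: S_def)
     then show ?thesis unfolding e by (simp add: S_def)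
    qed
    have "K"
     unfolding K_def
    proof (intro allI impI)
     fix a b x assume h: "\<t> a b = Some x & (a <= m \<or> b <= m)"
     have "b : B"
     proof (rule ccontr)
      assume "b ~: B"
      then have "rm \<t> B a b = Some x" using h by simp
      from out[OF this] show False using h by auto
     qed
     then have f: "\<t> b b = Some \<one>" using B Fx by blast
     then have "a = b" using PM_D(7)[OF \<t>P conjunct1[OF h] f] by simp
     then show "a = b & x = \<one>" using h f by simp
    qed
    moreover have "B = ?Fx"
    proof (rule antisym[OF B], rule subsetI, rule ccontr)
     fix b assume b: "b : ?Fx" "b ~: B"
     then have "rm \<t> B b b = Some \<one>" using Fx by simp
     from out[OF this] show False using b(1) Fx by auto
    qed
    ultimately show False using False by blast
   qed
   then show ?thesis unfolding if_not_P[OF False] .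
  qed
  have fin: "finite ?Fx" using finite_fixp[OF \<t>P, of 0] by blast
  have "XS m (res m z \<bullet>[m] csq m (basis \<d>)) \<g> = mob m (hs 0 z) \<t>"
   unfolding X mob_def fx
   by (rule sum.cong[OF refl]) (use True rmt hs_eq[OF z _ rm_PM[OF \<t>P]] in auto)
  also have "... = (\<Sum>B\<in>Pow ?Fx. XS 0 z (rm \<t> B))"
   unfolding mob_split[OF \<t>P, of m] XS_def ..
  also have "... = (\<Sum>B\<in>Pow ?Fx. if B = ?Fx then (if K then XS 0 z (outer m \<t>) else 0) else 0)"
   by (rule sum.cong[OF refl]) (use trm in auto)
  also have "... = (if K then XS 0 z (outer m \<t>) else 0)" using fin by simp
  also have "outer m \<t> = outer m \<g>" by (rule mtxI) (use big in auto)
  also have "K <-> isblk m \<g> & sub (mtx_corner m \<g>) \<d>"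
  proof
   assume K: K
   have lo: "a <= m & \<d> a b = Some x" if b: "b <= m" "\<g> a b = Some x" for a b x
   proof -
    have "b : cols \<d>" using True colsI[of \<g>, OF b(2)] b(1) by auto
    then obtain c h where c: "\<d> c b = Some h" by (auto simp: cols_def)
    have cm: "c <= m" using PM_D(2)[OF \<d> c] .
    have "?E c b = Some h" using c cm b by simp
    then have "\<t> a c = Some (x \<otimes> inv h)" using t b by blast
    then have e: "a = c" "x \<otimes> inv h = \<one>" using K cm unfolding K_def by blast+
    have "x = h" using e(2) PM_D(5)[OF P b(2)] PM_D(5)[OF \<d> c] by (metis inv_equality inv_inv inv_closed)
    then show ?thesis using e c cm by simp
   qed
   have hi: "b <= m" if a: "a <= m" "\<g> a b = Some x" for a b x
   proof (rule ccontr)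
    assume b: "\<not> b <= m"
    then have "\<t> a b = Some x" using big a by simp
    then have "a = b" using K a unfolding K_def by blast
    then show False using a b by simp
   qed
   show "isblk m \<g> & sub (mtx_corner m \<g>) \<d>"
    unfolding isblk_def sub_def corner_Some using lo hi by blast
  next
   assume h: "isblk m \<g> & sub (mtx_corner m \<g>) \<d>"
   show K
    unfolding K_def
   proof (intro allI impI)
    fix a c x assume a: "\<t> a c = Some x & (a <= m \<or> c <= m)"
    then obtain b g k where b: "\<g> a b = Some g" "?E c b = Some k" "x = g \<otimes> inv k" using t by blast
    have ab: "a <= m <-> b <= m" using h b(1) unfolding isblk_def by blast
    have le: "a <= m" "b <= m" "c <= m" using a ab Ebig[OF b(2)] by force+
    have dk: "\<d> c b = Some k" using Esm[OF b(2)] le by blast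
    have "mtx_corner m \<g> a b = Some g" using b le by simp
    then have dg: "\<d> a b = Some g" by (rule subD[OF conjunct2[OF h]])
    have "a = c" using PM_D(7)[OF \<d> dg dk] .
    moreover then have "g = k" using dg dk by simp
    ultimately show "a = c & x = \<one>" using b(3) PM_D(5)[OF P b(1)] by simp
   qed
  qed
  finally show ?thesis .
 qed
qed

lemma XS_zc:
 fixes z :: "('a, 'f::field) zel"
 assumes z: "z : Zc 0" and d: "ldeg 0 z (Suc d)" and y: "keys y <= PM m"
  and n: "m <= n" and g: "\<g> : Gam m n" "d <= card (S m \<g>)"
 shows "XS m (res m z \<bullet>[m] csq m y) \<g> =
  (if isblk m \<g> then XS 0 z (outer m \<g>) * hat y (mtx_corner m \<g>) else 0)"
 using y
proof (induction rule: pm_induct)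
 interpret Z: falg "Zbar G m :: ('a, 'f) zalg" by (rule falg_Z)
 note P = Gam_PM[OF g(1)] and zm = homD(1)[OF res_hom z, of m]
 have c: "csq m (y :: ('a, 'f) fgel) : Zc m" if "keys y <= PM m" for y
  using homD(1)[OF csq_hom] that by simp
 {
  case zero
  have "csq m (0 :: ('a, 'f) fgel) = \<zero>\<^bsub>Zbar G m\<^esub>"
   using alg_hom_zero[OF falg_FG falg_Z csq_hom, of m] by simp
  then show ?case using zm XS_lin(3)[OF Z.zero_closed Z.zero_closed n P] by simp
 next
  case (single x e)
  have k: "keys (basis x :: ('a, 'f) fgel) <= PM m" using single by simp
  have "csq m (single x e) = e \<odot>\<^bsub>Zbar G m\<^esub> csq m (basis x)"
   using homD(5)[OF csq_hom, of "basis x" m e] k by simp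
  then have "XS m (res m z \<bullet>[m] csq m (single x e)) \<g> =
    e * XS m (res m z \<bullet>[m] csq m (basis x)) \<g>"
   using zm c[OF k] XS_lin(2)[OF Z.m_closed[OF zm c[OF k]] Z.zero_closed n P] by (simp add: Z.smult_mult_r)
  then show ?case using XS_zc_basis[OF z d single n g] by simp
 next
  case (add a b)
  have "csq m (a + b) = csq m a \<oplus>\<^bsub>Zbar G m\<^esub> csq m b"
   using homD(3)[OF csq_hom, of a m b] add(1,2) by simp
  then have "XS m (res m z \<bullet>[m] csq m (a + b)) \<g> =
    XS m (res m z \<bullet>[m] csq m a) \<g> + XS m (res m z \<bullet>[m] csq m b) \<g>"
   using zm c[OF add(1)] c[OF add(2)] XS_lin(1)[OF Z.m_closed[OF zm c[OF add(1)]] Z.m_closed[OF zm c[OF add(2)]] n P]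
   by (simp add: Z.r_distr)
  then show ?case using add by (simp add: distrib_left)
 }
qed

subsection \<open>Block matrices\<close>

lemma blk_PM:
 assumes "\<k> : PM n" "\<r> : PM m"
 shows "blk m \<k> \<r> : PM (n + m)"
 unfolding PM_iff blk_Some
proof (intro conjI allI impI)
 fix a b x assume "a <= m & b <= m & \<r> a b = Some x \<or> m < a & m < b & \<k> (a - m) (b - m) = Some x"
 then show "1 <= a" "a <= n + m" "1 <= b" "b <= n + m" "x : carrier G"
  using PM_D(1-5)[OF assms(1), of "a - m" "b - m" x] PM_D(1-5)[OF assms(2), of a b x] by auto
next
 fix a b b' x x' assume "a <= m & b <= m & \<r> a b = Some x \<or> m < a & m < b & \<k> (a - m) (b - m) = Some x"
  "a <= m & b' <= m & \<r> a b' = Some x' \<or> m < a & m < b' & \<k> (a - m) (b' - m) = Some x'"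
 then show "b = b'" using PM_D(6)[OF assms(1), of "a - m" "b - m" x "b' - m" x'] PM_D(6)[OF assms(2), of a b x b' x'] by auto
next
 fix a a' b x x' assume "a <= m & b <= m & \<r> a b = Some x \<or> m < a & m < b & \<k> (a - m) (b - m) = Some x"
  "a' <= m & b <= m & \<r> a' b = Some x' \<or> m < a' & m < b & \<k> (a' - m) (b - m) = Some x'"
 then show "a = a'" using PM_D(7)[OF assms(1), of "a - m" "b - m" x "a' - m" x'] PM_D(7)[OF assms(2), of a b x a' x'] by auto
qed

lemma blk_big:
 assumes "\<r> : PM m" "m < a"
 shows "a : rows (blk m \<k> \<r>) <-> a - m : rows (outer 0 \<k>)" "a : cols (blk m \<k> \<r>) <-> a - m : cols (outer 0 \<k>)"
proof -
 have "(\<exists>b x. blk m \<k> \<r> a b = Some x) <-> (\<exists>b x. outer 0 \<k> (a - m) b = Some x)"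
 proof
  assume "\<exists>b x. outer 0 \<k> (a - m) b = Some x"
  then obtain b x where "outer 0 \<k> (a - m) b = Some x" by blast
  then have "blk m \<k> \<r> a (b + m) = Some x" using assms(2) by (simp add: blk_Some)
  then show "\<exists>b x. blk m \<k> \<r> a b = Some x" by blast
 next
  assume "\<exists>b x. blk m \<k> \<r> a b = Some x"
  then obtain b x where "blk m \<k> \<r> a b = Some x" by blast
  then have "outer 0 \<k> (a - m) (b - m) = Some x" using assms(2) by (simp add: blk_Some)
  then show "\<exists>b x. outer 0 \<k> (a - m) b = Some x" by blast
 qed
 then show "a : rows (blk m \<k> \<r>) <-> a - m : rows (outer 0 \<k>)" by (simp add: rows_def)
 have "(\<exists>b x. blk m \<k> \<r> b a = Some x) <-> (\<exists>b x. outer 0 \<k> b (a - m) = Some x)"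
 proof
  assume "\<exists>b x. outer 0 \<k> b (a - m) = Some x"
  then obtain b x where "outer 0 \<k> b (a - m) = Some x" by blast
  then have "blk m \<k> \<r> (b + m) a = Some x" using assms(2) by (simp add: blk_Some)
  then show "\<exists>b x. blk m \<k> \<r> b a = Some x" by blast
 next
  assume "\<exists>b x. blk m \<k> \<r> b a = Some x"
  then obtain b x where "blk m \<k> \<r> b a = Some x" by blast
  then have "outer 0 \<k> (b - m) (a - m) = Some x" using assms(2) by (simp add: blk_Some)
  then show "\<exists>b x. outer 0 \<k> b (a - m) = Some x" by blast
 qed
 then show "a : cols (blk m \<k> \<r>) <-> a - m : cols (outer 0 \<k>)" by (simp add: cols_def)
qed

lemma outer_0: "\<k> : PM n ==> outer 0 \<k> = \<k>"
 by (rule mtxI) (auto dest: PM_D(1,3))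

lemma blk_Gam:
 assumes "\<k> : Gam 0 n" "\<r> : PM m"
 shows "blk m \<k> \<r> : Gam m (n + m)" "S m (blk m \<k> \<r>) = (%a. a + m) ` S 0 \<k>" "card (S m (blk m \<k> \<r>)) = card (S 0 \<k>)"
proof -
 note P = Gam_PM[OF assms(1)]
 have b: "a : rows (blk m \<k> \<r>) <-> a - m : rows \<k>" "a : cols (blk m \<k> \<r>) <-> a - m : cols \<k>" if "m < a" for a
  using blk_big[OF assms(2) that, of \<k>] outer_0[OF P] by auto
 show "blk m \<k> \<r> : Gam m (n + m)"
  using blk_PM[OF P assms(2)] assms(1) b by (auto simp: Gam_def)
 have mem: "a : S m (blk m \<k> \<r>) <-> m < a & a - m : S 0 \<k>" for a using b[of a] by (auto simp: S_def)
 show 1: "S m (blk m \<k> \<r>) = (%a. a + m) ` S 0 \<k>"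
 proof (intro Set.set_eqI iffI)
  fix a assume "a : S m (blk m \<k> \<r>)"
  then have "m < a" "a - m : S 0 \<k>" using mem by auto
  then show "a : (%a. a + m) ` S 0 \<k>" by (intro image_eqI[of _ _ "a - m"]) auto
 next
  fix a assume "a : (%a. a + m) ` S 0 \<k>"
  then obtain b where "a = b + m" "b : S 0 \<k>" by blast
  then show "a : S m (blk m \<k> \<r>)" using mem[of a] by (auto simp: S_def)
 qed
 show "card (S m (blk m \<k> \<r>)) = card (S 0 \<k>)" unfolding 1 by (rule card_image) simp
qed

lemma isblk_blk: "isblk m (blk m \<k> \<r>)"
 by (auto simp: isblk_def blk_Some)

lemma corner_blk: "\<r> : PM m ==> mtx_corner m (blk m \<k> \<r>) = \<r>"
 by (rule mtxI) (auto simp: blk_Some dest: PM_D(2,4))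

text \<open>A conjugation of the lower block, shifted by m and made trivial on
  \<open>{1..m}\<close>, is an admissible conjugation of the whole block matrix.\<close>

lemma blk_cj:
 assumes "pl_ok 0 n p l" "\<k> : PM n" "\<r> : PM m" "invf m (n + m) c"
 shows "c (blk m (cj p l \<k>) \<r>) = c (blk m \<k> \<r>)"
proof -
 define p' where "p' a = (if m < a then p (a - m) + m else a)" for a
 define l' where "l' a = (if m < a then l (a - m) else \<one>)" for a
 note P = pl_okD[OF assms(1)]
 have 0: "p 0 = 0" using P(6)[of 0] by simp
 have pos: "m < p' a <-> m < a" for a
  using P(9)[of "a - m"] by (auto simp: p'_def)
 have "bij p" using P(1) by (rule permutes_bij)
 have "p' permutes {m<..n + m}"
 proof (rule bij_imp_permutes)
  show "bij_betw p' {m<..n + m} {m<..n + m}"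
   unfolding bij_betw_def
  proof
   show "inj_on p' {m<..n + m}"
   proof (rule inj_onI)
    fix a b assume "a : {m<..n + m}" "b : {m<..n + m}" "p' a = p' b"
    then have "p (a - m) = p (b - m)" "m < a" "m < b" by (auto simp: p'_def)
    then show "a = b" using P(5)[of "a - m" "b - m"] by simp
   qed
   show "p' ` {m<..n + m} = {m<..n + m}"
   proof (intro equalityI subsetI)
    fix a assume "a : p' ` {m<..n + m}"
    then obtain b where b: "a = p' b" "m < b" "b <= n + m" by auto
    then have "p (b - m) <= n" "m < a" using P(8)[of "b - m"] pos[of b] by auto
    then show "a : {m<..n + m}" using b by (simp add: p'_def)
   next
    fix a assume a: "a : {m<..n + m}"
    obtain b where b: "p b = a - m" using \<open>bij p\<close> by (metis bij_pointE)
    then have "1 <= b" "b <= n" using P(8,9)[of b] a by auto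
    then show "a : p' ` {m<..n + m}" using a b by (intro image_eqI[of _ _ "b + m"]) (auto simp: p'_def)
   qed
  qed
  fix a assume "a ~: {m<..n + m}"
  then show "p' a = a" using P(10)[of "a - m"] by (auto simp: p'_def)
 qed
 then have ok: "pl_ok m (n + m) p' l'" unfolding pl_ok_def using P(2) by (auto simp: l'_def)
 have "blk m (cj p l \<k>) \<r> = cj p' l' (blk m \<k> \<r>)" (is "?l = ?r")
 proof (rule mtxI)
  fix a b x
  have "\<one> \<otimes> y \<otimes> inv \<one> = y" if "\<r> a b = Some y" for y using PM_D(5)[OF assms(3) that] by simp
  then show "?l a b = Some x <-> ?r a b = Some x"
   unfolding blk_Some cj_Some using pos[of a] pos[of b]
   by (cases "m < a"; cases "m < b") (auto simp: p'_def l'_def)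
 qed
 then show ?thesis using assms(4) ok blk_PM[OF assms(2,3)] by (simp add: invf_def)
qed

lemma outer_Gam:
 assumes "\<g> : Gam m n" "isblk m \<g>"
 shows "outer m \<g> : Gam 0 n" "S 0 (outer m \<g>) = S m \<g>"
proof -
 note P = Gam_PM[OF assms(1)]
 have r: "a : rows (outer m \<g>) <-> m < a & a : rows \<g>" for a
  using assms(2) unfolding isblk_def rows_def mem_Collect_eq outer_Some by (meson not_le)
 have c: "a : cols (outer m \<g>) <-> m < a & a : cols \<g>" for a
  using assms(2) unfolding isblk_def cols_def mem_Collect_eq outer_Some by (meson not_le)
 have "outer m \<g> : PM n" using P unfolding PM_iff outer_Some by blast
 then show "outer m \<g> : Gam 0 n" using assms(1) by (auto simp: Gam_def r c)
 show "S 0 (outer m \<g>) = S m \<g>" by (auto simp: S_def r c)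
qed

text \<open>The witness \<open>q\<close> undoes the shift by m on the moved support and sends all
  other outer indices to 0.\<close>

lemma sim_blk_outer:
 assumes "\<g> : Gam m n" "isblk m \<g>"
 shows "sim m \<g> (blk m (outer m \<g>) (mtx_corner m \<g>))"
proof -
 note P = Gam_PM[OF assms(1)]
 define q where "q a = (if a <= m then a else if a - m : S m \<g> then a - m else 0)" for a
 have n0: "\<g> 0 b ~= Some y" "\<g> b 0 ~= Some y" for b y using PM_D(1,3)[OF P] by fastforce+
 have S0: "m < a" if "a : S m \<g>" for a using that by (simp add: S_def)
 have io: "a : S m \<g> & b : S m \<g>" if "\<g> a b = Some y" "m < a" "m < b" for a b y
  using that rowsI[of \<g> a b y] colsI[of \<g> a b y] by (auto simp: S_def)
 have bl: "a <= m <-> b <= m" if "\<g> a b = Some y" for a b y using assms(2) that unfolding isblk_def by blast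
 have "blk m (outer m \<g>) (mtx_corner m \<g>) = cj q (%_. \<one>) \<g>" (is "?l = ?r")
 proof (rule mtxI)
  fix a b x
  have "cj q (%_. \<one>) \<g> a b = Some x <-> \<g> (q a) (q b) = Some x"
   unfolding cj_Some using PM_D(5)[OF P] by auto
  also have "... <-> blk m (outer m \<g>) (mtx_corner m \<g>) a b = Some x"
  proof (cases "a <= m"; cases "b <= m")
   assume "a <= m" "b <= m"
   then show ?thesis by (simp add: q_def blk_Some)
  next
   assume h: "a <= m" "\<not> b <= m"
   have "\<g> a (q b) ~= Some x" using h bl[of a "q b" x] n0 S0[of "b - m"] by (auto simp: q_def)
   then show ?thesis using h by (simp add: q_def[of a] blk_Some)
  next
   assume h: "\<not> a <= m" "b <= m"
   have "\<g> (q a) b ~= Some x" using h bl[of "q a" b x] n0 S0[of "a - m"] by (auto simp: q_def)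
   then show ?thesis using h by (simp add: q_def[of b] blk_Some)
  next
   assume h: "\<not> a <= m" "\<not> b <= m"
   have "\<g> (q a) (q b) = Some x <-> m < a - m & m < b - m & \<g> (a - m) (b - m) = Some x"
    using h n0 S0[of "a - m"] S0[of "b - m"] io[of "a - m" "b - m" x] by (auto simp: q_def)
   then show ?thesis using h by (simp add: blk_Some)
  qed
  finally show "?l a b = Some x <-> ?r a b = Some x" by simp
 qed
 moreover have "\<forall>b\<in>S m \<g>. \<exists>a>m. q a = b"
 proof
  fix b assume b: "b : S m \<g>"
  then show "\<exists>a>m. q a = b" using S0[OF b] by (intro exI[of _ "b + m"]) (simp add: q_def)
 qed
 ultimately show ?thesis unfolding sim_def
  by (intro exI[of _ q] exI[of _ "%_. \<one>"] conjI) (auto simp: q_def split: if_splits)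
qed

text \<open>Without paths every outer column has its entry in an outer row. This defines an
  injective self-map of the finite outer support, hence a surjective one, so outer rows have no
  entries left for columns up to m.\<close>

lemma noPath_isblk:
 assumes g: "\<g> : Gam m n" and np: "\<And>k. 1 <= k ==> k <= m ==> \<not> path m \<g> k"
 shows "isblk m \<g>"
proof -
 note P = Gam_PM[OF g]
 define f where "f b = (THE a. \<exists>x. \<g> a b = Some x)" for b
 have f: "f b = a" if "\<g> a b = Some x" for a b x
  unfolding f_def by (rule the_equality) (use that PM_D(7)[OF P] in blast)+
 have fS: "f b : S m \<g> & (\<exists>x. \<g> (f b) b = Some x)" if b: "b : S m \<g>" for b
 proof -
  obtain a x where a: "\<g> a b = Some x" using Gam_S(1)[OF g, of b] b by (auto simp: cols_def)
  have "m < b" using b by (simp add: S_def)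
  then have "\<not> a <= m" using np[of a] a PM_D(1)[OF P a] unfolding path_def by blast
  then have "a : S m \<g>" using rowsI[of \<g>, OF a] by (simp add: S_def)
  then show ?thesis using f[OF a] a by auto
 qed
 have "inj_on f (S m \<g>)"
 proof (rule inj_onI)
  fix b b' assume "b : S m \<g>" "b' : S m \<g>" "f b = f b'"
  then show "b = b'" using fS[of b] fS[of b'] PM_D(6)[OF P] by metis
 qed
 then have fs: "f ` S m \<g> = S m \<g>"
  using fS by (intro endo_inj_surj finite_S[OF P]) auto
 show ?thesis
  unfolding isblk_def
 proof (intro allI impI iffI)
  fix a b x assume x: "\<g> a b = Some x"
  show "b <= m" if "a <= m"
  proof (rule ccontr)
   assume "\<not> b <= m"
   then have "path m \<g> a" using x unfolding path_def by (intro exI[of _ b]) auto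
   then show False using np[of a] that PM_D(1)[OF P x] by blast
  qed
  show "a <= m" if bm: "b <= m"
  proof (rule ccontr)
   assume "\<not> a <= m"
   then have "a : S m \<g>" using rowsI[of \<g>, OF x] by (simp add: S_def)
   then obtain b' where b': "b' : S m \<g>" "a = f b'" using fs by blast
   then obtain y where "\<g> a b' = Some y" using fS by blast
   then have "b = b'" using PM_D(6)[OF P x] by blast
   then show False using b' bm by (simp add: S_def)
  qed
 qed
qed

section \<open>Realising top symbols and generation of the limit algebra\<close>

lemma isblk_noPath: "isblk m \<g> ==> k <= m ==> \<not> path m \<g> k"
 unfolding isblk_def path_def by (meson not_le)

lemma XS_u1:
 fixes c :: "('a, 'f::field) zel"
 assumes c: "c : Zc m" and k: "1 <= k" "k <= m" and n: "m <= n" and g: "\<g> : Gam m n"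
  and d: "ldeg m c d" "d <= card (S m \<g>)"
 shows "XS m (us m k \<bullet>[m] c) \<g> = (if path m \<g> k then XS m c (ctr1 k \<g>) else 0)"
proof -
 interpret Z: falg "Zbar G m :: ('a, 'f) zalg" by (rule falg_Z)
 have "us m k \<bullet>[m] c : Zc m" using us_Zbar[OF k] c by (rule Z.m_closed)
 from XS_u[OF c this k n g d] show ?thesis unfolding path_def ctr1_def pp_def .
qed

lemma card_S_cj:
 assumes "pl_ok m n p l" "\<g> : PM n" "m <= n"
 shows "card (S m (cj p l \<g>)) = card (S m \<g>)"
proof (rule bij_betw_same_card[of p])
 have b: "bij p" using pl_okD(1)[OF assms(1)] by (rule permutes_bij)
 show "bij_betw p (S m (cj p l \<g>)) (S m \<g>)"
  unfolding bij_betw_def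
 proof
  show "inj_on p (S m (cj p l \<g>))" using pl_okD(4)[OF assms(1)] inj_on_subset by blast
  show "p ` S m (cj p l \<g>) = S m \<g>"
  proof (intro Set.set_eqI iffI)
   fix a assume a: "a : S m \<g>"
   obtain c where "p c = a" using b by (metis bij_pointE)
   then show "a : p ` S m (cj p l \<g>)" using a Gam_cj(2)[OF assms] by blast
  qed (use Gam_cj(2)[OF assms] in blast)
 qed
qed

lemma rows_cj:
 assumes "pl_ok m n p l" "k <= m"
 shows "k : rows (cj p l \<g>) <-> k : rows \<g>" "path m (cj p l \<g>) k <-> path m \<g> k"
proof -
 note P = pl_okD[OF assms(1)]
 have s: "\<exists>j. p j = i" for i using permutes_bij[OF P(1)] by (metis bij_pointE)
 have pk: "p k = k" using P(6)[OF assms(2)] .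
 have e: "(\<exists>x. cj p l \<g> k j = Some x) <-> (\<exists>y. \<g> k (p j) = Some y)" for j unfolding cj_Some pk by blast
 show "k : rows (cj p l \<g>) <-> k : rows \<g>" unfolding rows_def mem_Collect_eq e using s by metis
 show "path m (cj p l \<g>) k <-> path m \<g> k" unfolding path_def e using s P(7) by (metis not_le)
qed

text \<open>Choosing the smallest row with a path makes the cases disjoint, so the parts of a top
  symbol can be realised separately and added.\<close>

definition lead :: "nat => 'a mtx => nat => bool" where
 "lead m \<g> k <-> path m \<g> k & (\<forall>j. 1 <= j --> j < k --> \<not> path m \<g> j)"

text \<open>An index beyond m and beyond the outer support; for a matrix of order n it is at most
  \<open>Suc n\<close>, so one additional order always provides room.\<close>

definition fr :: "nat => 'a mtx => nat" where "fr m \<g> = Suc (Max (insert m (S m \<g>)))"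

lemma fr:
 assumes "\<g> : PM n" "m <= n"
 shows "fr m \<g> ~: S m \<g>" "m < fr m \<g>" "fr m \<g> <= Suc n"
proof -
 have f: "finite (insert m (S m \<g>))" using assms by simp
 have "a <= Max (insert m (S m \<g>))" if "a : insert m (S m \<g>)" for a by (rule Max_ge[OF f that])
 then show "fr m \<g> ~: S m \<g>" "m < fr m \<g>" by (fastforce simp: fr_def)+
 have "Max (insert m (S m \<g>)) <= n" using f S_sub[OF assms(1), of m] assms(2) by (subst Max_le_iff) auto
 then show "fr m \<g> <= Suc n" by (simp add: fr_def)
qed

text \<open>Contracting i gives back \<open>\<g>\<close>, so inserting j instead is an instance of
  \<open>sim_ctr_ins\<close>.\<close>

lemma ins_fresh:
 assumes g: "\<g> : Gam m n" and k: "1 <= k" "k <= m" "k : rows \<g>" and c: "invf m n c" "m <= n"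
  and i: "i ~: S m \<g>" "m < i" "i <= n" and j: "j ~: S m \<g>" "m < j" "j <= n"
 shows "c (ins k j \<g>) = c (ins k i \<g>)"
proof -
 note I = ins_Gam[OF g k i]
 have "sim m (ins k i \<g>) (ins k j (ctr k i \<one> (ins k i \<g>)))"
  by (rule sim_ctr_ins[OF I(1,3) k(2) i(2)]) (use j I(2) in auto)
 then have "sim m (ins k i \<g>) (ins k j \<g>)" unfolding I(4) .
 then show ?thesis
  by (rule sim_inv) (use Gam_PM[OF I(1)] Gam_PM[OF ins_Gam(1)[OF g k j]] c in auto)
qed

text \<open>The permutation fixes \<open>Suc n\<close>. The label there is reset to 1 because
  \<open>pl_ok\<close> leaves labels beyond n arbitrary, while the inserted entry must remain
  1.\<close>

lemma ins_cj:
 assumes ok: "pl_ok m n p l" and g: "\<g> : PM n" and k: "1 <= k" "k <= m" and n: "m <= n"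
 shows "pl_ok m (Suc n) p (l(Suc n := \<one>))"
  "ins k (Suc n) (cj p l \<g>) = cj p (l(Suc n := \<one>)) (ins k (Suc n) \<g>)"
proof -
 note P = pl_okD[OF ok]
 show "pl_ok m (Suc n) p (l(Suc n := \<one>))"
 proof -
  have "p permutes {m<..Suc n}" by (rule permutes_subset[OF P(1)]) auto
  then show ?thesis unfolding pl_ok_def using P(2,3) n by auto
 qed
 have pn: "p (Suc n) = Suc n" by (rule P(10)) simp
 have pa: "p a = Suc n <-> a = Suc n" "p a = k <-> a = k" for a
  using P(5)[of a "Suc n"] P(5)[of a k] pn P(6)[OF k(2)] by auto
 have nk: "Suc n ~= k" using k n by simp
 have o: "\<g> a b ~= Some y" if "a = Suc n \<or> b = Suc n" for a b y using PM_D(2,4)[OF g, of a b y] that by auto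
 show "ins k (Suc n) (cj p l \<g>) = cj p (l(Suc n := \<one>)) (ins k (Suc n) \<g>)" (is "?l = ?r")
 proof (rule mtxI)
  fix a b x
  show "?l a b = Some x <-> ?r a b = Some x"
   unfolding cj_Some ins_Some pa using P(3)[OF k(2)] P(6)[OF k(2)] o[of "p a" "p b"] nk pn
   by (cases "a = k"; cases "a = Suc n"; cases "b = Suc n") auto
 qed
qed

text \<open>Every top symbol supported on the matrices with a path out of \<open>k\<close> is realised by left
 multiplication with \<open>u\<^sub>k\<close>: the factor carries the symbol on the contracted matrices, and inserting
 a fresh point reverses a contraction up to conjugation.\<close>

lemma lift_path:
 fixes \<a> :: "('a, 'f::field) zel"
 assumes a: "\<a> : Zc m" and d: "ldeg m \<a> (Suc (Suc e))" and k: "1 <= k" "k <= m"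
 shows "\<exists>\<b>\<in>Zc m. ldeg m \<b> (Suc e) & (\<forall>n\<ge>m. \<forall>\<g>\<in>Gam m n. Suc e <= card (S m \<g>) -->
  XS m (us m k \<bullet>[m] \<b>) \<g> = (if lead m \<g> k then XS m \<a> \<g> else 0))"
proof -
 define c where "c \<g> = (if lead m \<g> k then XS m \<a> \<g> else 0)" for \<g>
 \<comment> \<open>The prospective top symbol of the factor, concentrated on size e. The first
   conjunct is \<open>Gam\<close> without its order, so that b is a function of the matrix alone,
   and a nonzero row k is what every contraction at k leaves behind.\<close>
 define b where "b \<g> = (if (\<forall>a>m. a : rows \<g> <-> a : cols \<g>) & card (S m \<g>) = e & k : rows \<g>
  then c (ins k (fr m \<g>) \<g>) else 0)" for \<g>
 have ci: "invf m n c" if n: "m <= n" for n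
  unfolding invf_def
 proof (intro allI impI)
  fix p l \<g> assume ok: "pl_ok m n p l" and g: "\<g> : PM n"
  have "XS m \<a> (cj p l \<g>) = XS m \<a> \<g>" using inv_XS[OF a n] ok g unfolding invf_def by blast
  moreover have "lead m (cj p l \<g>) k <-> lead m \<g> k"
   unfolding lead_def using rows_cj(2)[OF ok, of _ \<g>] k(2) by (meson le_trans less_imp_le)
  ultimately show "c (cj p l \<g>) = c \<g>" by (simp add: c_def)
 qed
 have bi: "invf m n b" if n: "m <= n" for n
  unfolding invf_def
 proof (intro allI impI)
  fix p l \<g> assume ok: "pl_ok m n p l" and g: "\<g> : PM n"
  let ?\<g>' = "cj p l \<g>"
  have g': "?\<g>' : PM n" by (rule cj_PM[OF ok g n])
  have G: "(\<forall>a>m. a : rows ?\<g>' <-> a : cols ?\<g>') <-> (\<forall>a>m. a : rows \<g> <-> a : cols \<g>)"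
   using Gam_cj(1)[OF ok g n] g g' unfolding Gam_def by blast
  \<comment> \<open>The fresh index is a maximum and need not be respected by conjugation. Both
    insertions are therefore moved to \<open>Suc n\<close>, where insertion commutes with
    conjugation.\<close>
  have eq: "c (ins k (fr m ?\<g>') ?\<g>') = c (ins k (fr m \<g>) \<g>)"
   if r: "k : rows \<g>" and "\<forall>a>m. a : rows \<g> <-> a : cols \<g>"
  proof -
   have gG: "\<g> : Gam m (Suc n)" "?\<g>' : Gam m (Suc n)"
    using that(2) G g g' PM_mono[of n "Suc n"] unfolding Gam_def by auto
   have r': "k : rows ?\<g>'" using r rows_cj(1)[OF ok k(2)] by simp
   have f: "Suc n ~: S m \<g>" "Suc n ~: S m ?\<g>'" "m < Suc n" "Suc n <= Suc n" "m <= Suc n"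
    using S_sub[OF g, of m] S_sub[OF g', of m] n by auto
   have "c (ins k (fr m ?\<g>') ?\<g>') = c (ins k (Suc n) ?\<g>')"
    by (rule ins_fresh[OF gG(2) k r' ci[OF f(5)] f(5) f(2-4) fr[OF g' n]])
   also have "... = c (ins k (Suc n) \<g>)"
    using ci[OF f(5)] ins_cj(1)[OF ok g k n] Gam_PM[OF ins_Gam(1)[OF gG(1) k r f(1,3,4)]]
    unfolding invf_def ins_cj(2)[OF ok g k n] by blast
   also have "... = c (ins k (fr m \<g>) \<g>)"
    by (rule ins_fresh[OF gG(1) k r ci[OF f(5)] f(5) fr[OF g n] f(1,3,4)])
   finally show ?thesis .
  qed
  show "b ?\<g>' = b \<g>"
   unfolding b_def G card_S_cj[OF ok g n] rows_cj(1)[OF ok k(2)] using eq by auto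
 qed
 define \<b> where "\<b> = Xi m b"
 have \<b>: "\<b> : Zc m"
  unfolding \<b>_def by (rule Xi_closed[where d = e]) (use bi in "auto simp: b_def split: if_splits")
 have X: "XS m \<b> \<g> = b \<g>" if "m <= n" "\<g> : Gam m n" for \<g> n
  unfolding \<b>_def by (rule XS_Xi[OF _ that]) (use \<b> in "simp add: \<b>_def")
 have ld: "ldeg m \<b> (Suc e)"
  unfolding ldeg_def using X by (auto simp: b_def split: if_splits)
 have "XS m (us m k \<bullet>[m] \<b>) \<g> = c \<g>" if n: "m <= n" and g: "\<g> : Gam m n" and s: "Suc e <= card (S m \<g>)" for n \<g>
 proof (cases "path m \<g> k")
  case False
  then show ?thesis unfolding XS_u1[OF \<b> k n g ld s] by (simp add: c_def lead_def)
 next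
  case True
  then obtain i x where i: "m < i" "\<g> k i = Some x" by (auto simp: path_def)
  note P = Gam_PM[OF g]
  note C = ctr_Gam[OF g i(2) k(2) i(1)]
  have ce: "ctr1 k \<g> = ctr k i x \<g>" by (rule ctr1_eq[OF P i(2)])
  let ?\<d> = "ctr k i x \<g>"
  \<comment> \<open>If the contraction has size e, inserting a fresh index returns
    \<open>\<g>\<close> up to conjugacy. If its size is larger, \<open>\<g>\<close> exceeds the
    degree of \<open>\<a>\<close> and both sides vanish.\<close>
  have "b ?\<d> = c \<g>"
  proof (cases "card (S m ?\<d>) = e")
   case True
   have cond: "\<forall>a>m. a : rows ?\<d> <-> a : cols ?\<d>" using C(1) by (simp add: Gam_def)
   note f = fr[OF Gam_PM[OF C(1)] n]
   have sm: "sim m \<g> (ins k (fr m ?\<d>) ?\<d>)"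
    by (rule sim_ctr_ins[OF g i(2) k(2) i(1)]) (use f C(2) in auto)
   have "ins k (fr m ?\<d>) ?\<d> : Gam m (Suc n)"
    by (rule ins_Gam(1)[OF _ k C(4) f]) (use C(1) Gam_mono[of n "Suc n"] in auto)
   from sim_inv[OF sm _ Gam_PM[OF this] _ ci] have "c (ins k (fr m ?\<d>) ?\<d>) = c \<g>"
    using P PM_mono[of n "Suc n"] n by auto
   then show ?thesis using True cond C(4) by (simp add: b_def)
  next
   case False
   then have "card (S m \<g>) >= Suc (Suc e)" using s C(5) by simp
   then have "XS m \<a> \<g> = 0" using d n g unfolding ldeg_def by (meson not_le)
   then show ?thesis using False by (simp add: b_def c_def)
  qed
  then show ?thesis unfolding XS_u1[OF \<b> k n g ld s] ce using True X[OF n C(1)] by simp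
 qed
 then show ?thesis using \<b> ld unfolding c_def by blast
qed

text \<open>At \<open>n = m\<close> there is nothing to pad, and the elements
  \<open>fel m m \<r>\<close> form the basis dual to the coordinates \<open>hat\<close>.\<close>

lemma hat_fel_eq:
 assumes "\<r> : PM m" "\<e> : PM m"
 shows "hat (fel m m \<r> :: ('a, 'f::field) fgel) \<e> = (if \<e> = \<r> then 1 else 0)"
proof -
 have p: "padd m m \<r> = \<r>" by (rule mtxI) (auto simp: padd_Some)
 have "\<e> = \<r>" if s: "sub \<e> \<r>" and c: "cols \<r> <= cols \<e>"
 proof (rule sub_supp_eq[OF s], rule subsetI)
  fix z assume "z : supp \<r>"
  then obtain i j x where z: "z = (i, j)" "\<r> i j = Some x" by (auto simp: supp_def)
  then have "j : cols \<e>" using c colsI[of \<r>, OF z(2)] by blast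
  then obtain i' y where y: "\<e> i' j = Some y" by (auto simp: cols_def)
  then have "i' = i" using PM_D(7)[OF assms(1) subD[OF s y] z(2)] by simp
  then show "z : supp \<e>" using y z by (auto simp: supp_def)
 qed
 then show ?thesis unfolding hat_fel[OF assms(1)] p by auto
qed

text \<open>The symbol of z at \<open>\<k>\<close> is that of \<open>\<a>\<close> at the block
  matrix made of \<open>\<k>\<close> and \<open>\<r>\<close>; the dual element
  \<open>fel m m \<r>\<close> then selects the corner \<open>\<r>\<close>.\<close>

lemma lift_block:
 fixes \<a> :: "('a, 'f::field) zel"
 assumes a: "\<a> : Zc m" and d: "ldeg m \<a> (Suc d)" and \<r>: "\<r> : PM m"
 shows "\<exists>z\<in>Zc 0. \<forall>n\<ge>m. \<forall>\<g>\<in>Gam m n. d <= card (S m \<g>) -->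
  XS m (res m z \<bullet>[m] csq m (fel m m \<r>)) \<g> =
  (if isblk m \<g> & mtx_corner m \<g> = \<r> then XS m \<a> \<g> else 0)"
proof -
 define b where "b \<k> = (if card (S 0 \<k>) = d then XS m \<a> (blk m \<k> \<r>) else 0)" for \<k>
 have bi: "invf 0 n b" for n
  unfolding invf_def
 proof (intro allI impI)
  fix p l \<k> assume ok: "pl_ok 0 n p l" and g: "\<k> : PM n"
  show "b (cj p l \<k>) = b \<k>"
   unfolding b_def card_S_cj[OF ok g le0] blk_cj[OF ok g \<r> inv_XS[OF a le_add2]] ..
 qed
 define z where "z = Xi 0 b"
 have z: "z : Zc 0"
  unfolding z_def by (rule Xi_closed[where d = d]) (use bi in "auto simp: b_def split: if_splits")
 have X: "XS 0 z \<g> = b \<g>" if "\<g> : Gam 0 n" for \<g> n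
  unfolding z_def by (rule XS_Xi[OF _ le0 that]) (use z in "simp add: z_def")
 have ld: "ldeg 0 z (Suc d)"
  unfolding ldeg_def using X by (auto simp: b_def split: if_splits)
 have "XS m (res m z \<bullet>[m] csq m (fel m m \<r>)) \<g> =
  (if isblk m \<g> & mtx_corner m \<g> = \<r> then XS m \<a> \<g> else 0)"
  if n: "m <= n" and g: "\<g> : Gam m n" and s: "d <= card (S m \<g>)" for n \<g>
 proof (cases "isblk m \<g> & mtx_corner m \<g> = \<r>")
  case False
  then show ?thesis
   unfolding XS_zc[OF z ld fel_PM[OF \<r>] n g s] hat_fel_eq[OF \<r> corner_PM[OF Gam_PM[OF g]]] by auto
 next
  case True
  note o = outer_Gam[OF g conjunct1[OF True]]
  have 1: "XS m (res m z \<bullet>[m] csq m (fel m m \<r>)) \<g> = b (outer m \<g>)"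
   using True X[OF o(1)]
   unfolding XS_zc[OF z ld fel_PM[OF \<r>] n g s] hat_fel_eq[OF \<r> corner_PM[OF Gam_PM[OF g]]] by simp
  have sm: "sim m \<g> (blk m (outer m \<g>) \<r>)" using sim_blk_outer[OF g conjunct1[OF True]] True by simp
  have 2: "XS m \<a> (blk m (outer m \<g>) \<r>) = XS m \<a> \<g>"
   by (rule sim_inv[OF sm _ blk_PM[OF Gam_PM[OF o(1)] \<r>] le_add2 inv_XS[OF a le_add2]])
    (use Gam_PM[OF g] PM_mono[of n "n + m"] in auto)
  have "b (outer m \<g>) = XS m \<a> \<g>"
  proof (cases "card (S m \<g>) = d")
   case False
   then have "XS m \<a> \<g> = 0" using d n g s unfolding ldeg_def by (metis le_antisym less_Suc_eq_le)
   then show ?thesis using False o(2) by (simp add: b_def)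
  qed (use 2 o(2) in "simp add: b_def")
  then show ?thesis using 1 True by simp
 qed
 then show ?thesis using z by blast
qed

text \<open>Induction on the degree bound. The top symbol is divided according to the leading row of
  a path or, when there is no path, according to the corner of the block matrix; each piece is
  realised inside \<open>W\<close>.\<close>

lemma Zbar_span_aux:
 fixes W :: "(('a, 'f::field) zel) set"
 assumes W: "is_subalg W (Zbar G m)" and z: "res m ` Zc 0 <= W"
  and c: "csq m ` Fc m <= W" and u: "\<And>k. 1 <= k ==> k <= m ==> us m k : W"
 shows "\<a> : Zc m ==> ldeg m \<a> d ==> \<a> : W"
proof (induction d arbitrary: \<a>)
 case 0
 then have "\<a> = \<zero>\<^bsub>Zbar G m\<^esub>" by (intro XS_inj) (auto simp: ldeg_def)
 then show ?case using is_subalgD(3)[OF W] by simp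
next
 case (Suc d)
 interpret Z: falg "Zbar G m :: ('a, 'f) zalg" by (rule falg_Z)
 note w = is_subalgD[OF W]
 note a = Suc.prems(1)
 \<comment> \<open>The part of the top symbol of \<open>\<a>\<close> supported on \<open>Q\<close>
   is the top symbol of an element of \<open>W\<close>. Disjoint unions correspond to sums.\<close>
 define rep where "rep Q <-> (\<exists>v\<in>W. \<forall>n\<ge>m. \<forall>\<g>\<in>Gam m n. d <= card (S m \<g>) --> XS m v \<g> = (if Q \<g> then XS m \<a> \<g> else 0))" for Q
 have rep0: "rep (%_. False)"
  unfolding rep_def
  by (rule bexI[OF _ w(3)]) (use XS_lin(3)[OF Z.zero_closed Z.zero_closed _ Gam_PM] in auto)
 have repU: "rep (%\<g>. Q \<g> \<or> Q' \<g>)" if QQ: "rep Q" "rep Q'" "\<And>\<g>. Q \<g> ==> \<not> Q' \<g>" for Q Q'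
 proof -
  obtain v where v: "v : W" "\<And>n \<g>. m <= n ==> \<g> : Gam m n ==> d <= card (S m \<g>) ==> XS m v \<g> = (if Q \<g> then XS m \<a> \<g> else 0)"
   using QQ(1) unfolding rep_def by blast
  obtain v' where v': "v' : W" "\<And>n \<g>. m <= n ==> \<g> : Gam m n ==> d <= card (S m \<g>) ==> XS m v' \<g> = (if Q' \<g> then XS m \<a> \<g> else 0)"
   using QQ(2) unfolding rep_def by blast
  have "XS m (v \<oplus>\<^bsub>Zbar G m\<^esub> v') \<g> = (if Q \<g> \<or> Q' \<g> then XS m \<a> \<g> else 0)"
   if "m <= n" "\<g> : Gam m n" "d <= card (S m \<g>)" for n \<g>
  proof -
   have "XS m (v \<oplus>\<^bsub>Zbar G m\<^esub> v') \<g> = XS m v \<g> + XS m v' \<g>"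
    by (rule XS_lin(1)[OF subsetD[OF w(1) v(1)] subsetD[OF w(1) v'(1)] that(1) Gam_PM[OF that(2)]])
   then show ?thesis unfolding v(2)[OF that] v'(2)[OF that] using QQ(3)[of \<g>] by simp
  qed
  then show ?thesis unfolding rep_def using w(4)[OF v(1) v'(1)] by blast
 qed
 have repF: "rep (%\<g>. \<exists>i\<in>I. Q i \<g>)"
  if "finite I" "\<And>i. i : I ==> rep (Q i)" "\<And>i j \<g>. i : I ==> j : I ==> Q i \<g> ==> Q j \<g> ==> i = j" for I :: "'i set" and Q
  using that
 proof (induction I rule: finite_induct)
  case empty
  then show ?case using rep0 by simp
 next
  case (insert i I)
  have 1: "rep (%\<g>. \<exists>i\<in>I. Q i \<g>)" by (rule insert.IH) (use insert.prems in blast)+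
  have "rep (%\<g>. Q i \<g> \<or> (\<exists>i\<in>I. Q i \<g>))"
  proof (rule repU[OF _ 1])
   show "rep (Q i)" by (rule insert.prems) simp
   show "\<not> (\<exists>i\<in>I. Q i \<g>)" if "Q i \<g>" for \<g>
    using insert.hyps insert.prems(2)[of i _ \<g>] that by blast
  qed
  then show ?case by simp
 qed
 have lp: "rep (%\<g>. lead m \<g> k)" if k: "k : {1..m}" for k
 proof (cases d)
  case 0
  \<comment> \<open>With bound 1 only matrices with empty outer support carry coordinates, and a
    path would need an outer column.\<close>
  have "XS m \<a> \<g> = 0" if n: "m <= n" and g: "\<g> : Gam m n" and l: "lead m \<g> k" for n \<g>
  proof (rule ccontr)
   assume "XS m \<a> \<g> ~= 0"
   then have "card (S m \<g>) < Suc d" using Suc.prems(2) n g unfolding ldeg_def by blast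
   then have "S m \<g> = {}" using 0 finite_S[OF Gam_PM[OF g], of m] by simp
   moreover obtain i x where "m < i" "\<g> k i = Some x" using l by (auto simp: lead_def path_def)
   ultimately show False using colsI[of \<g> k i x] by (auto simp: S_def)
  qed
  then show ?thesis using rep0 unfolding rep_def by (metis (no_types, lifting))
 next
  case (Suc e)
  obtain \<b> where \<b>: "\<b> : Zc m" "ldeg m \<b> (Suc e)"
   "\<forall>n\<ge>m. \<forall>\<g>\<in>Gam m n. Suc e <= card (S m \<g>) -->
    XS m (us m k \<bullet>[m] \<b>) \<g> = (if lead m \<g> k then XS m \<a> \<g> else 0)"
   using lift_path[OF a, of e k] Suc.prems(2) Suc k by auto
  \<comment> \<open>The factor has the smaller bound d, so the induction hypothesis puts it into
    \<open>W\<close>; multiplying by \<open>u_k\<close> raises the degree again.\<close>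
  have "\<b> : W" using Suc.IH[OF \<b>(1)] \<b>(2) Suc by simp
  then have "us m k \<bullet>[m] \<b> : W" using u k by (intro w(5)) auto
  then show ?thesis unfolding rep_def using \<b>(3) Suc by blast
 qed
 have lb: "rep (%\<g>. isblk m \<g> & mtx_corner m \<g> = \<r>)" if \<r>: "\<r> : PM m" for \<r>
 proof -
  obtain y where y: "y : Zc 0" "\<forall>n\<ge>m. \<forall>\<g>\<in>Gam m n. d <= card (S m \<g>) -->
   XS m (res m y \<bullet>[m] csq m (fel m m \<r>)) \<g> =
   (if isblk m \<g> & mtx_corner m \<g> = \<r> then XS m \<a> \<g> else 0)"
   using lift_block[OF a Suc.prems(2) \<r>] by blast
  have "res m y \<bullet>[m] csq m (fel m m \<r>) : W"
  proof (rule w(5))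
   show "res m y : W" using z y(1) by blast
   have "fel m m \<r> : carrier (FGbar G m :: ('a, 'f) fgalg)" using fel_PM[OF \<r>] by simp
   then show "csq m (fel m m \<r>) : W" using c by blast
  qed
  then show ?thesis unfolding rep_def using y(2) by blast
 qed
 have r1: "rep (%\<g>. \<exists>k\<in>{1..m}. lead m \<g> k)"
 proof (rule repF[OF _ lp])
  fix i j \<g> assume "i : {1..m}" "j : {1..m}" "lead m \<g> i" "lead m \<g> j"
  then show "i = j" unfolding lead_def atLeastAtMost_iff by (metis linorder_neqE_nat)
 qed simp
 have r2: "rep (%\<g>. \<exists>\<r>\<in>PM m. isblk m \<g> & mtx_corner m \<g> = \<r>)"
  by (rule repF) (use lb in auto)
 have "rep (%\<g>. (\<exists>k\<in>{1..m}. lead m \<g> k) \<or> (\<exists>\<r>\<in>PM m. isblk m \<g> & mtx_corner m \<g> = \<r>))"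
 proof (rule repU[OF r1 r2])
  fix \<g> assume "\<exists>k\<in>{1..m}. lead m \<g> k"
  then show "\<not> (\<exists>\<r>\<in>PM m. isblk m \<g> & mtx_corner m \<g> = \<r>)"
   using isblk_noPath[of m \<g>] by (auto simp: lead_def)
 qed
 then obtain v where v: "v : W" "\<And>n \<g>. m <= n ==> \<g> : Gam m n ==> d <= card (S m \<g>) ==>
  XS m v \<g> = (if (\<exists>k\<in>{1..m}. lead m \<g> k) \<or> (\<exists>\<r>\<in>PM m. isblk m \<g> & mtx_corner m \<g> = \<r>) then XS m \<a> \<g> else 0)"
  unfolding rep_def by blast
 have all: "(\<exists>k\<in>{1..m}. lead m \<g> k) \<or> (\<exists>\<r>\<in>PM m. isblk m \<g> & mtx_corner m \<g> = \<r>)"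
  if n: "m <= n" and g: "\<g> : Gam m n" for n \<g>
 proof (cases "\<exists>k. 1 <= k & k <= m & path m \<g> k")
  case True
  define k where "k = (LEAST k. 1 <= k & k <= m & path m \<g> k)"
  have k: "1 <= k & k <= m & path m \<g> k" unfolding k_def by (rule LeastI_ex[OF True])
  have "\<not> path m \<g> j" if "1 <= j" "j < k" for j
   using not_less_Least[of j "%k. 1 <= k & k <= m & path m \<g> k"] that k unfolding k_def[symmetric] by auto
  then have "lead m \<g> k" using k unfolding lead_def by blast
  then show ?thesis using k by auto
 next
  case False
  then have "isblk m \<g>" by (intro noPath_isblk[OF g]) auto
  then show ?thesis using corner_PM[OF Gam_PM[OF g], of m] by blast
 qed
 have vc: "v : Zc m" using v(1) w(1) by blast
 \<comment> \<open>Subtracting the realised top symbol lowers the bound from \<open>Suc d\<close> to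
   d.\<close>
 define r where "r = \<a> \<oplus>\<^bsub>Zbar G m\<^esub> (- 1) \<odot>\<^bsub>Zbar G m\<^esub> v"
 have rc: "r : Zc m" using a vc by (simp add: r_def)
 have "XS m r \<g> = 0" if "m <= n" "\<g> : Gam m n" "d <= card (S m \<g>)" for n \<g>
  using XS_lin(1)[OF a Z.smult_closed[OF vc] that(1) Gam_PM[OF that(2)]] XS_lin(2)[OF vc vc that(1) Gam_PM[OF that(2)]]
   v(2)[OF that] all[OF that(1,2)] unfolding r_def by auto
 then have "ldeg m r d" unfolding ldeg_def by (meson not_le)
 then have "r : W" by (rule Suc.IH[OF rc])
 moreover have "\<a> = r \<oplus>\<^bsub>Zbar G m\<^esub> v"
  using a vc by (simp add: r_def Z.smult_minus_one Z.a_assoc Z.l_neg)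
 ultimately show ?case using w(4)[OF _ v(1), of r] by simp
qed

lemma Zbar_span:
 fixes W :: "(('a, 'f::field) zel) set"
 assumes "is_subalg W (Zbar G m)" "res m ` Zc 0 <= W"
  "csq m ` Fc m <= W" "\<And>k. 1 <= k ==> k <= m ==> us m k : W"
 shows "Zc m <= W"
 using Zbar_span_aux[OF assms] ldeg_exists by blast

section \<open>Iterated contractions and independence over \<open>Zbar G 0\<close>\<close>

definition uact :: "nat => nat list => (('a, 'f::field) zel) => ('a, 'f) zel" where
 "uact m ks v = foldr (%k w. us m k \<bullet>[m] w) ks v"

lemma uact_simps [simp]: "uact m [] v = v" "uact m (k # ks) v = us m k \<bullet>[m] uact m ks v"
 by (simp_all add: uact_def)

lemma uact_closed:
 fixes v :: "('a, 'f::field) zel"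
 assumes "is_subalg W (Zbar G m)" "set ks <= {1..m}" "\<And>k. 1 <= k ==> k <= m ==> us m k : W" "v : W"
 shows "uact m ks v : W"
 using assms(2) by (induction ks) (use assms is_subalgD(5)[OF assms(1)] in auto)

lemma uact_carrier:
 fixes v :: "('a, 'f::field) zel"
 assumes "set ks <= {1..m}" "v : Zc m"
 shows "uact m ks v : Zc m"
 by (rule uact_closed[OF subalg_c[OF falg_Z] assms(1) _ assms(2)]) (rule us_Zbar)

lemma res_uact:
 fixes v :: "('a, 'f::field) zel"
 assumes "z : Zc 0" "v : Zc m" "set ks <= {1..m}"
 shows "res m z \<bullet>[m] uact m ks v = uact m ks (res m z \<bullet>[m] v)"
 using assms(3)
proof (induction ks)
 interpret Z: falg "Zbar G m :: ('a, 'f) zalg" by (rule falg_Z)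
 case (Cons k ks)
 have k: "(us m k :: ('a, 'f) zel) : Zc m" using Cons.prems by (intro us_Zbar) auto
 have z: "res m z : Zc m" by (rule homD(1)[OF res_hom assms(1)])
 have u: "uact m ks v : Zc m" using Cons.prems by (intro uact_carrier assms(2)) auto
 have "res m z \<bullet>[m] uact m (k # ks) v = (res m z \<bullet>[m] us m k) \<bullet>[m] uact m ks v"
  using Z.m_assoc[OF z k u] by simp
 also have "... = us m k \<bullet>[m] (res m z \<bullet>[m] uact m ks v)"
  unfolding res_comm[OF assms(1) k] by (rule Z.m_assoc[OF k z u])
 finally show ?case using Cons by simp
qed simp

text \<open>The outermost factor of a product is evaluated first, so the contractions run through
  the word from left to right; \<open>None\<close> records that a required path is missing.\<close>

fun ctrs :: "nat => nat list => 'a mtx => 'a mtx option" where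
 "ctrs m [] \<g> = Some \<g>"
| "ctrs m (k # ks) \<g> = (if path m \<g> k then ctrs m ks (ctr1 k \<g>) else None)"

lemma ctr1_Gam:
 assumes "\<g> : Gam m n" "path m \<g> k" "k <= m"
 shows "ctr1 k \<g> : Gam m n" "Suc (card (S m (ctr1 k \<g>))) = card (S m \<g>)"
proof -
 obtain i x where i: "m < i" "\<g> k i = Some x" using assms(2) by (auto simp: path_def)
 show "ctr1 k \<g> : Gam m n" "Suc (card (S m (ctr1 k \<g>))) = card (S m \<g>)"
  unfolding ctr1_eq[OF Gam_PM[OF assms(1)] i(2)] using ctr_Gam[OF assms(1) i(2) assms(3) i(1)] by auto
qed

text \<open>Each letter raises the degree by one and, on top symbols, contracts once; the size
  hypothesis keeps every intermediate evaluation in the top range required by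
  \<open>XS_u1\<close>.\<close>

lemma XS_uact:
 fixes v :: "('a, 'f::field) zel"
 assumes v: "v : Zc m" "ldeg m v (Suc e)" and ks: "set ks <= {1..m}"
 shows "ldeg m (uact m ks v) (Suc (e + length ks)) & (\<forall>n\<ge>m. \<forall>\<g>\<in>Gam m n. e + length ks <= card (S m \<g>) -->
  XS m (uact m ks v) \<g> = (case ctrs m ks \<g> of None => 0 | Some \<g>' => XS m v \<g>'))"
 using ks
proof (induction ks)
 case Nil
 then show ?case using v by simp
next
 case (Cons k ks)
 have k: "1 <= k" "k <= m" and ks: "set ks <= {1..m}" using Cons.prems by auto
 have u: "uact m ks v : Zc m" by (rule uact_carrier[OF ks v(1)])
 have ld: "ldeg m (uact m ks v) (Suc (e + length ks))"
  and IH: "\<And>n \<g>. m <= n ==> \<g> : Gam m n ==> e + length ks <= card (S m \<g>) ==>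
   XS m (uact m ks v) \<g> = (case ctrs m ks \<g> of None => 0 | Some \<g>' => XS m v \<g>')"
  using Cons.IH[OF ks] by auto
 have X: "XS m (uact m (k # ks) v) \<g> = (if path m \<g> k then XS m (uact m ks v) (ctr1 k \<g>) else 0)"
  if "m <= n" "\<g> : Gam m n" "Suc (e + length ks) <= card (S m \<g>)" for n \<g>
  unfolding uact_simps by (rule XS_u1[OF u k that(1,2) ld that(3)])
 have "ldeg m (uact m (k # ks) v) (Suc (e + length (k # ks)))"
  unfolding ldeg_def
 proof (intro allI impI ballI)
  fix n \<g> assume n: "m <= n" and g: "\<g> : Gam m n" and nz: "XS m (uact m (k # ks) v) \<g> ~= 0"
  show "card (S m \<g>) < Suc (e + length (k # ks))"
  proof (rule ccontr)
   assume "\<not> card (S m \<g>) < Suc (e + length (k # ks))"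
   then have c: "Suc (Suc (e + length ks)) <= card (S m \<g>)" by simp
   then have p: "path m \<g> k" "XS m (uact m ks v) (ctr1 k \<g>) ~= 0" using nz X[OF n g] by (auto split: if_splits)
   note C = ctr1_Gam[OF g p(1) k(2)]
   have "card (S m (ctr1 k \<g>)) < Suc (e + length ks)" using ld n C(1) p(2) unfolding ldeg_def by blast
   then show False using C(2) c by simp
  qed
 qed
 moreover have "XS m (uact m (k # ks) v) \<g> = (case ctrs m (k # ks) \<g> of None => 0 | Some \<g>' => XS m v \<g>')"
  if n: "m <= n" and g: "\<g> : Gam m n" and c: "e + length (k # ks) <= card (S m \<g>)" for n \<g>
 proof (cases "path m \<g> k")
  case True
  note C = ctr1_Gam[OF g True k(2)]
  have "e + length ks <= card (S m (ctr1 k \<g>))" using C(2) c by simp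
  from IH[OF n C(1) this] show ?thesis using X[OF n g] c True by simp
 qed (use X[OF n g] c in simp)
 ultimately show ?case by blast
qed

lemma ctrs_Gam:
 assumes "\<g> : Gam m n" "set ks <= {1..m}" "ctrs m ks \<g> = Some \<g>'"
 shows "\<g>' : Gam m n" "card (S m \<g>') + length ks = card (S m \<g>)"
proof -
 have "\<g>' : Gam m n & card (S m \<g>') + length ks = card (S m \<g>)"
  using assms
 proof (induction ks arbitrary: \<g>)
  case (Cons k ks)
  have p: "path m \<g> k" using Cons.prems by (auto split: if_splits)
  have k: "k <= m" using Cons.prems by simp
  note C = ctr1_Gam[OF Cons.prems(1) p k]
  have "\<g>' : Gam m n & card (S m \<g>') + length ks = card (S m (ctr1 k \<g>))"
   by (rule Cons.IH[OF C(1)]) (use Cons.prems p in auto)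
  then show ?case using C(2) by simp
 qed simp
 then show "\<g>' : Gam m n" "card (S m \<g>') + length ks = card (S m \<g>)" by auto
qed

lemma ctrs_insert:
 assumes g: "\<g> : Gam m n" and ks: "set ks <= rows \<g>" "set ks <= {1..m}" and n: "m <= n"
 shows "\<exists>N \<e>. m <= N & \<e> : Gam m N & rows \<g> <= rows \<e> & ctrs m ks \<e> = Some \<g> & card (S m \<e>) = card (S m \<g>) + length ks"
 using ks
proof (induction ks)
 case Nil
 then show ?case using g n by auto
next
 case (Cons k ks)
 then obtain N \<e> where e: "m <= N" "\<e> : Gam m N" "rows \<g> <= rows \<e>" "ctrs m ks \<e> = Some \<g>" "card (S m \<e>) = card (S m \<g>) + length ks"
  by auto
 let ?i = "Suc N"
 have k: "1 <= k" "k <= m" "k : rows \<e>" using Cons.prems e(3) by auto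
 have i: "?i ~: S m \<e>" "m < ?i" "?i <= ?i" using S_sub[OF Gam_PM[OF e(2)], of m] e(1) by auto
 have e': "\<e> : Gam m ?i" using e(2) Gam_mono[of N ?i m] by auto
 note I = ins_Gam[OF e' k i]
 have "path m (ins k ?i \<e>) k" unfolding path_def using I(3) i(2) by blast
 moreover have "ctr1 k (ins k ?i \<e>) = \<e>" using ctr1_eq[OF Gam_PM[OF I(1)] I(3)] I(4) by simp
 ultimately have "ctrs m (k # ks) (ins k ?i \<e>) = Some \<g>" using e(4) by simp
 moreover have "card (S m (ins k ?i \<e>)) = card (S m \<g>) + length (k # ks)"
  using I(2) i(1) e(5) finite_S[OF Gam_PM[OF e(2)], of m] by simp
 moreover have "rows \<g> <= rows (ins k ?i \<e>)" using I(5) e(3) by auto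
 moreover have "m <= ?i" using e(1) by simp
 ultimately show ?case using I(1) by blast
qed

text \<open>Two different rows have their entries in different columns i and i'. Contracting at k
  only alters row k and removes i, so the entry at k' and its column survive.\<close>

lemma ctr1_commute:
 assumes g: "\<g> : Gam m n" and k: "k <= m" "k' <= m" "k ~= k'" and p: "path m \<g> k" "path m \<g> k'"
 shows "path m (ctr1 k \<g>) k'" "ctr1 k' (ctr1 k \<g>) = ctr1 k (ctr1 k' \<g>)"
proof -
 note P = Gam_PM[OF g]
 obtain i x where i: "m < i" "\<g> k i = Some x" using p(1) by (auto simp: path_def)
 obtain i' x' where i': "m < i'" "\<g> k' i' = Some x'" using p(2) by (auto simp: path_def)
 have ii: "i ~= i'" using PM_D(7)[OF P i(2), of k' x'] i'(2) k(3) by auto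
 have ne: "k ~= i" "k' ~= i'" "k ~= i'" "k' ~= i" using i i' k by auto
 note C = ctr_Some[OF P i(2) ne(1)] and C' = ctr_Some[OF P i'(2) ne(2)]
 have a: "ctr k i x \<g> k' i' = Some x'" unfolding C using ne ii k(3) i'(2) by simp
 have a': "ctr k' i' x' \<g> k i = Some x" unfolding C' using ne ii k(3) i(2) by simp
 note Q = ctr_PM[OF P i(2) ne(1)] and Q' = ctr_PM[OF P i'(2) ne(2)]
 show "path m (ctr1 k \<g>) k'" unfolding ctr1_eq[OF P i(2)] path_def using a i'(1) by blast
 show "ctr1 k' (ctr1 k \<g>) = ctr1 k (ctr1 k' \<g>)"
  unfolding ctr1_eq[OF P i(2)] ctr1_eq[OF P i'(2)] ctr1_eq[OF Q a] ctr1_eq[OF Q' a']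
 proof (rule mtxI)
  fix b c y
  show "ctr k' i' x' (ctr k i x \<g>) b c = Some y <-> ctr k i x (ctr k' i' x' \<g>) b c = Some y"
   unfolding ctr_Some[OF Q a ne(2)] ctr_Some[OF Q' a' ne(1)] C C' using ii k(3) ne
   by (cases "b = k"; cases "b = k'") auto
 qed
qed

text \<open>A block matrix has no path at k, so the word must contract at k at some point; commuting
  contractions brings the first such letter to the front.\<close>

lemma ctrs_pull:
 assumes "\<g> : Gam m n" "set ks <= {1..m}" "ctrs m ks \<g> = Some \<g>'" "isblk m \<g>'" "path m \<g> k" "k <= m"
 shows "k : set ks & ctrs m (remove1 k ks) (ctr1 k \<g>) = Some \<g>'"
 using assms
proof (induction ks arbitrary: \<g>)
 case Nil
 then show ?case using isblk_noPath by auto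
next
 case (Cons j ks)
 have p: "path m \<g> j" "ctrs m ks (ctr1 j \<g>) = Some \<g>'" using Cons.prems(3) by (auto split: if_splits)
 show ?case
 proof (cases "j = k")
  case True
  then show ?thesis using p(2) by simp
 next
  case False
  have j: "j <= m" using Cons.prems(2) by simp
  note c = ctr1_commute[OF Cons.prems(1) j Cons.prems(6) False p(1) Cons.prems(5)]
  have "path m (ctr1 k \<g>) j" using ctr1_commute(1)[OF Cons.prems(1) Cons.prems(6) j _ Cons.prems(5) p(1)] False by simp
  moreover have "k : set ks & ctrs m (remove1 k ks) (ctr1 k (ctr1 j \<g>)) = Some \<g>'"
   by (rule Cons.IH[OF ctr1_Gam(1)[OF Cons.prems(1) p(1) j]]) (use Cons.prems p c(1) in auto)
  ultimately show ?thesis using False c(2) by simp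
 qed
qed

text \<open>The first letter of \<open>ks'\<close> has a path in \<open>\<g>\<close>, so
  \<open>ctrs_pull\<close> extracts it from \<open>ks\<close> as well; the remaining words are
  compared on the common contraction.\<close>

lemma ctrs_confluent:
 assumes "\<g> : Gam m n" "set ks <= {1..m}" "set ks' <= {1..m}" "ctrs m ks \<g> = Some \<d>" "isblk m \<d>"
  "ctrs m ks' \<g> = Some \<d>'" "isblk m \<d>'"
 shows "mset ks = mset ks'"
 using assms
proof (induction ks' arbitrary: ks \<g>)
 case Nil
 have "ks = []"
 proof (rule ccontr)
  assume "ks ~= []"
  then obtain j js where "ks = j # js" by (cases ks) auto
  then have "path m \<g> j" "j <= m" using Nil by (auto split: if_splits)
  then show False using Nil isblk_noPath by auto
 qed
 then show ?case by simp
next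
 case (Cons k ks')
 have p: "path m \<g> k" "ctrs m ks' (ctr1 k \<g>) = Some \<d>'" using Cons.prems(6) by (auto split: if_splits)
 have k: "k <= m" using Cons.prems(3) by simp
 note r = ctrs_pull[OF Cons.prems(1,2,4,5) p(1) k]
 have "mset (remove1 k ks) = mset ks'"
  by (rule Cons.IH[OF ctr1_Gam(1)[OF Cons.prems(1) p(1) k] _ _ conjunct2[OF r] Cons.prems(5) p(2) Cons.prems(7)])
   (use Cons.prems set_remove1_subset[of k ks] in auto)
 then show ?case using r by (metis insert_DiffM mset.simps(2) mset_remove1 set_mset_mset)
qed

lemma XS_finsum:
 fixes f :: "'i => ('a, 'f::field) zel"
 assumes "finite F" "f : F \<rightarrow> Zc m" "m <= n" "\<g> : PM n"
 shows "XS m (\<Oplus>\<^bsub>Zbar G m\<^esub>i\<in>F. f i) \<g> = (\<Sum>i\<in>F. XS m (f i) \<g>)"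
 using assms(1,2)
proof (induction F rule: finite_induct)
 interpret Z: falg "Zbar G m :: ('a, 'f) zalg" by (rule falg_Z)
 {
  case empty
  show ?case using XS_lin(3)[OF Z.zero_closed Z.zero_closed assms(3,4)] by simp
 next
  case (insert i F)
  have f: "f i : Zc m" "f : F \<rightarrow> Zc m" using insert.prems by auto
  have "XS m (\<Oplus>\<^bsub>Zbar G m\<^esub>i\<in>insert i F. f i) \<g> = XS m (f i \<oplus>\<^bsub>Zbar G m\<^esub> (\<Oplus>\<^bsub>Zbar G m\<^esub>i\<in>F. f i)) \<g>"
   using Z.finsum_insert[OF insert.hyps(1,2) f(2,1)] by simp
  also have "... = XS m (f i) \<g> + XS m (\<Oplus>\<^bsub>Zbar G m\<^esub>i\<in>F. f i) \<g>"
   by (rule XS_lin(1)[OF f(1) Z.finsum_closed[OF f(2)] assms(3,4)])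
  finally show ?case using insert f by simp
 }
qed

text \<open>The least bound of a nonzero element is a successor, and minimality yields a nonzero
  coordinate of exactly that size.\<close>

lemma exact_degree:
 fixes z :: "('a, 'f::field) zel"
 assumes z: "z : Zc m" "z ~= \<zero>\<^bsub>Zbar G m\<^esub>"
 shows "\<exists>e. ldeg m z (Suc e) & (\<exists>n\<ge>m. \<exists>\<k>\<in>Gam m n. XS m z \<k> ~= 0 & card (S m \<k>) = e)"
proof -
 define d where "d = (LEAST d. ldeg m z d)"
 have d: "ldeg m z d" unfolding d_def by (rule LeastI_ex[OF ldeg_exists[OF z(1)]])
 obtain e where e: "d = Suc e"
 proof (cases d)
  case 0
  then have "z = \<zero>\<^bsub>Zbar G m\<^esub>" using d by (intro XS_inj[OF z(1)]) (auto simp: ldeg_def)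
  then show ?thesis using z(2) by simp
 qed
 have "\<not> ldeg m z e" using not_less_Least[of e "ldeg m z"] e unfolding d_def[symmetric] by simp
 then obtain n \<k> where k: "n >= m" "\<k> : Gam m n" "XS m z \<k> ~= 0" "\<not> card (S m \<k>) < e" unfolding ldeg_def by blast
 moreover have "card (S m \<k>) < Suc e" using d k unfolding e ldeg_def by blast
 ultimately show ?thesis using d unfolding e by (metis less_antisym)
qed

text \<open>Placing \<open>\<k>\<close> in the lower block and cutting it out again translates it by
  m, which is a conjugation of its support.\<close>

lemma XS_shift:
 assumes "\<k> : Gam 0 n" "invf 0 (n + m) c"
 shows "c (outer m (blk m \<k> \<r>)) = c \<k>"
proof -
 note P = Gam_PM[OF assms(1)]
 define q where "q a = a - m" for a :: nat
 have eq: "outer m (blk m \<k> \<r>) = cj q (%_. \<one>) \<k>" (is "?l = ?r")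
 proof (rule mtxI)
  fix a b x
  have "cj q (%_. \<one>) \<k> a b = Some x <-> \<k> (a - m) (b - m) = Some x"
   unfolding cj_Some q_def using PM_D(5)[OF P] by auto
  then show "?l a b = Some x <-> ?r a b = Some x"
   using PM_D(1,3)[OF P, of "a - m" "b - m" x] by (auto simp: blk_Some)
 qed
 \<comment> \<open>Truncated subtraction may hit indices off the support; \<open>sim\<close>
   requires the value 0 there. The entries do not notice the change.\<close>
 define q' where "q' a = (if a - m : S 0 \<k> then a - m else 0)" for a
 have eq': "cj q (%_. \<one>) \<k> = cj q' (%_. \<one>) \<k>" (is "?l = ?r")
 proof (rule mtxI)
  fix a b x
  have n0: "\<k> 0 b ~= Some y" "\<k> b 0 ~= Some y" for b y using PM_D(1,3)[OF P] by fastforce+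
  have io: "a : S 0 \<k> & b : S 0 \<k>" if "\<k> a b = Some y" for a b y
   using PM_D(1,3)[OF P that] rowsI[of \<k> a b y] colsI[of \<k> a b y] that by (auto simp: S_def)
  have "\<k> (q a) (q b) = Some y <-> \<k> (q' a) (q' b) = Some y" for y
   using io[of "q a" "q b" y] n0 unfolding q_def q'_def by auto
  then show "?l a b = Some x <-> ?r a b = Some x" by simp
 qed
 have S0: "\<not> (0 : S 0 \<k>)" by (simp add: S_def)
 have sm: "sim 0 \<k> (outer m (blk m \<k> \<r>))"
  unfolding sim_def
 proof (intro exI[of _ q'] exI[of _ "%_. \<one>"] conjI ballI allI impI)
  show "outer m (blk m \<k> \<r>) = cj q' (%_. \<one>) \<k>" using eq eq' by simp
  fix k assume "k : S 0 \<k>"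
  then show "\<exists>i>0. q' i = k" using S0 by (intro exI[of _ "k + m"]) (auto simp: q'_def intro: gr0I)
 qed (auto simp: q'_def split: if_splits)
 have "outer m (blk m \<k> \<r>) : PM (n + m)"
 proof -
  have "outer m (blk m \<k> \<r>) = blk m \<k> (%_ _. None)" by (rule mtxI) (auto simp: blk_Some)
  moreover have "(%_ _. None) : PM m" by (simp add: PM_iff)
  ultimately show ?thesis using blk_PM[OF P] by metis
 qed
 then show ?thesis by (intro sim_inv[OF sm _ _ le0 assms(2)]) (use P PM_mono[of n "n + m"] in auto)
qed

text \<open>Evaluate a relation at a matrix \<open>\<e>\<close> that contracts along the word of one of its terms to a
 block matrix: by confluence no other word contributes to the top symbol there, and maximality of
 \<open>\<r>\<close> singles out one term for this word.\<close>

lemma Zbar_independent: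
 fixes z :: "nat list \<times> 'a mtx => ('a, 'f::field) zel"
 assumes F: "finite F" "\<And>ks \<d>. (ks, \<d>) : F ==> sorted ks & set ks <= rows \<d> & \<d> : PM m"
  and z: "z : F \<rightarrow> Zc 0"
  and s: "(\<Oplus>\<^bsub>Zbar G m\<^esub>i\<in>F. res m (z i) \<bullet>[m] uact m (fst i) (csq m (basis (snd i)))) = \<zero>\<^bsub>Zbar G m\<^esub>"
 shows "\<forall>i\<in>F. z i = \<zero>\<^bsub>Zbar G 0\<^esub>"
proof (rule ccontr)
 interpret Z: falg "Zbar G m :: ('a, 'f) zalg" by (rule falg_Z)
 interpret Z0: falg "Zbar G 0 :: ('a, 'f) zalg" by (rule falg_Z)
 define F' where "F' = {i : F. z i ~= \<zero>\<^bsub>Zbar G 0\<^esub>}"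
 assume "\<not> (\<forall>i\<in>F. z i = \<zero>\<^bsub>Zbar G 0\<^esub>)"
 then have F': "F' ~= {}" "finite F'" "F' <= F" using F(1) by (auto simp: F'_def)
 have zc: "z i : Zc 0" if "i : F" for i using z that by blast
 have ks: "set (fst i) <= {1..m}" "sorted (fst i)" "set (fst i) <= rows (snd i)" "snd i : PM m" if "i : F" for i
  using F(2)[of "fst i" "snd i"] that PM_rows[of "snd i" m] by auto
 have cc: "(csq m (basis (snd i)) :: ('a, 'f) zel) : Zc m" if "i : F" for i
  using ks(4)[OF that] by (intro homD(1)[OF csq_hom]) simp
 define v where "v i = res m (z i) \<bullet>[m] csq m (basis (snd i))" for i
 have vc: "v i : Zc m" if "i : F" for i
  unfolding v_def using homD(1)[OF res_hom zc[OF that]] cc[OF that] by (rule Z.m_closed)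
 define e where "e i = (SOME e. ldeg 0 (z i) (Suc e) & (\<exists>n\<ge>0. \<exists>\<k>\<in>Gam 0 n. XS 0 (z i) \<k> ~= 0 & card (S 0 \<k>) = e))" for i
 have e: "ldeg 0 (z i) (Suc (e i))" "\<exists>n. \<exists>\<k>\<in>Gam 0 n. XS 0 (z i) \<k> ~= 0 & card (S 0 \<k>) = e i" if "i : F'" for i
  using someI_ex[OF exact_degree[of "z i" 0]] that zc unfolding e_def F'_def by auto
 \<comment> \<open>The largest total degree, coefficient plus word length, among the terms with
   nonzero coefficient. The relation is evaluated only at this size.\<close>
 define D where "D = Max ((%i. e i + length (fst i)) ` F')"
 have D: "e i + length (fst i) <= D" if "i : F'" for i unfolding D_def using F'(2) that by (intro Max_ge) auto
 have "D : (%i. e i + length (fst i)) ` F'" unfolding D_def using F' by (intro Max_in) auto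
 then obtain j where j: "j : F'" "e j + length (fst j) = D" by auto
 obtain n \<k> where \<k>: "\<k> : Gam 0 n" "XS 0 (z j) \<k> ~= 0" "card (S 0 \<k>) = e j" using e(2)[OF j(1)] by blast
 \<comment> \<open>Matrices that accompany the chosen word and whose coefficient is nonzero at the
   chosen \<open>\<k>\<close>; the element of largest support in this set cannot be properly
   contained in another.\<close>
 define A where "A = {\<d>. (fst j, \<d>) : F' & XS 0 (z (fst j, \<d>)) \<k> ~= 0}"
 have "A <= snd ` F'" unfolding A_def by force
 then have A: "finite A" "snd j : A" using F'(2) finite_subset \<k>(2) j(1) by (auto simp: A_def)
 have "finite ((%\<d>. card (supp \<d>)) ` A)" "(%\<d>. card (supp \<d>)) ` A ~= {}" using A by auto
 from Max_in[OF this] obtain \<r> where \<r>: "\<r> : A" "card (supp \<r>) = Max ((%\<d>. card (supp \<d>)) ` A)" by auto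
 have \<r>m: "card (supp \<d>) <= card (supp \<r>)" if "\<d> : A" for \<d> unfolding \<r>(2) using A(1) that by (intro Max_ge) auto
 have jF: "(fst j, \<r>) : F" using \<r>(1) F'(3) by (auto simp: A_def)
 have \<r>P: "\<r> : PM m" using ks(4)[OF jF] by simp
 let ?B = "blk m \<k> \<r>"
 note B = blk_Gam[OF \<k>(1) \<r>P]
 have "set (fst j) <= rows ?B"
 proof
  fix k assume k: "k : set (fst j)"
  then obtain b x where "\<r> k b = Some x" using ks(3)[OF jF] by (auto simp: rows_def)
  then have "?B k b = Some x" using PM_D(2,4)[OF \<r>P] by (simp add: blk_Some)
  then show "k : rows ?B" by (rule rowsI)
 qed
 from ctrs_insert[OF B(1) this _ le_add2] ks(1)[OF jF]
 obtain N \<e> where \<e>: "m <= N" "\<e> : Gam m N" "ctrs m (fst j) \<e> = Some ?B" "card (S m \<e>) = card (S m ?B) + length (fst j)"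
  by auto
 have SD: "card (S m \<e>) = D" using \<e>(4) B(3) \<k>(3) j(2) by simp
 have val: "XS m (uact m (fst i) (v i)) \<e> = (if i = (fst j, \<r>) then XS 0 (z i) \<k> else 0)" if iF': "i : F'" for i
 proof -
  have i: "i : F" using iF' F'(3) by blast
  \<comment> \<open>A possibly generous degree bound for the coefficient, chosen so that every term
    has total degree D and \<open>XS_uact\<close> applies to all terms at the same matrix.\<close>
  let ?e = "D - length (fst i)"
  have De: "e i <= ?e" "?e + length (fst i) = D" using D[OF iF'] by auto
  have l0: "ldeg 0 (z i) (Suc ?e)" using e(1)[OF iF'] De(1) unfolding ldeg_def by fastforce
  note X = XS_zc_basis[OF zc[OF i] l0 ks(4)[OF i], folded v_def]
  have l: "ldeg m (v i) (Suc ?e)"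
   unfolding ldeg_def
  proof (intro allI impI ballI)
   fix n \<g> assume n: "m <= n" and g: "\<g> : Gam m n" and nz: "XS m (v i) \<g> ~= 0"
   show "card (S m \<g>) < Suc ?e"
   proof (rule ccontr)
    assume h: "\<not> card (S m \<g>) < Suc ?e"
    then have "isblk m \<g>" "XS 0 (z i) (outer m \<g>) ~= 0" using nz X[OF n g] by (auto split: if_splits)
    then show False using l0 h outer_Gam[OF g] unfolding ldeg_def by (metis le0)
   qed
  qed
  have V: "XS m (uact m (fst i) (v i)) \<e> = (case ctrs m (fst i) \<e> of None => 0 | Some \<g>' => XS m (v i) \<g>')"
   using XS_uact[OF vc[OF i] l ks(1)[OF i]] \<e>(1,2) SD De(2) by auto
  show ?thesis
  proof (cases "fst i = fst j")
   case True
   have "XS 0 (z i) (outer m ?B) = XS 0 (z i) \<k>" by (rule XS_shift[OF \<k>(1) inv_XS[OF zc[OF i] le0]])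
   moreover have "?e <= card (S m ?B)" using B(3) \<k>(3) j(2) True by simp
   ultimately have v1: "XS m (uact m (fst i) (v i)) \<e> = (if sub \<r> (snd i) then XS 0 (z i) \<k> else 0)"
    unfolding V using True \<e>(3) X[OF le_add2 B(1)] isblk_blk corner_blk[OF \<r>P, of \<k>] by simp
   have "i = (fst j, \<r>)" if sb: "sub \<r> (snd i)" and nz: "XS 0 (z i) \<k> ~= 0"
   proof -
    have "snd i : A" unfolding A_def using iF' nz True by (metis (mono_tags, lifting) mem_Collect_eq prod.collapse)
    then have "card (supp (snd i)) <= card (supp \<r>)" by (rule \<r>m)
    then have "supp \<r> = supp (snd i)" using card_seteq[OF finite_supp[OF ks(4)[OF i]] sub_supp[OF sb]] by blast
    then have "\<r> = snd i" using sub_supp_eq[OF sb] by simp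
    then show ?thesis using True by (simp add: prod_eq_iff)
   qed
   then have "i = (fst j, \<r>) & XS 0 (z i) \<k> ~= 0 <-> sub \<r> (snd i) & XS 0 (z i) \<k> ~= 0" by force
   moreover have "(if P then x else 0) = (if P' then x else (0::'f))" if "P' & x ~= 0 <-> P & x ~= 0" for P P' x
    using that by auto
   ultimately show ?thesis unfolding v1 by blast
  next
   case False
   have "XS m (v i) \<g>' = 0" if c: "ctrs m (fst i) \<e> = Some \<g>'" for \<g>'
   proof (rule ccontr)
    assume nz: "XS m (v i) \<g>' ~= 0"
    note C = ctrs_Gam[OF \<e>(2) ks(1)[OF i] c]
    have "?e <= card (S m \<g>')" using C(2) SD De(2) by simp
    then have "isblk m \<g>'" using X[OF \<e>(1) C(1)] nz by (auto split: if_splits)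
    \<comment> \<open>Confluence determines the letters only up to order, and sortedness of the
      index words turns this into equality.\<close>
    then have "mset (fst i) = mset (fst j)"
     using ks(1)[OF jF] by (intro ctrs_confluent[OF \<e>(2) ks(1)[OF i] _ c _ \<e>(3) isblk_blk]) auto
    moreover have "sorted (fst j)" using ks(2)[OF jF] by simp
    ultimately show False using ks(2)[OF i] False properties_for_sort by metis
   qed
   then show ?thesis unfolding V using False by (auto split: option.split)
  qed
 qed
 have tm: "res m (z i) \<bullet>[m] uact m (fst i) (csq m (basis (snd i))) = uact m (fst i) (v i)" if "i : F" for i
  unfolding v_def by (rule res_uact[OF zc[OF that] cc[OF that] ks(1)[OF that]])
 have uc: "uact m (fst i) (v i) : Zc m" if "i : F" for i by (rule uact_carrier[OF ks(1)[OF that] vc[OF that]])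
 have z0: "XS m (uact m (fst i) (v i)) \<e> = 0" if "i : F - F'" for i
 proof -
  have i: "i : F" "z i = \<zero>\<^bsub>Zbar G 0\<^esub>" using that by (auto simp: F'_def)
  have "res m \<zero>\<^bsub>Zbar G 0\<^esub> = (\<zero>\<^bsub>Zbar G m\<^esub> :: ('a, 'f) zel)" by (rule alg_hom_zero[OF falg_Z falg_Z res_hom])
  then have "uact m (fst i) (v i) = \<zero>\<^bsub>Zbar G m\<^esub>"
   using tm[OF i(1)] i(2) uact_carrier[OF ks(1)[OF i(1)] cc[OF i(1)]] by simp
  then show ?thesis using XS_lin(3)[OF Z.zero_closed Z.zero_closed \<e>(1) Gam_PM[OF \<e>(2)]] by simp
 qed
 have "0 = XS m (\<Oplus>\<^bsub>Zbar G m\<^esub>i\<in>F. uact m (fst i) (v i)) \<e>"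
 proof -
  have "(\<Oplus>\<^bsub>Zbar G m\<^esub>i\<in>F. uact m (fst i) (v i)) = \<zero>\<^bsub>Zbar G m\<^esub>"
   unfolding s[symmetric] by (rule Z.finsum_cong') (use tm uc in auto)
  then show ?thesis using XS_lin(3)[OF Z.zero_closed Z.zero_closed \<e>(1) Gam_PM[OF \<e>(2)]] by simp
 qed
 also have "... = (\<Sum>i\<in>F. XS m (uact m (fst i) (v i)) \<e>)"
  by (rule XS_finsum[OF F(1) _ \<e>(1) Gam_PM[OF \<e>(2)]]) (use uc in blast)
 also have "... = (\<Sum>i\<in>F'. XS m (uact m (fst i) (v i)) \<e>)"
  by (rule sum.mono_neutral_right[OF F(1) F'(3)]) (use z0 in blast)
 also have "... = (\<Sum>i\<in>F'. if i = (fst j, \<r>) then XS 0 (z i) \<k> else 0)"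
  by (rule sum.cong[OF refl val])
 also have "... = XS 0 (z (fst j, \<r>)) \<k>" using F'(2) \<r>(1) by (simp add: A_def)
 finally show False using \<r>(1) by (simp add: A_def)
qed

end

subsection \<open>The Coxeter presentation of the symmetric group\<close>

locale coxeter = monoid M for M (structure) +
 fixes m :: nat and s :: "nat => 'a"
 assumes s_closed: "1 <= i ==> i < m ==> s i : carrier M"
  and s_sq: "1 <= i ==> i < m ==> s i \<otimes> s i = \<one>"
  and s_comm: "1 <= i ==> i + 1 < j ==> j < m ==> s i \<otimes> s j = s j \<otimes> s i"
  and s_braid: "1 <= i ==> i + 1 < m ==> s i \<otimes> (s (i + 1) \<otimes> s i) = s (i + 1) \<otimes> (s i \<otimes> s (i + 1))"
begin

text \<open>The word \<open>s j\<close>, \<open>s (j+1)\<close>, up to \<open>s (k-1)\<close>. In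
  the symmetric group it is the cycle taking k to j, so these words represent the cosets of the
  stabiliser of k.\<close>

definition cyc :: "nat => nat => 'a" where "cyc j k = foldr (%i x. s i \<otimes> x) [j..<k] \<one>"

lemma cyc_refl [simp]: "cyc k k = \<one>"
 by (simp add: cyc_def)

lemma cyc_step: "j < k ==> cyc j k = s j \<otimes> cyc (Suc j) k"
 by (simp add: cyc_def upt_conv_Cons)

lemma cyc_closed:
 assumes "1 <= j" "j <= k" "k <= m"
 shows "cyc j k : carrier M"
 using assms(2,1,3)
proof (induction j rule: inc_induct)
 case (step j)
 then show ?case using s_closed[of j] by (simp add: cyc_step)
qed simp

lemma cyc_low:
 assumes i: "1 <= i" "i + 1 < j" and k: "j <= k" "k <= m"
 shows "s i \<otimes> cyc j k = cyc j k \<otimes> s i"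
 using k(1) i
proof (induction j rule: inc_induct)
 case base
 then show ?case using s_closed[of i] k(2) by simp
next
 case (step j)
 have c: "s i : carrier M" "s j : carrier M" "cyc (Suc j) k : carrier M"
  using s_closed[of i] s_closed[of j] cyc_closed[of "Suc j" k] step k by auto
 have "s i \<otimes> cyc j k = (s i \<otimes> s j) \<otimes> cyc (Suc j) k" using step c by (simp add: cyc_step m_assoc)
 also have "... = (s j \<otimes> s i) \<otimes> cyc (Suc j) k" using s_comm[of i j] step k by simp
 also have "... = s j \<otimes> (s i \<otimes> cyc (Suc j) k)" using c by (simp add: m_assoc)
 also have "s i \<otimes> cyc (Suc j) k = cyc (Suc j) k \<otimes> s i" using step by simp
 also have "s j \<otimes> (cyc (Suc j) k \<otimes> s i) = cyc j k \<otimes> s i" using step c by (simp add: cyc_step m_assoc)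
 finally show ?case .
qed

text \<open>The letter travels inward past commuting letters until it meets \<open>s i\<close>
  followed by \<open>s (Suc i)\<close>; the braid relation lowers its index there, and it commutes
  with the rest.\<close>

lemma cyc_high:
 assumes j: "1 <= j" "j <= i" and k: "Suc i < k" "k <= m"
 shows "s (Suc i) \<otimes> cyc j k = cyc j k \<otimes> s i"
 using j(2,1)
proof (induction j rule: inc_induct)
 case base
 let ?c = "cyc (Suc (Suc i)) k"
 have c: "s i : carrier M" "s (Suc i) : carrier M" "?c : carrier M"
  using s_closed[of i] s_closed[of "Suc i"] cyc_closed[of "Suc (Suc i)" k] base k by auto
 have e: "cyc i k = s i \<otimes> (s (Suc i) \<otimes> ?c)" using k by (simp add: cyc_step)
 have "s (Suc i) \<otimes> cyc i k = (s (Suc i) \<otimes> (s i \<otimes> s (Suc i))) \<otimes> ?c" unfolding e using c by (simp add: m_assoc)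
 also have "... = (s i \<otimes> (s (Suc i) \<otimes> s i)) \<otimes> ?c" using s_braid[of i] base k by simp
 also have "... = s i \<otimes> (s (Suc i) \<otimes> (s i \<otimes> ?c))" using c by (simp add: m_assoc)
 also have "s i \<otimes> ?c = ?c \<otimes> s i" using cyc_low[of i "Suc (Suc i)" k] base k by simp
 also have "s i \<otimes> (s (Suc i) \<otimes> (?c \<otimes> s i)) = cyc i k \<otimes> s i" unfolding e using c by (simp add: m_assoc)
 finally show ?case .
next
 case (step j)
 have c: "s i : carrier M" "s (Suc i) : carrier M" "s j : carrier M" "cyc (Suc j) k : carrier M"
  using s_closed[of i] s_closed[of "Suc i"] s_closed[of j] cyc_closed[of "Suc j" k] step k by auto
 have e: "cyc j k = s j \<otimes> cyc (Suc j) k" using step k by (intro cyc_step) simp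
 have "s (Suc i) \<otimes> cyc j k = (s (Suc i) \<otimes> s j) \<otimes> cyc (Suc j) k" unfolding e using c by (simp add: m_assoc)
 also have "... = (s j \<otimes> s (Suc i)) \<otimes> cyc (Suc j) k" using s_comm[of j "Suc i"] step k by simp
 also have "... = s j \<otimes> (s (Suc i) \<otimes> cyc (Suc j) k)" using c by (simp add: m_assoc)
 also have "s (Suc i) \<otimes> cyc (Suc j) k = cyc (Suc j) k \<otimes> s i" using step by simp
 also have "s j \<otimes> (cyc (Suc j) k \<otimes> s i) = cyc j k \<otimes> s i" unfolding e using c by (simp add: m_assoc)
 finally show ?case .
qed

end

abbreviation adj :: "nat => nat => nat" where "adj i \<equiv> transpose i (Suc i)"

text \<open>Functions under composition, so that the actual transpositions are an instance of the
  locale and the identities for \<open>cyc\<close> hold for words and for permutations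
  alike.\<close>

definition funs :: "(nat => nat) monoid" where "funs = \<lparr>carrier = UNIV, monoid.mult = (\<circ>), one = id\<rparr>"

lemma funs_simps [simp]: "carrier funs = UNIV" "monoid.mult funs = (\<circ>)" "one funs = id"
 by (simp_all add: funs_def)

lemma coxeter_funs: "coxeter funs m adj"
proof
 fix i j :: nat
 show "adj i \<otimes>\<^bsub>funs\<^esub> adj i = \<one>\<^bsub>funs\<^esub>" by simp
 show "adj i \<otimes>\<^bsub>funs\<^esub> adj j = adj j \<otimes>\<^bsub>funs\<^esub> adj i" if "i + 1 < j"
  using that by (auto simp: fun_eq_iff transpose_def)
 show "adj i \<otimes>\<^bsub>funs\<^esub> (adj (i + 1) \<otimes>\<^bsub>funs\<^esub> adj i) = adj (i + 1) \<otimes>\<^bsub>funs\<^esub> (adj i \<otimes>\<^bsub>funs\<^esub> adj (i + 1))"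
  by (auto simp: fun_eq_iff transpose_def)
qed (auto simp: o_assoc)

definition cycle :: "nat => nat => nat => nat" where "cycle = coxeter.cyc funs adj"

lemma cycle_refl [simp]: "cycle k k = id"
 unfolding cycle_def by (simp add: coxeter.cyc_refl[OF coxeter_funs])

lemma cycle_step: "j < k ==> cycle j k = adj j o cycle (Suc j) k"
 unfolding cycle_def by (subst coxeter.cyc_step[OF coxeter_funs]) auto

lemma cycle_low: "1 <= i ==> i + 1 < j ==> j <= k ==> adj i o cycle j k = cycle j k o adj i"
 using coxeter.cyc_low[OF coxeter_funs, of i j k k] unfolding cycle_def by simp

lemma cycle_high: "1 <= j ==> j <= i ==> Suc i < k ==> adj (Suc i) o cycle j k = cycle j k o adj i"
 using coxeter.cyc_high[OF coxeter_funs, of j i k k] unfolding cycle_def by simp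

lemma cycle_perm:
 assumes "1 <= j" "j <= k"
 shows "cycle j k permutes {1..k}" "cycle j k k = j"
proof -
 have "cycle j k permutes {1..k} & cycle j k k = j"
  using assms(2,1)
 proof (induction j rule: inc_induct)
  case (step j)
  have "adj j permutes {1..k}" using step by (intro permutes_swap_id) auto
  moreover have IH: "cycle (Suc j) k permutes {1..k}" "cycle (Suc j) k k = Suc j"
   using step.IH[OF le_SucI[OF step.prems]] by blast+
  ultimately have "(adj j o cycle (Suc j) k) permutes {1..k}" by (intro permutes_compose)
  moreover have "(adj j o cycle (Suc j) k) k = j" unfolding o_apply IH(2) by (rule transpose_apply_second)
  ultimately show ?case unfolding cycle_step[OF step.hyps(2)] by blast
 qed (simp add: permutes_id)
 then show "cycle j k permutes {1..k}" "cycle j k k = j" by auto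
qed

text \<open>What remains of p after splitting off the cycle that takes k to \<open>p k\<close>; for
  a permutation of \<open>{1..k}\<close> it fixes k.\<close>

definition tperm :: "nat => (nat => nat) => nat => nat" where
 "tperm k p = inv_into UNIV (cycle (p k) k) o p"

lemma tperm:
 assumes "p permutes {1..Suc k}"
 shows "tperm (Suc k) p permutes {1..k}" "p = cycle (p (Suc k)) (Suc k) o tperm (Suc k) p"
  "1 <= p (Suc k)" "p (Suc k) <= Suc k"
proof -
 have "p (Suc k) : {1..Suc k}" using permutes_in_image[OF assms, of "Suc k"] by simp
 then show j: "1 <= p (Suc k)" "p (Suc k) <= Suc k" by auto
 let ?c = "cycle (p (Suc k)) (Suc k)"
 note c = cycle_perm[OF j]
 have tp: "tperm (Suc k) p permutes {1..Suc k}"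
  unfolding tperm_def by (rule permutes_compose[OF assms permutes_inv[OF c(1)]])
 have fx: "tperm (Suc k) p (Suc k) = Suc k"
  unfolding tperm_def using permutes_inverses(2)[OF c(1), of "Suc k"] c(2) by simp
 show "tperm (Suc k) p permutes {1..k}"
 proof (rule permutes_superset[OF tp])
  fix x assume s: "x : {1..Suc k} - {1..k}"
  then have "x = Suc k" by auto
  then show "tperm (Suc k) p x = x" using fx by simp
 qed
 show "p = ?c o tperm (Suc k) p"
  unfolding tperm_def by (simp add: o_assoc permutes_inv_o(1)[OF c(1)])
qed

lemma tail_perm_eqI:
 assumes "1 <= j" "j <= k" "p = cycle j k o q" "p k = j"
 shows "tperm k p = q"
 unfolding tperm_def assms(4) unfolding assms(3)
 by (simp add: o_assoc permutes_inv_o(2)[OF cycle_perm(1)[OF assms(1,2)]])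

lemma adj_perm: "1 <= i ==> i < m ==> adj i permutes {1..m}"
 by (rule permutes_swap_id) auto

lemma adj_adj [simp]: "adj i o (adj i o p) = p"
 by (simp add: fun_eq_iff)

lemma adj_induct [consumes 1, case_names id adj]:
 assumes "p permutes {1..m}" "P id" "\<And>i p. 1 <= i ==> i < m ==> p permutes {1..m} ==> P p ==> P (adj i o p)"
 shows "P p"
proof -
 have "P p" if "p permutes {1..k}" "k <= m" for k p
  using that
 proof (induction k arbitrary: p)
  case (Suc k)
  note t = tperm[OF Suc.prems(1)]
  have t0: "P (tperm (Suc k) p)" "tperm (Suc k) p permutes {1..m}"
   using Suc.IH[OF t(1)] permutes_subset[OF t(1), of "{1..m}"] Suc.prems(2) by auto
  have "P (cycle j (Suc k) o tperm (Suc k) p) & (cycle j (Suc k) o tperm (Suc k) p) permutes {1..m}"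
   if "1 <= j" "j <= Suc k" for j
   using that(2,1)
  proof (induction j rule: inc_induct)
   case (step j)
   have IH: "P (cycle (Suc j) (Suc k) o tperm (Suc k) p)"
    "(cycle (Suc j) (Suc k) o tperm (Suc k) p) permutes {1..m}"
    using step.IH[OF le_SucI[OF step.prems]] by blast+
   have j: "1 <= j" "j < m" using step.hyps step.prems Suc.prems(2) by simp_all
   show ?case
    unfolding cycle_step[OF step.hyps(2)] o_assoc[symmetric]
    using assms(3)[OF j IH(2,1)] permutes_compose[OF IH(2) adj_perm[OF j]] by (rule conjI)
  qed (use t0 in simp)
  then show ?case using t(2-4) by metis
 qed (use assms(2) in "simp add: permutes_empty")
 then show ?thesis using assms(1) by blast
qed

context coxeter
begin

text \<open>The normal form word of a permutation, splitting off one cycle for each point from the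
  top down.\<close>

fun wp :: "nat => (nat => nat) => 'a" where
 "wp 0 p = \<one>"
| "wp (Suc k) p = cyc (p (Suc k)) (Suc k) \<otimes> wp k (tperm (Suc k) p)"

lemma wp_closed: "p permutes {1..k} ==> k <= m ==> wp k p : carrier M"
proof (induction k arbitrary: p)
 case (Suc k)
 then show ?case using tperm[OF Suc.prems(1)] cyc_closed[of "p (Suc k)" "Suc k"] by simp
qed simp

text \<open>The cases compare i with the image j of the last point. The letter \<open>s i\<close>
  passes the cycle unchanged, lengthens it, shortens it, or passes it with index lowered by
  one.\<close>

lemma wp_adj:
 assumes "p permutes {1..k}" "k <= m" "1 <= i" "i < k"
 shows "wp k (adj i o p) = s i \<otimes> wp k p"
 using assms
proof (induction k arbitrary: p i)
 case (Suc k)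
 let ?K = "Suc k" and ?t = "tperm (Suc k) p"
 define j where "j = p ?K"
 note t = tperm[OF Suc.prems(1), folded j_def]
 have c: "s i : carrier M" "wp k ?t : carrier M" "cyc j ?K : carrier M"
  using s_closed[of i] wp_closed[OF t(1)] cyc_closed[OF t(3,4)] Suc.prems by auto
 have R: "s i \<otimes> wp ?K p = s i \<otimes> (cyc j ?K \<otimes> wp k ?t)" by (simp add: j_def)
 have T: "wp ?K (adj i o p) = cyc j' ?K \<otimes> wp k q"
  if "1 <= j'" "j' <= ?K" "adj i j = j'" "adj i o p = cycle j' ?K o q" for j' q
  using tail_perm_eqI[OF that(1,2,4)] that(3) by (simp add: j_def)
 consider "i + 1 < j" | "i + 1 = j" | "i = j" | "j < i" by linarith
 then show ?case
 proof cases
  case 1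
  have "adj i o p = cycle j ?K o (adj i o ?t)"
   using cycle_low[OF Suc.prems(3) 1 t(4)] t(2) by (metis o_assoc)
  then have "wp ?K (adj i o p) = cyc j ?K \<otimes> wp k (adj i o ?t)" by (intro T t(3,4)) (use 1 in simp_all)
  also have "wp k (adj i o ?t) = s i \<otimes> wp k ?t" by (rule Suc.IH[OF t(1)]) (use 1 t(4) Suc.prems in auto)
  also have "cyc j ?K \<otimes> (s i \<otimes> wp k ?t) = s i \<otimes> (cyc j ?K \<otimes> wp k ?t)"
   using cyc_low[OF Suc.prems(3) 1 t(4) Suc.prems(2)] c by (metis m_assoc)
  finally show ?thesis unfolding R .
 next
  case 2
  have "adj i o p = cycle i ?K o ?t" using t(2) cycle_step[of i ?K] 2 t(4) by (metis Suc_eq_plus1 Suc_le_lessD o_assoc)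
  then have "wp ?K (adj i o p) = cyc i ?K \<otimes> wp k ?t" by (intro T) (use 2 Suc.prems in auto)
  also have "cyc i ?K = s i \<otimes> cyc j ?K" using cyc_step[of i ?K] 2 t(4) by simp
  finally show ?thesis unfolding R using c by (simp add: m_assoc)
 next
  case 3
  have j: "j < ?K" using 3 Suc.prems(4) by simp
  have c': "cyc (Suc j) ?K : carrier M" using cyc_closed[of "Suc j" ?K] j Suc.prems(2) by simp
  have "adj i o p = cycle (Suc j) ?K o ?t" using t(2) cycle_step[OF j] 3 adj_adj by (metis o_assoc)
  then have "wp ?K (adj i o p) = cyc (Suc j) ?K \<otimes> wp k ?t" by (intro T) (use 3 j in auto)
  also have "cyc (Suc j) ?K = s i \<otimes> cyc j ?K"
   unfolding cyc_step[OF j] using s_sq[of i] 3 c c' Suc.prems by (simp add: m_assoc[symmetric])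
  finally show ?thesis unfolding R using c by (simp add: m_assoc)
 next
  case 4
  then obtain i' where i': "i = Suc i'" "j <= i'" by (cases i) auto
  have si: "s i' : carrier M" using s_closed[of i'] i' t(3) Suc.prems by simp
  have "adj i o p = cycle j ?K o (adj i' o ?t)"
   using cycle_high[OF t(3) i'(2), of ?K] t(2) i' Suc.prems(4) by (metis o_assoc)
  then have "wp ?K (adj i o p) = cyc j ?K \<otimes> wp k (adj i' o ?t)" by (intro T t(3,4)) (use 4 in simp_all)
  also have "wp k (adj i' o ?t) = s i' \<otimes> wp k ?t" by (rule Suc.IH[OF t(1)]) (use i' t(3) Suc.prems in auto)
  also have "cyc j ?K \<otimes> (s i' \<otimes> wp k ?t) = s i \<otimes> (cyc j ?K \<otimes> wp k ?t)"
   using cyc_high[OF t(3) i'(2) _ Suc.prems(2)] i' Suc.prems(4) c si by (metis m_assoc)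
  finally show ?thesis unfolding R .
 qed
qed simp

lemma wp_id: "wp k id = \<one>"
proof (induction k)
 case (Suc k)
 have "tperm (Suc k) id = id" by (rule tail_perm_eqI[where j = "Suc k"]) auto
 moreover have "wp (Suc k) id = cyc (Suc k) (Suc k) \<otimes> wp k (tperm (Suc k) id)" by (simp only: wp.simps id_apply)
 ultimately show ?case by (simp only: Suc cyc_refl l_one one_closed)
qed simp

text \<open>Since \<open>wp_adj\<close> holds for all adjacent transpositions, induction over
  products of these makes the normal form multiplicative; the symmetric group thus acts through the
  relations alone.\<close>

lemma wp_comp:
 assumes "p permutes {1..m}" "q permutes {1..m}"
 shows "wp m (p o q) = wp m p \<otimes> wp m q"
 using assms(1)
proof (induction p rule: adj_induct)
 case id
 show ?case using wp_closed[OF assms(2)] by (simp only: id_comp wp_id le_refl l_one)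
next
 case (adj i p)
 have c: "s i : carrier M" "wp m p : carrier M" "wp m q : carrier M"
  using s_closed adj wp_closed assms(2) by auto
 have "wp m (adj i o p o q) = s i \<otimes> (wp m p \<otimes> wp m q)"
  unfolding o_assoc[symmetric] wp_adj[OF permutes_compose[OF assms(2) adj(3)] le_refl adj(1,2)] adj(4) ..
 also have "... = wp m (adj i o p) \<otimes> wp m q" unfolding wp_adj[OF adj(3) le_refl adj(1,2)] using c by (simp add: m_assoc)
 finally show ?case .
qed

end

section \<open>Normal forms of matrices of order m\<close>

context gmat begin

text \<open>The product of the idempotent erasing the rows in \<open>J\<close>, the diagonal matrix
  of g and the permutation matrix of p. On \<open>J\<close> the data g and p are not determined by
  the matrix.\<close>

definition tmat :: "nat => (nat => 'a) => (nat => nat) => nat set => 'a mtx" where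
 "tmat m g p J = (%i j. if 1 <= i & i <= m & i = p j & i ~: J then Some (g i) else None)"

lemma tmat_Some [simp]: "tmat m g p J i j = Some x <-> 1 <= i & i <= m & i = p j & i ~: J & x = g i"
 by (auto simp: tmat_def)

lemma Gpow_mem: "g : Gp m ==> 1 <= i ==> i <= m ==> g i : carrier G"
 by (auto simp: PiE_iff)

lemma perm_range: "p permutes {1..m} ==> 1 <= p j & p j <= m <-> 1 <= j & j <= m"
 using permutes_in_image[of p "{1..m}" j] by simp

lemma tmat_PM:
 assumes "g : Gp m" "p permutes {1..m}"
 shows "tmat m g p J : PM m"
 unfolding PM_iff tmat_Some
proof (intro conjI allI impI)
 fix i j x assume "1 <= i & i <= m & i = p j & i ~: J & x = g i"
 then show "1 <= i" "i <= m" "1 <= j" "j <= m" "x : carrier G"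
  using Gpow_mem[OF assms(1)] perm_range[OF assms(2), of j] by auto
next
 fix i j j' x x'
 assume "1 <= i & i <= m & i = p j & i ~: J & x = g i" "1 <= i & i <= m & i = p j' & i ~: J & x' = g i"
 then show "j = j'" using permutes_inj[OF assms(2)] by (metis injD)
qed simp

lemma gen_tmat:
 assumes g: "g : Gp m" and p: "p permutes {1..m}"
 shows "h : Gp m ==> mm m (mtx_diag m h) (tmat m g p J) = tmat m (h \<otimes>\<^bsub>Gpow G m\<^esub> g) p J"
  "1 <= i ==> i < m ==> mm m (pm m i) (tmat m g p J) = tmat m (perm_act m (adj i) g) (adj i o p) (adj i ` J)"
  "mm m (em m i) (tmat m g p J) = tmat m g p (insert i J)"
proof -
 note T = tmat_PM[OF g p, of J] and gc = Gpow_mem[OF g]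
 show "mm m (mtx_diag m h) (tmat m g p J) = tmat m (h \<otimes>\<^bsub>Gpow G m\<^esub> g) p J" (is "?l = ?r") if "h : Gp m"
 proof (rule mtxI)
  fix a b x
  have "mtx_diag m h : PM m" by (rule diag_PM) (rule Gpow_mem[OF that])
  then show "?l a b = Some x <-> ?r a b = Some x"
   using T by (auto simp: mSome)
 qed
 show "mm m (em m i) (tmat m g p J) = tmat m g p (insert i J)"
  by (rule mtxI) (use T gc in "auto simp: mSome")
 assume i: "1 <= i" "i < m"
 show "mm m (pm m i) (tmat m g p J) = tmat m (perm_act m (adj i) g) (adj i o p) (adj i ` J)" (is "?l = ?r")
 proof (rule mtxI)
  fix a b x
  have P: "pm m i : PM m" by (rule perm_PM) simp
  have r: "1 <= adj i c & adj i c <= m <-> 1 <= c & c <= m" for c using perm_range[OF adj_perm[OF i]] .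
  have J: "adj i c : J <-> c : adj i ` J" for c using in_transpose_image_iff[of c i "Suc i" J] by simp
  have "mm m (pm m i) (tmat m g p J) a b = Some x <->
   (\<exists>k. 1 <= a & a <= m & adj i k = a & 1 <= k & k <= m & k = p b & k ~: J & x = g k)"
   unfolding mSome[OF P T] perm_Some tmat_Some using gc by auto
  also have "... <-> 1 <= a & a <= m & adj i a = p b & adj i a ~: J & x = g (adj i a)"
  proof -
   have a: "adj i k = a <-> k = adj i a" for k by (metis transpose_involutory)
   show ?thesis unfolding a using r[of a] by auto
  qed
  also have "... <-> tmat m (perm_act m (adj i) g) (adj i o p) (adj i ` J) a b = Some x"
  proof -
   have "adj i a = p b <-> a = (adj i o p) b" by (metis transpose_involutory o_apply)
   moreover have "perm_act m (adj i) g a = g (adj i a)" if "1 <= a" "a <= m" using that by (simp add: perm_act_def)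
   ultimately show ?thesis unfolding tmat_Some J by auto
  qed
  finally show "?l a b = Some x <-> ?r a b = Some x" .
 qed
qed

lemma tmat_one: "tmat m \<one>\<^bsub>Gpow G m\<^esub> id {} = I1 m"
 by (rule mtxI) auto

text \<open>\<open>Gprime_factor\<close> at m = 0. The permutation is inverted because
  \<open>mon\<close> gives the column as a function of the row and \<open>tmat\<close> the row as a
  function of the column.\<close>

lemma tmat_exists:
 assumes "\<g> : PM m"
 shows "\<exists>g p J. g : Gp m & p permutes {1..m} & J <= {1..m} & \<g> = tmat m g p J"
proof -
 have "\<g> : Gprime G 0 m" using assms by (simp add: Gprime_def)
 from Gprime_factor[OF this le0] obtain p l J
  where p: "pl_ok 0 m p l" "J <= {0<..m}" "\<g> = mm m (idm m J) (mon m p l)" by blast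
 note P = pl_okD[OF p(1)]
 have e: "{0<..m} = {1..m}" by auto
 have "\<g> = tmat m (restrict l {1..m}) (inv_into UNIV p) J" (is "?l = ?r")
 proof (rule mtxI)
  fix a b x
  have "inv_into UNIV p b = a <-> b = p a" using permutes_inv_eq[OF P(1), of b a] by auto
  then show "?l a b = Some x <-> ?r a b = Some x"
   unfolding p(3) mSome[OF idm_PM mon_PM[OF p(1) le0]] using P(2) by auto
 qed
 moreover have "restrict l {1..m} : Gp m" using P(2) by auto
 moreover have "inv_into UNIV p permutes {1..m}" using permutes_inv[OF P(1)] unfolding e .
 ultimately show ?thesis using p(2) unfolding e by blast
qed

text \<open>Starting from the identity, adjacent transpositions build the permutation, then one
  diagonal factor the labels, then idempotents the erased rows, all by left multiplication.\<close>

lemma PM_induct [consumes 1, case_names one diag perm eps]: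
 assumes "\<g> : PM m" "P (I1 m)"
  and D: "\<And>g \<g>. g : Gp m ==> \<g> : PM m ==> P \<g> ==> P (mm m (mtx_diag m g) \<g>)"
  and T: "\<And>i \<g>. 1 <= i ==> i < m ==> \<g> : PM m ==> P \<g> ==> P (mm m (pm m i) \<g>)"
  and E: "\<And>i \<g>. 1 <= i ==> i <= m ==> \<g> : PM m ==> P \<g> ==> P (mm m (em m i) \<g>)"
 shows "P \<g>"
proof -
 obtain g p J where t: "g : Gp m" "p permutes {1..m}" "J <= {1..m}" "\<g> = tmat m g p J"
  using tmat_exists[OF assms(1)] by blast
 have o: "\<one>\<^bsub>Gpow G m\<^esub> : Gp m" by auto
 have 1: "P (tmat m \<one>\<^bsub>Gpow G m\<^esub> p {})"
  using t(2)
 proof (induction p rule: adj_induct)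
  case id
  show ?case unfolding tmat_one by (rule assms(2))
 next
  case (adj i p)
  have "perm_act m (adj i) \<one>\<^bsub>Gpow G m\<^esub> = \<one>\<^bsub>Gpow G m\<^esub>"
   using perm_range[OF adj_perm[OF adj(1,2)]] by (auto simp: perm_act_def fun_eq_iff)
  then show ?case
   using T[OF adj(1,2) tmat_PM[OF o adj(3)] adj(4)] unfolding gen_tmat(2)[OF o adj(3,1,2)] by (simp only: image_empty)
 qed
 have "g \<otimes>\<^bsub>Gpow G m\<^esub> \<one>\<^bsub>Gpow G m\<^esub> = g" using t(1) by (auto simp: PiE_iff extensional_def fun_eq_iff)
 then have 2: "P (tmat m g p {})" using D[OF t(1) tmat_PM[OF o t(2)] 1] unfolding gen_tmat(1)[OF o t(2,1)] by simp
 have "finite J" using t(3) finite_subset by blast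
 then have "P (tmat m g p J)"
  using t(3)
 proof (induction J rule: finite_induct)
  case (insert i J)
  then show ?case using E[OF _ _ tmat_PM[OF t(1,2)], of i J] unfolding gen_tmat(3)[OF t(1,2)] by simp
 qed (rule 2)
 then show ?thesis unfolding t(4) .
qed

end

subsection \<open>Algebras satisfying the relations\<close>

locale gmat_falg = gmat G + Q: falg Q for G (structure) and Q :: "('f::field, 'b) module"
begin

abbreviation qm (infixl "\<cdot>" 70) where "x \<cdot> y \<equiv> x \<otimes>\<^bsub>Q\<^esub> y"

end

text \<open>An algebra with elements satisfying the defining relations. It is established for the
  presented algebra, where it yields spanning, and for \<open>Zbar G m\<close>, where it yields the
  homomorphism from the presented algebra.\<close>

locale rook_pres = gmat_falg G Q for G (structure) and Q :: "('f::field, 'b) module" +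
 fixes m :: nat and D :: "(nat => 'a) => 'b" and s e u :: "nat => 'b"
 assumes D_closed: "g : Gp m ==> D g : carrier Q"
  and s_closed: "1 <= i ==> i < m ==> s i : carrier Q"
  and e_closed: "1 <= i ==> i <= m ==> e i : carrier Q"
  and u_closed: "1 <= i ==> i <= m ==> u i : carrier Q"
  and D_mult: "g : Gp m ==> g' : Gp m ==> D g \<cdot> D g' = D (g \<otimes>\<^bsub>Gpow G m\<^esub> g')"
  and D_one: "D \<one>\<^bsub>Gpow G m\<^esub> = \<one>\<^bsub>Q\<^esub>"
  and s_sq: "1 <= i ==> i < m ==> s i \<cdot> s i = \<one>\<^bsub>Q\<^esub>"
  and s_comm: "1 <= i ==> i + 1 < j ==> j < m ==> s i \<cdot> s j = s j \<cdot> s i"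
  and s_braid: "1 <= i ==> i + 1 < m ==>
   s i \<cdot> (s (i + 1) \<cdot> s i) = s (i + 1) \<cdot> (s i \<cdot> s (i + 1))"
  and s_D: "1 <= i ==> i < m ==> g : Gp m ==> s i \<cdot> D g = D (perm_act m (adj i) g) \<cdot> s i"
  and e_idem: "1 <= i ==> i <= m ==> e i \<cdot> e i = e i"
  and e_comm: "1 <= i ==> i <= m ==> 1 <= j ==> j <= m ==> e i \<cdot> e j = e j \<cdot> e i"
  and s_e: "1 <= i ==> i < m ==> s i \<cdot> e i = e (i + 1) \<cdot> s i"
  and s_e_comm: "1 <= i ==> i < m ==> 1 <= j ==> j <= m ==> j ~= i ==> j ~= i + 1 ==> s i \<cdot> e j = e j \<cdot> s i"
  and s_ee: "1 <= i ==> i < m ==> s i \<cdot> (e i \<cdot> e (i + 1)) = e i \<cdot> e (i + 1)"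
  and e_D: "1 <= i ==> i <= m ==> g : Gp m ==> e i \<cdot> D g = D g \<cdot> e i"
  and e_absorb: "1 <= i ==> i <= m ==> h : carrier G ==> e i \<cdot> D (at_pos G m i h) = e i"
  and D_u: "1 <= k ==> k <= m ==> g : Gp m ==> D g \<cdot> u k = u k \<cdot> D g"
  and s_u: "1 <= k ==> k < m ==> s k \<cdot> u k = u (k + 1) \<cdot> s k \<oplus>\<^bsub>Q\<^esub>
   (\<Oplus>\<^bsub>Q\<^esub>h\<in>carrier G. D (prk m k h)) \<cdot> (\<one>\<^bsub>Q\<^esub> \<ominus>\<^bsub>Q\<^esub> e k) \<cdot> (\<one>\<^bsub>Q\<^esub> \<ominus>\<^bsub>Q\<^esub> e (k + 1))"
  and s_u_comm: "1 <= k ==> k < m ==> 1 <= l ==> l <= m ==> l ~= k ==> l ~= k + 1 ==> s k \<cdot> u l = u l \<cdot> s k"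
  and u_comm: "1 <= k ==> k <= m ==> 1 <= l ==> l <= m ==> u k \<cdot> u l = u l \<cdot> u k"
  and e_u: "1 <= k ==> k <= m ==> e k \<cdot> u k = \<zero>\<^bsub>Q\<^esub>"
  and u_e: "1 <= k ==> k <= m ==> u k \<cdot> e k = \<zero>\<^bsub>Q\<^esub>"
  and e_u_comm: "1 <= k ==> k <= m ==> 1 <= l ==> l <= m ==> l ~= k ==> e l \<cdot> u k = u k \<cdot> e l"
begin

lemma coxeter_Q: "coxeter Q m s"
 using Q.monoid_axioms s_closed s_sq s_comm s_braid unfolding coxeter_def coxeter_axioms_def by blast

interpretation C: coxeter Q m s by (rule coxeter_Q)

abbreviation w :: "(nat => nat) => 'b" where "w \<equiv> coxeter.wp Q s m"

text \<open>The product of the \<open>e i\<close> over \<open>J\<close> up to k, in decreasing order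
  of i; \<open>EJ_insert\<close> then shows that the order is immaterial.\<close>

fun EJ :: "nat => nat set => 'b" where
 "EJ 0 J = \<one>\<^bsub>Q\<^esub>"
| "EJ (Suc k) J = (if Suc k : J then e (Suc k) \<cdot> EJ k J else EJ k J)"

lemma EJ_closed: "k <= m ==> EJ k J : carrier Q"
 by (induction k) (simp_all add: e_closed)

lemma EJ_cong: "J \<inter> {1..k} = J' \<inter> {1..k} ==> EJ k J = EJ k J'"
proof (induction k)
 case (Suc k)
 have "J \<inter> {1..k} = (J \<inter> {1..Suc k}) \<inter> {1..k}" "J' \<inter> {1..k} = (J' \<inter> {1..Suc k}) \<inter> {1..k}" by auto
 then have "EJ k J = EJ k J'" using Suc by simp
 moreover have "Suc k : J \<inter> {1..Suc k} <-> Suc k : J' \<inter> {1..Suc k}" using Suc.prems by simp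
 then have "Suc k : J <-> Suc k : J'" by simp
 ultimately show ?case by simp
qed simp

lemma EJ_insert: "k <= m ==> 1 <= i ==> i <= k ==> EJ k (insert i J) = e i \<cdot> EJ k J"
proof (induction k)
 case (Suc k)
 have c: "e (Suc k) : carrier Q" "e i : carrier Q" "EJ k J : carrier Q"
  using Suc.prems by (auto intro: e_closed EJ_closed)
 show ?case
 proof (cases "i = Suc k")
  case True
  have "EJ k (insert i J) = EJ k J" by (rule EJ_cong) (use True in auto)
  then show ?thesis using True c e_idem[of i] Suc.prems by (simp add: Q.m_assoc[symmetric])
 next
  case False
  then have "EJ k (insert i J) = e i \<cdot> EJ k J" using Suc by simp
  moreover have "e (Suc k) \<cdot> (e i \<cdot> EJ k J) = e i \<cdot> (e (Suc k) \<cdot> EJ k J)"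
   using c e_comm[of i "Suc k"] Suc.prems by (simp add: Q.m_assoc[symmetric])
  ultimately show ?thesis using False by simp
 qed
qed simp

abbreviation EE :: "nat set => 'b" where "EE \<equiv> EJ m"

lemma EE_closed [simp]: "EE J : carrier Q" by (simp add: EJ_closed)

lemma EE_empty [simp]: "EJ k {} = \<one>\<^bsub>Q\<^esub>" by (induction k) simp_all

lemma EE_insert: "1 <= i ==> i <= m ==> EE (insert i J) = e i \<cdot> EE J" by (rule EJ_insert) auto

lemma EE_induct [consumes 1, case_names empty insert]:
 assumes "J <= {1..m}" "P {}" "\<And>i J. 1 <= i ==> i <= m ==> J <= {1..m} ==> P J ==> P (insert i J)"
 shows "P J"
proof -
 have "finite J" using assms(1) finite_subset by blast
 then show ?thesis using assms(1) by (induction J rule: finite_induct) (use assms(2,3) in auto)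
qed

lemma EE_D:
 assumes "J <= {1..m}" "g : Gp m"
 shows "EE J \<cdot> D g = D g \<cdot> EE J"
 using assms(1)
proof (induction J rule: EE_induct)
 case empty
 then show ?case using D_closed[OF assms(2)] by simp
next
 case (insert i J)
 have c: "e i : carrier Q" "D g : carrier Q" using insert e_closed D_closed assms(2) by auto
 have "EE (insert i J) \<cdot> D g = e i \<cdot> (D g \<cdot> EE J)" using insert c by (simp add: EE_insert Q.m_assoc)
 also have "... = D g \<cdot> (e i \<cdot> EE J)" using e_D[OF insert(1,2) assms(2)] c by (simp add: Q.m_assoc[symmetric])
 finally show ?case using insert by (simp add: EE_insert)
qed

lemma at_pos_Gpow: "1 <= i ==> i <= m ==> h : carrier G ==> at_pos G m i h : Gp m"
 by (auto simp: at_pos_def)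

text \<open>Induction on \<open>J\<close>: the component of h at the new index i splits off as
  \<open>at_pos G m i (h i)\<close> and is absorbed by \<open>e i\<close>; the rest is trivial
  outside the smaller set.\<close>

lemma EE_absorb:
 assumes "J <= {1..m}" "h : Gp m" "\<And>i. 1 <= i ==> i <= m ==> i ~: J ==> h i = \<one>"
 shows "EE J \<cdot> D h = EE J"
 using assms
proof (induction J arbitrary: h rule: EE_induct)
 case empty
 have "h = \<one>\<^bsub>Gpow G m\<^esub>"
 proof (rule ext)
  fix i show "h i = \<one>\<^bsub>Gpow G m\<^esub> i" using empty by (cases "i : {1..m}") (auto simp: PiE_iff extensional_def)
 qed
 then show ?case unfolding \<open>h = \<one>\<^bsub>Gpow G m\<^esub>\<close> D_one by simp
next
 case (insert i J)
 define h1 where "h1 = h(i := \<one>)"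
 define a where "a = at_pos G m i (h i)"
 have hi: "h i : carrier G" using Gpow_mem[OF insert.prems(1)] insert by blast
 have h1: "h1 : Gp m" using insert by (auto simp: h1_def PiE_iff extensional_def)
 have a: "a : Gp m" unfolding a_def by (rule at_pos_Gpow[OF insert(1,2) hi])
 have "h = a \<otimes>\<^bsub>Gpow G m\<^esub> h1"
 proof (rule ext)
  fix j show "h j = (a \<otimes>\<^bsub>Gpow G m\<^esub> h1) j"
   using insert.prems(1) hi by (cases "j : {1..m}") (auto simp: a_def at_pos_def h1_def PiE_iff extensional_def)
 qed
 then have Dh: "D h = D a \<cdot> D h1" using D_mult[OF a h1] by simp
 have c: "e i : carrier Q" "D a : carrier Q" "D h1 : carrier Q" using insert e_closed D_closed a h1 by auto
 have "EE J \<cdot> D h1 = EE J" by (rule insert.IH[OF h1]) (use insert.prems in "auto simp: h1_def")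
 moreover have "EE (insert i J) \<cdot> D h = e i \<cdot> ((EE J \<cdot> D a) \<cdot> D h1)" unfolding Dh using insert c by (simp add: EE_insert Q.m_assoc)
 moreover have "... = (e i \<cdot> D a) \<cdot> (EE J \<cdot> D h1)" unfolding EE_D[OF insert(3) a] using c by (simp add: Q.m_assoc)
 ultimately show ?case using e_absorb[OF insert(1,2) hi] insert(1,2) by (simp add: EE_insert a_def)
qed

text \<open>The case \<open>j = Suc i\<close> is obtained from the relation for \<open>j = i\<close>
  by multiplying with the involution \<open>s i\<close> on both sides.\<close>

lemma s_e_any:
 assumes i: "1 <= i" "i < m" and j: "1 <= j" "j <= m"
 shows "s i \<cdot> e j = e (adj i j) \<cdot> s i"
proof -
 have c: "s i : carrier Q" "e i : carrier Q" "e (Suc i) : carrier Q" using i s_closed e_closed by auto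
 consider "j = i" | "j = Suc i" | "j ~= i" "j ~= Suc i" by blast
 then show ?thesis
 proof cases
  case 1
  then show ?thesis using s_e[OF i] by simp
 next
  case 2
  have se: "s i \<cdot> e i = e (Suc i) \<cdot> s i" using s_e[OF i] by simp
  have "e (Suc i) = (e (Suc i) \<cdot> s i) \<cdot> s i" using c s_sq[OF i] by (simp add: Q.m_assoc)
  also have "... = s i \<cdot> (e i \<cdot> s i)" unfolding se[symmetric] using c by (simp add: Q.m_assoc)
  finally have "s i \<cdot> e (Suc i) = (s i \<cdot> s i) \<cdot> (e i \<cdot> s i)" using c by (simp add: Q.m_assoc)
  then show ?thesis using 2 c s_sq[OF i] by simp
 next
  case 3
  then show ?thesis using s_e_comm[OF i j] by (simp add: transpose_apply_other)
 qed
qed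

lemma adj_in: "1 <= i ==> i < m ==> 1 <= j ==> j <= m ==> 1 <= adj i j & adj i j <= m"
 using perm_range[OF adj_perm] by blast

lemma s_EE:
 assumes i: "1 <= i" "i < m" and "J <= {1..m}"
 shows "s i \<cdot> EE J = EE (adj i ` J) \<cdot> s i"
 using assms(3)
proof (induction J rule: EE_induct)
 case empty
 then show ?case using s_closed[OF i] by simp
next
 case (insert j J)
 note a = adj_in[OF i insert(1,2)]
 have c: "s i : carrier Q" "e j : carrier Q" "e (adj i j) : carrier Q" using i s_closed e_closed insert a by auto
 have "s i \<cdot> EE (insert j J) = (s i \<cdot> e j) \<cdot> EE J" using insert c by (simp add: EE_insert Q.m_assoc)
 also have "... = e (adj i j) \<cdot> (s i \<cdot> EE J)" unfolding s_e_any[OF i insert(1,2)] using c by (simp add: Q.m_assoc)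
 also have "... = (e (adj i j) \<cdot> EE (adj i ` J)) \<cdot> s i" unfolding insert(4) using c by (simp add: Q.m_assoc)
 finally show ?case using a by (simp add: EE_insert)
qed

lemma w_closed: "p permutes {1..m} ==> w p : carrier Q" by (rule C.wp_closed) auto

lemma w_adj: "p permutes {1..m} ==> 1 <= i ==> i < m ==> w (adj i o p) = s i \<cdot> w p"
 by (rule C.wp_adj) auto

lemma w_e:
 assumes "p permutes {1..m}" "1 <= j" "j <= m"
 shows "w p \<cdot> e j = e (p j) \<cdot> w p"
 using assms(1)
proof (induction p rule: adj_induct)
 case id
 have "w id = \<one>\<^bsub>Q\<^esub>" by (rule C.wp_id)
 show ?case unfolding \<open>w id = \<one>\<^bsub>Q\<^esub>\<close> using e_closed[OF assms(2,3)] by simp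
next
 case (adj i p)
 have oj: "(adj i o p) j = adj i (p j)" by simp
 have pj: "1 <= p j" "p j <= m" using perm_range[OF adj(3), of j] assms(2,3) by auto
 note a = adj_in[OF adj(1,2) pj]
 have c: "s i : carrier Q" "e j : carrier Q" "e (p j) : carrier Q" "e (adj i (p j)) : carrier Q" "w p : carrier Q"
  using s_closed e_closed w_closed adj assms(2,3) pj a by auto
 have "w (adj i o p) \<cdot> e j = s i \<cdot> (w p \<cdot> e j)" unfolding w_adj[OF adj(3,1,2)] using c by (simp add: Q.m_assoc)
 also have "... = (s i \<cdot> e (p j)) \<cdot> w p" unfolding adj(4) using c by (simp add: Q.m_assoc)
 also have "... = e (adj i (p j)) \<cdot> w (adj i o p)" unfolding s_e_any[OF adj(1,2) pj] w_adj[OF adj(3,1,2)] using c by (simp add: Q.m_assoc)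
 finally show ?case unfolding oj .
qed

text \<open>The relation \<open>s_ee\<close> concerns neighbours. A permutation taking 1 and 2 to a
  and b conjugates it, in the mirrored form \<open>key\<close>, to an arbitrary pair.\<close>

lemma ee_w:
 assumes a: "1 <= a" "a <= m" and b: "1 <= b" "b <= m" and ab: "a ~= b"
 shows "e a \<cdot> (e b \<cdot> w (transpose a b)) = e a \<cdot> e b"
proof -
 have m2: "1 < m" using assms by linarith
 define q where "q i = (if i = Suc 0 then a else b)" for i :: nat
 have "bij_betw q {1, Suc 1} {a, b}" using ab by (auto simp: bij_betw_def inj_on_def q_def)
 then have "\<exists>p. p permutes {1..m} & (\<forall>i\<in>{1, Suc 1}. p i = q i)"
  using a b m2 by (intro extend_perm[of "{1..m}" "{1, Suc 1}" "{a, b}" q]) auto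
 then obtain p where p: "p permutes {1..m}" "p 1 = a" "p (Suc 1) = b" using ab by (auto simp: q_def)
 let ?p = "inv_into UNIV p"
 have ip: "?p permutes {1..m}" by (rule permutes_inv[OF p(1)])
 have t: "transpose a b = p o (adj 1 o ?p)"
 proof
  fix c
  define k where "k = ?p c"
  have ck: "c = p k" using permutes_inverses(1)[OF p(1), of c] by (simp add: k_def)
  have q: "p i = a <-> i = 1" "p i = b <-> i = Suc 1" for i using permutes_inj[OF p(1)] p(2,3) by (auto dest: injD)
  have "transpose a b (p k) = p (adj 1 k)" unfolding transpose_def q using p(2,3) by simp
  then show "transpose a b c = (p o (adj 1 o ?p)) c" unfolding o_apply k_def[symmetric] ck[symmetric] .
 qed
 have ap: "(adj 1 o ?p) permutes {1..m}" by (rule permutes_compose[OF ip adj_perm]) (use m2 in auto)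
 have wt: "w (transpose a b) = w p \<cdot> (s 1 \<cdot> w ?p)"
  unfolding t C.wp_comp[OF p(1) ap] using w_adj[OF ip, of 1] m2 by simp
 have e1: "e a \<cdot> w p = w p \<cdot> e 1" "e b \<cdot> w p = w p \<cdot> e (Suc 1)"
  using w_e[OF p(1), of 1] w_e[OF p(1), of "Suc 1"] p(2,3) m2 by auto
 have c: "e a : carrier Q" "e b : carrier Q" "w p : carrier Q" "w ?p : carrier Q" "s 1 : carrier Q" "e 1 : carrier Q" "e (Suc 1) : carrier Q"
  using e_closed a b w_closed[OF p(1)] w_closed[OF ip] s_closed m2 by auto
 have pp: "w p \<cdot> w ?p = \<one>\<^bsub>Q\<^esub>"
  using C.wp_comp[OF p(1) ip] permutes_inv_o(1)[OF p(1)] by (simp only: C.wp_id)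
 have key: "e 1 \<cdot> (e (Suc 1) \<cdot> s 1) = e 1 \<cdot> e (Suc 1)"
 proof -
  have se: "s 1 \<cdot> e 1 = e (Suc 1) \<cdot> s 1" "s 1 \<cdot> e (Suc 1) = e 1 \<cdot> s 1"
   using s_e_any[of 1 1] s_e_any[of 1 "Suc 1"] m2 by auto
  have "e 1 \<cdot> (e (Suc 1) \<cdot> s 1) = (e 1 \<cdot> s 1) \<cdot> e 1" unfolding se(1)[symmetric] using c by (simp add: Q.m_assoc)
  also have "... = s 1 \<cdot> (e (Suc 1) \<cdot> e 1)" unfolding se(2)[symmetric] using c by (simp add: Q.m_assoc)
  also have "e (Suc 1) \<cdot> e 1 = e 1 \<cdot> e (Suc 1)" by (rule e_comm) (use m2 in auto)
  finally show ?thesis using s_ee[of 1] m2 by simp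
 qed
 have "e a \<cdot> (e b \<cdot> w (transpose a b)) = e a \<cdot> ((e b \<cdot> w p) \<cdot> (s 1 \<cdot> w ?p))" unfolding wt using c by (simp add: Q.m_assoc)
 also have "... = (e a \<cdot> w p) \<cdot> (e (Suc 1) \<cdot> (s 1 \<cdot> w ?p))" unfolding e1(2) using c by (simp add: Q.m_assoc)
 also have "... = w p \<cdot> ((e 1 \<cdot> (e (Suc 1) \<cdot> s 1)) \<cdot> w ?p)" unfolding e1(1) using c by (simp add: Q.m_assoc)
 also have "... = (w p \<cdot> e 1) \<cdot> (e (Suc 1) \<cdot> w ?p)" unfolding key using c by (simp add: Q.m_assoc)
 also have "... = e a \<cdot> ((w p \<cdot> e (Suc 1)) \<cdot> w ?p)" unfolding e1(1)[symmetric] using c by (simp add: Q.m_assoc)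
 also have "... = e a \<cdot> (e b \<cdot> (w p \<cdot> w ?p))" unfolding e1(2)[symmetric] using c by (simp add: Q.m_assoc)
 finally show ?thesis unfolding pp using c by simp
qed

lemma EE_e:
 assumes "J <= {1..m}" "1 <= i" "i <= m"
 shows "EE J \<cdot> e i = e i \<cdot> EE J"
 using assms(1)
proof (induction J rule: EE_induct)
 case empty
 then show ?case using e_closed[OF assms(2,3)] by simp
next
 case (insert j J)
 have c: "e i : carrier Q" "e j : carrier Q" using insert e_closed assms by auto
 have "EE (insert j J) \<cdot> e i = (e j \<cdot> e i) \<cdot> EE J" using insert c by (simp add: EE_insert Q.m_assoc)
 also have "... = e i \<cdot> (e j \<cdot> EE J)" using e_comm[OF insert(1,2) assms(2,3)] c by (simp add: Q.m_assoc)
 finally show ?case using insert by (simp add: EE_insert)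
qed

text \<open>A permutation of \<open>J\<close> is a product of transpositions of points of
  \<open>J\<close>. For each of these two idempotents can be duplicated out of \<open>EE J\<close>,
  and \<open>ee_w\<close> absorbs the transposition.\<close>

lemma EE_w:
 assumes J: "J <= {1..m}" and "p permutes J"
 shows "EE J \<cdot> w p = EE J"
 using assms(2) finite_subset[OF J finite_atLeastAtMost]
proof (induction p rule: permutes_induct)
 case id
 show ?case by (simp only: C.wp_id Q.r_one EE_closed)
next
 case (swap a b p)
 have a: "1 <= a" "a <= m" "1 <= b" "b <= m" using swap J by auto
 have pm: "p permutes {1..m}" by (rule permutes_subset[OF swap(4) J])
 have tm: "transpose a b permutes {1..m}" using a by (intro permutes_swap_id) auto
 have c: "e a : carrier Q" "e b : carrier Q" "w p : carrier Q" "w (transpose a b) : carrier Q"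
  using a e_closed w_closed[OF pm] w_closed[OF tm] by auto
 have "EE J = e a \<cdot> EE J" "EE J = e b \<cdot> EE J"
  using EE_insert[of a J] EE_insert[of b J] swap a by (simp_all add: insert_absorb)
 then have E: "EE J = EE J \<cdot> (e a \<cdot> e b)"
  using EE_e[OF J, of a] EE_e[OF J, of b] a c by (simp add: Q.m_assoc[symmetric])
 have "EE J \<cdot> w (transpose a b) = EE J \<cdot> (e a \<cdot> (e b \<cdot> w (transpose a b)))" by (subst E) (use c in "simp add: Q.m_assoc")
 also have "... = EE J" unfolding ee_w[OF a swap(3)] E[symmetric] ..
 finally have "EE J \<cdot> w (transpose a b) = EE J" .
 then show ?case unfolding C.wp_comp[OF tm pm] using c swap(5) by (simp add: Q.m_assoc[symmetric])
qed

definition WT :: "(nat => 'a) => (nat => nat) => nat set => 'b" where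
 "WT g p J = EE J \<cdot> (D g \<cdot> w p)"

lemma WT_closed: "g : Gp m ==> p permutes {1..m} ==> WT g p J : carrier Q"
 using D_closed w_closed by (simp add: WT_def)

text \<open>Normal forms of one matrix have the same \<open>J\<close>, and off \<open>J\<close> the
  labels and permutations agree. They differ by a diagonal element trivial off \<open>J\<close> and
  a permutation of \<open>J\<close>, both absorbed by \<open>EE J\<close>.\<close>

lemma WT_cong:
 assumes g: "g : Gp m" "g' : Gp m" and p: "p permutes {1..m}" "p' permutes {1..m}"
  and J: "J <= {1..m}" "J' <= {1..m}" and eq: "tmat m g p J = tmat m g' p' J'"
 shows "WT g p J = WT g' p' J'"
proof -
 interpret P: group "Gpow G m" by simp
 let ?i = "inv_into UNIV p" and ?i' = "inv_into UNIV p'"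
 have e: "tmat m g p J i j = Some x <-> tmat m g' p' J' i j = Some x" for i j x unfolding eq ..
 have "i : J <-> i : J'" if "1 <= i" "i <= m" for i
  using e[of i "?i i" "g i"] e[of i "?i' i" "g' i"] that permutes_inverses(1)[OF p(1), of i] permutes_inverses(1)[OF p(2), of i]
  by auto
 then have JJ: "J = J'" using J by fastforce
 have off: "g i = g' i & p' (?i i) = i" if "1 <= i" "i <= m" "i ~: J" for i
  using e[of i "?i i" "g i"] that permutes_inverses(1)[OF p(1), of i] by auto
 define h where "h = g \<otimes>\<^bsub>Gpow G m\<^esub> inv\<^bsub>Gpow G m\<^esub> g'"
 have h: "h : Gp m" unfolding h_def using g by blast
 have "h i = \<one>" if "1 <= i" "i <= m" "i ~: J" for i
 proof -
  have "inv\<^bsub>Gpow G m\<^esub> g' = (\<lambda>i\<in>{1..m}. inv (g' i))" using g(2) by (intro inv_product_group) auto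
  then have "h i = g i \<otimes> inv (g' i)" using that by (simp add: h_def)
  then show ?thesis using off[OF that] Gpow_mem[OF g(2) that(1,2)] by simp
 qed
 then have Eh: "EE J \<cdot> D h = EE J" by (intro EE_absorb[OF J(1) h])
 have "g = h \<otimes>\<^bsub>Gpow G m\<^esub> g'" unfolding h_def using g P.inv_solve_right by (metis P.m_assoc P.l_inv P.r_one P.inv_closed)
 then have Dg: "D g = D h \<cdot> D g'" using D_mult[OF h g(2)] by simp
 define q where "q = p o ?i'"
 have q: "q permutes {1..m}" unfolding q_def by (rule permutes_compose[OF permutes_inv[OF p(2)] p(1)])
 have qJ: "q permutes J"
 proof (rule permutes_superset[OF q])
  fix i assume i: "i : {1..m} - J"
  then have "?i' i = ?i i" using off[of i] permutes_inverses(2)[OF p(2), of "?i i"] by auto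
  then show "q i = i" using permutes_inverses(1)[OF p(1), of i] by (simp add: q_def)
 qed
 have "q o p' = p" by (simp add: q_def fun_eq_iff permutes_inverses(2)[OF p(2)])
 then have wp: "w p = w q \<cdot> w p'" using C.wp_comp[OF q p(2)] by simp
 have c: "D h : carrier Q" "D g' : carrier Q" "w q : carrier Q" "w p' : carrier Q"
  using D_closed h g w_closed[OF q] w_closed[OF p(2)] by auto
 have "WT g p J = ((EE J \<cdot> D h) \<cdot> D g') \<cdot> (w q \<cdot> w p')" unfolding WT_def Dg wp using c by (simp add: Q.m_assoc)
 also have "... = D g' \<cdot> ((EE J \<cdot> w q) \<cdot> w p')" unfolding Eh EE_D[OF J(1) g(2)] using c by (simp add: Q.m_assoc)
 also have "... = (D g' \<cdot> EE J) \<cdot> w p'" unfolding EE_w[OF J(1) qJ] using c by (simp add: Q.m_assoc)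
 also have "... = WT g' p' J'" unfolding EE_D[OF J(1) g(2), symmetric] WT_def JJ[symmetric] using c by (simp add: Q.m_assoc)
 finally show ?thesis .
qed

text \<open>The image of a matrix, defined through an arbitrary choice of normal form;
  \<open>WT_cong\<close> makes it independent of the choice.\<close>

definition W :: "'a mtx => 'b" where
 "W \<g> = (SOME q. \<exists>g p J. g : Gp m & p permutes {1..m} & J <= {1..m} & \<g> = tmat m g p J & q = WT g p J)"

lemma W_tmat:
 assumes "g : Gp m" "p permutes {1..m}" "J <= {1..m}"
 shows "W (tmat m g p J) = WT g p J"
proof -
 have "\<exists>q. \<exists>g' p' J'. g' : Gp m & p' permutes {1..m} & J' <= {1..m} & tmat m g p J = tmat m g' p' J' & q = WT g' p' J'"
  using assms by blast
 from someI_ex[OF this, folded W_def] show ?thesis using WT_cong[OF _ assms(1) _ assms(2) _ assms(3)] by metis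
qed

lemma W_closed: "\<g> : PM m ==> W \<g> : carrier Q"
 using tmat_exists[of \<g> m] W_tmat WT_closed by metis

lemma W_one: "W (I1 m) = \<one>\<^bsub>Q\<^esub>"
proof -
 have "W (tmat m \<one>\<^bsub>Gpow G m\<^esub> id {}) = WT \<one>\<^bsub>Gpow G m\<^esub> id {}" by (rule W_tmat) (auto simp: permutes_id)
 also have "... = \<one>\<^bsub>Q\<^esub>" unfolding WT_def D_one EE_empty C.wp_id by simp
 finally show ?thesis unfolding tmat_one .
qed

lemma gen_W:
 assumes "\<g> : PM m"
 shows "h : Gp m ==> D h \<cdot> W \<g> = W (mm m (mtx_diag m h) \<g>)"
  "1 <= i ==> i < m ==> s i \<cdot> W \<g> = W (mm m (pm m i) \<g>)"
  "1 <= i ==> i <= m ==> e i \<cdot> W \<g> = W (mm m (em m i) \<g>)"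
proof -
 interpret P: group "Gpow G m" by simp
 obtain g p J where t: "g : Gp m" "p permutes {1..m}" "J <= {1..m}" "\<g> = tmat m g p J"
  using tmat_exists[OF assms] by blast
 have c: "D g : carrier Q" "w p : carrier Q" using t D_closed w_closed by auto
 note G = gen_tmat[OF t(1,2)]
 show "D h \<cdot> W \<g> = W (mm m (mtx_diag m h) \<g>)" if h: "h : Gp m"
 proof -
  have hg: "h \<otimes>\<^bsub>Gpow G m\<^esub> g : Gp m" using h t(1) by (rule P.m_closed)
  have dh: "D h : carrier Q" by (rule D_closed[OF h])
  have "D h \<cdot> WT g p J = (D h \<cdot> EE J) \<cdot> (D g \<cdot> w p)" unfolding WT_def using c dh by (simp add: Q.m_assoc)
  also have "... = EE J \<cdot> ((D h \<cdot> D g) \<cdot> w p)" unfolding EE_D[OF t(3) h, symmetric] using c dh by (simp add: Q.m_assoc)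
  also have "... = WT (h \<otimes>\<^bsub>Gpow G m\<^esub> g) p J" unfolding WT_def D_mult[OF h t(1)] ..
  finally show ?thesis unfolding t(4) G(1)[OF h] W_tmat[OF t(1-3)] W_tmat[OF hg t(2,3)] .
 qed
 show "e i \<cdot> W \<g> = W (mm m (em m i) \<g>)" if i: "1 <= i" "i <= m"
 proof -
  have "insert i J <= {1..m}" using t(3) i by simp
  moreover have "e i \<cdot> WT g p J = WT g p (insert i J)"
   unfolding WT_def EE_insert[OF i] using c e_closed[OF i] by (simp add: Q.m_assoc)
  ultimately show ?thesis unfolding t(4) G(3) W_tmat[OF t(1-3)] using W_tmat[OF t(1,2)] by simp
 qed
 show "s i \<cdot> W \<g> = W (mm m (pm m i) \<g>)" if i: "1 <= i" "i < m"
 proof -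
  have ag: "perm_act m (adj i) g : Gp m"
   using perm_range[OF adj_perm[OF i]] t(1) unfolding perm_act_def by (auto simp: PiE_iff)
  have ap: "(adj i o p) permutes {1..m}" by (rule permutes_compose[OF t(2) adj_perm[OF i]])
  have aJ: "adj i ` J <= {1..m}" using adj_in[OF i] t(3) by auto
  have si: "s i : carrier Q" "D (perm_act m (adj i) g) : carrier Q" using s_closed[OF i] D_closed[OF ag] by auto
  have "s i \<cdot> WT g p J = (s i \<cdot> EE J) \<cdot> (D g \<cdot> w p)" unfolding WT_def using c si by (simp add: Q.m_assoc)
  also have "... = EE (adj i ` J) \<cdot> ((s i \<cdot> D g) \<cdot> w p)" unfolding s_EE[OF i t(3)] using c si by (simp add: Q.m_assoc)
  also have "... = WT (perm_act m (adj i) g) (adj i o p) (adj i ` J)"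
   unfolding WT_def s_D[OF i t(1)] w_adj[OF t(2) i] using c si by (simp add: Q.m_assoc)
  finally show ?thesis unfolding t(4) G(2)[OF i] W_tmat[OF t(1-3)] W_tmat[OF ag ap aJ] .
 qed
qed

end

context gmat begin

lemma pair_Gpow:
 assumes "1 <= k" "k < m" "h : carrier G"
 shows "prk m k h : Gp m"
proof -
 interpret P: group "Gpow G m" by simp
 have "at_pos G m i y : Gp m" if "1 <= i" "i <= m" "y : carrier G" for i y
  using that by (auto simp: at_pos_def)
 then show ?thesis unfolding pair_elt_def by (intro P.m_closed) (use assms in auto)
qed

text \<open>Index set of the eventual basis. Sorting fixes one order for commuting letters, and the
  condition on rows excludes the monomials that \<open>u k \<cdot> e k = \<zero>\<close> annihilates
  (\<open>uv_zero\<close>).\<close>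

definition Ix :: "nat => (nat list \<times> 'a mtx) set" where
 "Ix m = {(ks, \<g>). sorted ks & set ks <= rows \<g> & \<g> : PM m}"

end

section \<open>Monomials in the \<open>u k\<close> and their filtration by length\<close>

context rook_pres
begin

definition uv :: "nat list => 'a mtx => 'b" where
 "uv ks \<g> = foldr (%k x. u k \<cdot> x) ks (W \<g>)"

lemma uv_simps [simp]: "uv [] \<g> = W \<g>" "uv (k # ks) \<g> = u k \<cdot> uv ks \<g>"
 by (simp_all add: uv_def)

lemma uv_closed: "set ks <= {1..m} ==> \<g> : PM m ==> uv ks \<g> : carrier Q"
 by (induction ks) (simp_all add: W_closed u_closed)

lemma D_uv:
 assumes "set ks <= {1..m}" "\<g> : PM m" "g : Gp m"
 shows "D g \<cdot> uv ks \<g> = uv ks (mm m (mtx_diag m g) \<g>)"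
 using assms(1)
proof (induction ks)
 case Nil
 show ?case using gen_W(1)[OF assms(2,3)] by simp
next
 case (Cons k ks)
 have k: "1 <= k" "k <= m" using Cons.prems by auto
 have c: "D g : carrier Q" "u k : carrier Q" "uv ks \<g> : carrier Q"
  using D_closed assms u_closed k uv_closed Cons.prems by auto
 have "D g \<cdot> uv (k # ks) \<g> = (D g \<cdot> u k) \<cdot> uv ks \<g>" using c by (simp add: Q.m_assoc)
 also have "... = u k \<cdot> (D g \<cdot> uv ks \<g>)" unfolding D_u[OF k assms(3)] using c by (simp add: Q.m_assoc)
 finally show ?case using Cons by simp
qed

lemma e_uv:
 assumes "set ks <= {1..m}" "\<g> : PM m" "1 <= l" "l <= m"
 shows "e l \<cdot> uv ks \<g> = (if l : set ks then \<zero>\<^bsub>Q\<^esub> else uv ks (mm m (em m l) \<g>))"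
 using assms(1)
proof (induction ks)
 case Nil
 show ?case using gen_W(3)[OF assms(2-4)] by simp
next
 case (Cons k ks)
 have k: "1 <= k" "k <= m" using Cons.prems by auto
 have c: "e l : carrier Q" "u k : carrier Q" "uv ks \<g> : carrier Q"
  using e_closed assms u_closed k uv_closed Cons.prems by auto
 have 1: "e l \<cdot> uv (k # ks) \<g> = (e l \<cdot> u k) \<cdot> uv ks \<g>" using c by (simp add: Q.m_assoc)
 show ?case
 proof (cases "l = k")
  case True
  then show ?thesis unfolding 1 using e_u[OF k] c by simp
 next
  case False
  have "e l \<cdot> uv (k # ks) \<g> = u k \<cdot> (e l \<cdot> uv ks \<g>)"
   unfolding 1 e_u_comm[OF k assms(3,4) False] using c by (simp add: Q.m_assoc)
  then show ?thesis using Cons False c by simp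
 qed
qed

lemma eps_fix: "\<g> : PM m ==> l ~: rows \<g> ==> mm m (em m l) \<g> = \<g>"
proof (rule mtxI)
 fix a b x assume g: "\<g> : PM m" "l ~: rows \<g>"
 have "a ~= l" if "\<g> a b = Some y" for y using rowsI[of \<g> a b y] that g(2) by auto
 then show "mm m (em m l) \<g> a b = Some x <-> \<g> a b = Some x"
  unfolding mSome[OF eps_PM g(1)] using PM_D(1,2,5)[OF g(1)] by auto
qed

text \<open>As row k vanishes, \<open>e k\<close> can be inserted in front of the matrix for free.
  It moves left past the other letters until it meets the last \<open>u k\<close> of the word, and
  their product is zero.\<close>

lemma uv_zero:
 assumes "set ks <= {1..m}" "\<g> : PM m" "k : set ks" "k ~: rows \<g>"
 shows "uv ks \<g> = \<zero>\<^bsub>Q\<^esub>"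
 using assms(1,3)
proof (induction ks)
 case (Cons j ks)
 have j: "1 <= j" "j <= m" "set ks <= {1..m}" using Cons.prems by auto
 have c: "u j : carrier Q" "e j : carrier Q" "uv ks \<g> : carrier Q" using j u_closed e_closed uv_closed assms(2) by auto
 show ?case
 proof (cases "k : set ks")
  case True
  then show ?thesis using Cons.IH[OF j(3)] c by simp
 next
  case False
  then have jk: "j = k" using Cons.prems by simp
  have "uv ks \<g> = e j \<cdot> uv ks \<g>"
   using e_uv[OF j(3) assms(2) j(1,2)] eps_fix[OF assms(2,4)] False jk by simp
  then have "uv (j # ks) \<g> = (u j \<cdot> e j) \<cdot> uv ks \<g>" using c by (simp add: Q.m_assoc)
  then show ?thesis unfolding u_e[OF j(1,2)] using c by simp
 qed
qed simp

lemma uv_insort: "1 <= k ==> k <= m ==> set ks <= {1..m} ==> \<g> : PM m ==> uv (insort k ks) \<g> = u k \<cdot> uv ks \<g>"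
proof (induction ks)
 case (Cons j ks)
 have j: "1 <= j" "j <= m" "set ks <= {1..m}" using Cons.prems by auto
 have c: "u j : carrier Q" "u k : carrier Q" "uv ks \<g> : carrier Q" using j u_closed Cons.prems uv_closed by auto
 have "u j \<cdot> (u k \<cdot> uv ks \<g>) = u k \<cdot> (u j \<cdot> uv ks \<g>)"
  using u_comm[OF j(1,2) Cons.prems(1,2)] c by (simp add: Q.m_assoc[symmetric])
 then show ?case using Cons j by simp
qed simp

lemma uv_sort: "set ks <= {1..m} ==> \<g> : PM m ==> uv (sort ks) \<g> = uv ks \<g>"
 by (induction ks) (simp_all add: uv_insort)

text \<open>Length is only a filtration: moving \<open>s k\<close> past \<open>u k\<close> creates a
  correction term with one letter less, so closure under generators is proved for all words up to a
  given length.\<close>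

definition V :: "nat => 'b set" where
 "V d = Q.lspan {uv ks \<g> | ks \<g>. set ks <= {1..m} & \<g> : PM m & length ks <= d}"

lemma V_gen: "{uv ks \<g> | ks \<g>. set ks <= {1..m} & \<g> : PM m & length ks <= d} <= carrier Q"
 using uv_closed by blast

lemma V_carrier: "v : V d ==> v : carrier Q"
 unfolding V_def by (rule Q.lspan_carrier[OF V_gen])

lemma V_base: "set ks <= {1..m} ==> \<g> : PM m ==> length ks <= d ==> uv ks \<g> : V d"
 unfolding V_def by (rule Q.lspan_base[OF V_gen]) blast

lemma V_lin:
 "\<zero>\<^bsub>Q\<^esub> : V d" "v : V d ==> v' : V d ==> v \<oplus>\<^bsub>Q\<^esub> v' : V d" "v : V d ==> v' : V d ==> v \<ominus>\<^bsub>Q\<^esub> v' : V d"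
 unfolding V_def Q.minus_eq
 by (rule Q.lspan.intros(1), rule Q.lspan_add[OF V_gen], assumption+,
   rule Q.lspan_add[OF V_gen], assumption, rule Q.lspan_uminus[OF V_gen])

lemma V_smult: "v : V d ==> a \<odot>\<^bsub>Q\<^esub> v : V d"
 unfolding V_def by (rule Q.lspan_smult[OF V_gen])

lemma V_mono: "d <= d' ==> V d <= V d'"
 unfolding V_def by (rule Q.lspan_mono) (blast intro: order_trans)

lemma V_map:
 assumes "v : V d" "x : carrier Q"
  and "\<And>ks \<g>. set ks <= {1..m} ==> \<g> : PM m ==> length ks <= d ==> x \<cdot> uv ks \<g> : V d'"
 shows "x \<cdot> v : V d'"
 using assms(1) unfolding V_def
 by (rule Q.lspan_map[OF V_gen V_gen _ assms(2)]) (use assms(3) in "auto simp: V_def")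

lemma V_D: "v : V d ==> g : Gp m ==> D g \<cdot> v : V d"
proof (rule V_map[OF _ D_closed])
 fix ks \<g> assume h: "g : Gp m" "set ks <= {1..m}" "\<g> : PM m" "length ks <= d"
 have "mtx_diag m g : PM m" by (rule diag_PM) (rule Gpow_mem[OF h(1)])
 then show "D g \<cdot> uv ks \<g> : V d" unfolding D_uv[OF h(2,3,1)] by (intro V_base[OF h(2) _ h(4)] mm_closed h(3))
qed

lemma V_e: "v : V d ==> 1 <= i ==> i <= m ==> e i \<cdot> v : V d"
proof (rule V_map[OF _ e_closed])
 fix ks \<g> assume h: "1 <= i" "i <= m" "set ks <= {1..m}" "\<g> : PM m" "length ks <= d"
 have "uv ks (mm m (em m i) \<g>) : V d" by (rule V_base[OF h(3) _ h(5)]) (use h in auto)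
 then show "e i \<cdot> uv ks \<g> : V d" unfolding e_uv[OF h(3,4,1,2)] using V_lin(1) by simp
qed

lemma V_u: "v : V d ==> 1 <= i ==> i <= m ==> u i \<cdot> v : V (Suc d)"
proof (rule V_map[OF _ u_closed])
 fix ks \<g> assume "1 <= i" "i <= m" "set ks <= {1..m}" "\<g> : PM m" "length ks <= d"
 then show "u i \<cdot> uv ks \<g> : V (Suc d)" using V_base[of "i # ks" \<g> "Suc d"] by simp
qed

abbreviation tt :: "nat => 'b" where
 "tt k \<equiv> (\<Oplus>\<^bsub>Q\<^esub>h\<in>carrier G. D (prk m k h)) \<cdot> (\<one>\<^bsub>Q\<^esub> \<ominus>\<^bsub>Q\<^esub> e k) \<cdot> (\<one>\<^bsub>Q\<^esub> \<ominus>\<^bsub>Q\<^esub> e (k + 1))"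

lemma tt_closed:
 assumes "1 <= k" "k < m"
 shows "(\<Oplus>\<^bsub>Q\<^esub>h\<in>carrier G. D (prk m k h)) : carrier Q" "tt k : carrier Q"
proof -
 show "(\<Oplus>\<^bsub>Q\<^esub>h\<in>carrier G. D (prk m k h)) : carrier Q"
  by (rule Q.finsum_closed) (use pair_Gpow[OF assms] D_closed in blast)
 then show "tt k : carrier Q" using assms e_closed[of k] e_closed[of "k + 1"] by auto
qed

lemma V_tt:
 assumes v: "v : V d" and k: "1 <= k" "k < m"
 shows "tt k \<cdot> v : V d"
proof -
 have ec: "e k : carrier Q" "e (k + 1) : carrier Q" using k e_closed by auto
 have r: "(\<one>\<^bsub>Q\<^esub> \<ominus>\<^bsub>Q\<^esub> e i) \<cdot> x : V d" if x: "x : V d" and i: "1 <= i" "i <= m" for x i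
 proof -
  have "(\<one>\<^bsub>Q\<^esub> \<ominus>\<^bsub>Q\<^esub> e i) \<cdot> x = x \<ominus>\<^bsub>Q\<^esub> e i \<cdot> x"
   using e_closed[OF i] V_carrier[OF x] by (simp add: Q.minus_eq Q.l_distr Q.l_minus)
  then show ?thesis using V_lin(3)[OF x V_e[OF x i]] by simp
 qed
 let ?T = "\<Oplus>\<^bsub>Q\<^esub>h\<in>carrier G. D (prk m k h)"
 have T: "?T \<cdot> x : V d" if x: "x : V d" for x
 proof -
  have p: "(%h. D (prk m k h)) : carrier G \<rightarrow> carrier Q" using pair_Gpow[OF k] D_closed by blast
  have "?T \<cdot> x = (\<Oplus>\<^bsub>Q\<^esub>h\<in>carrier G. D (prk m k h) \<cdot> x)"
   by (rule Q.finsum_ldistr[OF finG V_carrier[OF x] p])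
  also have "... : V d"
  proof -
   have "(\<Oplus>\<^bsub>Q\<^esub>h\<in>H. D (prk m k h) \<cdot> x) : V d" if "finite H" "H <= carrier G" for H
    using that
   proof (induction H rule: finite_induct)
    case empty
    then show ?case using V_lin(1) by simp
   next
    case (insert h H)
    have "D (pair_elt G m k (k + 1) y) \<cdot> x : V d" if "y : insert h H" for y
     using V_D[OF x pair_Gpow[OF k]] that insert.prems by blast
    moreover from this have "(\<Oplus>\<^bsub>Q\<^esub>h\<in>insert h H. D (prk m k h) \<cdot> x) =
     D (prk m k h) \<cdot> x \<oplus>\<^bsub>Q\<^esub> (\<Oplus>\<^bsub>Q\<^esub>h\<in>H. D (prk m k h) \<cdot> x)"
     using insert.hyps V_carrier by (intro Q.finsum_insert) auto
    ultimately show ?case using insert V_lin(2) by simp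
   qed
   then show ?thesis using finG by blast
  qed
  finally show ?thesis .
 qed
 have "tt k \<cdot> v = ?T \<cdot> ((\<one>\<^bsub>Q\<^esub> \<ominus>\<^bsub>Q\<^esub> e k) \<cdot> ((\<one>\<^bsub>Q\<^esub> \<ominus>\<^bsub>Q\<^esub> e (k + 1)) \<cdot> v))"
  using tt_closed(1)[OF k] ec V_carrier[OF v] by (simp add: Q.m_assoc)
 then show ?thesis using T r v k by simp
qed

text \<open>Induction on the length. The letter after \<open>s i\<close> either commutes with it up
  to renaming or produces a correction of smaller length, to which the induction hypothesis
  applies.\<close>

lemma V_s: "v : V d ==> 1 <= i ==> i < m ==> s i \<cdot> v : V d"
proof (induction d arbitrary: v)
 case 0
 show ?case
 proof (rule V_map[OF 0(1) s_closed[OF 0(2,3)]])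
  fix ks \<g> assume h: "set ks <= {1..m}" "\<g> : PM m" "length ks <= 0"
  have "mm m (pm m i) \<g> : PM m" using h perm_PM[of "adj i" m] by auto
  then show "s i \<cdot> uv ks \<g> : V 0" using gen_W(2)[OF h(2) 0(2,3)] V_base[of "[]" "mm m (pm m i) \<g>" 0] h by simp
 qed
next
 case (Suc d)
 note i = Suc.prems(2,3)
 have sc: "s i : carrier Q" by (rule s_closed[OF i])
 note ss = s_sq[OF i]
 have i1: "1 <= i + 1" "i + 1 <= m" "i <= m" using i by auto
 note uc = u_closed[OF i(1) i1(3)] u_closed[OF i1(1,2)] and tc = tt_closed(2)[OF i]
 note su = s_u[OF i]
 show ?case
 proof (rule V_map[OF Suc.prems(1) sc])
  fix ks \<g> assume h: "set ks <= {1..m}" "\<g> : PM m" "length ks <= Suc d"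
  show "s i \<cdot> uv ks \<g> : V (Suc d)"
  proof (cases ks)
   case Nil
   have "mm m (pm m i) \<g> : PM m" using h perm_PM[of "adj i" m] by auto
   then show ?thesis using gen_W(2)[OF h(2) i] V_base[of "[]" "mm m (pm m i) \<g>" "Suc d"] Nil by simp
  next
   case (Cons k js)
   have k: "1 <= k" "k <= m" using h Cons by auto
   define x where "x = uv js \<g>"
   have x: "x : V d" unfolding x_def by (rule V_base) (use h Cons in auto)
   note xc = V_carrier[OF x]
   have sx: "s i \<cdot> x : V d" by (rule Suc.IH[OF x i])
   note sxc = V_carrier[OF sx]
   have goal: "s i \<cdot> uv ks \<g> = s i \<cdot> (u k \<cdot> x)" by (simp add: Cons x_def)
   consider "k = i" | "k = i + 1" | "k ~= i" "k ~= i + 1" by blast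
   then show ?thesis
   proof cases
    case 1
    have "s i \<cdot> (u i \<cdot> x) = (s i \<cdot> u i) \<cdot> x" using sc uc xc by (simp add: Q.m_assoc)
    also have "... = u (i + 1) \<cdot> (s i \<cdot> x) \<oplus>\<^bsub>Q\<^esub> tt i \<cdot> x"
     unfolding su using sc uc xc tc by (simp add: Q.l_distr Q.m_assoc)
    also have "... : V (Suc d)" using V_u[OF sx i1(1,2)] V_tt[OF x i] V_mono[of d "Suc d"] by (intro V_lin(2)) auto
    finally show ?thesis unfolding goal 1 .
   next
    case 2
    \<comment> \<open>Multiplying the relation for \<open>s i \<cdot> u i\<close> by
      \<open>s i\<close> on both sides expresses \<open>s i \<cdot> u (i + 1)\<close> as
      \<open>u i \<cdot> s i\<close> minus \<open>s i \<cdot> tt i \<cdot> s i\<close>; y is this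
      correction applied to x.\<close>
    define y where "y = s i \<cdot> (tt i \<cdot> (s i \<cdot> x))"
    have y: "y : V d" unfolding y_def by (intro Suc.IH V_tt sx i)
    note yc = V_carrier[OF y]
    have "u i \<cdot> (s i \<cdot> x) = s i \<cdot> ((s i \<cdot> u i) \<cdot> (s i \<cdot> x))"
     using sc uc sxc ss by (simp add: Q.m_assoc[symmetric])
    also have "(s i \<cdot> u i) \<cdot> (s i \<cdot> x) = u (i + 1) \<cdot> (s i \<cdot> (s i \<cdot> x)) \<oplus>\<^bsub>Q\<^esub> tt i \<cdot> (s i \<cdot> x)"
     unfolding su using sc uc sxc tc by (simp add: Q.l_distr Q.m_assoc)
    also have "s i \<cdot> (s i \<cdot> x) = x" using ss sc xc by (simp add: Q.m_assoc[symmetric])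
    also have "s i \<cdot> (u (i + 1) \<cdot> x \<oplus>\<^bsub>Q\<^esub> tt i \<cdot> (s i \<cdot> x)) = s i \<cdot> (u (i + 1) \<cdot> x) \<oplus>\<^bsub>Q\<^esub> y"
     unfolding y_def using sc uc xc sxc tc by (simp add: Q.r_distr)
    finally have "s i \<cdot> (u (i + 1) \<cdot> x) = u i \<cdot> (s i \<cdot> x) \<ominus>\<^bsub>Q\<^esub> y"
     using sc uc xc yc by (simp add: Q.minus_eq Q.a_assoc Q.r_neg)
    also have "... : V (Suc d)"
     using V_u[OF sx i(1) i1(3)] y V_mono[of d "Suc d"] by (intro V_lin(3)) auto
    finally show ?thesis unfolding goal 2 .
   next
    case 3
    have "s i \<cdot> (u k \<cdot> x) = (s i \<cdot> u k) \<cdot> x" using sc u_closed[OF k] xc by (simp add: Q.m_assoc)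
    also have "... = u k \<cdot> (s i \<cdot> x)" unfolding s_u_comm[OF i k 3] using sc u_closed[OF k] xc by (simp add: Q.m_assoc)
    also have "... : V (Suc d)" by (rule V_u[OF sx k])
    finally show ?thesis unfolding goal .
   qed
  qed
 qed
qed

lemma V_one: "\<one>\<^bsub>Q\<^esub> : V 0"
 using V_base[of "[]" "I1 m" 0] W_one by simp

lemma uv_Ix: "(%(ks, \<g>). uv ks \<g>) : Ix m \<rightarrow> carrier Q"
proof
 fix x assume "x : Ix m"
 then obtain ks \<g> where x: "x = (ks, \<g>)" "set ks <= rows \<g>" "\<g> : PM m" by (auto simp: Ix_def)
 then have "set ks <= {1..m}" using PM_rows[OF x(3)] by blast
 from uv_closed[OF this x(3)] show "(case x of (ks, \<g>) => uv ks \<g>) : carrier Q" unfolding x(1) by simp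
qed

text \<open>An arbitrary word is sorted by commutation of the letters, and it contributes nothing if
  some letter is a zero row of its matrix.\<close>

lemma V_Ix:
 assumes "v : V d"
 shows "\<exists>c. keys c <= Ix m & v = Q.lc (%(ks, \<g>). uv ks \<g>) c"
proof (rule Q.lspan_image_lc[OF uv_Ix])
 have I: "(%(ks, \<g>). uv ks \<g>) ` Ix m <= carrier Q" using uv_Ix by blast
 have "{uv ks \<g> | ks \<g>. set ks <= {1..m} & \<g> : PM m & length ks <= d} <= Q.lspan ((%(ks, \<g>). uv ks \<g>) ` Ix m)"
 proof
  fix x assume "x : {uv ks \<g> | ks \<g>. set ks <= {1..m} & \<g> : PM m & length ks <= d}"
  then obtain ks \<g> where h: "x = uv ks \<g>" "set ks <= {1..m}" "\<g> : PM m" by blast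
  show "x : Q.lspan ((%(ks, \<g>). uv ks \<g>) ` Ix m)"
  proof (cases "set ks <= rows \<g>")
   case True
   then have "(sort ks, \<g>) : Ix m" using h by (simp add: Ix_def)
   then have "x : (%(ks, \<g>). uv ks \<g>) ` Ix m" using uv_sort[OF h(2,3)] h(1) by force
   then show ?thesis by (rule Q.lspan_base[OF I])
  next
   case False
   then obtain k where "k : set ks" "k ~: rows \<g>" by blast
   from uv_zero[OF h(2,3) this] show ?thesis unfolding h(1) using Q.lspan.intros(1) by simp
  qed
 qed
 from Q.lspan_lspan[OF this I] assms show "v : Q.lspan ((%(ks, \<g>). uv ks \<g>) ` Ix m)" unfolding V_def by blast
qed

end

subsection \<open>Free algebras\<close>

definition free_mon :: "'a set => 'a list monoid" where
 "free_mon X = \<lparr>carrier = lists X, monoid.mult = (@), one = []\<rparr>"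

lemma free_mon_simps [simp]: "carrier (free_mon X) = lists X" "monoid.mult (free_mon X) = (@)" "one (free_mon X) = []"
 by (simp_all add: free_mon_def)

lemma mon_free: "monoid (free_mon X)"
 by unfold_locales auto

lemma free_eq: "free_alg X = monoid_algebra (free_mon X)"
 by (simp add: free_alg_def free_mon_def)

lemma falg_free: "falg (free_alg X :: ('f::field, 'a list \<Rightarrow>\<^sub>0 'f) module)"
 unfolding free_eq by (rule falg_ma[OF mon_free])

context falg
begin

definition wev :: "('c => 'a) => 'c list => 'a" where "wev f ws = foldr (%x y. f x \<otimes> y) ws \<one>"

lemma wev_simps [simp]: "wev f [] = \<one>" "wev f (x # ws) = f x \<otimes> wev f ws"
 by (simp_all add: wev_def)

lemma wev_closed: "f : X \<rightarrow> carrier A ==> ws : lists X ==> wev f ws : carrier A"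
 by (induction ws) auto

lemma wev_append: "f : X \<rightarrow> carrier A ==> v : lists X ==> ws : lists X ==> wev f (v @ ws) = wev f v \<otimes> wev f ws"
proof (induction v)
 case Nil
 then show ?case using wev_closed[OF Nil(1,3)] by simp
next
 case (Cons x v)
 then have "f x : carrier A" "wev f v : carrier A" "wev f ws : carrier A" using wev_closed by auto
 then show ?case using Cons by (simp add: m_assoc)
qed

lemma free_hom:
 assumes "f : X \<rightarrow> carrier A"
 shows "lc (wev f) : alg_hom (free_alg X) A" "ws : lists X ==> lc (wev f) (basis ws) = wev f ws"
proof -
 show "lc (wev f) : alg_hom (free_alg X) A"
  unfolding free_eq
  by (rule lc_ma_hom[OF _ _ mon_free]) (use wev_closed[OF assms] wev_append[OF assms] in auto)
 show "lc (wev f) (basis ws) = wev f ws" if "ws : lists X" using wev_closed[OF assms that] by simp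
qed

end

section \<open>Evaluating the presentation in an algebra\<close>

context gmat begin

lemma free_hom_word:
 fixes \<f> :: "(('a, 'f::field) fw) => 'z"
 assumes "falg A" and \<f>: "\<f> : alg_hom (free_alg X) A" and "x : X"
 shows "\<f> (basis [x]) : carrier A" "y : X ==> \<f> (basis [x, y]) = \<f> (basis [x]) \<otimes>\<^bsub>A\<^esub> \<f> (basis [y])"
  "y : X ==> z : X ==> \<f> (basis [x, y, z]) = \<f> (basis [x]) \<otimes>\<^bsub>A\<^esub> (\<f> (basis [y]) \<otimes>\<^bsub>A\<^esub> \<f> (basis [z]))"
  "\<f> (basis []) = \<one>\<^bsub>A\<^esub>"
proof -
 note h = homD[OF \<f>, unfolded free_eq]
 show "\<f> (basis [x]) : carrier A" using h(1)[of "basis [x]"] assms(3) by simp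
 have 2: "\<f> (basis [x, y]) = \<f> (basis [x]) \<otimes>\<^bsub>A\<^esub> \<f> (basis [y])" if "x : X" "y : X" for x y
  using h(2)[of "basis [x]" "basis [y]"] that by simp
 show "y : X ==> \<f> (basis [x, y]) = \<f> (basis [x]) \<otimes>\<^bsub>A\<^esub> \<f> (basis [y])" by (rule 2[OF assms(3)])
 show "\<f> (basis [x, y, z]) = \<f> (basis [x]) \<otimes>\<^bsub>A\<^esub> (\<f> (basis [y]) \<otimes>\<^bsub>A\<^esub> \<f> (basis [z]))" if "y : X" "z : X"
  using h(2)[of "basis [x]" "basis [y, z]"] 2[OF that] that assms(3) by simp
 show "\<f> (basis []) = \<one>\<^bsub>A\<^esub>" using h(4) by simp
qed

lemma Hgens_mem [simp]:
 "GenG g : Hgens G m <-> g : Gp m" "GenS i : Hgens G m <-> 1 <= i & i < m"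
 "GenE i : Hgens G m <-> 1 <= i & i <= m" "GenU i : Hgens G m <-> 1 <= i & i <= m"
 by (auto simp: Hgens_def)

lemma free_hom_SU:
 fixes \<f> :: "(('a, 'f::field) fw) => 'z"
 assumes A: "falg A" and \<f>: "\<f> : alg_hom (free_alg (Hgens G m)) A" and k: "1 <= k" "k < m"
 shows "\<f> (basis [GenU (k + 1), GenS k]
    + (\<Sum>h\<in>carrier G. basis [GenG (prk m k h)])
      \<otimes>\<^bsub>free_alg (Hgens G m)\<^esub> (basis [] - basis [GenE k])
      \<otimes>\<^bsub>free_alg (Hgens G m)\<^esub> (basis [] - basis [GenE (k + 1)])) =
  \<f> (basis [GenU (k + 1)]) \<otimes>\<^bsub>A\<^esub> \<f> (basis [GenS k]) \<oplus>\<^bsub>A\<^esub>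
   (\<Oplus>\<^bsub>A\<^esub>h\<in>carrier G. \<f> (basis [GenG (prk m k h)])) \<otimes>\<^bsub>A\<^esub>
   (\<one>\<^bsub>A\<^esub> \<ominus>\<^bsub>A\<^esub> \<f> (basis [GenE k])) \<otimes>\<^bsub>A\<^esub> (\<one>\<^bsub>A\<^esub> \<ominus>\<^bsub>A\<^esub> \<f> (basis [GenE (k + 1)]))"
proof -
 let ?X = "Hgens G m"
 interpret F: falg "free_alg ?X :: ('f, ('a, 'f) fw) module" by (rule falg_free)
 let ?T = "(\<Sum>h\<in>carrier G. basis [GenG (prk m k h)]) :: ('a, 'f) fw"
 let ?e = "%i. basis [] - basis [GenE i] :: ('a, 'f) fw"
 note \<f>' = \<f>[unfolded free_eq]
 note w = free_hom_word[OF A \<f>]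
 have kk: "GenU (k + 1) : ?X" "GenS k : ?X" "GenE k : ?X" "GenE (k + 1) : ?X" using k by simp_all
 have Tk: "keys (basis [GenG (prk m k h)] :: ('a, 'f) fw) <= carrier (free_mon ?X)"
  if "h : carrier G" for h using pair_Gpow[OF k that] Hgens_mem(1)[of "prk m k h" m] by (simp del: carrier_product_group)
 have T: "?T : carrier (free_alg ?X)" unfolding free_eq ma_simps by (rule keys_sum[OF Tk])
 have ek: "keys (basis [] :: ('a, 'f) fw) <= carrier (free_mon ?X)"
  "keys (basis [GenE i] :: ('a, 'f) fw) <= carrier (free_mon ?X)" if "GenE i : ?X" for i using that by auto
 have ec: "?e i : carrier (free_alg ?X)" "\<f> (?e i) = \<one>\<^bsub>A\<^esub> \<ominus>\<^bsub>A\<^esub> \<f> (basis [GenE i])" if "GenE i : ?X" for i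
 proof -
  show "?e i : carrier (free_alg ?X)"
   unfolding free_eq ma_simps pm_diff
   by (rule keys_add_sub[OF ek(1)[OF that]]) (rule order_trans[OF keys_scale ek(2)[OF that]])
  show "\<f> (?e i) = \<one>\<^bsub>A\<^esub> \<ominus>\<^bsub>A\<^esub> \<f> (basis [GenE i])"
   unfolding alg_hom_diff[OF A \<f>' ek[OF that]] w(4)[OF that] ..
 qed
 have us: "basis [GenU (k + 1), GenS k] : carrier (free_alg ?X :: ('f, ('a, 'f) fw) module)"
  unfolding free_eq ma_simps using kk by simp
 have add: "a + b = a \<oplus>\<^bsub>free_alg ?X\<^esub> b" for a b :: "('a, 'f) fw" unfolding free_eq by simp
 have "\<f> ?T = (\<Oplus>\<^bsub>A\<^esub>h\<in>carrier G. \<f> (basis [GenG (prk m k h)]))"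
  by (rule alg_hom_sum[OF A \<f>' mon_free finG Tk])
 then show ?thesis
  unfolding add using homD(2,3)[OF \<f>] T ec[OF kk(3)] ec[OF kk(4)] us w(2)[OF kk(1,2)] by simp
qed

text \<open>Passes from equality of the images of relators to the algebraic form of the relations.
  It is applied to the quotient map of the free algebra.\<close>

lemma rook_pres_hom:
 fixes \<f> :: "(('a, 'f::field) fw) => 'z"
 assumes A: "falg A" and \<f>: "\<f> : alg_hom (free_alg (Hgens G m)) A"
  and rel: "\<And>l r. (l, r) : Hrels G m ==> \<f> l = \<f> r"
 shows "rook_pres G A m (%g. \<f> (basis [GenG g])) (%i. \<f> (basis [GenS i])) (%i. \<f> (basis [GenE i])) (%i. \<f> (basis [GenU i]))"
proof (intro rook_pres.intro rook_pres_axioms.intro gmat_falg.intro)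
 let ?g = "%g. \<f> (basis [GenG g])" and ?s = "%i. \<f> (basis [GenS i])"
  and ?e = "%i. \<f> (basis [GenE i])" and ?u = "%i. \<f> (basis [GenU i])"
 note w = free_hom_word[OF A \<f>]
 have \<f>0: "\<f> 0 = \<zero>\<^bsub>A\<^esub>" using alg_hom_zero[OF falg_free A \<f>] by (simp add: free_eq)
 show "gmat G" by (rule gmat_axioms)
 show "falg A" by (rule A)
 interpret P: group "Gpow G m" by simp
 show "?g (\<one>\<^bsub>Gpow G m\<^esub>) = \<one>\<^bsub>A\<^esub>"
  using rel[OF Hrels.G_one] w(4)[OF Hgens_mem(1)[THEN iffD2, OF P.one_closed]] by simp
 {
  fix g g' assume g: "g : Gp m" and g': "g' : Gp m"
  show "?g g \<otimes>\<^bsub>A\<^esub> ?g (g') = ?g (g \<otimes>\<^bsub>Gpow G m\<^esub> g')"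
   using rel[OF Hrels.G_mult[OF g g']] w(2)[OF Hgens_mem(1)[THEN iffD2, OF g] Hgens_mem(1)[THEN iffD2, OF g']] by simp
 next
  fix g assume g: "g : Gp m"
  have gH: "GenG g : Hgens G m" using g Hgens_mem(1) by blast
  show "?g g : carrier A" by (rule w(1)[OF gH])
  show "?e i \<otimes>\<^bsub>A\<^esub> ?g g = ?g g \<otimes>\<^bsub>A\<^esub> ?e i" if "1 <= i" "i <= m" for i
   using rel[OF Hrels.E_G[OF _ g], of i] w(2)[OF _ gH, of "GenE i"] w(2)[OF gH, of "GenE i"] that by simp
  show "?g g \<otimes>\<^bsub>A\<^esub> ?u k = ?u k \<otimes>\<^bsub>A\<^esub> ?g g" if "1 <= k" "k <= m" for k
   using rel[OF Hrels.G_U[OF _ g], of k] w(2)[OF _ gH, of "GenU k"] w(2)[OF gH, of "GenU k"] that by simp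
  fix i assume i: "1 <= i" "i < m"
  have "perm_act m (adj i) g : Gp m"
   using perm_range[OF adj_perm[OF i]] g unfolding perm_act_def by (auto simp: PiE_iff)
  then have gH': "GenG (perm_act m (adj i) g) : Hgens G m" using Hgens_mem(1) by blast
  have iH: "GenS i : Hgens G m" using i by simp
  show "?s i \<otimes>\<^bsub>A\<^esub> ?g g = ?g (perm_act m (adj i) g) \<otimes>\<^bsub>A\<^esub> ?s i"
   using rel[OF Hrels.S_G[OF _ g], of i] w(2)[OF iH gH] w(2)[OF gH' iH] i by simp
 next
  fix i h assume i: "1 <= i" "i <= m" and h: "h : carrier G"
  have "at_pos G m i h : Gp m" using i h by (auto simp: at_pos_def)
  then have "GenG (at_pos G m i h) : Hgens G m" using Hgens_mem(1) by blast
  then show "?e i \<otimes>\<^bsub>A\<^esub> ?g (at_pos G m i h) = ?e i"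
   using rel[OF Hrels.E_absorb_left[OF _ h], of i] w(2)[of "GenE i" "GenG (at_pos G m i h)"] i by simp
 next
  fix k l assume k: "1 <= k" "k <= m" and l: "1 <= l" "l <= m"
  have H: "GenE k : Hgens G m" "GenE l : Hgens G m" "GenU k : Hgens G m" "GenU l : Hgens G m" using k l by simp_all
  have kl: "k : {1..m}" "l : {1..m}" using k l by simp_all
  show "?e k \<otimes>\<^bsub>A\<^esub> ?e l = ?e l \<otimes>\<^bsub>A\<^esub> ?e k"
   using rel[OF Hrels.E_comm[OF kl]] w(2)[OF H(1,2)] w(2)[OF H(2,1)] by simp
  show "?u k \<otimes>\<^bsub>A\<^esub> ?u l = ?u l \<otimes>\<^bsub>A\<^esub> ?u k"
   using rel[OF Hrels.U_comm[OF kl]] w(2)[OF H(3,4)] w(2)[OF H(4,3)] by simp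
  show "?e l \<otimes>\<^bsub>A\<^esub> ?u k = ?u k \<otimes>\<^bsub>A\<^esub> ?e l" if "l ~= k"
   using rel[OF Hrels.E_U_comm[OF kl that]] w(2)[OF H(2,3)] w(2)[OF H(3,2)] by simp
 next
  fix k assume k: "1 <= k" "k <= m"
  have H: "GenE k : Hgens G m" "GenU k : Hgens G m" using k by simp_all
  have kl: "k : {1..m}" using k by simp
  show "?e k : carrier A" "?u k : carrier A" by (rule w(1)[OF H(1)], rule w(1)[OF H(2)])
  show "?e k \<otimes>\<^bsub>A\<^esub> ?e k = ?e k"
   using rel[OF Hrels.E_idem[OF kl]] w(2)[OF H(1,1)] by simp
  show "?e k \<otimes>\<^bsub>A\<^esub> ?u k = \<zero>\<^bsub>A\<^esub>"
   using rel[OF Hrels.E_U_zero[OF kl]] w(2)[OF H] \<f>0 by simp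
  show "?u k \<otimes>\<^bsub>A\<^esub> ?e k = \<zero>\<^bsub>A\<^esub>"
   using rel[OF Hrels.U_E_zero[OF kl]] w(2)[OF H(2,1)] \<f>0 by simp
 next
  fix i assume i: "1 <= i" "i < m"
  have H: "GenS i : Hgens G m" "GenE i : Hgens G m" "GenE (i + 1) : Hgens G m" "GenU i : Hgens G m" using i by simp_all
  have ii: "i : {1..<m}" using i by simp
  show "?s i : carrier A" by (rule w(1)[OF H(1)])
  show "?s i \<otimes>\<^bsub>A\<^esub> ?s i = \<one>\<^bsub>A\<^esub>"
   using rel[OF Hrels.S_square[OF ii]] w(2)[OF H(1,1)] w(4)[OF H(1)] by simp
  show "?s i \<otimes>\<^bsub>A\<^esub> ?e i = ?e (i + 1) \<otimes>\<^bsub>A\<^esub> ?s i"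
   using rel[OF Hrels.S_E[OF ii]] w(2)[OF H(1,2)] w(2)[OF H(3,1)] by simp
  show "?s i \<otimes>\<^bsub>A\<^esub> (?e i \<otimes>\<^bsub>A\<^esub> ?e (i + 1)) = ?e i \<otimes>\<^bsub>A\<^esub> ?e (i + 1)"
   using rel[OF Hrels.S_E_E[OF ii]] w(3)[OF H(1-3)] w(2)[OF H(2,3)] by simp
  show "?s i \<otimes>\<^bsub>A\<^esub> ?u i = ?u (i + 1) \<otimes>\<^bsub>A\<^esub> ?s i \<oplus>\<^bsub>A\<^esub>
   (\<Oplus>\<^bsub>A\<^esub>h\<in>carrier G. ?g (prk m i h)) \<otimes>\<^bsub>A\<^esub>
   (\<one>\<^bsub>A\<^esub> \<ominus>\<^bsub>A\<^esub> ?e i) \<otimes>\<^bsub>A\<^esub> (\<one>\<^bsub>A\<^esub> \<ominus>\<^bsub>A\<^esub> ?e (i + 1))"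
   using rel[OF Hrels.S_U[OF ii]] unfolding free_hom_SU[OF A \<f> i] w(2)[OF H(1,4)] .
  fix l assume l: "1 <= l" "l <= m" "l ~= i" "l ~= i + 1"
  have lH: "GenE l : Hgens G m" "GenU l : Hgens G m" using l by simp_all
  have ll: "l : {1..m}" using l by simp
  show "?s i \<otimes>\<^bsub>A\<^esub> ?e l = ?e l \<otimes>\<^bsub>A\<^esub> ?s i"
   using rel[OF Hrels.S_E_comm[OF ii ll l(3,4)]] w(2)[OF H(1) lH(1)] w(2)[OF lH(1) H(1)] by simp
  show "?s i \<otimes>\<^bsub>A\<^esub> ?u l = ?u l \<otimes>\<^bsub>A\<^esub> ?s i"
   using rel[OF Hrels.S_U_comm[OF ii ll l(3,4)]] w(2)[OF H(1) lH(2)] w(2)[OF lH(2) H(1)] by simp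
 next
  fix i assume i: "1 <= i" "i + 1 < m"
  have H: "GenS i : Hgens G m" "GenS (i + 1) : Hgens G m" using i by simp_all
  have ii: "i : {1..<m}" "i + 1 : {1..<m}" using i by simp_all
  show "?s i \<otimes>\<^bsub>A\<^esub> (?s (i + 1) \<otimes>\<^bsub>A\<^esub> ?s i) =
   ?s (i + 1) \<otimes>\<^bsub>A\<^esub> (?s i \<otimes>\<^bsub>A\<^esub> ?s (i + 1))"
   using rel[OF Hrels.S_braid[OF ii]] w(3)[OF H(1) H(2) H(1)] w(3)[OF H(2) H(1) H(2)] by simp
 next
  fix i j assume i: "1 <= i" "i + 1 < j" "j < m"
  have H: "GenS i : Hgens G m" "GenS j : Hgens G m" using i by simp_all
  have ii: "i : {1..<m}" "j : {1..<m}" "\<bar>int i - int j\<bar> > 1" using i by simp_all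
  show "?s i \<otimes>\<^bsub>A\<^esub> ?s j = ?s j \<otimes>\<^bsub>A\<^esub> ?s i"
   using rel[OF Hrels.S_comm[OF ii]] w(2)[OF H] w(2)[OF H(2,1)] by simp
 }
qed

end

context rook_pres begin

lemma e_absorb_right: "1 <= i ==> i <= m ==> h : carrier G ==> D (at_pos G m i h) \<cdot> e i = e i"
 using e_D[OF _ _ at_pos_Gpow] e_absorb by simp

text \<open>The passage in the other direction, applied to the evaluation in
  \<open>Zbar G m\<close>: every relator lies in the kernel, so the evaluation descends to the
  presented algebra.\<close>

lemma Hrels_hold:
 fixes \<f> :: "(('a, 'f) fw) => 'b"
 assumes \<f>: "\<f> : alg_hom (free_alg (Hgens G m)) Q"
  and gens: "\<And>g. g : Gp m ==> \<f> (basis [GenG g]) = D g" "\<And>i. 1 <= i ==> i < m ==> \<f> (basis [GenS i]) = s i"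
   "\<And>i. 1 <= i ==> i <= m ==> \<f> (basis [GenE i]) = e i" "\<And>i. 1 <= i ==> i <= m ==> \<f> (basis [GenU i]) = u i"
  and lr: "(l, r) : Hrels G m"
 shows "\<f> l = \<f> r"
proof -
 note w = free_hom_word[OF Q.falg_axioms \<f>]
 note M = Hgens_mem[THEN iffD2]
 interpret P: group "Gpow G m" by simp
 have z: "\<f> 0 = \<zero>\<^bsub>Q\<^esub>" using alg_hom_zero[OF falg_free Q.falg_axioms \<f>] by (simp add: free_eq)
 have gw: "\<f> (basis [x, y]) = \<f> (basis [x]) \<cdot> \<f> (basis [y])" if "x : Hgens G m" "y : Hgens G m" for x y by (rule w(2)[OF that])
 have w3: "\<f> (basis [x, y, z]) = \<f> (basis [x]) \<cdot> (\<f> (basis [y]) \<cdot> \<f> (basis [z]))"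
  if "x : Hgens G m" "y : Hgens G m" "z : Hgens G m" for x y z by (rule w(3)[OF that])
 from lr show ?thesis
 proof cases
  case (G_mult g g')
  have "\<f> (basis [GenG g, GenG g']) = D g \<cdot> D g'" using gw[OF M(1)[OF G_mult(3)] M(1)[OF G_mult(4)]] gens(1) G_mult by simp
  then show ?thesis using D_mult[OF G_mult(3,4)] gens(1)[OF P.m_closed[OF G_mult(3,4)]] G_mult(1,2) by simp
 next
  case G_one
  have "\<f> (basis []) = \<one>\<^bsub>Q\<^esub>" using w(4)[OF M(1)[OF P.one_closed]] .
  then show ?thesis using G_one gens(1)[OF P.one_closed] D_one by simp
 next
  case (S_square i)
  have i: "1 <= i" "i < m" using S_square by auto
  show ?thesis unfolding S_square gw[OF M(2)[OF conjI[OF i]] M(2)[OF conjI[OF i]]] w(4)[OF M(2)[OF conjI[OF i]]] gens(2)[OF i] by (rule s_sq[OF i])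
 next
  case (S_comm i j)
  have i: "1 <= i" "i < m" "1 <= j" "j < m" and ij: "i + 1 < j \<or> j + 1 < i" using S_comm by auto
  have "s i \<cdot> s j = s j \<cdot> s i" using ij s_comm[of i j] s_comm[of j i] i by auto
  then show ?thesis unfolding S_comm using gw[of "GenS i" "GenS j"] gw[of "GenS j" "GenS i"] gens(2) i by simp
 next
  case (S_braid i)
  have i: "1 <= i" "i + 1 < m" using S_braid by auto
  show ?thesis unfolding S_braid using w3[of "GenS i" "GenS (i + 1)" "GenS i"] w3[of "GenS (i + 1)" "GenS i" "GenS (i + 1)"]
   gens(2)[of i] gens(2)[of "i + 1"] s_braid[OF i] i by simp
 next
  case (S_G i g)
  have i: "1 <= i" "i < m" using S_G by auto
  have g': "perm_act m (adj i) g : Gp m"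
   using perm_range[OF adj_perm[OF i]] S_G(4) unfolding perm_act_def by (auto simp: PiE_iff)
  have "\<f> l = s i \<cdot> D g" unfolding S_G(1) gw[OF M(2)[OF conjI[OF i]] M(1)[OF S_G(4)]] gens(1)[OF S_G(4)] gens(2)[OF i] ..
  moreover have "\<f> r = D (perm_act m (adj i) g) \<cdot> s i"
   using gw[OF M(1)[OF g'] M(2)[OF conjI[OF i]]] gens(1)[OF g'] gens(2)[OF i] unfolding S_G(2) by simp
  ultimately show ?thesis using s_D[OF i S_G(4)] by simp
 next
  case (E_idem i)
  then show ?thesis using gw[of "GenE i" "GenE i"] gens(3)[of i] e_idem[of i] by simp
 next
  case (E_comm i j)
  then show ?thesis using gw[of "GenE i" "GenE j"] gw[of "GenE j" "GenE i"] gens(3)[of i] gens(3)[of j] e_comm[of i j] by simp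
 next
  case (S_E i)
  then show ?thesis using gw[of "GenS i" "GenE i"] gw[of "GenE (i + 1)" "GenS i"] gens(2)[of i] gens(3)[of i] gens(3)[of "i + 1"] s_e[of i] by simp
 next
  case (S_E_comm i j)
  then show ?thesis using gw[of "GenS i" "GenE j"] gw[of "GenE j" "GenS i"] gens(2)[of i] gens(3)[of j] s_e_comm[of i j] by simp
 next
  case (S_E_E i)
  then show ?thesis using w3[of "GenS i" "GenE i" "GenE (i + 1)"] gw[of "GenE i" "GenE (i + 1)"] gens(2)[of i] gens(3)[of i] gens(3)[of "i + 1"] s_ee[of i] by simp
 next
  case (E_G i g)
  have i: "1 <= i" "i <= m" using E_G by auto
  show ?thesis unfolding E_G(1,2) gw[OF M(3)[OF conjI[OF i]] M(1)[OF E_G(4)]] gw[OF M(1)[OF E_G(4)] M(3)[OF conjI[OF i]]]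
   gens(1)[OF E_G(4)] gens(3)[OF i] by (rule e_D[OF i E_G(4)])
 next
  case (E_absorb_left i h)
  have i: "1 <= i" "i <= m" using E_absorb_left by auto
  note a = at_pos_Gpow[OF i E_absorb_left(4)]
  show ?thesis unfolding E_absorb_left(1,2) gw[OF M(3)[OF conjI[OF i]] M(1)[OF a]] gens(1)[OF a] gens(3)[OF i]
   by (rule e_absorb[OF i E_absorb_left(4)])
 next
  case (E_absorb_right i h)
  have i: "1 <= i" "i <= m" using E_absorb_right by auto
  note a = at_pos_Gpow[OF i E_absorb_right(4)]
  show ?thesis unfolding E_absorb_right(1,2) gw[OF M(1)[OF a] M(3)[OF conjI[OF i]]] gens(1)[OF a] gens(3)[OF i]
   by (rule e_absorb_right[OF i E_absorb_right(4)])
 next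
  case (G_U k g)
  have i: "1 <= k" "k <= m" using G_U by auto
  show ?thesis unfolding G_U(1,2) gw[OF M(1)[OF G_U(4)] M(4)[OF conjI[OF i]]] gw[OF M(4)[OF conjI[OF i]] M(1)[OF G_U(4)]]
   gens(1)[OF G_U(4)] gens(4)[OF i] by (rule D_u[OF i G_U(4)])
 next
  case (S_U k)
  have k: "1 <= k" "k < m" using S_U by auto
  have T: "(\<Oplus>\<^bsub>Q\<^esub>h\<in>carrier G. \<f> (basis [GenG (prk m k h)])) = (\<Oplus>\<^bsub>Q\<^esub>h\<in>carrier G. D (prk m k h))"
   by (rule Q.finsum_cong') (use gens(1)[OF pair_Gpow[OF k]] D_closed[OF pair_Gpow[OF k]] in auto)
  have v: "\<f> (basis [GenU (k + 1)]) = u (k + 1)" "\<f> (basis [GenS k]) = s k" "\<f> (basis [GenE k]) = e k" "\<f> (basis [GenE (k + 1)]) = e (k + 1)"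
   "\<f> (basis [GenU k]) = u k" using gens k by simp_all
  have "\<f> l = s k \<cdot> u k" unfolding S_U(1) using gw[of "GenS k" "GenU k"] v k by simp
  then show ?thesis unfolding S_U(2) free_hom_SU[OF Q.falg_axioms \<f> k] T v using s_u[OF k] by simp
 next
  case (S_U_comm k l)
  then show ?thesis using gw[of "GenS k" "GenU l"] gw[of "GenU l" "GenS k"] gens(2)[of k] gens(4)[of l] s_u_comm[of k l] by simp
 next
  case (U_comm k l)
  then show ?thesis using gw[of "GenU k" "GenU l"] gw[of "GenU l" "GenU k"] gens(4)[of k] gens(4)[of l] u_comm[of k l] by simp
 next
  case (E_U_zero k)
  then show ?thesis using gw[of "GenE k" "GenU k"] gens(3)[of k] gens(4)[of k] e_u[of k] z by simp
 next
  case (U_E_zero k)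
  then show ?thesis using gw[of "GenU k" "GenE k"] gens(3)[of k] gens(4)[of k] u_e[of k] z by simp
 next
  case (E_U_comm k l)
  then show ?thesis using gw[of "GenE l" "GenU k"] gw[of "GenU k" "GenE l"] gens(3)[of l] gens(4)[of k] e_u_comm[of k l] by simp
 qed
qed

end

section \<open>The defining relations in the limit algebra\<close>

context gmat begin

lemma perm_mon: "1 <= i ==> i < n ==> mtx_perm G n (adj i) = mon n (adj i) (%_. \<one>)"
proof (rule mtxI)
 fix a b x assume i: "1 <= i" "i < n"
 have "adj i b = a <-> b = adj i a" by (metis transpose_involutory)
 then show "mtx_perm G n (adj i) a b = Some x <-> mon n (adj i) (%_. \<one>) a b = Some x"
  using perm_range[OF adj_perm[OF i], of a] by auto
qed

lemma adj_ok: "1 <= i ==> i < n ==> pl_ok 0 n (adj i) (%_. \<one>)"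
 by (rule transpose_ok) auto

lemma embed_perm: "1 <= i ==> i < m ==> m <= n ==> emb m n (pm m i) = mon n (adj i) (%_. \<one>)"
proof (rule mtxI)
 fix a b x assume i: "1 <= i" "i < m" "m <= n"
 have "adj i a = a" if "m < a" using i that by (simp add: transpose_apply_other)
 then show "emb m n (pm m i) a b = Some x <-> mon n (adj i) (%_. \<one>) a b = Some x"
  unfolding perm_mon[OF i(1,2)] embed_Some mon_Some
  using perm_range[OF adj_perm[OF i(1,2)], of a] i(3) by (cases "m < a") auto
qed

lemma embed_eps: "1 <= k ==> k <= m ==> m <= n ==> emb m n (em m k) = idm n {k}"
proof (rule mtxI)
 fix a b x assume "1 <= k" "k <= m" "m <= n"
 then show "emb m n (em m k) a b = Some x <-> idm n {k} a b = Some x"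
  unfolding embed_Some eps_Some idm_Some by auto
qed

definition dl :: "nat => (nat => 'a) => nat => 'a" where
 "dl m g a = (if 1 <= a & a <= m then g a else \<one>)"

lemma dl_ok: "g : Gp m ==> pl_ok 0 n id (dl m g)"
 unfolding pl_ok_def using Gpow_mem by (auto simp: dl_def permutes_id)

lemma embed_diag: "m <= n ==> emb m n (mtx_diag m g) = mon n id (dl m g)"
 by (rule mtxI) (auto simp: dl_def)

lemma embed_pair:
 assumes "1 <= k" "k < m" "m <= n" "h : carrier G"
 shows "emb m n (mtx_diag m (prk m k h)) = mtx_diag n (prk n k h)"
 unfolding embed_diag[OF assms(3)]
proof (rule mtxI)
 fix a b x
 have "dl m (prk m k h) a = prk n k h a" if "1 <= a" "a <= n"
  using that assms by (auto simp: dl_def pair_elt_def at_pos_def)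
 then show "mon n id (dl m (prk m k h)) a b = Some x <-> mtx_diag n (prk n k h) a b = Some x"
  by auto
qed

text \<open>Since p fixes k and preserves the indices beyond k, conjugation merely permutes the
  summands of \<open>u_elt G k n\<close>.\<close>

lemma mon_u:
 assumes ok: "pl_ok 0 n p l" and k: "1 <= k" "k <= n" "p k = k" and b: "bij_betw p {k+1..n} {k+1..n}"
 shows "basis (mon n p l) \<star>[n] u_elt G k n = u_elt G k n \<star>[n] (basis (mon n p l) :: ('a, 'f::field) fgel)"
proof -
 have "basis (mon n p l) \<star>[n] u_elt G k n = (\<Sum>i\<in>{k+1..n}. basis (mon n p l) \<star>[n] (R n k i :: ('a, 'f) fgel))"
  unfolding u_elt_R[OF k(1)] ma_sum ..
 also have "... = (\<Sum>i\<in>{k+1..n}. basis (mon n p l) \<star>[n] R n k (p i))"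
  by (rule sum.reindex_bij_betw[OF b, symmetric])
 also have "... = (\<Sum>i\<in>{k+1..n}. R n k i \<star>[n] basis (mon n p l))"
 proof (rule sum.cong[OF refl])
  fix i assume "i : {k+1..n}"
  then show "basis (mon n p l) \<star>[n] R n k (p i) = R n k i \<star>[n] (basis (mon n p l) :: ('a, 'f) fgel)"
   using R_conj[OF ok k(1,2), of i] k(3) by simp
 qed
 finally show ?thesis unfolding u_elt_R[OF k(1)] ma_sum .
qed

text \<open>The summands beyond \<open>k + 1\<close> are carried to those of
  \<open>u_elt G (k + 1) n\<close>. In the summand at \<open>k + 1\<close>, which is symmetric in
  its two indices, the transposition from \<open>R\<close> meets the one moved across and cancels,
  leaving the term with \<open>t_elt\<close>.\<close>

lemma perm_u:
 assumes k: "1 <= k" "k < n"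
 shows "basis (mon n (adj k) (%_. \<one>)) \<star>[n] u_elt G k n =
  u_elt G (k + 1) n \<star>[n] basis (mon n (adj k) (%_. \<one>))
   + t_elt G n k (k + 1) \<star>[n] eps1 n k \<star>[n] (eps1 n (k + 1) :: ('a, 'f::field) fgel)"
proof -
 interpret F: falg "FGbar G n :: ('a, 'f) fgalg" by (rule falg_FG)
 let ?s = "basis (mon n (adj k) (%_. \<one>)) :: ('a, 'f) fgel"
 let ?m = "%x y. x \<star>[n] y"
 let ?t = "t_elt G n k (k + 1) :: ('a, 'f) fgel"
 note ok = adj_ok[OF k]
 have sc: "?s : Fc n" using mon_PM0[OF ok] by simp
 have tc: "?t : Fc n"
  unfolding t_elt_def ma_simps
 proof (rule keys_sum)
  fix h assume h: "h : carrier G"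
  have "mtx_diag n (prk n k h) : PM n"
   by (rule diag_PM) (use Gpow_mem[OF pair_Gpow[OF k h]] in auto)
  then show "keys (basis (mtx_diag n (prk n k h)) :: ('a, 'f) fgel) <= PM n" by simp
 qed
 have ss: "?m ?s ?s = \<one>\<^bsub>FGbar G n\<^esub>"
 proof -
  have "mon n (adj k o adj k) (%a. \<one> \<otimes> \<one>) = I1 n" by (rule mtxI) auto
  then show ?thesis using mon_mon[OF ok ok] by simp
 qed
 have a: "adj k k = k + 1" "adj k (k + 1) = k" by simp_all
 have e: "?m (eps1 n k) ?s = ?m ?s (eps1 n (k + 1))" "?m (eps1 n (k + 1)) ?s = ?m ?s (eps1 n k)"
  by (rule eps1_mon[OF ok, of k, unfolded a, symmetric], rule eps1_mon[OF ok, of "k + 1", unfolded a, symmetric])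
 have "?m ?t (basis (mtx_perm G n (transpose k (k + 1)))) = (\<Sum>h\<in>carrier G. basis (SW n k (k + 1) h))"
  by (rule SW_carrier_sum) (use k in auto)
 then have T: "(\<Sum>h\<in>carrier G. basis (SW n k (k + 1) h)) = ?m ?t ?s"
  using perm_mon[OF k] by simp
 have "?m ?s (R n k (k + 1)) = ?m (R n (k + 1) k) ?s"
  by (rule R_conj[OF ok, of "k + 1" k, unfolded a]) (use k in auto)
 also have "R n (k + 1) k = (R n k (k + 1) :: ('a, 'f) fgel)" by (rule R_sym) (use k in auto)
 also have "?m (R n k (k + 1)) ?s = ?m (?m ?t ?s) (?m (eps1 n k) (?m (eps1 n (k + 1)) ?s))"
  unfolding R_def T using sc tc eps1_c F.m_closed by (simp add: F.m_assoc del: ma_simps(5))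
 also have "?m (eps1 n k) (?m (eps1 n (k + 1)) ?s) = ?m ?s (?m (eps1 n (k + 1)) (eps1 n k))"
  unfolding e using sc eps1_c F.m_closed e(1) by (simp add: F.m_assoc[symmetric] del: ma_simps(5))
 also have "?m (?m ?t ?s) (?m ?s (?m (eps1 n (k + 1)) (eps1 n k))) = ?m (?m ?t (?m ?s ?s)) (?m (eps1 n (k + 1)) (eps1 n k))"
  using sc tc eps1_c F.m_closed by (simp add: F.m_assoc del: ma_simps(5) ma_single_mult)
 also have "... = ?m (?m ?t (eps1 n k)) (eps1 n (k + 1))"
  unfolding ss eps1_comm[of n "k + 1" k] using tc eps1_c F.m_closed by (simp add: F.m_assoc del: ma_simps)
 finally have top: "?m ?s (R n k (k + 1)) = ?m (?m ?t (eps1 n k)) (eps1 n (k + 1))" .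
 have rest: "?m ?s (R n k i) = ?m (R n (k + 1) i) ?s" if "i : {k + 2..n}" for i
 proof -
  have i: "adj k i = i" using that by (intro transpose_apply_other) auto
  show ?thesis by (rule R_conj[OF ok, of "k + 1" i, unfolded a i]) (use k that in auto)
 qed
 have "{k + 1..n} = insert (k + 1) {k + 2..n}" using k by auto
 then have "?m ?s (u_elt G k n) = ?m ?s (R n k (k + 1)) + (\<Sum>i\<in>{k + 2..n}. ?m ?s (R n k i))"
  unfolding u_elt_R[OF k(1)] ma_sum by simp
 also have "(\<Sum>i\<in>{k + 2..n}. ?m ?s (R n k i)) = (\<Sum>i\<in>{k + 2..n}. ?m (R n (k + 1) i) ?s)" by (rule sum.cong[OF refl rest])
 also have "... = ?m (u_elt G (k + 1) n) ?s"
 proof -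
  have "u_elt G (k + 1) n = (\<Sum>i=k+1+1..n. R n (k + 1) i :: ('a, 'f) fgel)" by (rule u_elt_R) simp
  then show ?thesis by (simp add: ma_sum)
 qed
 finally show ?thesis unfolding top by (simp add: add.commute)
qed

text \<open>All constituents of \<open>u_elt G l n\<close> are combinations of matrices fixing the
  first k indices, and with these \<open>u_elt G k n\<close> commutes by
  \<open>u_comm_Gprime\<close>.\<close>

lemma u_elt_comm_less:
 assumes k: "1 <= k" "k < l" "l <= n"
 shows "u_elt G k n \<star>[n] u_elt G l n = u_elt G l n \<star>[n] (u_elt G k n :: ('a, 'f::field) fgel)"
proof -
 interpret F: falg "FGbar G n :: ('a, 'f) fgalg" by (rule falg_FG)
 let ?m = "%x y. x \<star>[n] y"
 let ?u = "u_elt G k n :: ('a, 'f) fgel"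
 have uc: "?u : Fc n" by (rule u_elt_c[OF k(1)])
 have kn: "k <= n" using k by simp
 have g: "?m ?u (basis \<u>) = ?m (basis \<u>) ?u" if "\<u> : Gprime G k n" for \<u> by (rule u_comm_Gprime[OF k(1) kn that])
 have prod: "?m ?u (?m b c) = ?m (?m b c) ?u"
  if "b : Fc n" "c : Fc n" "?m ?u b = ?m b ?u" "?m ?u c = ?m c ?u" for b c
  using that uc by (metis F.m_assoc)
 have eps: "?m ?u (eps1 n i) = ?m (eps1 n i) ?u" if "k < i" for i
 proof -
  have "I1 n : Gprime G k n" using kn by (auto simp: Gprime_def)
  then show ?thesis unfolding eps1_def ma_diff using g eps_Gprime[OF that kn] by simp
 qed
 have R: "?m ?u (R n l i) = ?m (R n l i) ?u" if i: "i : {l + 1..n}" for i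
 proof -
  have sw: "SW n l i h : Gprime G k n" if h: "h : carrier G" for h
   unfolding SW_def
  proof (rule mon_Gprime[OF _ kn])
   have "transpose l i permutes {k<..n}" by (rule permutes_swap_id) (use k i in auto)
   then show "pl_ok k n (transpose l i) (lab l i h)" using k i h by (auto simp: pl_ok_def lab_def)
  qed
  have "?m ?u (\<Sum>h\<in>carrier G. basis (SW n l i h)) = ?m (\<Sum>h\<in>carrier G. basis (SW n l i h)) ?u"
   unfolding ma_sum by (rule sum.cong[OF refl g[OF sw]])
  moreover have "(\<Sum>h\<in>carrier G. basis (SW n l i h) :: ('a, 'f) fgel) : Fc n"
   by (rule SWsum_c) (use k i in auto)
  ultimately show ?thesis unfolding R_def
   by (intro prod F.m_closed eps1_c eps) (use k i in auto)
 qed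
 have l: "1 <= l" using k by simp
 show ?thesis unfolding u_elt_R[OF l] ma_sum by (intro sum.cong refl R) auto
qed

lemma u_elt_comm:
 assumes "1 <= k" "k <= n" "1 <= l" "l <= n"
 shows "u_elt G k n \<star>[n] u_elt G l n = u_elt G l n \<star>[n] (u_elt G k n :: ('a, 'f::field) fgel)"
proof (cases k l rule: linorder_cases)
 case less
 then show ?thesis by (rule u_elt_comm_less[OF assms(1) _ assms(4)])
next
 case greater
 then show ?thesis by (rule u_elt_comm_less[OF assms(3) _ assms(2), symmetric])
qed simp

lemma idm_u:
 assumes k: "1 <= k" "k <= n"
 shows "basis (idm n {k}) \<star>[n] u_elt G k n = (0 :: ('a, 'f::field) fgel)"
  "u_elt G k n \<star>[n] basis (idm n {k}) = (0 :: ('a, 'f) fgel)"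
  "basis (idm n J) \<star>[n] u_elt G k n = u_elt G k n \<star>[n] (basis (idm n J) :: ('a, 'f) fgel)"
proof -
 have i: "1 <= i" "i <= n" "k ~= i" if "i : {k+1..n}" for i using that k by auto
 show "basis (idm n {k}) \<star>[n] u_elt G k n = (0 :: ('a, 'f) fgel)"
  unfolding u_elt_R[OF k(1)] ma_sum by (rule sum.neutral) (use R_idm(2)[OF k i] in blast)
 show "u_elt G k n \<star>[n] basis (idm n {k}) = (0 :: ('a, 'f) fgel)"
  unfolding u_elt_R[OF k(1)] ma_sum by (rule sum.neutral) (use R_idm(1)[OF k i] in blast)
 show "basis (idm n J) \<star>[n] u_elt G k n = u_elt G k n \<star>[n] (basis (idm n J) :: ('a, 'f) fgel)"
  unfolding u_elt_R[OF k(1)] ma_sum by (rule sum.cong[OF refl]) (rule R_idm(3)[OF k i, symmetric])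
qed

lemma Zbar_minus_app:
 fixes x y :: "('a, 'f::field) zel"
 assumes "y : Zc m" "m <= n"
 shows "(x \<ominus>\<^bsub>Zbar G m\<^esub> y) n = x n - y n"
proof -
 interpret Z: falg "Zbar G m :: ('a, 'f) zalg" by (rule falg_Z)
 show ?thesis unfolding Z.minus_eq Z.smult_minus_one[OF assms(1), symmetric] Zb_app[OF assms(2)] pm_diff ..
qed

lemma Zbar_finsum_app:
 fixes f :: "'i => ('a, 'f::field) zel"
 assumes "finite I" "f : I \<rightarrow> Zc m" "m <= n"
 shows "(\<Oplus>\<^bsub>Zbar G m\<^esub>i\<in>I. f i) n = (\<Sum>i\<in>I. f i n)"
 using assms(1,2)
proof (induction I rule: finite_induct)
 interpret Z: falg "Zbar G m :: ('a, 'f) zalg" by (rule falg_Z)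
 {
  case empty
  show ?case using Zb_app(4)[OF assms(3)] by simp
 next
  case (insert i I)
  have f: "f i : Zc m" "f : I \<rightarrow> Zc m" using insert.prems by auto
  show ?case unfolding Z.finsum_insert[OF insert.hyps(1,2) f(2,1)] Zb_app[OF assms(3)]
   using insert f by simp
 }
qed

lemma perm_perm:
 assumes "p permutes {1..m}" "q permutes {1..m}"
 shows "mm m (mtx_perm G m p) (mtx_perm G m q) = mtx_perm G m (p o q)" (is "?l = ?r")
proof (rule mtxI)
 fix a b x
 show "?l a b = Some x <-> ?r a b = Some x"
  unfolding mSome[OF perm_PM[OF permutes_inj[OF assms(1)]] perm_PM[OF permutes_inj[OF assms(2)]]] perm_Some
  using perm_range[OF assms(2), of b] by auto
qed

abbreviation cs :: "nat => 'a mtx => ('a, 'f::field) zel" where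
 "cs m \<g> \<equiv> csq m (basis \<g>)"

lemma cs_closed: "\<g> : PM m ==> (cs m \<g> :: ('a, 'f::field) zel) : Zc m"
 by (rule homD(1)[OF csq_hom]) simp

lemma cs_mult: "\<g> : PM m ==> \<d> : PM m ==>
  cs m \<g> \<bullet>[m] cs m \<d> = (cs m (mm m \<g> \<d>) :: ('a, 'f::field) zel)"
 using homD(2)[OF csq_hom, of "basis \<g> :: ('a, 'f) fgel" m "basis \<d>"] by simp

lemma cs_app: "m <= n ==> cs m \<g> n = basis (emb m n \<g>)"
 by (simp add: csq_app lin_ext_lin)

lemma cs_one: "cs m (I1 m) = (\<one>\<^bsub>Zbar G m\<^esub> :: ('a, 'f::field) zel)"
 using homD(4)[OF csq_hom, of m] by simp

lemma u_seq_app: "m <= n ==> us m k n = u_elt G k n"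
 by (simp add: u_seq_def)

lemma Gpow_diag_PM: "g : Gp m ==> mtx_diag m g : PM m"
 by (rule diag_PM) (rule Gpow_mem)

text \<open>Relations among matrices are verified in order m and transported by the constant
  sequences; those involving \<open>us\<close> are verified in every order n on embedded
  matrices.\<close>

lemma rook_pres_Zbar:
 "rook_pres G (Zbar G m :: ('a, 'f::field) zalg) m (%g. cs m (mtx_diag m g))
  (%i. cs m (pm m i)) (%i. cs m (em m i)) (us m)"
proof (intro rook_pres.intro rook_pres_axioms.intro gmat_falg.intro)
 let ?Z = "Zbar G m :: ('a, 'f) zalg"
 interpret Z: falg ?Z by (rule falg_Z)
 interpret P: group "Gpow G m" by simp
 let ?s = "%i. pm m i" and ?e = "em m" and ?d = "mtx_diag m"
 have sP: "?s i : PM m" for i by (rule perm_PM) simp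
 note dP = Gpow_diag_PM and eP = eps_PM
 have ext: "x = y" if "x : carrier ?Z" "y : carrier ?Z" "\<And>n. m <= n ==> x n = y n" for x y
  by (rule Zbar_ext[OF ZbarD(1)[OF that(1)] ZbarD(1)[OF that(2)] that(3)])
 show "gmat G" by (rule gmat_axioms)
 show "falg ?Z" by (rule falg_Z)
 have "mtx_diag m \<one>\<^bsub>Gpow G m\<^esub> = I1 m" by (rule mtxI) auto
 then show "cs m (?d \<one>\<^bsub>Gpow G m\<^esub>) = \<one>\<^bsub>?Z\<^esub>" by (simp only: cs_one)
 {
  fix g g' assume g: "g : Gp m" "g' : Gp m"
  have "mm m (?d g) (?d g') = ?d (g \<otimes>\<^bsub>Gpow G m\<^esub> g')" by (rule mtxI) (auto simp: mSome[OF dP[OF g(1)] dP[OF g(2)]])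
  then show "cs m (?d g) \<otimes>\<^bsub>?Z\<^esub> cs m (?d g') = cs m (?d (g \<otimes>\<^bsub>Gpow G m\<^esub> g'))" by (simp only: cs_mult[OF dP[OF g(1)] dP[OF g(2)]])
 next
  fix g assume g: "g : Gp m"
  show "cs m (?d g) : carrier ?Z" by (rule cs_closed[OF dP[OF g]])
  show "cs m (?e i) \<otimes>\<^bsub>?Z\<^esub> cs m (?d g) = cs m (?d g) \<otimes>\<^bsub>?Z\<^esub> cs m (?e i)" if "1 <= i" "i <= m" for i
  proof -
   have "mm m (?e i) (?d g) = mm m (?d g) (?e i)"
    by (rule mtxI) (use Gpow_mem[OF g] in "auto simp: mSome[OF dP[OF g] eP] mSome[OF eP dP[OF g]]")
   then show ?thesis by (simp only: cs_mult[OF eP dP[OF g]] cs_mult[OF dP[OF g] eP])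
  qed
  show "cs m (?d g) \<otimes>\<^bsub>?Z\<^esub> us m k = us m k \<otimes>\<^bsub>?Z\<^esub> cs m (?d g)" (is "?l = ?r") if k: "1 <= k" "k <= m" for k
  proof (rule ext)
   fix n assume n: "m <= n"
   show "?l n = ?r n"
    unfolding Zb_app[OF n] cs_app[OF n] u_seq_app[OF n] embed_diag[OF n]
    by (rule mon_u[OF dl_ok[OF g]]) (use k n in auto)
  qed (use cs_closed[OF dP[OF g]] us_Zbar[OF k] in auto)
  fix i assume i: "1 <= i" "i < m"
  have g': "perm_act m (adj i) g : Gp m"
   using perm_range[OF adj_perm[OF i]] g unfolding perm_act_def by (auto simp: PiE_iff)
  have "mm m (?s i) (?d g) = mm m (?d (perm_act m (adj i) g)) (?s i)" (is "?l = ?r")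
  proof (rule mtxI)
   fix a b x
   have "perm_act m (adj i) g a = g b" if "1 <= a" "a <= m" "adj i b = a" using that by (auto simp: perm_act_def)
   then show "?l a b = Some x <-> ?r a b = Some x"
    unfolding mSome[OF sP dP[OF g]] mSome[OF dP[OF g'] sP] perm_Some diag_Some
    using Gpow_mem[OF g, of b] by auto
  qed
  then show "cs m (?s i) \<otimes>\<^bsub>?Z\<^esub> cs m (?d g) = cs m (?d (perm_act m (adj i) g)) \<otimes>\<^bsub>?Z\<^esub> cs m (?s i)"
   by (simp only: cs_mult[OF sP dP[OF g]] cs_mult[OF dP[OF g'] sP])
 next
  fix i h assume i: "1 <= i" "i <= m" and h: "h : carrier G"
  have a: "at_pos G m i h : Gp m" using i h by (auto simp: at_pos_def)
  have "mm m (?e i) (?d (at_pos G m i h)) = ?e i" (is "?l = ?r")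
  proof (rule mtxI)
   fix c b x
   have "at_pos G m i h c = \<one>" if "1 <= c" "c <= m" "c ~= i" using that by (simp add: at_pos_def)
   then show "?l c b = Some x <-> ?r c b = Some x"
    unfolding mSome[OF eP dP[OF a]] eps_Some diag_Some by auto
  qed
  then show "cs m (?e i) \<otimes>\<^bsub>?Z\<^esub> cs m (?d (at_pos G m i h)) = cs m (?e i)" by (simp only: cs_mult[OF eP dP[OF a]])
 next
  fix k l assume k: "1 <= k" "k <= m" and l: "1 <= l" "l <= m"
  have "mm m (?e k) (?e l) = mm m (?e l) (?e k)" unfolding eps_idm idm_idm by (simp add: Un_commute)
  then show "cs m (?e k) \<otimes>\<^bsub>?Z\<^esub> cs m (?e l) = cs m (?e l) \<otimes>\<^bsub>?Z\<^esub> cs m (?e k)" by (simp only: cs_mult[OF eP eP])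
  show "us m k \<otimes>\<^bsub>?Z\<^esub> us m l = us m l \<otimes>\<^bsub>?Z\<^esub> us m k" (is "?l = ?r")
  proof (rule ext)
   fix n assume n: "m <= n"
   show "?l n = ?r n"
    unfolding Zb_app[OF n] u_seq_app[OF n] by (rule u_elt_comm) (use k l n in auto)
  qed (use us_Zbar[OF k] us_Zbar[OF l] in auto)
  show "cs m (?e l) \<otimes>\<^bsub>?Z\<^esub> us m k = us m k \<otimes>\<^bsub>?Z\<^esub> cs m (?e l)" (is "?l = ?r") if "l ~= k"
  proof (rule ext)
   fix n assume n: "m <= n"
   show "?l n = ?r n"
    unfolding Zb_app[OF n] u_seq_app[OF n] cs_app[OF n] embed_eps[OF l n] by (rule idm_u(3)) (use k n in auto)
  qed (use us_Zbar[OF k] cs_closed[OF eP] in auto)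
 next
  fix k assume k: "1 <= k" "k <= m"
  show "cs m (?e k) : carrier ?Z" "us m k : carrier ?Z" by (rule cs_closed[OF eP], rule us_Zbar[OF k])
  have "mm m (?e k) (?e k) = ?e k" unfolding eps_idm idm_idm by simp
  then show "cs m (?e k) \<otimes>\<^bsub>?Z\<^esub> cs m (?e k) = cs m (?e k)" by (simp only: cs_mult[OF eP eP])
  show "cs m (?e k) \<otimes>\<^bsub>?Z\<^esub> us m k = \<zero>\<^bsub>?Z\<^esub>" (is "?l = ?r")
  proof (rule ext)
   fix n assume n: "m <= n"
   show "?l n = ?r n"
    unfolding Zb_app[OF n] u_seq_app[OF n] cs_app[OF n] embed_eps[OF k n] by (rule idm_u(1)) (use k n in auto)
  qed (use us_Zbar[OF k] cs_closed[OF eP] in auto)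
  show "us m k \<otimes>\<^bsub>?Z\<^esub> cs m (?e k) = \<zero>\<^bsub>?Z\<^esub>" (is "?l = ?r")
  proof (rule ext)
   fix n assume n: "m <= n"
   show "?l n = ?r n"
    unfolding Zb_app[OF n] u_seq_app[OF n] cs_app[OF n] embed_eps[OF k n] by (rule idm_u(2)) (use k n in auto)
  qed (use us_Zbar[OF k] cs_closed[OF eP] in auto)
 next
  fix i assume i: "1 <= i" "i < m"
  note pm = perm_mon[OF i] and ok = adj_ok[OF i] and ap = adj_perm[OF i]
  have i1: "1 <= i" "i <= m" "1 <= i + 1" "i + 1 <= m" using i by auto
  show "cs m (?s i) : carrier ?Z" by (rule cs_closed[OF sP])
  have "mm m (?s i) (?s i) = I1 m" unfolding perm_perm[OF ap ap] by (rule mtxI) auto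
  then show "cs m (?s i) \<otimes>\<^bsub>?Z\<^esub> cs m (?s i) = \<one>\<^bsub>?Z\<^esub>" by (simp only: cs_mult[OF sP sP] cs_one)
  have se: "mm m (?s i) (?e (adj i j)) = mm m (?e j) (?s i)" for j
   using mon_idm[OF ok, of "{j}"] unfolding pm eps_idm by simp
  show "cs m (?s i) \<otimes>\<^bsub>?Z\<^esub> cs m (?e i) = cs m (?e (i + 1)) \<otimes>\<^bsub>?Z\<^esub> cs m (?s i)"
   using se[of "i + 1"] by (simp add: cs_mult[OF sP eP] cs_mult[OF eP sP])
  have "mm m (?s i) (mm m (?e i) (?e (i + 1))) = mm m (?e i) (?e (i + 1))"
   unfolding eps_idm idm_idm
   by (rule mtxI) (auto simp: mSome[OF sP idm_PM] transpose_def)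
  then show "cs m (?s i) \<otimes>\<^bsub>?Z\<^esub> (cs m (?e i) \<otimes>\<^bsub>?Z\<^esub> cs m (?e (i + 1))) = cs m (?e i) \<otimes>\<^bsub>?Z\<^esub> cs m (?e (i + 1))"
   by (simp only: cs_mult[OF eP eP] cs_mult[OF sP mm_closed[OF eP eP]])
  let ?T = "\<Oplus>\<^bsub>?Z\<^esub>h\<in>carrier G. cs m (?d (prk m i h))"
  have p: "(%h. cs m (?d (prk m i h))) : carrier G \<rightarrow> carrier ?Z" using cs_closed[OF dP[OF pair_Gpow[OF i]]] by blast
  have Tc: "?T : carrier ?Z" by (rule Z.finsum_closed[OF p])
  show "cs m (?s i) \<otimes>\<^bsub>?Z\<^esub> us m i = us m (i + 1) \<otimes>\<^bsub>?Z\<^esub> cs m (?s i) \<oplus>\<^bsub>?Z\<^esub>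
   ?T \<otimes>\<^bsub>?Z\<^esub> (\<one>\<^bsub>?Z\<^esub> \<ominus>\<^bsub>?Z\<^esub> cs m (?e i)) \<otimes>\<^bsub>?Z\<^esub> (\<one>\<^bsub>?Z\<^esub> \<ominus>\<^bsub>?Z\<^esub> cs m (?e (i + 1)))"
  proof (rule ext)
   fix n assume n: "m <= n"
   have "?T n = (\<Sum>h\<in>carrier G. cs m (?d (prk m i h)) n)" by (rule Zbar_finsum_app[OF finG p n])
   also have "... = t_elt G n i (i + 1)"
    unfolding t_elt_def by (rule sum.cong[OF refl]) (simp only: cs_app[OF n] embed_pair[OF i n])
   finally have T: "?T n = t_elt G n i (i + 1)" .
   have e: "(\<one>\<^bsub>?Z\<^esub> \<ominus>\<^bsub>?Z\<^esub> cs m (?e j)) n = eps1 n j" if "1 <= j" "j <= m" for j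
    unfolding Zbar_minus_app[OF cs_closed[OF eP] n] Zb_app[OF n] cs_app[OF n] embed_eps[OF that n] eps1_def
    by (simp only: eps_idm)
   show "(cs m (?s i) \<otimes>\<^bsub>?Z\<^esub> us m i) n = (us m (i + 1) \<otimes>\<^bsub>?Z\<^esub> cs m (?s i) \<oplus>\<^bsub>?Z\<^esub>
    ?T \<otimes>\<^bsub>?Z\<^esub> (\<one>\<^bsub>?Z\<^esub> \<ominus>\<^bsub>?Z\<^esub> cs m (?e i)) \<otimes>\<^bsub>?Z\<^esub> (\<one>\<^bsub>?Z\<^esub> \<ominus>\<^bsub>?Z\<^esub> cs m (?e (i + 1)))) n"
    unfolding Zb_app(1,2)[OF n] u_seq_app[OF n] cs_app[OF n] embed_perm[OF i n] T e[OF i1(1,2)] e[OF i1(3,4)]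
    by (rule perm_u) (use i n in auto)
  qed (intro Z.a_closed Z.m_closed Z.minus_closed Z.one_closed Tc cs_closed[OF sP] cs_closed[OF eP]
    us_Zbar[OF i1(1,2)] us_Zbar[OF i1(3,4)])+
  fix l assume l: "1 <= l" "l <= m" "l ~= i" "l ~= i + 1"
  have al: "adj i l = l" using l by (simp add: transpose_apply_other)
  show "cs m (?s i) \<otimes>\<^bsub>?Z\<^esub> cs m (?e l) = cs m (?e l) \<otimes>\<^bsub>?Z\<^esub> cs m (?s i)"
   using se[of l] al by (simp add: cs_mult[OF sP eP] cs_mult[OF eP sP])
  show "cs m (?s i) \<otimes>\<^bsub>?Z\<^esub> us m l = us m l \<otimes>\<^bsub>?Z\<^esub> cs m (?s i)" (is "?l = ?r")
  proof (rule ext)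
   fix n assume n: "m <= n"
   \<comment> \<open>Either both transposed indices exceed l, or both are below l and no index
     beyond l moves.\<close>
   have b: "bij_betw (adj i) {l+1..n} {l+1..n}"
   proof (cases "l < i")
    case True
    then have "adj i permutes {l+1..n}" by (intro permutes_swap_id) (use i n in auto)
    then show ?thesis by (rule permutes_imp_bij)
   next
    case False
    then have "adj i a = a" if "a : {l+1..n}" for a using that l(3,4) by (intro transpose_apply_other) auto
    then show ?thesis using bij_betw_cong[of "{l+1..n}" "adj i" id "{l+1..n}"] by simp
   qed
   have ok: "pl_ok 0 n (adj i) (%_. \<one>)" by (rule adj_ok) (use i n in auto)
   show "?l n = ?r n"
    unfolding Zb_app[OF n] u_seq_app[OF n] cs_app[OF n] embed_perm[OF i n]
    by (rule mon_u[OF ok l(1) _ al b]) (use l n in auto)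
  qed (use cs_closed[OF sP] us_Zbar[OF l(1,2)] in auto)
 next
  fix i assume i: "1 <= i" "i + 1 < m"
  have a: "adj i permutes {1..m}" "adj (i + 1) permutes {1..m}" using i adj_perm[of i m] adj_perm[of "i + 1" m] by auto
  note c = permutes_compose
  have "adj i o (adj (i + 1) o adj i) = adj (i + 1) o (adj i o adj (i + 1))"
   by (auto simp: fun_eq_iff transpose_def)
  then show "cs m (?s i) \<otimes>\<^bsub>?Z\<^esub> (cs m (?s (i + 1)) \<otimes>\<^bsub>?Z\<^esub> cs m (?s i)) =
   cs m (?s (i + 1)) \<otimes>\<^bsub>?Z\<^esub> (cs m (?s i) \<otimes>\<^bsub>?Z\<^esub> cs m (?s (i + 1)))"
   unfolding cs_mult[OF sP sP] perm_perm[OF a(1,2)] perm_perm[OF a(2,1)]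
    cs_mult[OF sP perm_PM[OF permutes_inj[OF c[OF a(1,2)]]]] cs_mult[OF sP perm_PM[OF permutes_inj[OF c[OF a(2,1)]]]]
    perm_perm[OF a(1) c[OF a(1,2)]] perm_perm[OF a(2) c[OF a(2,1)]] by (simp only:)
 next
  fix i j assume i: "1 <= i" "i + 1 < j" "j < m"
  have a: "adj i permutes {1..m}" "adj j permutes {1..m}" using i adj_perm[of i m] adj_perm[of j m] by auto
  have "adj i o adj j = adj j o adj i" using i by (auto simp: fun_eq_iff transpose_def)
  then show "cs m (?s i) \<otimes>\<^bsub>?Z\<^esub> cs m (?s j) = cs m (?s j) \<otimes>\<^bsub>?Z\<^esub> cs m (?s i)"
   by (simp only: cs_mult[OF sP sP] perm_perm[OF a(1,2)] perm_perm[OF a(2,1)])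
 }
qed

lemma Hrels_carrier:
 assumes "(l, r) : (Hrels G m :: ((('a, 'f::field) fw) \<times> _) set)"
 shows "keys l <= lists (Hgens G m) & keys r <= lists (Hgens G m)"
proof -
 interpret P: group "Gpow G m" by simp
 have one: "keys (basis w :: ('a, 'f) fw) <= lists (Hgens G m)" if "w : lists (Hgens G m)" for w
  using that by simp
 have act: "perm_act m (transpose i (i + 1)) g : Gp m" if "i : {1..<m}" "g : Gp m" for i g
  using perm_range[OF adj_perm[of i m]] that unfolding perm_act_def by (auto simp: PiE_iff)
 have pos: "at_pos G m i h : Gp m" if "h : carrier G" for i h using that by (auto simp: at_pos_def)
 note M = Hgens_mem
 from assms show ?thesis
 proof cases
  case (S_U k)
  have k: "1 <= k" "k < m" using S_U by auto
  let ?F = "free_alg (Hgens G m) :: ('f, ('a, 'f) fw) module"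
  have T: "keys (\<Sum>h\<in>carrier G. basis [GenG (prk m k h)] :: ('a, 'f) fw) <= lists (Hgens G m)"
   by (rule keys_sum, rule one) (use pair_Gpow[OF k] M(1) in auto)
  have e: "keys (basis [] - basis [GenE i] :: ('a, 'f) fw) <= lists (Hgens G m)" if "1 <= i" "i <= m" for i
   unfolding pm_diff
   by (rule keys_add_sub[OF one order_trans[OF keys_scale one]]) (use that M(3) in auto)
  have prod: "keys (a \<otimes>\<^bsub>?F\<^esub> b) <= lists (Hgens G m)"
   if "keys a <= lists (Hgens G m)" "keys b <= lists (Hgens G m)" for a b :: "('a, 'f) fw"
   unfolding free_eq by (rule ma_keys_mult[OF that]) simp
  show ?thesis
   unfolding S_U
   by (intro conjI keys_add_sub prod T e one) (use k M in auto)
 next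
  case (G_mult g g')
  have "GenG (g \<otimes>\<^bsub>Gpow G m\<^esub> g') : Hgens G m" using P.m_closed[OF G_mult(3,4)] M(1) by blast
  then show ?thesis unfolding G_mult(1,2) using G_mult(3,4) M(1) by (intro conjI one) auto
 next
  case G_one
  show ?thesis unfolding G_one using P.one_closed M(1) by (intro conjI one) auto
 next
  case (S_G i g)
  have "GenG (perm_act m (transpose i (i + 1)) g) : Hgens G m" using act[OF S_G(3,4)] M(1) by blast
  then show ?thesis unfolding S_G(1,2) using S_G(3,4) M by (intro conjI one) auto
 next
  case (E_absorb_left i h)
  then show ?thesis unfolding E_absorb_left(1,2) using pos[of h i] M by (intro conjI one) auto
 next
  case (E_absorb_right i h)
  then show ?thesis unfolding E_absorb_right(1,2) using pos[of h i] M by (intro conjI one) auto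
 next
  case (E_G i g)
  then show ?thesis unfolding E_G(1,2) using M by (intro conjI one) auto
 next
  case (G_U k g)
  then show ?thesis unfolding G_U(1,2) using M by (intro conjI one) auto
 qed simp_all
qed

section \<open>The two isomorphisms\<close>

abbreviation hb :: "nat => nat list \<times> 'a mtx => ('a, 'f::field) zel" where
 "hb m i \<equiv> uact m (fst i) (csq m (basis (snd i)))"

text \<open>Scalars are embedded as multiples of the unit of \<open>Zbar G 0\<close>, so linear
  independence is a special case of \<open>Zbar_independent\<close>.\<close>

lemma hb_lc_zero:
 fixes c :: "nat list \<times> 'a mtx \<Rightarrow>\<^sub>0 'f::field"
 assumes k: "keys c <= Ix m" and z: "falg.lc (Zbar G m) (hb m) c = \<zero>\<^bsub>Zbar G m\<^esub>"
 shows "c = 0"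
proof -
 interpret Z: falg "Zbar G m :: ('a, 'f) zalg" by (rule falg_Z)
 interpret Z0: falg "Zbar G 0 :: ('a, 'f) zalg" by (rule falg_Z)
 define y where "y i = lookup c i \<odot>\<^bsub>Zbar G 0\<^esub> (\<one>\<^bsub>Zbar G 0\<^esub> :: ('a, 'f) zel)" for i
 have I: "sorted ks & set ks <= rows \<d> & \<d> : PM m" if "(ks, \<d>) : keys c" for ks \<d>
  using that k by (auto simp: Ix_def)
 have b: "(hb m i :: ('a, 'f) zel) : Zc m" if "i : keys c" for i
  using I[of "fst i" "snd i"] that PM_rows[of "snd i" m] by (intro uact_carrier cs_closed) auto
 have r: "res m (y i) = lookup c i \<odot>\<^bsub>Zbar G m\<^esub> \<one>\<^bsub>Zbar G m\<^esub>" for i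
  unfolding y_def homD(5)[OF res_hom Z0.one_closed] homD(4)[OF res_hom] ..
 have t: "res m (y i) \<bullet>[m] hb m i = lookup c i \<odot>\<^bsub>Zbar G m\<^esub> hb m i" if "i : keys c" for i
  unfolding r using b[OF that] by (simp add: Z.smult_mult_l)
 have "(\<Oplus>\<^bsub>Zbar G m\<^esub>i\<in>keys c. res m (y i) \<bullet>[m] hb m i) = \<zero>\<^bsub>Zbar G m\<^esub>"
  unfolding z[symmetric] Z.lc_def by (rule Z.finsum_cong') (use t b in auto)
 then have y0: "\<forall>i\<in>keys c. y i = \<zero>\<^bsub>Zbar G 0\<^esub>"
  by (intro Zbar_independent[OF finite_keys I]) (auto simp: y_def)
 have l0: "lookup c i = 0" if i: "i : keys c" for i
 proof -
  \<comment> \<open>In order 0 there is only the empty matrix, whose coefficient in the sequence is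
    the scalar itself.\<close>
  have "psc (lookup c i) (basis (I1 0)) = (0 :: ('a, 'f) fgel)"
   using fun_cong[OF bspec[OF y0 i], of 0] unfolding y_def Zb_app[OF le_refl] .
  then have "lookup (single (I1 0) (lookup c i)) (I1 0) = 0" by simp
  then show ?thesis by simp
 qed
 have "lookup c i = 0" for i using l0[of i] in_keys_iff[of i c] by blast
 then show "c = 0" by (intro poly_mapping_eqI) simp
qed

lemma gen_elt_c:
 "(gen_elt G m :: 'a gen => ('a, 'f::field) zel) : Hgens G m \<rightarrow> Zc m"
proof
 fix x assume x: "x : Hgens G m"
 show "(gen_elt G m x :: ('a, 'f) zel) : Zc m"
 proof (cases x)
  case (GenG g)
  then have "g : Gp m" using x Hgens_mem(1) by blast
  then show ?thesis unfolding GenG gen_elt.simps by (intro cs_closed Gpow_diag_PM)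
 next
  case (GenS i)
  show ?thesis unfolding GenS gen_elt.simps by (intro cs_closed perm_PM) simp
 next
  case (GenE i)
  show ?thesis unfolding GenE gen_elt.simps by (intro cs_closed eps_PM)
 next
  case (GenU i)
  then show ?thesis using x us_Zbar[of i m] by simp
 qed
qed

lemma Hbar_carrier: "carrier (Hbar G m :: ('a, 'f::field) zalg) =
  gen_subalg (Zbar G m) (csq m ` Fc m \<union> us m ` {1..m})"
 by (simp add: Hbar_def)

lemma Hbar_gens: "csq m ` Fc m \<union> us m ` {1..m} \<subseteq>
  carrier (Zbar G m :: ('a, 'f::field) zalg)"
 using homD(1)[OF csq_hom] us_Zbar[of _ m] by auto

lemma Hbar_sub:
 fixes m :: nat
 defines "H \<equiv> Hbar G m :: ('a, 'f::field) zalg"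
 shows "is_subalg (carrier H) (Zbar G m)" "falg H" "carrier H <= Zc m"
  "csq m ` Fc m <= carrier H" "us m ` {1..m} <= carrier H"
  "is_subalg B (Zbar G m) ==> csq m ` Fc m <= B ==> us m ` {1..m} <= B ==> carrier H <= B"
proof -
 note g = gen_subalg[OF falg_Z Hbar_gens, folded Hbar_carrier]
 show s: "is_subalg (carrier H) (Zbar G m)" unfolding H_def by (rule g(1))
 show "falg H" using falg_subalg[OF falg_Z s] by (simp add: H_def Hbar_def)
 show "carrier H <= Zc m" by (rule is_subalgD(1)[OF s])
 show "csq m ` Fc m <= carrier H" "us m ` {1..m} <= carrier H"
  unfolding H_def by (rule order_trans[OF Un_upper1 g(2)], rule order_trans[OF Un_upper2 g(2)])
 show "is_subalg B (Zbar G m) ==> csq m ` Fc m <= B ==> us m ` {1..m} <= B ==> carrier H <= B"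
  unfolding H_def by (rule g(3)) auto
qed

lemma alg_hom_Hbar: "h : alg_hom A (Hbar G m) <-> h : alg_hom A (Zbar G m) & h ` carrier A <= carrier (Hbar G m :: ('a, 'f::field) zalg)"
proof -
 have "carrier (Hbar G m :: ('a, 'f) zalg) <= Zc m" by (rule Hbar_sub(3))
 then show ?thesis unfolding alg_hom_def ring_hom_def by (auto simp: Hbar_def)
qed

text \<open>The elements indexed by \<open>Ix m\<close> span the presented algebra, and their images
  \<open>hb m\<close> are independent, so the descended evaluation is injective. The second conjunct
  transports spanning to \<open>Hbar G m\<close>, where the tensor decomposition requires
  it.\<close>

lemma Hpres_iso:
 "(\<exists>\<f>\<in>alg_iso (Hbar G m :: ('a, 'f::field) zalg) (Hpres G m).
   \<forall>x\<in>Hgens G m. \<f> (gen_elt G m x) = presented_gen (Hgens G m) (Hrels G m) x) \<and>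
  (\<forall>y\<in>carrier (Hbar G m :: ('a, 'f) zalg).
   \<exists>c. keys c <= Ix m & y = falg.lc (Hbar G m) (hb m) c)"
proof -
 let ?Z = "Zbar G m :: ('a, 'f) zalg" and ?H = "Hbar G m :: ('a, 'f) zalg"
 let ?X = "Hgens G m" and ?R = "Hrels G m :: ((('a, 'f) fw) \<times> (('a, 'f) fw)) set"
 let ?F = "free_alg ?X :: ('f, ('a, 'f) fw) module" and ?Q = "Hpres G m :: ('f, (('a, 'f) fw) set) module"
 interpret Z: falg ?Z by (rule falg_Z)
 interpret F: falg ?F by (rule falg_free)
 have Fc: "a : carrier ?F <-> keys a <= lists ?X" for a by (simp add: free_eq)
 have Fd: "a \<ominus>\<^bsub>?F\<^esub> b = a - b" if "b : carrier ?F" for a b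
  unfolding F.minus_eq F.smult_minus_one[OF that, symmetric] pm_diff by (simp add: free_eq)
 define \<Phi> where "\<Phi> = Z.lc (Z.wev (gen_elt G m))"
 note fh = Z.free_hom[OF gen_elt_c, folded \<Phi>_def]
 have \<Phi>1: "\<Phi> (basis [x]) = gen_elt G m x" if "x : ?X" for x
 proof -
  have "(gen_elt G m x :: ('a, 'f) zel) : carrier ?Z" by (rule funcset_mem[OF gen_elt_c that])
  then show ?thesis using fh(2)[of "[x]"] that by simp
 qed
 have \<Phi>rel: "\<Phi> l = \<Phi> r" if "(l, r) : ?R" for l r
  by (rule rook_pres.Hrels_hold[OF rook_pres_Zbar fh(1) _ _ _ _ that])
   (use \<Phi>1 Hgens_mem in "simp_all del: carrier_product_group")
 define I where "I = relation_ideal ?X ?R"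
 have rc: "{l - r | l r. (l, r) : ?R} <= carrier ?F"
 proof
  fix a assume "a : {l - r | l r. (l, r) : ?R}"
  then obtain l r where a: "a = l - r" "(l, r) : ?R" by blast
  have "r : carrier ?F" "l : carrier ?F" using Hrels_carrier[OF a(2)] Fc by auto
  then show "a : carrier ?F" unfolding a(1) using Fd by (metis F.minus_closed)
 qed
 have Iid: "ideal I ?F" unfolding I_def relation_ideal_def by (rule F.genideal_ideal[OF rc])
 interpret hr: ring_hom_ring ?F ?Z \<Phi> by (rule alg_hom_ring[OF falg_free falg_Z fh(1)])
 have "I <= a_kernel ?F ?Z \<Phi>"
  unfolding I_def relation_ideal_def
 proof (rule F.genideal_minimal[OF hr.kernel_is_ideal], rule subsetI)
  fix a assume a: "a : {l - r | l r. (l, r) : ?R}"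
  then obtain l r where lr: "a = l - r" "(l, r) : ?R" by blast
  have c: "l : carrier ?F" "r : carrier ?F" using Hrels_carrier[OF lr(2)] Fc by auto
  have "\<Phi> a = \<Phi> l \<ominus>\<^bsub>?Z\<^esub> \<Phi> r"
   unfolding lr(1) by (rule alg_hom_diff[OF falg_Z fh(1)[unfolded free_eq]]) (use c Fc in auto)
  also have "... = \<zero>\<^bsub>?Z\<^esub>" unfolding \<Phi>rel[OF lr(2)] using homD(1)[OF fh(1) c(2)] by (simp add: Z.minus_eq Z.r_neg)
  finally have "\<Phi> a = \<zero>\<^bsub>?Z\<^esub>" .
  then show "a : a_kernel ?F ?Z \<Phi>" unfolding a_kernel_def' using subsetD[OF rc a] by blast
 qed
 then have ker: "\<Phi> a = \<zero>\<^bsub>?Z\<^esub>" if "a : I" for a using that unfolding a_kernel_def' by blast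
 have Q: "?Q = alg_quot ?F I" unfolding Hpres_def presented_alg_def I_def ..
 have Qf: "falg ?Q" unfolding Q by (rule F.falg_alg_quot[OF Iid])
 interpret Q: falg ?Q by (rule Qf)
 define \<pi> where "\<pi> = (+>\<^bsub>?F\<^esub>) I"
 have \<pi>: "\<pi> : alg_hom ?F ?Q" unfolding \<pi>_def Q by (rule F.coset_alg_hom[OF Iid])
 have Qc: "carrier ?Q = \<pi> ` carrier ?F" unfolding Q \<pi>_def by (rule F.carrier_alg_quot)
 have \<pi>eq: "\<pi> a = \<pi> b <-> a - b : I" if "a : carrier ?F" "b : carrier ?F" for a b
  unfolding \<pi>_def using F.quotient_eq_iff_same_a_r_cos[OF Iid that] Fd[OF that(2), of a] by auto
 have "\<pi> l = \<pi> r" if "(l, r) : ?R" for l r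
 proof -
  have "l - r : I" unfolding I_def relation_ideal_def using F.genideal_self[OF rc] that by blast
  then show ?thesis using \<pi>eq Hrels_carrier[OF that] Fc by blast
 qed
 from rook_pres_hom[OF Qf \<pi> this] interpret RP: rook_pres G ?Q m "%g. \<pi> (basis [GenG g])" "%i. \<pi> (basis [GenS i])"
  "%i. \<pi> (basis [GenE i])" "%i. \<pi> (basis [GenU i])" .
 have w1: "basis [x] : carrier ?F" if "x : ?X" for x using that Fc by simp
 have V: "\<exists>d. \<pi> a : RP.V d" if "keys a <= lists ?X" for a
  using that
 proof (induction rule: pm_induct)
  case zero
  have "\<pi> 0 = \<zero>\<^bsub>?Q\<^esub>" using alg_hom_zero[OF falg_free Qf \<pi>] by (simp add: free_eq)
  then show ?case using RP.V_lin(1) by auto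
 next
  case (single ws c)
  have "\<exists>d. \<pi> (basis ws) : RP.V d"
   using single
  proof (induction ws)
   case Nil
   have "\<pi> (basis []) = \<one>\<^bsub>?Q\<^esub>" using homD(4)[OF \<pi>] by (simp add: free_eq)
   then show ?case using RP.V_one by auto
  next
   case (Cons x ws)
   have x: "x : ?X" and ws: "ws : lists ?X" using Cons.hyps by auto
   obtain d where d: "\<pi> (basis ws) : RP.V d" using Cons.IH by blast
   have "basis (x # ws) = basis [x] \<otimes>\<^bsub>?F\<^esub> (basis ws :: ('a, 'f) fw)" by (simp add: free_eq)
   then have e: "\<pi> (basis (x # ws)) = \<pi> (basis [x]) \<otimes>\<^bsub>?Q\<^esub> \<pi> (basis ws)"
    using homD(2)[OF \<pi> w1[OF x], of "basis ws"] ws Fc by simp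
   show ?case
   proof (cases x)
    case (GenG g)
    then have "g : Gp m" using x Hgens_mem(1) by blast
    from RP.V_D[OF d this] show ?thesis unfolding e unfolding GenG by blast
   next
    case (GenS i)
    then have "1 <= i" "i < m" using x by auto
    from RP.V_s[OF d this] show ?thesis unfolding e unfolding GenS by blast
   next
    case (GenE i)
    then have "1 <= i" "i <= m" using x by auto
    from RP.V_e[OF d this] show ?thesis unfolding e unfolding GenE by blast
   next
    case (GenU i)
    then have "1 <= i" "i <= m" using x by auto
    from RP.V_u[OF d this] show ?thesis unfolding e unfolding GenU by blast
   qed
  qed
  then obtain d where "\<pi> (basis ws) : RP.V d" by blast
  moreover have "\<pi> (single ws c) = c \<odot>\<^bsub>?Q\<^esub> \<pi> (basis ws)"
   using homD(5)[OF \<pi>, of "basis ws" c] single Fc by (simp add: free_eq)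
  ultimately have "\<pi> (single ws c) : RP.V d" using RP.V_smult[of "\<pi> (basis ws)" d c] by (simp only:)
  then show ?case by blast
 next
  case (add a b)
  then obtain d d' where d: "\<pi> a : RP.V d" "\<pi> b : RP.V d'" by blast
  have "\<pi> a : RP.V (max d d')" "\<pi> b : RP.V (max d d')"
   using d RP.V_mono[of d "max d d'"] RP.V_mono[of d' "max d d'"] by auto
  moreover have "\<pi> (a + b) = \<pi> a \<oplus>\<^bsub>?Q\<^esub> \<pi> b" using homD(3)[OF \<pi>, of a b] add Fc by (simp add: free_eq)
  ultimately have "\<pi> (a + b) : RP.V (max d d')" using RP.V_lin(2)[of "\<pi> a" "max d d'" "\<pi> b"] by (simp only:)
  then show ?case by blast
 qed
 have span: "\<exists>c. keys c <= Ix m & y = Q.lc (%(ks, \<g>). RP.uv ks \<g>) c" if "y : carrier ?Q" for y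
  using that V RP.V_Ix Fc unfolding Qc by blast
 \<comment> \<open>The evaluation descended to the quotient through chosen representatives;
   \<open>ker\<close> makes the value independent of the choice.\<close>
 define h where "h y = \<Phi> (SOME a. a : carrier ?F & \<pi> a = y)" for y
 have h\<pi>: "h (\<pi> a) = \<Phi> a" if a: "a : carrier ?F" for a
 proof -
  define b where "b = (SOME b. b : carrier ?F & \<pi> b = \<pi> a)"
  have b: "b : carrier ?F & \<pi> b = \<pi> a" unfolding b_def by (rule someI[of _ a]) (use a in simp)
  then have "\<Phi> (b - a) = \<zero>\<^bsub>?Z\<^esub>" using ker \<pi>eq[of b a] a by blast
  moreover have "\<Phi> (b - a) = \<Phi> b \<ominus>\<^bsub>?Z\<^esub> \<Phi> a"
   by (rule alg_hom_diff[OF falg_Z fh(1)[unfolded free_eq]]) (use a b Fc in auto)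
  ultimately show ?thesis
   using Z.r_right_minus_eq[of "\<Phi> b" "\<Phi> a"] homD(1)[OF fh(1)] a b unfolding h_def b_def[symmetric] by auto
 qed
 have hh: "h : alg_hom ?Q ?Z"
 proof -
  note f = homD[OF fh(1)] and p = homD[OF \<pi>]
  have ex: "\<exists>a. x = \<pi> a & a : carrier ?F" if "x : carrier ?Q" for x using that Qc by blast
  have "h : ring_hom ?Q ?Z"
  proof (rule ring_hom_memI)
   show "h \<one>\<^bsub>?Q\<^esub> = \<one>\<^bsub>?Z\<^esub>" unfolding p(4)[symmetric] h\<pi>[OF F.one_closed] by (rule f(4))
   fix x assume "x : carrier ?Q"
   then obtain a where a: "x = \<pi> a" "a : carrier ?F" using ex by blast
   show "h x : carrier ?Z" unfolding a(1) h\<pi>[OF a(2)] by (rule f(1)[OF a(2)])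
   fix y assume "y : carrier ?Q"
   then obtain b where b: "y = \<pi> b" "b : carrier ?F" using ex by blast
   show "h (x \<otimes>\<^bsub>?Q\<^esub> y) = h x \<otimes>\<^bsub>?Z\<^esub> h y"
    unfolding a(1) b(1) p(2)[OF a(2) b(2), symmetric] h\<pi>[OF F.m_closed[OF a(2) b(2)]] h\<pi>[OF a(2)] h\<pi>[OF b(2)] by (rule f(2)[OF a(2) b(2)])
   show "h (x \<oplus>\<^bsub>?Q\<^esub> y) = h x \<oplus>\<^bsub>?Z\<^esub> h y"
    unfolding a(1) b(1) p(3)[OF a(2) b(2), symmetric] h\<pi>[OF F.a_closed[OF a(2) b(2)]] h\<pi>[OF a(2)] h\<pi>[OF b(2)] by (rule f(3)[OF a(2) b(2)])
  qed
  moreover have "h (c \<odot>\<^bsub>?Q\<^esub> x) = c \<odot>\<^bsub>?Z\<^esub> h x" if "x : carrier ?Q" for x c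
  proof -
   from ex[OF that] obtain a where a: "x = \<pi> a" "a : carrier ?F" by blast
   show ?thesis unfolding a(1) p(5)[OF a(2), symmetric] h\<pi>[OF F.smult_closed[OF a(2)]] h\<pi>[OF a(2)] by (rule f(5)[OF a(2)])
  qed
  ultimately show ?thesis unfolding alg_hom_def by blast
 qed
 note hD = homD[OF hh]
 have hg: "h (\<pi> (basis [x])) = gen_elt G m x" if "x : ?X" for x using h\<pi>[OF w1[OF that]] \<Phi>1[OF that] by simp
 \<comment> \<open>\<open>W\<close> is defined through a choice of normal form, so its image is
   identified by building the matrix from generators, on which both sides obey the same
   multiplication rule.\<close>
 have hW: "h (RP.W \<g>) = cs m \<g>" if "\<g> : PM m" for \<g>
  using that
 proof (induction rule: PM_induct)
  case one
  show ?case unfolding RP.W_one hD(4) cs_one ..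
 next
  case (diag g \<g>)
  have gX: "GenG g : ?X" using diag(1) Hgens_mem(1) by blast
  show ?case unfolding RP.gen_W(1)[OF diag(2,1), symmetric] hD(2)[OF RP.D_closed[OF diag(1)] RP.W_closed[OF diag(2)]] hg[OF gX] diag(3)
   unfolding gen_elt.simps by (rule cs_mult[OF Gpow_diag_PM[OF diag(1)] diag(2)])
 next
  case (perm i \<g>)
  have gX: "GenS i : ?X" using perm(1,2) by simp
  have P: "pm m i : PM m" by (rule perm_PM) simp
  show ?case unfolding RP.gen_W(2)[OF perm(3,1,2), symmetric] hD(2)[OF RP.s_closed[OF perm(1,2)] RP.W_closed[OF perm(3)]] hg[OF gX] perm(4)
   using cs_mult[OF P perm(3)] by simp
 next
  case (eps i \<g>)
  have gX: "GenE i : ?X" using eps(1,2) by simp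
  show ?case unfolding RP.gen_W(3)[OF eps(3,1,2), symmetric] hD(2)[OF RP.e_closed[OF eps(1,2)] RP.W_closed[OF eps(3)]] hg[OF gX] eps(4)
   unfolding gen_elt.simps by (rule cs_mult[OF eps_PM eps(3)])
 qed
 have huv: "h (RP.uv ks \<g>) = uact m ks (cs m \<g>)" if "set ks <= {1..m}" "\<g> : PM m" for ks \<g>
  using that(1)
 proof (induction ks)
  case Nil
  then show ?case using hW[OF that(2)] by simp
 next
  case (Cons k ks)
  have k: "1 <= k" "k <= m" "set ks <= {1..m}" using Cons.prems by auto
  have gX: "GenU k : ?X" using k by simp
  have "h (RP.uv (k # ks) \<g>) = h (\<pi> (basis [GenU k])) \<otimes>\<^bsub>?Z\<^esub> h (RP.uv ks \<g>)"
   unfolding RP.uv_simps by (rule hD(2)[OF RP.u_closed[OF k(1,2)] RP.uv_closed[OF k(3) that(2)]])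
  then show ?case unfolding hg[OF gX] using Cons.IH[OF k(3)] by simp
 qed
 have hb: "(h o (%(ks, \<g>). RP.uv ks \<g>)) i = hb m i" if i: "i : Ix m" for i
 proof -
  obtain ks \<g> where e: "i = (ks, \<g>)" "set ks <= rows \<g>" "\<g> : PM m" using i by (auto simp: Ix_def)
  have "set ks <= {1..m}" using PM_rows[OF e(3)] e(2) by blast
  then show ?thesis using huv[OF _ e(3)] e(1) by simp
 qed
 have hlc: "h (Q.lc (%(ks, \<g>). RP.uv ks \<g>) c) = falg.lc B (hb m) c"
  if c: "keys c <= Ix m" and B: "falg B" "h : alg_hom ?Q B" for c and B :: "('a, 'f) zalg"
 proof -
  interpret B: falg B by (rule B)
  have "h (Q.lc (%(ks, \<g>). RP.uv ks \<g>) c) = B.lc (h o (%(ks, \<g>). RP.uv ks \<g>)) c"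
   by (rule Q.alg_hom_lc[OF B RP.uv_Ix c])
  also have "... = B.lc (hb m) c"
  proof (rule B.lc_cong)
   fix i assume i: "i : keys c"
   then show "(h o (%(ks, \<g>). RP.uv ks \<g>)) i = hb m i" using c hb by blast
  next
   show "hb m : keys c \<rightarrow> carrier B"
   proof
    fix i assume "i : keys c"
    then have i: "i : Ix m" using c by blast
    then have "(%(ks, \<g>). RP.uv ks \<g>) i : carrier ?Q" using RP.uv_Ix by blast
    from homD(1)[OF B(2) this] show "hb m i : carrier B" using hb[OF i] by simp
   qed
  qed
  finally show ?thesis .
 qed
 \<comment> \<open>Spanning upstairs writes y in the indexed monomials, and independence of their
   images forces all coefficients to vanish.\<close>
 have ker0: "y = \<zero>\<^bsub>?Q\<^esub>" if y: "y : carrier ?Q" and hy: "h y = \<zero>\<^bsub>?Z\<^esub>" for y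
 proof -
  obtain c where c: "keys c <= Ix m" "y = Q.lc (%(ks, \<g>). RP.uv ks \<g>) c" using span[OF y] by blast
  have "Z.lc (hb m) c = \<zero>\<^bsub>?Z\<^esub>" using hlc[OF c(1) falg_Z hh] hy c(2) by simp
  from hb_lc_zero[OF c(1) this] show ?thesis unfolding c(2) by simp
 qed
 have inj: "inj_on h (carrier ?Q)"
 proof (rule inj_onI)
  fix x y assume xy: "x : carrier ?Q" "y : carrier ?Q" "h x = h y"
  let ?y = "(- 1) \<odot>\<^bsub>?Q\<^esub> y"
  have "h (x \<oplus>\<^bsub>?Q\<^esub> ?y) = h y \<oplus>\<^bsub>?Z\<^esub> (- 1) \<odot>\<^bsub>?Z\<^esub> h y"
   using hD(3)[OF xy(1) Q.smult_closed[OF xy(2)], of "- 1"] hD(5)[OF xy(2), of "- 1"] xy(3) by simp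
  also have "... = \<zero>\<^bsub>?Z\<^esub>" using hD(1)[OF xy(2)] by (simp add: Z.smult_minus_one Z.r_neg)
  finally have "x \<oplus>\<^bsub>?Q\<^esub> ?y = \<zero>\<^bsub>?Q\<^esub>" by (intro ker0) (use xy in auto)
  then have "x \<ominus>\<^bsub>?Q\<^esub> y = \<zero>\<^bsub>?Q\<^esub>" using Q.smult_minus_one[OF xy(2)] by (simp add: Q.minus_eq)
  then show "x = y" using Q.r_right_minus_eq[OF xy(1,2)] by blast
 qed
 have img: "h ` carrier ?Q = carrier ?H"
 proof
  have im: "is_subalg (h ` carrier ?Q) ?Z" by (rule is_subalg_image[OF Qf falg_Z hh])
  show "carrier ?H <= h ` carrier ?Q"
  proof (rule Hbar_sub(6)[OF im])
   show "us m ` {1..m} <= h ` carrier ?Q"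
   proof
    fix x assume "x : (us m ` {1..m} :: (('a, 'f) zel) set)"
    then obtain k where k: "x = us m k" "1 <= k" "k <= m" by auto
    have "h (\<pi> (basis [GenU k])) = us m k" using hg[of "GenU k"] k by simp
    then show "x : h ` carrier ?Q" using RP.u_closed[OF k(2,3)] k(1) by (metis imageI)
   qed
   show "csq m ` Fc m <= h ` carrier ?Q"
   proof (rule image_subsetI)
    fix y :: "('a, 'f) fgel" assume "y : Fc m"
    then have "keys y <= PM m" by simp
    then show "csq m y : h ` carrier ?Q"
    proof (induction rule: pm_induct)
     case zero
     have "csq m (0 :: ('a, 'f) fgel) = \<zero>\<^bsub>?Z\<^esub>"
      using alg_hom_zero[OF falg_FG falg_Z csq_hom, of m] by simp
     then show ?case using is_subalgD(3)[OF im] by simp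
    next
     case (single \<g> c)
     have "h (RP.W \<g>) : h ` carrier ?Q" using RP.W_closed[OF single] by blast
     then have "c \<odot>\<^bsub>?Z\<^esub> cs m \<g> : h ` carrier ?Q" unfolding hW[OF single] by (rule is_subalgD(6)[OF im])
     moreover have "csq m (single \<g> c) = c \<odot>\<^bsub>?Z\<^esub> cs m \<g>"
      using homD(5)[OF csq_hom, of "basis \<g> :: ('a, 'f) fgel" m c] single by simp
     ultimately show ?case by simp
    next
     case (add a b)
     have "csq m (a + b) = csq m a \<oplus>\<^bsub>?Z\<^esub> csq m b"
      using homD(3)[OF csq_hom, of a m b] add(1,2) by simp
     then show ?case using is_subalgD(4)[OF im add(3,4)] by simp
    qed
   qed
  qed
  have gH: "gen_elt G m x : carrier ?H" if x: "x : ?X" for x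
  proof -
   have cH: "cs m \<g> : carrier ?H" if "\<g> : PM m" for \<g>
   proof -
    have "basis \<g> : carrier (FGbar G m :: ('a, 'f) fgalg)" using that by simp
    then show ?thesis using Hbar_sub(4) by blast
   qed
   show ?thesis
   proof (cases x)
    case (GenG g)
    then have "g : Gp m" using x Hgens_mem(1) by blast
    then show ?thesis unfolding GenG gen_elt.simps by (intro cH Gpow_diag_PM)
   next
    case (GenS i)
    show ?thesis unfolding GenS gen_elt.simps by (intro cH perm_PM) simp
   next
    case (GenE i)
    show ?thesis unfolding GenE gen_elt.simps by (intro cH eps_PM)
   next
    case (GenU i)
    then have "i : {1..m}" using x by simp
    then show ?thesis unfolding GenU gen_elt.simps using Hbar_sub(5) by blast
   qed
  qed
  note sH = is_subalgD[OF Hbar_sub(1)]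
  have ev: "Z.wev (gen_elt G m) ws : carrier ?H" if "ws : lists ?X" for ws
   using that
  proof (induction ws)
   case Nil
   show ?case unfolding Z.wev_simps by (rule sH(2))
  next
   case (Cons x ws)
   then show ?case unfolding Z.wev_simps by (intro sH(5) gH) auto
  qed
  have "\<Phi> a : carrier ?H" if "keys a <= lists ?X" for a
   using that
  proof (induction rule: pm_induct)
   case zero
   then show ?case unfolding \<Phi>_def Z.lc_zero by (rule sH(3))
  next
   case (single ws c)
   have "\<Phi> (single ws c) = c \<odot>\<^bsub>?Z\<^esub> Z.wev (gen_elt G m) ws"
    unfolding \<Phi>_def by (rule Z.lc_single) (rule Z.wev_closed[OF gen_elt_c single])
   then show ?case using sH(6)[OF ev[OF single]] by simp
  next
   case (add a b)
   have "\<Phi> (a + b) = \<Phi> a \<oplus>\<^bsub>?Z\<^esub> \<Phi> b" using homD(3)[OF fh(1), of a b] add(1,2) Fc by (simp add: free_eq)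
   then show ?case using sH(4)[OF add(3,4)] by simp
  qed
  then show "h ` carrier ?Q <= carrier ?H" using h\<pi> Fc unfolding Qc by auto
 qed
 have hH: "h : alg_hom ?Q ?H" unfolding alg_hom_Hbar using hh img by simp
 have "h : alg_iso ?Q ?H" unfolding alg_iso_alt bij_betw_def using hH inj img by simp
 then have "inv_into (carrier ?Q) h : alg_iso ?H ?Q" by (rule alg_iso_inv[OF Qf])
 moreover have "inv_into (carrier ?Q) h (gen_elt G m x) = presented_gen ?X ?R x" if x: "x : ?X" for x
 proof -
  have "\<pi> (basis [x]) : carrier ?Q" using w1[OF x] unfolding Qc by blast
  then have "inv_into (carrier ?Q) h (h (\<pi> (basis [x]))) = \<pi> (basis [x])" by (rule inv_into_f_f[OF inj])
  then have "inv_into (carrier ?Q) h (gen_elt G m x) = \<pi> (basis [x])" unfolding hg[OF x] .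
  then show ?thesis by (simp only: presented_gen_def \<pi>_def I_def)
 qed
 moreover have "\<exists>c. keys c <= Ix m & y = falg.lc ?H (hb m) c" if "y : carrier ?H" for y
 proof -
  from that img obtain q where q: "q : carrier ?Q" "y = h q" by blast
  obtain c where c: "keys c <= Ix m" "q = Q.lc (%(ks, \<g>). RP.uv ks \<g>) c" using span[OF q(1)] by blast
  show ?thesis using hlc[OF c(1) Hbar_sub(2) hH] c q(2) by blast
 qed
 ultimately show ?thesis by blast
qed

text \<open>\<open>Zbar G m\<close> is free over the central image of \<open>Zbar G 0\<close> on the
  family \<open>hb m\<close>, which also spans \<open>Hbar G m\<close>; this is the situation of
  \<open>tensor_iso_of_free\<close>.\<close>

lemma Zbar_tensor_iso:
 "alg_iso (Zbar G m :: ('a, 'f::field) zalg) (tensor_alg (Zbar G 0) (Hbar G m)) ~= {}"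
proof (rule tensor_iso_of_free[where \<r> = "res m" and \<iota> = "%x. x" and b = "hb m" and I = "Ix m"])
 let ?Z = "Zbar G m :: ('a, 'f) zalg" and ?H = "Hbar G m :: ('a, 'f) zalg"
 show "falg (Zbar G 0 :: ('a, 'f) zalg)" "falg ?Z" by (rule falg_Z)+
 show "falg ?H" by (rule Hbar_sub(2))
 show "res m : alg_hom (Zbar G 0) ?Z" by (rule res_hom)
 show "(%x. x) : alg_hom ?H ?Z" using Hbar_sub(3)[of m] by (auto simp: alg_hom_def ring_hom_def Hbar_def)
 show "res m x \<otimes>\<^bsub>?Z\<^esub> y = y \<otimes>\<^bsub>?Z\<^esub> res m x" if "x : Zc 0" "y : carrier ?H" for x y
  using that Hbar_sub(3) by (intro res_comm) auto
 show "hb m : Ix m \<rightarrow> carrier ?H"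
 proof
  fix i :: "nat list \<times> 'a mtx" assume "i : Ix m"
  then have i: "set (fst i) <= rows (snd i)" "snd i : PM m" by (auto simp: Ix_def)
  have ks: "set (fst i) <= {1..m}" using PM_rows[OF i(2)] i(1) by blast
  have "basis (snd i) : carrier (FGbar G m :: ('a, 'f) fgalg)" using i(2) by simp
  then have c: "cs m (snd i) : carrier ?H" using Hbar_sub(4) by blast
  have "us m k : carrier ?H" if "1 <= k" "k <= m" for k using that Hbar_sub(5)[of m] by auto
  then show "hb m i : carrier ?H" by (rule uact_closed[OF Hbar_sub(1) ks _ c])
 qed
 show "\<exists>c. keys c <= Ix m & y = falg.lc ?H (hb m) c" if "y : carrier ?H" for y
  using Hpres_iso that by blast
 show "carrier ?Z <= W" if W: "is_subalg W ?Z" "res m ` Zc 0 <= W" "(%x. x) ` carrier ?H <= W" for W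
 proof (rule Zbar_span[OF W(1,2)])
  have H: "carrier ?H <= W" using W(3) by simp
  show "csq m ` Fc m <= W" by (rule order_trans[OF Hbar_sub(4) H])
  show "us m k : W" if "1 <= k" "k <= m" for k using that order_trans[OF Hbar_sub(5) H] by auto
 qed
 show "\<forall>i\<in>F. z i = \<zero>\<^bsub>Zbar G 0\<^esub>"
  if "finite F" "F <= Ix m" "z : F \<rightarrow> Zc 0" "(\<Oplus>\<^bsub>?Z\<^esub>i\<in>F. res m (z i) \<otimes>\<^bsub>?Z\<^esub> hb m i) = \<zero>\<^bsub>?Z\<^esub>" for F z
  by (rule Zbar_independent[OF that(1) _ that(3,4)]) (use that(2) in "auto simp: Ix_def")
qed

end

theorem theorem4p13:
 fixes G :: "('g, 'x) monoid_scheme" and m :: nat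
 assumes "group G" and "finite (carrier G)" and "m \<ge> 1"
 shows "alg_iso (Zbar G m :: ('f::field, nat \<Rightarrow> 'g mtx \<Rightarrow>\<^sub>0 'f) module)
      (tensor_alg (Zbar G 0) (Hbar G m)) \<noteq> {}
    \<and> (\<exists>\<phi> \<in> alg_iso (Hbar G m :: ('f, nat \<Rightarrow> 'g mtx \<Rightarrow>\<^sub>0 'f) module) (Hpres G m).
      \<forall>x\<in>Hgens G m. \<phi> (gen_elt G m x) = presented_gen (Hgens G m) (Hrels G m) x)"
proof -
 interpret gmat G using assms(1,2) by (intro gmat.intro gmat_axioms.intro)
 show ?thesis by (rule conjI[OF Zbar_tensor_iso conjunct1[OF Hpres_iso]])
qed

end
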